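(* Let $H=\bigoplus_{n\in\mathbb{N}_0}H(n)$ be a graded Hopf algebra over a field $\Bbbk$ with $H(0)=\Bbbk G$ for some finite group $G$, and let $L=\bigoplus_{n\in\mathbb{N}_0}L(n)$ be a graded left $H$-comodule algebra. The following are equivalent: (i) $L$ is right $H$-simple and $L^{\mathrm{co}H}=\Bbbk$. (ii) $L$ is (isomorphic, as a graded $H$-comodule algebra, to) a graded $H$-comodule subalgebra of $H^{\mathrm{coinv}}\#({}_\psi\Bbbk F)$ for some subgroup $F$ of $G$ and some $2$-cocycle $\psi$ of $F$.
   Context: Everything is over a field $\Bbbk$. A graded Hopf algebra is a Hopf algebra with an $\mathbb{N}_0$-grading of its underlying vector space such that multiplication, unit, comultiplication and counit preserve the grading (tensor products have the total grading; $\Bbbk$ is in degree $0$). A left $H$-comodule algebra is an algebra $L$ that is a left $H$-comodule whose coaction $\rho\colon L\to H\otimes L$, $\ell\mapsto\ell_{(-1)}\otimes\ell_{(0)}$, is an algebra map; it is graded if it has an $\mathbb{N}_0$-grading preserved by multiplication, unit and coaction. A graded $H$-comodule subalgebra is a subalgebra that is an $H$-subcomodule and a graded subspace (the sum of its intersections with the homogeneous components), with the induced grading. $L$ is right $H$-simple if $L\neq0$ and its only right ideals that are $H$-subcomodules are $0$ and $L$. $L^{\mathrm{co}H}=\{\ell\in L\mid\rho(\ell)=1\otimes\ell\}$. $H(0)=\Bbbk G$ is meant as Hopf algebras. Let $\pi\colon H\to H(0)$ be the canonical projection and $\iota\colon H(0)\to H$ the inclusion; both are Hopf algebra maps. $H^{\mathrm{coinv}}=\{r\in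 H\mid r_{(1)}\otimes\pi(r_{(2)})=r\otimes1\}$, with $\Delta(r)=r_{(1)}\otimes r_{(2)}$. For a left $H(0)$-comodule algebra $E$, $H^{\mathrm{coinv}}\#E$ is the left $H$-comodule algebra with underlying vector space $H^{\mathrm{coinv}}\otimes E$, multiplication $(a\otimes\ell)(b\otimes m)=a\,\iota(\ell_{(-2)})\,b\,\iota(S(\ell_{(-1)}))\otimes\ell_{(0)}m$ ($S$ the antipode of $H(0)$), and $H$-coaction $\rho(a\otimes\ell)=a_{(1)}\iota(\ell_{(-1)})\otimes a_{(2)}\otimes\ell_{(0)}$. It is graded with degree $n$ component $(H(n)\cap H^{\mathrm{coinv}})\otimes E$. A $2$-cocycle of a group $F$ is a map $\psi\colon F\times F\to\Bbbk^\times$ with $\psi(a,b)\psi(ab,c)=\psi(b,c)\psi(a,bc)$ and $\psi(a,e)=1=\psi(e,a)$. For a subgroup $F\subset G$, ${}_\psi\Bbbk F$ is the $\Bbbk G$-comodule algebra with underlying space $\Bbbk F$, product $g*h=\psi(g,h)gh$ and coaction $\rho(g)=g\otimes g$ for $g,h\in F$. *)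

theory Defs
  imports "HOL-Algebra.Module" "HOL-Algebra.AbelCoset"
begin

section \<open>Linear algebra over a field \<open>R\<close>\<close>

text \<open>Vector spaces are the modules of \<^theory>\<open>HOL-Algebra.Module\<close>. When a record is used only as a
  vector space, its fields \<open>mult\<close> and \<open>one\<close> are irrelevant.\<close>

definition gen_submodule ::
  "('k, 'r) ring_scheme \<Rightarrow> ('k, 'v, 'm) module_scheme \<Rightarrow> 'v set \<Rightarrow> 'v set" where
  "gen_submodule R V X = \<Inter>{N. submodule N R V \<and> X \<subseteq> N}"

definition linear_map ::
  "('k, 'r) ring_scheme \<Rightarrow> ('k, 'v, 'm) module_scheme \<Rightarrow> ('k, 'w, 'n) module_scheme \<Rightarrow> ('v \<Rightarrow> 'w) \<Rightarrow> bool"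
  where
  "linear_map R V W f \<longleftrightarrow>
     f \<in> carrier V \<rightarrow> carrier W \<and>
     (\<forall>x\<in>carrier V. \<forall>y\<in>carrier V. f (x \<oplus>\<^bsub>V\<^esub> y) = f x \<oplus>\<^bsub>W\<^esub> f y) \<and>
     (\<forall>c\<in>carrier R. \<forall>x\<in>carrier V. f (c \<odot>\<^bsub>V\<^esub> x) = c \<odot>\<^bsub>W\<^esub> f x)"

definition ground_algebra :: "('k, 'r) ring_scheme \<Rightarrow> ('k, 'k) module" where
  "ground_algebra R =
     \<lparr>carrier = carrier R, mult = mult R, one = one R, zero = zero R, add = add R, smult = mult R\<rparr>"

text \<open>\<open>free_module R X\<close> consists of the finitely supported functions on \<open>X\<close>, extended by zero.\<close>

definition free_module :: "('k, 'r) ring_scheme \<Rightarrow> 'x set \<Rightarrow> ('k, 'x \<Rightarrow> 'k) module" where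
  "free_module R X =
     \<lparr>carrier = {f. (\<forall>x. f x \<in> carrier R) \<and> finite {x. f x \<noteq> \<zero>\<^bsub>R\<^esub>} \<and> {x. f x \<noteq> \<zero>\<^bsub>R\<^esub>} \<subseteq> X},
      mult = undefined, one = undefined,
      zero = (\<lambda>_. \<zero>\<^bsub>R\<^esub>), add = (\<lambda>f g x. f x \<oplus>\<^bsub>R\<^esub> g x),
      smult = (\<lambda>c f x. c \<otimes>\<^bsub>R\<^esub> f x)\<rparr>"

definition basis_vec :: "('k, 'r) ring_scheme \<Rightarrow> 'x \<Rightarrow> 'x \<Rightarrow> 'k" where
  "basis_vec R x = (\<lambda>y. if y = x then \<one>\<^bsub>R\<^esub> else \<zero>\<^bsub>R\<^esub>)"

text \<open>The linear extension of \<open>\<phi>\<close> from the basis to the free module.\<close>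

definition lin_ext ::
  "('k, 'r) ring_scheme \<Rightarrow> ('k, 'v, 'm) module_scheme \<Rightarrow> ('x \<Rightarrow> 'k) \<Rightarrow> ('x \<Rightarrow> 'v) \<Rightarrow> 'v" where
  "lin_ext R V f \<phi> = (\<Oplus>\<^bsub>V\<^esub>x\<in>{x. f x \<noteq> \<zero>\<^bsub>R\<^esub>}. f x \<odot>\<^bsub>V\<^esub> \<phi> x)"


section \<open>Tensor products\<close>

text \<open>\<open>A \<otimes> B\<close> is the quotient of the free vector space on \<open>A \<times> B\<close> by the span of the usual
  bilinearity relations, so its elements are cosets.\<close>

definition tensor_relations ::
  "('k, 'r) ring_scheme \<Rightarrow> ('k, 'a, 'm) module_scheme \<Rightarrow> ('k, 'b, 'n) module_scheme
    \<Rightarrow> ('a \<times> 'b \<Rightarrow> 'k) set" where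
  "tensor_relations R A B =
     (let P = free_module R (carrier A \<times> carrier B); e = (\<lambda>a b. basis_vec R (a, b)) in
      gen_submodule R P
       ({e (a \<oplus>\<^bsub>A\<^esub> a') b \<ominus>\<^bsub>P\<^esub> (e a b \<oplus>\<^bsub>P\<^esub> e a' b) | a a' b.
           a \<in> carrier A \<and> a' \<in> carrier A \<and> b \<in> carrier B} \<union>
        {e a (b \<oplus>\<^bsub>B\<^esub> b') \<ominus>\<^bsub>P\<^esub> (e a b \<oplus>\<^bsub>P\<^esub> e a b') | a b b'.
           a \<in> carrier A \<and> b \<in> carrier B \<and> b' \<in> carrier B} \<union>
        {e (c \<odot>\<^bsub>A\<^esub> a) b \<ominus>\<^bsub>P\<^esub> c \<odot>\<^bsub>P\<^esub> e a b | c a b.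
           c \<in> carrier R \<and> a \<in> carrier A \<and> b \<in> carrier B} \<union>
        {e a (c \<odot>\<^bsub>B\<^esub> b) \<ominus>\<^bsub>P\<^esub> c \<odot>\<^bsub>P\<^esub> e a b | c a b.
           c \<in> carrier R \<and> a \<in> carrier A \<and> b \<in> carrier B}))"

definition tensor_space ::
  "('k, 'r) ring_scheme \<Rightarrow> ('k, 'a, 'm) module_scheme \<Rightarrow> ('k, 'b, 'n) module_scheme
    \<Rightarrow> ('k, ('a \<times> 'b \<Rightarrow> 'k) set) module" where
  "tensor_space R A B =
     (let P = free_module R (carrier A \<times> carrier B); N = tensor_relations R A B in
      \<lparr>carrier = a_rcosets\<^bsub>P\<^esub> N, mult = undefined, one = undefined,
       zero = N, add = (\<lambda>s t. s <+>\<^bsub>P\<^esub> t),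
       smult = (\<lambda>c s. \<Union>f\<in>s. N +>\<^bsub>P\<^esub> (c \<odot>\<^bsub>P\<^esub> f))\<rparr>)"

definition ptensor ::
  "('k, 'r) ring_scheme \<Rightarrow> ('k, 'a, 'm) module_scheme \<Rightarrow> ('k, 'b, 'n) module_scheme
    \<Rightarrow> 'a \<Rightarrow> 'b \<Rightarrow> ('a \<times> 'b \<Rightarrow> 'k) set" where
  "ptensor R A B a b =
     tensor_relations R A B +>\<^bsub>free_module R (carrier A \<times> carrier B)\<^esub> basis_vec R (a, b)"

text \<open>For a bilinear \<open>\<phi> : A \<times> B \<rightarrow> V\<close>, \<open>sweedler R V t \<phi>\<close> is the value at \<open>t \<in> A \<otimes> B\<close> of the induced
  linear map \<open>A \<otimes> B \<rightarrow> V\<close>; it does not depend on the chosen representative. With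
  \<open>t = t\<^sub>1 \<otimes> t\<^sub>2\<close> in Sweedler notation, \<open>sweedler R V t (\<lambda>a b. \<phi> a b)\<close> is \<open>\<phi>(t\<^sub>1, t\<^sub>2)\<close>.\<close>

definition sweedler ::
  "('k, 'r) ring_scheme \<Rightarrow> ('k, 'v, 'm) module_scheme \<Rightarrow> ('a \<times> 'b \<Rightarrow> 'k) set \<Rightarrow> ('a \<Rightarrow> 'b \<Rightarrow> 'v) \<Rightarrow> 'v"
  where
  "sweedler R V t \<phi> = lin_ext R V (SOME f. f \<in> t) (\<lambda>(a, b). \<phi> a b)"

text \<open>The tensor product of algebras, with \<open>(a \<otimes> b) (c \<otimes> d) = ac \<otimes> bd\<close>.\<close>

definition tensor ::
  "('k, 'r) ring_scheme \<Rightarrow> ('k, 'a, 'm) module_scheme \<Rightarrow> ('k, 'b, 'n) module_scheme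
    \<Rightarrow> ('k, ('a \<times> 'b \<Rightarrow> 'k) set) module" where
  "tensor R A B =
     (tensor_space R A B)
       \<lparr>mult := (\<lambda>s t. sweedler R (tensor_space R A B) s (\<lambda>a b.
                      sweedler R (tensor_space R A B) t (\<lambda>c d.
                        ptensor R A B (a \<otimes>\<^bsub>A\<^esub> c) (b \<otimes>\<^bsub>B\<^esub> d)))),
        one := ptensor R A B \<one>\<^bsub>A\<^esub> \<one>\<^bsub>B\<^esub>\<rparr>"

text \<open>For subspaces \<open>U \<subseteq> A\<close> and \<open>W \<subseteq> B\<close>, the image of \<open>U \<otimes> W\<close> in \<open>A \<otimes> B\<close>.\<close>

definition tensor_sub ::
  "('k, 'r) ring_scheme \<Rightarrow> ('k, 'a, 'm) module_scheme \<Rightarrow> ('k, 'b, 'n) module_scheme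
    \<Rightarrow> 'a set \<Rightarrow> 'b set \<Rightarrow> ('a \<times> 'b \<Rightarrow> 'k) set set" where
  "tensor_sub R A B U W = gen_submodule R (tensor R A B) {ptensor R A B u w | u w. u \<in> U \<and> w \<in> W}"

text \<open>The preimage of \<open>t \<in> A \<otimes> B\<close> under the canonical injection \<open>A \<otimes> W \<rightarrow> A \<otimes> B\<close> for a
  subspace \<open>W \<subseteq> B\<close>, meaningful if \<open>t\<close> lies in its image.\<close>

definition corestrict ::
  "('k, 'r) ring_scheme \<Rightarrow> ('k, 'a, 'm) module_scheme \<Rightarrow> ('k, 'b, 'n) module_scheme \<Rightarrow> 'b set
    \<Rightarrow> ('a \<times> 'b \<Rightarrow> 'k) set \<Rightarrow> ('a \<times> 'b \<Rightarrow> 'k) set" where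
  "corestrict R A B W t =
     (THE s. s \<in> carrier (tensor R A (B\<lparr>carrier := W\<rparr>)) \<and>
             sweedler R (tensor R A B) s (ptensor R A B) = t)"


section \<open>Gradings\<close>

definition homogeneous_decomposition ::
  "('k, 'v, 'm) module_scheme \<Rightarrow> (nat \<Rightarrow> 'v set) \<Rightarrow> 'v \<Rightarrow> (nat \<Rightarrow> 'v) \<Rightarrow> bool" where
  "homogeneous_decomposition V gr v f \<longleftrightarrow>
     (\<forall>n. f n \<in> gr n) \<and> finite {n. f n \<noteq> \<zero>\<^bsub>V\<^esub>} \<and> v = (\<Oplus>\<^bsub>V\<^esub>n\<in>{n. f n \<noteq> \<zero>\<^bsub>V\<^esub>}. f n)"

definition grading ::
  "('k, 'r) ring_scheme \<Rightarrow> ('k, 'v, 'm) module_scheme \<Rightarrow> (nat \<Rightarrow> 'v set) \<Rightarrow> bool" where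
  "grading R V gr \<longleftrightarrow>
     (\<forall>n. submodule (gr n) R V) \<and>
     (\<forall>v\<in>carrier V. \<exists>!f. homogeneous_decomposition V gr v f)"

definition component ::
  "('k, 'v, 'm) module_scheme \<Rightarrow> (nat \<Rightarrow> 'v set) \<Rightarrow> nat \<Rightarrow> 'v \<Rightarrow> 'v" where
  "component V gr n v = (THE f. homogeneous_decomposition V gr v f) n"

definition tensor_grading ::
  "('k, 'r) ring_scheme \<Rightarrow> ('k, 'a, 'm) module_scheme \<Rightarrow> (nat \<Rightarrow> 'a set)
    \<Rightarrow> ('k, 'b, 'n) module_scheme \<Rightarrow> (nat \<Rightarrow> 'b set) \<Rightarrow> nat \<Rightarrow> ('a \<times> 'b \<Rightarrow> 'k) set set" where
  "tensor_grading R A grA B grB n =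
     gen_submodule R (tensor R A B)
       {ptensor R A B a b | a b i j. i + j = n \<and> a \<in> grA i \<and> b \<in> grB j}"

definition graded_subspace ::
  "('k, 'r) ring_scheme \<Rightarrow> ('k, 'v, 'm) module_scheme \<Rightarrow> (nat \<Rightarrow> 'v set) \<Rightarrow> 'v set \<Rightarrow> bool" where
  "graded_subspace R V gr M \<longleftrightarrow>
     submodule M R V \<and> M = gen_submodule R V (\<Union>n. M \<inter> gr n)"


section \<open>Algebras and Hopf algebras\<close>

text \<open>Associative unital algebras, neither necessarily commutative nor nonzero; the locale
  \<open>algebra\<close> of \<^theory>\<open>HOL-Algebra.Module\<close> requires commutativity.\<close>

definition assoc_algebra ::
  "('k, 'r) ring_scheme \<Rightarrow> ('k, 'a, 'm) module_scheme \<Rightarrow> bool" where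
  "assoc_algebra R A \<longleftrightarrow>
     module R A \<and> ring A \<and>
     (\<forall>c\<in>carrier R. \<forall>x\<in>carrier A. \<forall>y\<in>carrier A.
        (c \<odot>\<^bsub>A\<^esub> x) \<otimes>\<^bsub>A\<^esub> y = c \<odot>\<^bsub>A\<^esub> (x \<otimes>\<^bsub>A\<^esub> y) \<and> x \<otimes>\<^bsub>A\<^esub> (c \<odot>\<^bsub>A\<^esub> y) = c \<odot>\<^bsub>A\<^esub> (x \<otimes>\<^bsub>A\<^esub> y))"

definition alg_hom ::
  "('k, 'r) ring_scheme \<Rightarrow> ('k, 'a, 'm) module_scheme \<Rightarrow> ('k, 'b, 'n) module_scheme \<Rightarrow> ('a \<Rightarrow> 'b) \<Rightarrow> bool"
  where
  "alg_hom R A B f \<longleftrightarrow> f \<in> ring_hom A B \<and> linear_map R A B f"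

definition subalgebra_of ::
  "('k, 'r) ring_scheme \<Rightarrow> ('k, 'a, 'm) module_scheme \<Rightarrow> 'a set \<Rightarrow> bool" where
  "subalgebra_of R A M \<longleftrightarrow>
     submodule M R A \<and> \<one>\<^bsub>A\<^esub> \<in> M \<and> (\<forall>x\<in>M. \<forall>y\<in>M. x \<otimes>\<^bsub>A\<^esub> y \<in> M)"

record ('k, 'a) hopf = "('k, 'a) module" +
  comult :: "'a \<Rightarrow> ('a \<times> 'a \<Rightarrow> 'k) set"
  counit :: "'a \<Rightarrow> 'k"
  antipode :: "'a \<Rightarrow> 'a"

definition hopf_algebra ::
  "('k, 'r) ring_scheme \<Rightarrow> ('k, 'a) hopf \<Rightarrow> bool" where
  "hopf_algebra R H \<longleftrightarrow>
     assoc_algebra R H \<and>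
     alg_hom R H (tensor R H H) (comult H) \<and>
     alg_hom R H (ground_algebra R) (counit H) \<and>
     linear_map R H H (antipode H) \<and>
     (\<forall>h\<in>carrier H.
        (let T = tensor R H (tensor R H H) in
         sweedler R T (comult H h) (\<lambda>x y. sweedler R T (comult H x) (\<lambda>x1 x2.
             ptensor R H (tensor R H H) x1 (ptensor R H H x2 y))) =
         sweedler R T (comult H h) (\<lambda>x y. sweedler R T (comult H y) (\<lambda>y1 y2.
             ptensor R H (tensor R H H) x (ptensor R H H y1 y2)))) \<and>
        sweedler R H (comult H h) (\<lambda>x y. counit H x \<odot>\<^bsub>H\<^esub> y) = h \<and>
        sweedler R H (comult H h) (\<lambda>x y. counit H y \<odot>\<^bsub>H\<^esub> x) = h \<and>
        sweedler R H (comult H h) (\<lambda>x y. antipode H x \<otimes>\<^bsub>H\<^esub> y) = counit H h \<odot>\<^bsub>H\<^esub> \<one>\<^bsub>H\<^esub> \<and>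
        sweedler R H (comult H h) (\<lambda>x y. x \<otimes>\<^bsub>H\<^esub> antipode H y) = counit H h \<odot>\<^bsub>H\<^esub> \<one>\<^bsub>H\<^esub>)"

definition hopf_hom ::
  "('k, 'r) ring_scheme \<Rightarrow> ('k, 'a) hopf \<Rightarrow> ('k, 'b) hopf \<Rightarrow> ('a \<Rightarrow> 'b) \<Rightarrow> bool" where
  "hopf_hom R K H f \<longleftrightarrow>
     alg_hom R K H f \<and>
     (\<forall>x\<in>carrier K.
        comult H (f x) = sweedler R (tensor R H H) (comult K x) (\<lambda>y z. ptensor R H H (f y) (f z)) \<and>
        counit H (f x) = counit K x \<and>
        antipode H (f x) = f (antipode K x))"

definition graded_hopf_algebra ::
  "('k, 'r) ring_scheme \<Rightarrow> ('k, 'a) hopf \<Rightarrow> (nat \<Rightarrow> 'a set) \<Rightarrow> bool" where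
  "graded_hopf_algebra R H gr \<longleftrightarrow>
     hopf_algebra R H \<and> grading R H gr \<and>
     \<one>\<^bsub>H\<^esub> \<in> gr 0 \<and>
     (\<forall>i j. \<forall>x\<in>gr i. \<forall>y\<in>gr j. x \<otimes>\<^bsub>H\<^esub> y \<in> gr (i + j)) \<and>
     (\<forall>n. \<forall>x\<in>gr n. comult H x \<in> tensor_grading R H gr H gr n) \<and>
     (\<forall>n>0. \<forall>x\<in>gr n. counit H x = \<zero>\<^bsub>R\<^esub>)"


section \<open>Left comodule algebras\<close>

record ('k, 'h, 'a) comod_alg = "('k, 'a) module" +
  coact :: "'a \<Rightarrow> ('h \<times> 'a \<Rightarrow> 'k) set"

definition comodule_algebra ::
  "('k, 'r) ring_scheme \<Rightarrow> ('k, 'h) hopf \<Rightarrow> ('k, 'h, 'a) comod_alg \<Rightarrow> bool" where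
  "comodule_algebra R H L \<longleftrightarrow>
     assoc_algebra R L \<and>
     alg_hom R L (tensor R H L) (coact L) \<and>
     (\<forall>l\<in>carrier L.
        (let T = tensor R H (tensor R H L) in
         sweedler R T (coact L l) (\<lambda>x m. sweedler R T (comult H x) (\<lambda>x1 x2.
             ptensor R H (tensor R H L) x1 (ptensor R H L x2 m))) =
         sweedler R T (coact L l) (\<lambda>x m. sweedler R T (coact L m) (\<lambda>y m'.
             ptensor R H (tensor R H L) x (ptensor R H L y m')))) \<and>
        sweedler R L (coact L l) (\<lambda>x m. counit H x \<odot>\<^bsub>L\<^esub> m) = l)"

definition graded_comodule_algebra ::
  "('k, 'r) ring_scheme \<Rightarrow> ('k, 'h) hopf \<Rightarrow> (nat \<Rightarrow> 'h set) \<Rightarrow> ('k, 'h, 'a) comod_alg \<Rightarrow> (nat \<Rightarrow> 'a set) \<Rightarrow> bool"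
  where
  "graded_comodule_algebra R H grH L grL \<longleftrightarrow>
     comodule_algebra R H L \<and> grading R L grL \<and>
     \<one>\<^bsub>L\<^esub> \<in> grL 0 \<and>
     (\<forall>i j. \<forall>x\<in>grL i. \<forall>y\<in>grL j. x \<otimes>\<^bsub>L\<^esub> y \<in> grL (i + j)) \<and>
     (\<forall>n. \<forall>x\<in>grL n. coact L x \<in> tensor_grading R H grH L grL n)"

definition subcomodule ::
  "('k, 'r) ring_scheme \<Rightarrow> ('k, 'h) hopf \<Rightarrow> ('k, 'h, 'a) comod_alg \<Rightarrow> 'a set \<Rightarrow> bool" where
  "subcomodule R H L M \<longleftrightarrow>
     submodule M R L \<and> (\<forall>x\<in>M. coact L x \<in> tensor_sub R H L (carrier H) M)"

definition graded_comodule_subalgebra ::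
  "('k, 'r) ring_scheme \<Rightarrow> ('k, 'h) hopf \<Rightarrow> ('k, 'h, 'a) comod_alg \<Rightarrow> (nat \<Rightarrow> 'a set) \<Rightarrow> 'a set \<Rightarrow> bool" where
  "graded_comodule_subalgebra R H L gr M \<longleftrightarrow>
     subalgebra_of R L M \<and> subcomodule R H L M \<and> graded_subspace R L gr M"

text \<open>A comodule subalgebra as a comodule algebra in its own right, with coaction \<open>M \<rightarrow> H \<otimes> M\<close>.\<close>

definition sub_comod_alg ::
  "('k, 'r) ring_scheme \<Rightarrow> ('k, 'h) hopf \<Rightarrow> ('k, 'h, 'a) comod_alg \<Rightarrow> 'a set \<Rightarrow> ('k, 'h, 'a) comod_alg" where
  "sub_comod_alg R H L M = L\<lparr>carrier := M, coact := (\<lambda>x. corestrict R H L M (coact L x))\<rparr>"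

definition graded_comod_alg_iso ::
  "('k, 'r) ring_scheme \<Rightarrow> ('k, 'h) hopf \<Rightarrow> ('k, 'h, 'a) comod_alg \<Rightarrow> (nat \<Rightarrow> 'a set)
    \<Rightarrow> ('k, 'h, 'b) comod_alg \<Rightarrow> (nat \<Rightarrow> 'b set) \<Rightarrow> ('a \<Rightarrow> 'b) \<Rightarrow> bool" where
  "graded_comod_alg_iso R H L grL M grM f \<longleftrightarrow>
     alg_hom R L M f \<and> bij_betw f (carrier L) (carrier M) \<and>
     (\<forall>l\<in>carrier L.
        coact M (f l) = sweedler R (tensor R H M) (coact L l) (\<lambda>x m. ptensor R H M x (f m))) \<and>
     (\<forall>n. f ` grL n = grM n)"

definition right_H_simple ::
  "('k, 'r) ring_scheme \<Rightarrow> ('k, 'h) hopf \<Rightarrow> ('k, 'h, 'a) comod_alg \<Rightarrow> bool" where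
  "right_H_simple R H L \<longleftrightarrow>
     carrier L \<noteq> {\<zero>\<^bsub>L\<^esub>} \<and>
     (\<forall>I. subcomodule R H L I \<and> (\<forall>x\<in>I. \<forall>a\<in>carrier L. x \<otimes>\<^bsub>L\<^esub> a \<in> I)
        \<longrightarrow> I = {\<zero>\<^bsub>L\<^esub>} \<or> I = carrier L)"

definition coinvariants ::
  "('k, 'r) ring_scheme \<Rightarrow> ('k, 'h) hopf \<Rightarrow> ('k, 'h, 'a) comod_alg \<Rightarrow> 'a set" where
  "coinvariants R H L = {l \<in> carrier L. coact L l = ptensor R H L \<one>\<^bsub>H\<^esub> l}"


section \<open>Twisted group algebras\<close>

definition two_cocycle ::
  "('k, 'r) ring_scheme \<Rightarrow> ('g, 's) monoid_scheme \<Rightarrow> 'g set \<Rightarrow> ('g \<Rightarrow> 'g \<Rightarrow> 'k) \<Rightarrow> bool" where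
  "two_cocycle R G F \<psi> \<longleftrightarrow>
     (\<forall>a\<in>F. \<forall>b\<in>F. \<psi> a b \<in> Units R) \<and>
     (\<forall>a\<in>F. \<forall>b\<in>F. \<forall>c\<in>F.
        \<psi> a b \<otimes>\<^bsub>R\<^esub> \<psi> (a \<otimes>\<^bsub>G\<^esub> b) c = \<psi> b c \<otimes>\<^bsub>R\<^esub> \<psi> a (b \<otimes>\<^bsub>G\<^esub> c)) \<and>
     (\<forall>a\<in>F. \<psi> a \<one>\<^bsub>G\<^esub> = \<one>\<^bsub>R\<^esub> \<and> \<psi> \<one>\<^bsub>G\<^esub> a = \<one>\<^bsub>R\<^esub>)"

text \<open>The algebra underlying \<open>\<^sub>\<psi>\<k>F\<close>; the group element \<open>g\<close> is \<open>basis_vec R g\<close>.\<close>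

definition twisted_alg ::
  "('k, 'r) ring_scheme \<Rightarrow> ('g, 's) monoid_scheme \<Rightarrow> 'g set \<Rightarrow> ('g \<Rightarrow> 'g \<Rightarrow> 'k) \<Rightarrow> ('k, 'g \<Rightarrow> 'k) module" where
  "twisted_alg R G F \<psi> =
     (free_module R F)
       \<lparr>mult := (\<lambda>x y. lin_ext R (free_module R F) x (\<lambda>g. lin_ext R (free_module R F) y (\<lambda>h.
                   \<psi> g h \<odot>\<^bsub>free_module R F\<^esub> basis_vec R (g \<otimes>\<^bsub>G\<^esub> h)))),
        one := basis_vec R \<one>\<^bsub>G\<^esub>\<rparr>"

definition group_algebra ::
  "('k, 'r) ring_scheme \<Rightarrow> ('g, 's) monoid_scheme \<Rightarrow> ('k, 'g \<Rightarrow> 'k) hopf" where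
  "group_algebra R G =
     (let A = twisted_alg R G (carrier G) (\<lambda>_ _. \<one>\<^bsub>R\<^esub>) in
      module.extend A
       (hopf.fields
         (\<lambda>x. lin_ext R (tensor R A A) x (\<lambda>g. ptensor R A A (basis_vec R g) (basis_vec R g)))
         (\<lambda>x. lin_ext R (ground_algebra R) x (\<lambda>_. \<one>\<^bsub>R\<^esub>))
         (\<lambda>x. lin_ext R A x (\<lambda>g. basis_vec R (inv\<^bsub>G\<^esub> g)))))"

definition twisted_group_algebra ::
  "('k, 'r) ring_scheme \<Rightarrow> ('g, 's) monoid_scheme \<Rightarrow> 'g set \<Rightarrow> ('g \<Rightarrow> 'g \<Rightarrow> 'k)
    \<Rightarrow> ('k, 'g \<Rightarrow> 'k, 'g \<Rightarrow> 'k) comod_alg" where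
  "twisted_group_algebra R G F \<psi> =
     (let K = group_algebra R G; E = twisted_alg R G F \<psi> in
      module.extend E
       (comod_alg.fields
         (\<lambda>x. lin_ext R (tensor R K E) x (\<lambda>g. ptensor R K E (basis_vec R g) (basis_vec R g)))))"


section \<open>The smash product\<close>

text \<open>The identification of a Hopf algebra \<open>K\<close> with \<open>H(0)\<close> is an injective Hopf algebra map
  \<open>\<iota> : K \<rightarrow> H\<close> with image \<open>H(0)\<close>. It is the inclusion of \<open>H(0)\<close> into \<open>H\<close>; the projection of \<open>H\<close>
  onto \<open>H(0)\<close> is read as a map to \<open>K\<close>.\<close>

definition is_degree_zero_part ::
  "('k, 'r) ring_scheme \<Rightarrow> ('k, 'h) hopf \<Rightarrow> (nat \<Rightarrow> 'h set) \<Rightarrow> ('k, 'a) hopf \<Rightarrow> ('a \<Rightarrow> 'h) \<Rightarrow> bool" where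
  "is_degree_zero_part R H gr K \<iota> \<longleftrightarrow> hopf_hom R K H \<iota> \<and> bij_betw \<iota> (carrier K) (gr 0)"

definition degree_zero_proj ::
  "('k, 'h) hopf \<Rightarrow> (nat \<Rightarrow> 'h set) \<Rightarrow> ('k, 'a) hopf \<Rightarrow> ('a \<Rightarrow> 'h) \<Rightarrow> 'h \<Rightarrow> 'a" where
  "degree_zero_proj H gr K \<iota> h = inv_into (carrier K) \<iota> (component H gr 0 h)"

definition H_coinv ::
  "('k, 'r) ring_scheme \<Rightarrow> ('k, 'h) hopf \<Rightarrow> ('k, 'a) hopf \<Rightarrow> ('h \<Rightarrow> 'a) \<Rightarrow> 'h set" where
  "H_coinv R H K \<pi> =
     {r \<in> carrier H.
        sweedler R (tensor R H K) (comult H r) (\<lambda>x y. ptensor R H K x (\<pi> y)) = ptensor R H K r \<one>\<^bsub>K\<^esub>}"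

text \<open>In the product, \<open>l\<^sub>-\<^sub>2 \<otimes> l\<^sub>-\<^sub>1\<close> is \<open>\<Delta>(l\<^sub>-\<^sub>1)\<close>. The sum over it is
  taken inside the first tensor factor since only the whole sum
  \<open>\<iota>(l\<^sub>-\<^sub>2) b \<iota>(S(l\<^sub>-\<^sub>1))\<close> lies in \<open>H\<^sup>c\<^sup>o\<^sup>i\<^sup>n\<^sup>v\<close>. The coaction uses that
  \<open>\<Delta>\<close> maps \<open>H\<^sup>c\<^sup>o\<^sup>i\<^sup>n\<^sup>v\<close> to \<open>H \<otimes> H\<^sup>c\<^sup>o\<^sup>i\<^sup>n\<^sup>v\<close>. The unit
  \<open>1 \<otimes> 1\<close> is inherited from \<open>tensor\<close>.\<close>

definition smash ::
  "('k, 'r) ring_scheme \<Rightarrow> ('k, 'h) hopf \<Rightarrow> ('k, 'a) hopf \<Rightarrow> ('a \<Rightarrow> 'h) \<Rightarrow> ('h \<Rightarrow> 'a)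
    \<Rightarrow> ('k, 'a, 'e) comod_alg \<Rightarrow> ('k, 'h, ('h \<times> 'e \<Rightarrow> 'k) set) comod_alg" where
  "smash R H K \<iota> \<pi> E =
     (let C = H_coinv R H K \<pi>; HC = H\<lparr>carrier := C\<rparr>; T = tensor R HC E; HT = tensor R H T in
      module.extend
       (T\<lparr>mult := (\<lambda>s t.
            sweedler R T s (\<lambda>a l. sweedler R T t (\<lambda>b m.
              sweedler R T (coact E l) (\<lambda>x l0.
                ptensor R HC E
                  (sweedler R H (comult K x) (\<lambda>x1 x2. a \<otimes>\<^bsub>H\<^esub> \<iota> x1 \<otimes>\<^bsub>H\<^esub> b \<otimes>\<^bsub>H\<^esub> \<iota> (antipode K x2)))
                  (l0 \<otimes>\<^bsub>E\<^esub> m)))))\<rparr>)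
       (comod_alg.fields (\<lambda>s.
            sweedler R HT s (\<lambda>a l. sweedler R HT (coact E l) (\<lambda>x l0.
              sweedler R HT (corestrict R H H C (comult H a)) (\<lambda>a1 a2.
                ptensor R H T (a1 \<otimes>\<^bsub>H\<^esub> \<iota> x) (ptensor R HC E a2 l0)))))))"

definition smash_grading ::
  "('k, 'r) ring_scheme \<Rightarrow> ('k, 'h) hopf \<Rightarrow> (nat \<Rightarrow> 'h set) \<Rightarrow> ('k, 'a) hopf \<Rightarrow> ('h \<Rightarrow> 'a)
    \<Rightarrow> ('k, 'a, 'e) comod_alg \<Rightarrow> nat \<Rightarrow> ('h \<times> 'e \<Rightarrow> 'k) set set" where
  "smash_grading R H gr K \<pi> E n =
     (let C = H_coinv R H K \<pi> in tensor_sub R (H\<lparr>carrier := C\<rparr>) E (gr n \<inter> C) (carrier E))"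

end

theory Submission
  imports Defs
begin

text \<open>
  Write \<open>E\<close> for the cocycle group algebra. A subcomodule of the smash product contains, with every
  nonzero element, a nonzero element of degree zero: if \<open>N\<close> is the top degree, apply \<open>f \<otimes> id\<close> to the
  coaction for a functional \<open>f\<close> concentrated in degree \<open>N\<close>. The degree zero part is \<open>1 \<otimes> E\<close>,
  whose homogeneous elements are multiples of the invertible group elements. As \<open>G\<close> is finite, the
  inverse of such an element is, up to a scalar, one of its powers, hence lies in every subalgebra
  containing it. So a nonzero right ideal subcomodule of a comodule subalgebra contains \<open>1\<close>.

  Conversely, let \<open>L\<close> be simple with trivial coinvariants. A nonzero \<open>x \<in> L(0)\<close> of degree \<open>g \<in> G\<close>
  generates the right ideal subcomodule \<open>xL = L\<close>, hence is invertible, and the quotient of two such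
  elements is coinvariant, hence a scalar. So \<open>L(0)\<close> is a cocycle group algebra \<open>E\<close>. With \<open>p\<^sub>0\<close> the
  projection of \<open>L\<close> onto \<open>L(0)\<close>, the map \<open>l \<mapsto> l\<^sub>-\<^sub>1 \<otimes> p\<^sub>0(l\<^sub>0)\<close> is a map of comodule algebras
  from \<open>L\<close> to the cotensor product of \<open>H\<close> and \<open>E\<close> over \<open>H(0)\<close>, which is isomorphic to the smash
  product. Its kernel is a proper ideal and a subcomodule, so the map is injective.
\<close>

text \<open>Tensors are cosets in a free module and the operations of the smash product are nested
  \<open>sweedler\<close> values, so identities cannot be read off from representatives. Everything
  is therefore moved into \<open>H\<close>. Since \<open>F\<close> is a basis of \<open>E\<close>,
  an element t of the smash product is replaced by its family of coordinates
  \<open>coord k t\<close> in \<open>H\<close>. The functionals \<open>ec k\<close>, the coefficient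
  of the group element k in the degree zero part, are orthogonal idempotents of the dual algebra
  whose sum is the counit; they turn coinvariance into the equations \<open>dc k r = ...\<close> in
  \<open>H\<close> and split \<open>L\<close> into weight spaces. Dually, \<open>L\<close> is a
  module over the functionals through \<open>act\<close>: subcomodules are the stable subspaces, and
  comodule maps are the linear maps that commute with all functionals. That contraction by a well
  chosen functional does not lose a nonzero element rests on one identity, \<epsilon>(coord k (f.t))
  = f(coord k t * k): the functionals on the coaction read off the coordinates.\<close>

context field begin

section \<open>Vector spaces and linear maps\<close>

lemma module_abelian_group: "module R V \<Longrightarrow> abelian_group V"
  by (rule module.axioms(2))

lemma module_abelian_monoid: "module R V \<Longrightarrow> abelian_monoid V"
  using module_abelian_group abelian_group.axioms(1) by blast

lemma mod_add [simp, intro]: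
    "module R V \<Longrightarrow> x \<in> carrier V \<Longrightarrow> y \<in> carrier V \<Longrightarrow> x \<oplus>\<^bsub>V\<^esub> y \<in> carrier V"
  and mod_zero [simp, intro]: "module R V \<Longrightarrow> \<zero>\<^bsub>V\<^esub> \<in> carrier V"
  and mod_neg [simp, intro]: "module R V \<Longrightarrow> x \<in> carrier V \<Longrightarrow> \<ominus>\<^bsub>V\<^esub> x \<in> carrier V"
  and mod_diff [simp, intro]:
    "module R V \<Longrightarrow> x \<in> carrier V \<Longrightarrow> y \<in> carrier V \<Longrightarrow> x \<ominus>\<^bsub>V\<^esub> y \<in> carrier V"
  and mod_smult [simp, intro]:
    "module R V \<Longrightarrow> c \<in> carrier R \<Longrightarrow> x \<in> carrier V \<Longrightarrow> c \<odot>\<^bsub>V\<^esub> x \<in> carrier V"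
  and mod_zero_add [simp]: "module R V \<Longrightarrow> x \<in> carrier V \<Longrightarrow> \<zero>\<^bsub>V\<^esub> \<oplus>\<^bsub>V\<^esub> x = x"
  and mod_add_zero [simp]: "module R V \<Longrightarrow> x \<in> carrier V \<Longrightarrow> x \<oplus>\<^bsub>V\<^esub> \<zero>\<^bsub>V\<^esub> = x"
  and mod_one_smult [simp]: "module R V \<Longrightarrow> x \<in> carrier V \<Longrightarrow> \<one> \<odot>\<^bsub>V\<^esub> x = x"
  and mod_zero_smult [simp]: "module R V \<Longrightarrow> x \<in> carrier V \<Longrightarrow> \<zero> \<odot>\<^bsub>V\<^esub> x = \<zero>\<^bsub>V\<^esub>"
  and mod_smult_zero [simp]: "module R V \<Longrightarrow> c \<in> carrier R \<Longrightarrow> c \<odot>\<^bsub>V\<^esub> \<zero>\<^bsub>V\<^esub> = \<zero>\<^bsub>V\<^esub>"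
  by (simp_all add: module_abelian_group module_abelian_monoid abelian_monoid.a_closed abelian_monoid.zero_closed
      abelian_monoid.l_zero abelian_monoid.r_zero abelian_group.a_inv_closed
      abelian_group.minus_closed module.smult_closed module.smult_one module.smult_l_null
      module.smult_r_null)

lemma mod_assoc:
    "module R V \<Longrightarrow> x \<in> carrier V \<Longrightarrow> y \<in> carrier V \<Longrightarrow> z \<in> carrier V \<Longrightarrow>
      x \<oplus>\<^bsub>V\<^esub> y \<oplus>\<^bsub>V\<^esub> z = x \<oplus>\<^bsub>V\<^esub> (y \<oplus>\<^bsub>V\<^esub> z)"
  and mod_comm:
    "module R V \<Longrightarrow> x \<in> carrier V \<Longrightarrow> y \<in> carrier V \<Longrightarrow> x \<oplus>\<^bsub>V\<^esub> y = y \<oplus>\<^bsub>V\<^esub> x"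
  and mod_lcomm:
    "module R V \<Longrightarrow> x \<in> carrier V \<Longrightarrow> y \<in> carrier V \<Longrightarrow> z \<in> carrier V \<Longrightarrow>
      x \<oplus>\<^bsub>V\<^esub> (y \<oplus>\<^bsub>V\<^esub> z) = y \<oplus>\<^bsub>V\<^esub> (x \<oplus>\<^bsub>V\<^esub> z)"
  and mod_smult_add:
    "module R V \<Longrightarrow> c \<in> carrier R \<Longrightarrow> x \<in> carrier V \<Longrightarrow> y \<in> carrier V \<Longrightarrow>
      c \<odot>\<^bsub>V\<^esub> (x \<oplus>\<^bsub>V\<^esub> y) = c \<odot>\<^bsub>V\<^esub> x \<oplus>\<^bsub>V\<^esub> c \<odot>\<^bsub>V\<^esub> y"
  and mod_add_smult:
    "module R V \<Longrightarrow> c \<in> carrier R \<Longrightarrow> d \<in> carrier R \<Longrightarrow> x \<in> carrier V \<Longrightarrow>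
      (c \<oplus> d) \<odot>\<^bsub>V\<^esub> x = c \<odot>\<^bsub>V\<^esub> x \<oplus>\<^bsub>V\<^esub> d \<odot>\<^bsub>V\<^esub> x"
  and mod_smult_smult:
    "module R V \<Longrightarrow> c \<in> carrier R \<Longrightarrow> d \<in> carrier R \<Longrightarrow> x \<in> carrier V \<Longrightarrow>
      (c \<otimes> d) \<odot>\<^bsub>V\<^esub> x = c \<odot>\<^bsub>V\<^esub> (d \<odot>\<^bsub>V\<^esub> x)"
  by (simp_all add: module_abelian_group module_abelian_monoid abelian_monoid.a_assoc abelian_monoid.a_comm
      abelian_monoid.a_lcomm module.smult_l_distr module.smult_r_distr module.smult_assoc1)

lemmas mod_ac = mod_assoc mod_comm mod_lcomm

lemma mod_smult_lcomm:
  assumes "module R V" "c \<in> carrier R" "d \<in> carrier R" "x \<in> carrier V"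
  shows "c \<odot>\<^bsub>V\<^esub> (d \<odot>\<^bsub>V\<^esub> x) = d \<odot>\<^bsub>V\<^esub> (c \<odot>\<^bsub>V\<^esub> x)"
  using assms by (metis m_comm mod_smult_smult)

lemma mod_neg_eq: "module R V \<Longrightarrow> x \<in> carrier V \<Longrightarrow> \<ominus>\<^bsub>V\<^esub> x = (\<ominus> \<one>) \<odot>\<^bsub>V\<^esub> x"
  by (simp add: module.smult_l_minus)

lemma mod_diff_eq:
  "module R V \<Longrightarrow> x \<in> carrier V \<Longrightarrow> y \<in> carrier V \<Longrightarrow> x \<ominus>\<^bsub>V\<^esub> y = x \<oplus>\<^bsub>V\<^esub> (\<ominus> \<one>) \<odot>\<^bsub>V\<^esub> y"
  by (simp add: a_minus_def mod_neg_eq)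

lemma mod_add_neg_smult [simp]:
  "module R V \<Longrightarrow> x \<in> carrier V \<Longrightarrow> x \<oplus>\<^bsub>V\<^esub> (\<ominus> \<one>) \<odot>\<^bsub>V\<^esub> x = \<zero>\<^bsub>V\<^esub>"
  by (metis abelian_group.r_neg mod_neg_eq module_abelian_group)

lemma mod_diff_self [simp]: "module R V \<Longrightarrow> x \<in> carrier V \<Longrightarrow> x \<ominus>\<^bsub>V\<^esub> x = \<zero>\<^bsub>V\<^esub>"
  by (simp add: mod_diff_eq)

lemma mod_diff_add [simp]:
  "module R V \<Longrightarrow> x \<in> carrier V \<Longrightarrow> y \<in> carrier V \<Longrightarrow> (x \<ominus>\<^bsub>V\<^esub> y) \<oplus>\<^bsub>V\<^esub> y = x"
  using mod_add_neg_smult[of V y] by (simp add: mod_diff_eq mod_assoc mod_comm[of V _ y])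

lemma mod_eq_of_diff_zero:
  assumes "module R V" "x \<in> carrier V" "y \<in> carrier V" "x \<ominus>\<^bsub>V\<^esub> y = \<zero>\<^bsub>V\<^esub>"
  shows "x = y"
  using mod_diff_add[OF assms(1-3)] assms by simp

lemma mod_smult_eq_zeroD:
  assumes "module R V" "c \<in> carrier R" "c \<noteq> \<zero>" "x \<in> carrier V" "c \<odot>\<^bsub>V\<^esub> x = \<zero>\<^bsub>V\<^esub>"
  shows "x = \<zero>\<^bsub>V\<^esub>"
proof -
  have "inv c \<in> carrier R" "inv c \<otimes> c = \<one>" using assms field_Units by auto
  then show ?thesis
    using assms mod_smult_smult[of V "inv c" c x] by simp
qed

lemma mod_finsum_closed [simp, intro]:
  "module R V \<Longrightarrow> f \<in> S \<rightarrow> carrier V \<Longrightarrow> finsum V f S \<in> carrier V"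
  by (simp add: abelian_monoid.finsum_closed module_abelian_group module_abelian_monoid)

lemma mod_finsum_insert [simp]:
  "module R V \<Longrightarrow> finite S \<Longrightarrow> a \<notin> S \<Longrightarrow> f \<in> S \<rightarrow> carrier V \<Longrightarrow> f a \<in> carrier V \<Longrightarrow>
    finsum V f (insert a S) = f a \<oplus>\<^bsub>V\<^esub> finsum V f S"
  by (simp add: abelian_monoid.finsum_insert module_abelian_group module_abelian_monoid)

lemma mod_finsum_empty [simp]: "module R V \<Longrightarrow> finsum V f {} = \<zero>\<^bsub>V\<^esub>"
  by (simp add: abelian_monoid.finsum_empty module_abelian_group module_abelian_monoid)

lemma mod_finsum_cong:
  assumes "module R V" "\<And>i. i \<in> S \<Longrightarrow> f i = g i" "\<And>i. i \<in> S \<Longrightarrow> g i \<in> carrier V"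
  shows "finsum V f S = finsum V g S"
  by (rule abelian_monoid.finsum_cong')
    (use assms in \<open>auto simp: module_abelian_group module_abelian_monoid\<close>)

lemma mod_finsum_add:
  "module R V \<Longrightarrow> f \<in> S \<rightarrow> carrier V \<Longrightarrow> g \<in> S \<rightarrow> carrier V \<Longrightarrow>
    finsum V (\<lambda>x. f x \<oplus>\<^bsub>V\<^esub> g x) S = finsum V f S \<oplus>\<^bsub>V\<^esub> finsum V g S"
  by (simp add: abelian_monoid.finsum_addf module_abelian_group module_abelian_monoid)

lemma mod_finsum_smult:
  "module R V \<Longrightarrow> finite S \<Longrightarrow> c \<in> carrier R \<Longrightarrow> f \<in> S \<rightarrow> carrier V \<Longrightarrow>
    finsum V (\<lambda>x. c \<odot>\<^bsub>V\<^esub> f x) S = c \<odot>\<^bsub>V\<^esub> finsum V f S"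
  by (simp add: module.finsum_smult_ldistr)

lemma mod_finsum_zero:
  "module R V \<Longrightarrow> (\<And>i. i \<in> S \<Longrightarrow> f i = \<zero>\<^bsub>V\<^esub>) \<Longrightarrow> finsum V f S = \<zero>\<^bsub>V\<^esub>"
  by (simp add: finsum_def comm_monoid.finprod_one_eqI[OF abelian_monoid.a_comm_monoid[OF module_abelian_monoid], simplified])

lemma mod_finsum_superset:
  assumes V: "module R V" and "finite T" "S \<subseteq> T" and zero: "\<And>i. i \<in> T - S \<Longrightarrow> f i = \<zero>\<^bsub>V\<^esub>"
    and S: "\<And>i. i \<in> S \<Longrightarrow> f i \<in> carrier V"
  shows "finsum V f S = finsum V f T"
proof -
  have f: "f \<in> S \<rightarrow> carrier V" "f \<in> T - S \<rightarrow> carrier V" using S zero V by auto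
  have "finsum V f (S \<union> (T - S)) = finsum V f S \<oplus>\<^bsub>V\<^esub> finsum V f (T - S)"
    by (rule abelian_monoid.finsum_Un_disjoint[OF module_abelian_monoid[OF V]])
      (use assms(2,3) f finite_subset in auto)
  moreover have "finsum V f (T - S) = \<zero>\<^bsub>V\<^esub>" using V zero by (rule mod_finsum_zero)
  ultimately show ?thesis using V f assms(3) by (simp add: Un_absorb1)
qed

lemma mod_finsum_single:
  assumes "module R V" "finite S" "i \<in> S" "x \<in> carrier V" "f i = x"
    "\<And>j. j \<in> S \<Longrightarrow> j \<noteq> i \<Longrightarrow> f j = \<zero>\<^bsub>V\<^esub>"
  shows "finsum V f S = x"
  using mod_finsum_superset[of V S "{i}" f] mod_finsum_insert[of V "{}" i f] assms by auto

subsection \<open>Subspaces\<close>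

lemma submoduleD:
  assumes "submodule N R V"
  shows "\<And>x. x \<in> N \<Longrightarrow> x \<in> carrier V" "\<zero>\<^bsub>V\<^esub> \<in> N"
    "\<And>x y. x \<in> N \<Longrightarrow> y \<in> N \<Longrightarrow> x \<oplus>\<^bsub>V\<^esub> y \<in> N"
    "\<And>c x. c \<in> carrier R \<Longrightarrow> x \<in> N \<Longrightarrow> c \<odot>\<^bsub>V\<^esub> x \<in> N"
  using submodule.smult_closed[OF assms] subgroup.subset[OF submodule.axioms(1)[OF assms]]
    subgroup.one_closed[OF submodule.axioms(1)[OF assms]]
    subgroup.m_closed[OF submodule.axioms(1)[OF assms]]
  by auto

lemma submodule_intro:
  assumes V: "module R V" and "\<And>x. x \<in> N \<Longrightarrow> x \<in> carrier V" "\<zero>\<^bsub>V\<^esub> \<in> N"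
    "\<And>x y. x \<in> N \<Longrightarrow> y \<in> N \<Longrightarrow> x \<oplus>\<^bsub>V\<^esub> y \<in> N"
    "\<And>c x. c \<in> carrier R \<Longrightarrow> x \<in> N \<Longrightarrow> c \<odot>\<^bsub>V\<^esub> x \<in> N"
  shows "submodule N R V"
  by (rule module.submoduleI[OF V]) (use assms in \<open>auto simp: mod_neg_eq\<close>)

lemma submodule_module: "module R V \<Longrightarrow> submodule N R V \<Longrightarrow> module R (V\<lparr>carrier := N\<rparr>)"
  by (rule submodule.submodule_is_module)

lemma submodule_carrier [simp]: "module R V \<Longrightarrow> submodule (carrier V) R V"
  by (rule module.carrier_is_submodule)

lemma submodule_zero [simp]: "module R V \<Longrightarrow> submodule {\<zero>\<^bsub>V\<^esub>} R V"
  by (rule submodule_intro) auto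

lemma submodule_finsum:
  assumes "module R V" "submodule N R V" "\<And>i. i \<in> S \<Longrightarrow> f i \<in> N"
  shows "finsum V f S \<in> N"
proof (cases "finite S")
  case True
  then show ?thesis using assms(3)
  proof (induction S)
    case (insert a S)
    then show ?case using assms(1) submoduleD[OF assms(2)] by (auto simp: Pi_def)
  qed (use assms submoduleD in auto)
next
  case False
  interpret abelian_monoid V using assms(1) by (simp add: module_abelian_group module_abelian_monoid)
  show ?thesis using False submoduleD[OF assms(2)] by simp
qed

lemma gen_submodule_submodule:
  assumes V: "module R V" and X: "X \<subseteq> carrier V"
  shows "submodule (gen_submodule R V X) R V"
proof (rule submodule_intro[OF V])
  have "submodule (carrier V) R V" using V by simp
  then show "x \<in> carrier V" if "x \<in> gen_submodule R V X" for x
    using that X unfolding gen_submodule_def by blast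
qed (auto simp: gen_submodule_def submoduleD)

lemma gen_submodule_incl: "x \<in> X \<Longrightarrow> x \<in> gen_submodule R V X"
  by (auto simp: gen_submodule_def)

lemma gen_submodule_least: "submodule N R V \<Longrightarrow> X \<subseteq> N \<Longrightarrow> gen_submodule R V X \<subseteq> N"
  by (auto simp: gen_submodule_def)

subsection \<open>Linear maps\<close>

lemma linear_mapI:
  assumes "\<And>x. x \<in> carrier V \<Longrightarrow> f x \<in> carrier W"
    "\<And>x y. x \<in> carrier V \<Longrightarrow> y \<in> carrier V \<Longrightarrow> f (x \<oplus>\<^bsub>V\<^esub> y) = f x \<oplus>\<^bsub>W\<^esub> f y"
    "\<And>c x. c \<in> carrier R \<Longrightarrow> x \<in> carrier V \<Longrightarrow> f (c \<odot>\<^bsub>V\<^esub> x) = c \<odot>\<^bsub>W\<^esub> f x"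
  shows "linear_map R V W f"
  using assms by (auto simp: linear_map_def)

lemma lin_closed: "linear_map R V W f \<Longrightarrow> x \<in> carrier V \<Longrightarrow> f x \<in> carrier W"
  and lin_add: "linear_map R V W f \<Longrightarrow> x \<in> carrier V \<Longrightarrow> y \<in> carrier V \<Longrightarrow>
    f (x \<oplus>\<^bsub>V\<^esub> y) = f x \<oplus>\<^bsub>W\<^esub> f y"
  and lin_smult: "linear_map R V W f \<Longrightarrow> c \<in> carrier R \<Longrightarrow> x \<in> carrier V \<Longrightarrow>
    f (c \<odot>\<^bsub>V\<^esub> x) = c \<odot>\<^bsub>W\<^esub> f x"
  by (auto simp: linear_map_def)

lemma lin_zero:
  assumes "module R V" "module R W" "linear_map R V W f" shows "f \<zero>\<^bsub>V\<^esub> = \<zero>\<^bsub>W\<^esub>"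
  using lin_smult[OF assms(3), of \<zero> "\<zero>\<^bsub>V\<^esub>"] lin_closed[OF assms(3), of "\<zero>\<^bsub>V\<^esub>"] assms by simp

lemma lin_diff:
  assumes "module R V" "module R W" "linear_map R V W f" "x \<in> carrier V" "y \<in> carrier V"
  shows "f (x \<ominus>\<^bsub>V\<^esub> y) = f x \<ominus>\<^bsub>W\<^esub> f y"
  using assms by (simp add: mod_diff_eq lin_add lin_smult lin_closed)

lemma lin_finsum:
  assumes "module R V" "module R W" "linear_map R V W f" "\<And>i. i \<in> S \<Longrightarrow> g i \<in> carrier V"
  shows "f (finsum V g S) = finsum W (\<lambda>i. f (g i)) S"
proof (cases "finite S")
  case True
  then show ?thesis using assms(4)
  proof (induction S)
    case (insert a S)
    then have g: "g \<in> S \<rightarrow> carrier V" "g a \<in> carrier V" by auto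
    then have "(\<lambda>i. f (g i)) \<in> S \<rightarrow> carrier W" "f (g a) \<in> carrier W"
      using lin_closed[OF assms(3)] by auto
    then show ?case using g insert assms(1-3) by (simp add: lin_add)
  qed (use assms in \<open>simp add: lin_zero\<close>)
next
  case False
  interpret V: abelian_monoid V using assms(1) by (simp add: module_abelian_group module_abelian_monoid)
  interpret W: abelian_monoid W using assms(2) by (simp add: module_abelian_group module_abelian_monoid)
  show ?thesis using False assms by (simp add: lin_zero)
qed

lemma lin_id: "linear_map R V V (\<lambda>x. x)"
  by (simp add: linear_map_def)

lemma lin_comp:
  "linear_map R V W f \<Longrightarrow> linear_map R W U g \<Longrightarrow> linear_map R V U (\<lambda>x. g (f x))"
  by (auto simp: linear_map_def Pi_def)

lemma lin_smult_const:
  "module R W \<Longrightarrow> linear_map R V W f \<Longrightarrow> c \<in> carrier R \<Longrightarrow> linear_map R V W (\<lambda>x. c \<odot>\<^bsub>W\<^esub> f x)"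
  by (rule linear_mapI) (auto simp: lin_closed lin_add lin_smult mod_smult_add mod_smult_lcomm)

lemma lin_zero_map: "module R W \<Longrightarrow> linear_map R V W (\<lambda>x. \<zero>\<^bsub>W\<^esub>)"
  by (rule linear_mapI) auto

lemma lin_add_map:
  assumes "module R W" "linear_map R V W f" "linear_map R V W g"
  shows "linear_map R V W (\<lambda>x. f x \<oplus>\<^bsub>W\<^esub> g x)"
  by (rule linear_mapI)
    (use assms in \<open>auto simp: lin_closed lin_add lin_smult mod_smult_add mod_ac\<close>)

lemma lin_finsum_map:
  assumes W: "module R W" and "finite S" and "\<And>i. i \<in> S \<Longrightarrow> linear_map R V W (f i)"
  shows "linear_map R V W (\<lambda>x. finsum W (\<lambda>i. f i x) S)"
proof (rule linear_mapI)
  note f = lin_closed[OF assms(3)] lin_add[OF assms(3)] lin_smult[OF assms(3)]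
  show "finsum W (\<lambda>i. f i x) S \<in> carrier W" if "x \<in> carrier V" for x
    using W f that by auto
  show "finsum W (\<lambda>i. f i (x \<oplus>\<^bsub>V\<^esub> y)) S = finsum W (\<lambda>i. f i x) S \<oplus>\<^bsub>W\<^esub> finsum W (\<lambda>i. f i y) S"
    if "x \<in> carrier V" "y \<in> carrier V" for x y
    using W f that by (subst mod_finsum_add[symmetric]) (auto intro!: mod_finsum_cong)
  show "finsum W (\<lambda>i. f i (c \<odot>\<^bsub>V\<^esub> x)) S = c \<odot>\<^bsub>W\<^esub> finsum W (\<lambda>i. f i x) S"
    if "c \<in> carrier R" "x \<in> carrier V" for c x
    using W f that assms(2) by (subst mod_finsum_smult[symmetric]) (auto intro!: mod_finsum_cong)
qed

lemma submodule_vimage: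
  assumes "module R V" "module R W" "linear_map R V W f" "submodule N R W"
  shows "submodule {x \<in> carrier V. f x \<in> N} R V"
  by (rule submodule_intro)
    (use assms submoduleD[OF assms(4)] in \<open>auto simp: lin_add lin_smult lin_zero\<close>)

lemma submodule_image:
  assumes "module R V" "module R W" "linear_map R V W f" "submodule N R V"
  shows "submodule (f ` N) R W"
proof (rule submodule_intro)
  note N = submoduleD[OF assms(4)]
  show "\<zero>\<^bsub>W\<^esub> \<in> f ` N" using lin_zero[OF assms(1-3)] N(2) by force
  show "x \<oplus>\<^bsub>W\<^esub> y \<in> f ` N" if xy: "x \<in> f ` N" "y \<in> f ` N" for x y
  proof -
    from xy obtain u v where "u \<in> N" "v \<in> N" "x = f u" "y = f v" by auto
    then have "x \<oplus>\<^bsub>W\<^esub> y = f (u \<oplus>\<^bsub>V\<^esub> v)" "u \<oplus>\<^bsub>V\<^esub> v \<in> N"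
      using N lin_add[OF assms(3)] by auto
    then show ?thesis by auto
  qed
  show "c \<odot>\<^bsub>W\<^esub> x \<in> f ` N" if cx: "c \<in> carrier R" "x \<in> f ` N" for c x
  proof -
    from cx obtain u where "u \<in> N" "x = f u" by auto
    then have "c \<odot>\<^bsub>W\<^esub> x = f (c \<odot>\<^bsub>V\<^esub> u)" "c \<odot>\<^bsub>V\<^esub> u \<in> N"
      using N lin_smult[OF assms(3)] cx by auto
    then show ?thesis by auto
  qed
qed (use assms submoduleD[OF assms(4)] lin_closed[OF assms(3)] in auto)

lemma lin_incl: "submodule N R V \<Longrightarrow> linear_map R (V\<lparr>carrier := N\<rparr>) V (\<lambda>x. x)"
  by (auto simp: linear_map_def submoduleD)

lemma lin_restrict: "submodule N R V \<Longrightarrow> linear_map R V W f \<Longrightarrow> linear_map R (V\<lparr>carrier := N\<rparr>) W f"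
  by (auto simp: linear_map_def Pi_def submoduleD)

lemma lin_corestrict:
  "linear_map R V W f \<Longrightarrow> (\<And>x. x \<in> carrier V \<Longrightarrow> f x \<in> N) \<Longrightarrow> linear_map R V (W\<lparr>carrier := N\<rparr>) f"
  by (auto simp: linear_map_def)

lemma ground_simps [simp]: "carrier (ground_algebra R) = carrier R" "add (ground_algebra R) = add R"
  "zero (ground_algebra R) = zero R" "smult (ground_algebra R) = mult R"
  "mult (ground_algebra R) = mult R" "one (ground_algebra R) = one R"
  by (simp_all add: ground_algebra_def)

lemma ground_module [simp]: "module R (ground_algebra R)"
proof (rule moduleI)
  show "abelian_group (ground_algebra R)"
  proof (rule abelian_groupI)
    show "\<exists>y\<in>carrier (ground_algebra R). y \<oplus>\<^bsub>ground_algebra R\<^esub> x = \<zero>\<^bsub>ground_algebra R\<^esub>"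
      if "x \<in> carrier (ground_algebra R)" for x
      using that l_neg[of x] by (intro bexI[of _ "\<ominus> x"]) auto
  qed (simp_all add: a_assoc a_comm a_lcomm)
qed (simp_all add: is_cring l_distr r_distr m_assoc)

lemma inj_on_lin:
  assumes "module R V" "module R W" "linear_map R V W f"
    "\<And>x. x \<in> carrier V \<Longrightarrow> f x = \<zero>\<^bsub>W\<^esub> \<Longrightarrow> x = \<zero>\<^bsub>V\<^esub>"
  shows "inj_on f (carrier V)"
proof (rule inj_onI)
  fix x y assume xy: "x \<in> carrier V" "y \<in> carrier V" "f x = f y"
  then have "f (x \<ominus>\<^bsub>V\<^esub> y) = \<zero>\<^bsub>W\<^esub>"
    using assms(1-3) by (simp add: lin_diff lin_closed)
  then have "x \<ominus>\<^bsub>V\<^esub> y = \<zero>\<^bsub>V\<^esub>" using assms(1) xy by (intro assms(4)) auto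
  then show "x = y" by (rule mod_eq_of_diff_zero[OF assms(1) xy(1,2)])
qed


lemma mod_add_right_cancel:
  assumes V: "module R V" and x: "x \<in> carrier V" "y \<in> carrier V" "z \<in> carrier V"
    and eq: "x \<oplus>\<^bsub>V\<^esub> z = y \<oplus>\<^bsub>V\<^esub> z"
  shows "x = y"
proof -
  have *: "(w \<oplus>\<^bsub>V\<^esub> z) \<oplus>\<^bsub>V\<^esub> (\<ominus> \<one>) \<odot>\<^bsub>V\<^esub> z = w" if "w \<in> carrier V" for w
    using that V x by (simp add: mod_assoc)
  show ?thesis using trans[OF *[OF x(1), symmetric, unfolded eq] *[OF x(2)]] .
qed

subsection \<open>Linear functionals\<close>

abbreviation functional :: "('a, 'v, 'm) module_scheme \<Rightarrow> ('v \<Rightarrow> 'a) \<Rightarrow> bool" where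
  "functional V f \<equiv> linear_map R V (ground_algebra R) f"

lemma functional_closed [simp]: "functional V f \<Longrightarrow> x \<in> carrier V \<Longrightarrow> f x \<in> carrier R"
  and functional_add: "functional V f \<Longrightarrow> x \<in> carrier V \<Longrightarrow> y \<in> carrier V \<Longrightarrow>
    f (x \<oplus>\<^bsub>V\<^esub> y) = f x \<oplus> f y"
  and functional_smult: "functional V f \<Longrightarrow> c \<in> carrier R \<Longrightarrow> x \<in> carrier V \<Longrightarrow>
    f (c \<odot>\<^bsub>V\<^esub> x) = c \<otimes> f x"
  by (auto simp: linear_map_def)

lemma functional_zero: "module R V \<Longrightarrow> functional V f \<Longrightarrow> f \<zero>\<^bsub>V\<^esub> = \<zero>"
  using lin_zero[of V "ground_algebra R" f] by simp

text \<open>The coefficient of \<open>x\<close> is unique: if two decompositions had different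
  coefficients, dividing by the difference would put \<open>x\<close> into \<open>M\<close>. So any
  choice of the coefficient is automatically linear, and \<open>feq\<close> computes it from
  whichever decomposition is at hand.\<close>

lemma complement_functional:
  assumes V: "module R V" and M: "submodule M R V" and x: "x \<in> carrier V" "x \<notin> M"
    and decomp: "\<And>v. v \<in> carrier V \<Longrightarrow> \<exists>c\<in>carrier R. \<exists>m\<in>M. v = m \<oplus>\<^bsub>V\<^esub> c \<odot>\<^bsub>V\<^esub> x"
  shows "\<exists>f. functional V f \<and> (\<forall>m\<in>M. f m = \<zero>) \<and> f x = \<one>"
proof -
  note MD = submoduleD[OF M]
  have uniq: "c = c'" if "c \<in> carrier R" "c' \<in> carrier R" "m \<in> M" "m' \<in> M"
    "m \<oplus>\<^bsub>V\<^esub> c \<odot>\<^bsub>V\<^esub> x = m' \<oplus>\<^bsub>V\<^esub> c' \<odot>\<^bsub>V\<^esub> x" for c c' m m'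
  proof (rule ccontr)
    assume "c \<noteq> c'"
    define d where "d = c \<ominus> c'"
    have dc: "d \<oplus> c' = c" using that by (simp add: d_def a_minus_def a_assoc l_neg)
    have d: "d \<in> carrier R" "d \<noteq> \<zero>" using that \<open>c \<noteq> c'\<close> dc by (auto simp: d_def)
    then have i: "inv d \<in> carrier R" "inv d \<otimes> d = \<one>" using field_Units by auto
    have "d \<odot>\<^bsub>V\<^esub> x \<oplus>\<^bsub>V\<^esub> (m \<oplus>\<^bsub>V\<^esub> c' \<odot>\<^bsub>V\<^esub> x) = m \<oplus>\<^bsub>V\<^esub> (d \<oplus> c') \<odot>\<^bsub>V\<^esub> x"
      using that d V x MD(1) by (simp add: mod_add_smult mod_lcomm)
    also note dc
    also note that(5)
    finally have "(d \<odot>\<^bsub>V\<^esub> x \<oplus>\<^bsub>V\<^esub> m) \<oplus>\<^bsub>V\<^esub> c' \<odot>\<^bsub>V\<^esub> x = m' \<oplus>\<^bsub>V\<^esub> c' \<odot>\<^bsub>V\<^esub> x"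
      using that d V x MD(1) by (simp add: mod_assoc)
    then have "d \<odot>\<^bsub>V\<^esub> x \<oplus>\<^bsub>V\<^esub> m = m'"
      by (rule mod_add_right_cancel[OF V, rotated 3]) (use that(1-4) d V x MD(1) in auto)
    then have "m' \<oplus>\<^bsub>V\<^esub> (\<ominus> \<one>) \<odot>\<^bsub>V\<^esub> m = d \<odot>\<^bsub>V\<^esub> x"
      using d V x MD(1)[OF that(3)] by (auto simp: mod_assoc)
    moreover have "m' \<oplus>\<^bsub>V\<^esub> (\<ominus> \<one>) \<odot>\<^bsub>V\<^esub> m \<in> M" by (intro MD(3,4) that) auto
    ultimately have "d \<odot>\<^bsub>V\<^esub> x \<in> M" by simp
    then have "inv d \<odot>\<^bsub>V\<^esub> (d \<odot>\<^bsub>V\<^esub> x) \<in> M" using MD(4) i by blast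
    moreover have "inv d \<odot>\<^bsub>V\<^esub> (d \<odot>\<^bsub>V\<^esub> x) = x"
      using i d V x by (simp add: mod_smult_smult[symmetric])
    ultimately show False using x by simp
  qed
  define f where "f v = (SOME c. c \<in> carrier R \<and> (\<exists>m\<in>M. v = m \<oplus>\<^bsub>V\<^esub> c \<odot>\<^bsub>V\<^esub> x))" for v
  have f: "f v \<in> carrier R \<and> (\<exists>m\<in>M. v = m \<oplus>\<^bsub>V\<^esub> f v \<odot>\<^bsub>V\<^esub> x)" if "v \<in> carrier V" for v
    unfolding f_def by (rule someI_ex) (use decomp[OF that] in blast)
  have feq: "f v = c" if "c \<in> carrier R" "m \<in> M" "v = m \<oplus>\<^bsub>V\<^esub> c \<odot>\<^bsub>V\<^esub> x" for v c m
  proof -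
    have v: "v \<in> carrier V" using that V x MD by auto
    then show ?thesis using f[OF v] uniq[OF _ that(1) _ that(2)] that(3) by metis
  qed
  have "functional V f"
  proof (rule linear_mapI; simp)
    show "f v \<in> carrier R" if "v \<in> carrier V" for v using f that by blast
    show "f (v \<oplus>\<^bsub>V\<^esub> w) = f v \<oplus> f w" if vw: "v \<in> carrier V" "w \<in> carrier V" for v w
    proof -
      obtain m n where mn: "m \<in> M" "v = m \<oplus>\<^bsub>V\<^esub> f v \<odot>\<^bsub>V\<^esub> x" "n \<in> M" "w = n \<oplus>\<^bsub>V\<^esub> f w \<odot>\<^bsub>V\<^esub> x"
        using f vw by blast
      have c: "f v \<in> carrier R" "f w \<in> carrier R" using f vw by auto
      have "(m \<oplus>\<^bsub>V\<^esub> f v \<odot>\<^bsub>V\<^esub> x) \<oplus>\<^bsub>V\<^esub> (n \<oplus>\<^bsub>V\<^esub> f w \<odot>\<^bsub>V\<^esub> x) = (m \<oplus>\<^bsub>V\<^esub> n) \<oplus>\<^bsub>V\<^esub> (f v \<oplus> f w) \<odot>\<^bsub>V\<^esub> x"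
        using c mn(1,3) MD V x by (simp add: mod_add_smult mod_ac)
      then show ?thesis using c mn MD by (intro feq[of _ "m \<oplus>\<^bsub>V\<^esub> n"]) auto
    qed
    show "f (c \<odot>\<^bsub>V\<^esub> v) = c \<otimes> f v" if cv: "c \<in> carrier R" "v \<in> carrier V" for c v
    proof -
      obtain m where m: "m \<in> M" "v = m \<oplus>\<^bsub>V\<^esub> f v \<odot>\<^bsub>V\<^esub> x" using f cv by blast
      have fv: "f v \<in> carrier R" using f cv by auto
      have "c \<odot>\<^bsub>V\<^esub> (m \<oplus>\<^bsub>V\<^esub> f v \<odot>\<^bsub>V\<^esub> x) = c \<odot>\<^bsub>V\<^esub> m \<oplus>\<^bsub>V\<^esub> (c \<otimes> f v) \<odot>\<^bsub>V\<^esub> x"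
        using fv cv m(1) MD V x by (simp add: mod_smult_add mod_smult_smult)
      then show ?thesis using fv cv m MD by (intro feq[of _ "c \<odot>\<^bsub>V\<^esub> m"]) auto
    qed
  qed
  moreover have "f m = \<zero>" if "m \<in> M" for m
    using that V x MD by (intro feq[of _ m]) auto
  moreover have "f x = \<one>"
    using V x MD by (intro feq[of _ "\<zero>\<^bsub>V\<^esub>"]) auto
  ultimately show ?thesis by blast
qed

text \<open>Zorn's lemma takes the place of a basis: a subspace \<open>M\<close> maximal among those
  that contain \<open>W\<close> and avoid \<open>x\<close> is a complement of the line through
  \<open>x\<close>, and the coefficient along that line is the functional.\<close>

lemma functional_separation:
  assumes V: "module R V" and W: "submodule W R V" and x: "x \<in> carrier V" "x \<notin> W"
  shows "\<exists>f. functional V f \<and> (\<forall>w\<in>W. f w = \<zero>) \<and> f x = \<one>"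
proof -
  let ?S = "{N. submodule N R V \<and> W \<subseteq> N \<and> x \<notin> N}"
  have "\<exists>M\<in>?S. \<forall>X\<in>?S. M \<subseteq> X \<longrightarrow> X = M"
  proof (rule subset_Zorn_nonempty)
    show "?S \<noteq> {}" using W x(2) by blast
    fix C assume C: "C \<noteq> {}" "subset.chain ?S C"
    have sub: "C \<subseteq> ?S" and chain: "\<forall>N\<in>C. \<forall>N'\<in>C. N \<subseteq> N' \<or> N' \<subseteq> N"
      using C(2) unfolding subset_chain_def by simp_all
    have CS: "submodule N R V \<and> W \<subseteq> N \<and> x \<notin> N" if "N \<in> C" for N
      using sub that by auto
    have ch: "N \<subseteq> N' \<or> N' \<subseteq> N" if "N \<in> C" "N' \<in> C" for N N'
      using chain that by simp
    have "submodule (\<Union>C) R V"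
    proof (rule submodule_intro[OF V])
      have CD: "N \<subseteq> carrier V \<and> \<zero>\<^bsub>V\<^esub> \<in> N \<and> (\<forall>y\<in>N. \<forall>z\<in>N. y \<oplus>\<^bsub>V\<^esub> z \<in> N) \<and>
        (\<forall>c\<in>carrier R. \<forall>y\<in>N. c \<odot>\<^bsub>V\<^esub> y \<in> N)" if "N \<in> C" for N
        using submoduleD[of N V] CS[OF that] by auto
      show "y \<in> carrier V" if "y \<in> \<Union>C" for y using that CD by blast
      show "\<zero>\<^bsub>V\<^esub> \<in> \<Union>C" using C(1) CD by blast
      show "c \<odot>\<^bsub>V\<^esub> y \<in> \<Union>C" if "c \<in> carrier R" "y \<in> \<Union>C" for c y
        using that CD by blast
      show "y \<oplus>\<^bsub>V\<^esub> z \<in> \<Union>C" if yz: "y \<in> \<Union>C" "z \<in> \<Union>C" for y z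
      proof -
        obtain N N' where N: "N \<in> C" "N' \<in> C" "y \<in> N" "z \<in> N'" using yz by blast
        then consider "y \<in> N'" | "z \<in> N" using ch by blast
        then show ?thesis
        proof cases
          case 1
          then have "y \<oplus>\<^bsub>V\<^esub> z \<in> N'" using CD N by blast
          then show ?thesis using N by blast
        next
          case 2
          then have "y \<oplus>\<^bsub>V\<^esub> z \<in> N" using CD N by blast
          then show ?thesis using N by blast
        qed
      qed
    qed
    moreover have "W \<subseteq> \<Union>C" "x \<notin> \<Union>C" using C(1) CS by auto
    ultimately show "\<Union>C \<in> ?S" by simp
  qed
  then obtain M where M: "submodule M R V" "W \<subseteq> M" "x \<notin> M"
    and max0: "\<forall>N\<in>?S. M \<subseteq> N \<longrightarrow> N = M" by auto
  have max: "N = M" if "submodule N R V" "M \<subseteq> N" "x \<notin> N" for N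
    using max0 that M(2) by auto
  note MD = submoduleD[OF M(1)]
  have decomp: "\<exists>c\<in>carrier R. \<exists>m\<in>M. v = m \<oplus>\<^bsub>V\<^esub> c \<odot>\<^bsub>V\<^esub> x" if v: "v \<in> carrier V" for v
  proof (cases "v \<in> M")
    case True
    then show ?thesis using V x v by (intro bexI[of _ \<zero>] bexI[of _ v]) auto
  next
    case False
    let ?N = "{m \<oplus>\<^bsub>V\<^esub> c \<odot>\<^bsub>V\<^esub> v | m c. m \<in> M \<and> c \<in> carrier R}"
    have NI: "m \<oplus>\<^bsub>V\<^esub> c \<odot>\<^bsub>V\<^esub> v \<in> ?N" if "m \<in> M" "c \<in> carrier R" for m c using that by blast
    have "submodule ?N R V"
    proof (rule submodule_intro[OF V])
      show "y \<in> carrier V" if "y \<in> ?N" for y using that V v MD by auto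
      show "\<zero>\<^bsub>V\<^esub> \<in> ?N" using NI[of "\<zero>\<^bsub>V\<^esub>" \<zero>] MD V v by simp
      show "c \<odot>\<^bsub>V\<^esub> y \<in> ?N" if c: "c \<in> carrier R" and y: "y \<in> ?N" for c y
      proof -
        obtain m d where "m \<in> M" "d \<in> carrier R" "y = m \<oplus>\<^bsub>V\<^esub> d \<odot>\<^bsub>V\<^esub> v" using y by blast
        then show ?thesis using NI[of "c \<odot>\<^bsub>V\<^esub> m" "c \<otimes> d"] c V v MD
          by (simp add: mod_smult_add mod_smult_smult)
      qed
      show "y \<oplus>\<^bsub>V\<^esub> z \<in> ?N" if y: "y \<in> ?N" and z: "z \<in> ?N" for y z
      proof -
        obtain m d where 1: "m \<in> M" "d \<in> carrier R" "y = m \<oplus>\<^bsub>V\<^esub> d \<odot>\<^bsub>V\<^esub> v" using y by blast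
        obtain n e where 2: "n \<in> M" "e \<in> carrier R" "z = n \<oplus>\<^bsub>V\<^esub> e \<odot>\<^bsub>V\<^esub> v" using z by blast
        have "y \<oplus>\<^bsub>V\<^esub> z = (m \<oplus>\<^bsub>V\<^esub> n) \<oplus>\<^bsub>V\<^esub> (d \<oplus> e) \<odot>\<^bsub>V\<^esub> v"
          using 1 2 V v MD by (simp add: mod_add_smult mod_ac)
        then show ?thesis using NI[of "m \<oplus>\<^bsub>V\<^esub> n" "d \<oplus> e"] 1 2 MD by simp
      qed
    qed
    moreover have "M \<subseteq> ?N"
    proof
      fix m assume m: "m \<in> M"
      then have "m \<oplus>\<^bsub>V\<^esub> \<zero> \<odot>\<^bsub>V\<^esub> v \<in> ?N" by (intro NI) auto
      then show "m \<in> ?N" using V v MD(1)[OF m] by (simp del: mem_Collect_eq)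
    qed
    moreover have "v \<in> ?N" using NI[of "\<zero>\<^bsub>V\<^esub>" \<one>] V v MD(2) by (simp del: mem_Collect_eq)
    ultimately have N: "submodule ?N R V" "M \<subseteq> ?N" "v \<in> ?N" .
    \<comment> \<open>\<open>?N\<close> is \<open>M\<close> plus the line through \<open>v\<close>;
      being strictly larger than \<open>M\<close>, it must contain \<open>x\<close>. The coefficient
      of \<open>v\<close> in \<open>x\<close> is nonzero because \<open>x\<close> is not in
      \<open>M\<close>, so the equation can be solved for \<open>v\<close>.\<close>
    have "x \<in> ?N"
    proof (rule ccontr)
      assume "x \<notin> ?N"
      then have "?N = M" by (rule max[OF N(1,2)])
      then show False using False N(3) by argo
    qed
    then obtain m c where mc: "m \<in> M" "c \<in> carrier R" "x = m \<oplus>\<^bsub>V\<^esub> c \<odot>\<^bsub>V\<^esub> v" by blast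
    have "c \<noteq> \<zero>" using mc M(3) V v MD by auto
    then have i: "inv c \<in> carrier R" "inv c \<otimes> c = \<one>" using mc field_Units by auto
    have n: "\<ominus> (inv c) \<in> carrier R" using i by simp
    have "inv c \<odot>\<^bsub>V\<^esub> x = inv c \<odot>\<^bsub>V\<^esub> m \<oplus>\<^bsub>V\<^esub> v"
      using mc i V v MD by (simp add: mod_smult_add mod_smult_smult[symmetric])
    then have "(\<ominus> (inv c)) \<odot>\<^bsub>V\<^esub> m \<oplus>\<^bsub>V\<^esub> inv c \<odot>\<^bsub>V\<^esub> x = v"
      using mc i n V v MD
      by (simp add: mod_assoc[symmetric] mod_add_smult[symmetric] l_neg)
    then show ?thesis using i n mc MD
      by (intro bexI[of _ "inv c"] bexI[of _ "(\<ominus> (inv c)) \<odot>\<^bsub>V\<^esub> m"]) auto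
  qed
  show ?thesis using complement_functional[OF V M(1) x(1) M(3) decomp] M(2) by auto
qed

text \<open>Separation of the difference from the zero subspace. It identifies two elements of
  \<open>H\<close> of which only the values under functionals are accessible, through contractions
  of a coaction.\<close>

lemma functional_eqI:
  assumes "module R V" "x \<in> carrier V" "y \<in> carrier V" "\<And>f. functional V f \<Longrightarrow> f x = f y"
  shows "x = y"
proof (rule ccontr)
  assume "x \<noteq> y"
  then have "x \<ominus>\<^bsub>V\<^esub> y \<notin> {\<zero>\<^bsub>V\<^esub>}" using mod_eq_of_diff_zero[OF assms(1-3)] by auto
  from functional_separation[OF assms(1) submodule_zero[OF assms(1)] mod_diff[OF assms(1-3)] this]
  obtain f where f: "functional V f" "f (x \<ominus>\<^bsub>V\<^esub> y) = \<one>" by auto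
  have "f (x \<ominus>\<^bsub>V\<^esub> y) = f y \<oplus> (\<ominus> \<one>) \<otimes> f y"
    using assms(1-3) assms(4)[OF f(1)] f(1) by (simp add: mod_diff_eq functional_add functional_smult)
  also have "\<dots> = \<zero>" using f(1) assms(3) by (simp add: l_minus r_neg)
  finally show False using f(2) by simp
qed

section \<open>Free modules\<close>

lemma free_simps [simp]:
  "zero (free_module R X) = (\<lambda>_. \<zero>)"
  "add (free_module R X) f g = (\<lambda>x. f x \<oplus> g x)"
  "smult (free_module R X) c f = (\<lambda>x. c \<otimes> f x)"
  by (simp_all add: free_module_def)

lemma free_carrier:
  "f \<in> carrier (free_module R X) \<longleftrightarrow>
    (\<forall>x. f x \<in> carrier R) \<and> finite {x. f x \<noteq> \<zero>} \<and> (\<forall>x. x \<notin> X \<longrightarrow> f x = \<zero>)"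
  by (auto simp: free_module_def)

lemma free_closed [simp]: "f \<in> carrier (free_module R X) \<Longrightarrow> f x \<in> carrier R"
  by (simp add: free_carrier)

lemma free_module_module [simp]: "module R (free_module R X)"
proof -
  have add: "(\<lambda>x. f x \<oplus> g x) \<in> carrier (free_module R X)"
    if "f \<in> carrier (free_module R X)" "g \<in> carrier (free_module R X)" for f g
  proof -
    have "{x. f x \<oplus> g x \<noteq> \<zero>} \<subseteq> {x. f x \<noteq> \<zero>} \<union> {x. g x \<noteq> \<zero>}"
      by auto
    from finite_subset[OF this] show ?thesis using that by (auto simp: free_carrier)
  qed
  have sm: "(\<lambda>x. c \<otimes> f x) \<in> carrier (free_module R X)"
    if "c \<in> carrier R" "f \<in> carrier (free_module R X)" for c f
  proof -
    have "{x. c \<otimes> f x \<noteq> \<zero>} \<subseteq> {x. f x \<noteq> \<zero>}"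
      using that by auto
    from finite_subset[OF this] show ?thesis using that by (auto simp: free_carrier)
  qed
  have "abelian_group (free_module R X)"
  proof (rule abelian_groupI)
    show "\<exists>g\<in>carrier (free_module R X). g \<oplus>\<^bsub>free_module R X\<^esub> f = \<zero>\<^bsub>free_module R X\<^esub>"
      if f: "f \<in> carrier (free_module R X)" for f
    proof
      show "(\<lambda>x. (\<ominus> \<one>) \<otimes> f x) \<in> carrier (free_module R X)" using f by (intro sm) auto
      show "(\<lambda>x. (\<ominus> \<one>) \<otimes> f x) \<oplus>\<^bsub>free_module R X\<^esub> f = \<zero>\<^bsub>free_module R X\<^esub>"
        using f by (simp add: fun_eq_iff l_minus l_neg)
    qed
    show "\<zero>\<^bsub>free_module R X\<^esub> \<in> carrier (free_module R X)" by (simp add: free_carrier)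
  qed (simp_all add: add fun_eq_iff a_ac)
  then show ?thesis
    by (rule moduleI[OF is_cring])
      (simp_all add: sm fun_eq_iff l_distr r_distr m_assoc)
qed

lemma basis_vec_carrier [simp]: "x \<in> X \<Longrightarrow> basis_vec R x \<in> carrier (free_module R X)"
  by (auto simp: free_carrier basis_vec_def)

lemma free_expand:
  assumes f: "f \<in> carrier (free_module R X)" and S: "finite S" "S \<subseteq> X" "\<And>x. x \<notin> S \<Longrightarrow> f x = \<zero>"
  shows "f = finsum (free_module R X) (\<lambda>x. f x \<odot>\<^bsub>free_module R X\<^esub> basis_vec R x) S"
  using S f
proof (induction S arbitrary: f)
  case empty
  then show ?case by (simp add: fun_eq_iff)
next
  case (insert a S)
  let ?P = "free_module R X" and ?g = "f(a := \<zero>)"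
  have sub: "{x. ?g x \<noteq> \<zero>} \<subseteq> {x. f x \<noteq> \<zero>}" by auto
  have g: "?g \<in> carrier ?P"
    using insert.prems(3) finite_subset[OF sub] by (auto simp: free_carrier)
  have "?g = finsum ?P (\<lambda>x. ?g x \<odot>\<^bsub>?P\<^esub> basis_vec R x) S"
    by (intro insert.IH g) (use insert.prems in auto)
  also have "\<dots> = finsum ?P (\<lambda>x. f x \<odot>\<^bsub>?P\<^esub> basis_vec R x) S"
    using insert.hyps insert.prems by (intro mod_finsum_cong)
      (auto simp del: free_simps)
  finally have eq: "?g = finsum ?P (\<lambda>x. f x \<odot>\<^bsub>?P\<^esub> basis_vec R x) S" .
  have "finsum ?P (\<lambda>x. f x \<odot>\<^bsub>?P\<^esub> basis_vec R x) (insert a S) =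
      f a \<odot>\<^bsub>?P\<^esub> basis_vec R a \<oplus>\<^bsub>?P\<^esub> finsum ?P (\<lambda>x. f x \<odot>\<^bsub>?P\<^esub> basis_vec R x) S"
    using insert.hyps insert.prems by (intro mod_finsum_insert) (auto simp del: free_simps)
  also have "\<dots> = f a \<odot>\<^bsub>?P\<^esub> basis_vec R a \<oplus>\<^bsub>?P\<^esub> ?g" by (simp only: eq[symmetric])
  also have "\<dots> = f"
    using insert.prems(3) by (auto simp: fun_eq_iff basis_vec_def)
  finally show ?case by (rule sym)
qed

text \<open>\<open>lin_ext\<close> sums over the exact support, which changes under addition and
  scaling. Over a common larger index set linearity becomes a termwise statement.\<close>

lemma lin_ext_superset:
  assumes V: "module R V" and f: "f \<in> carrier (free_module R X)"
    and S: "finite S" "S \<subseteq> X" "\<And>x. x \<notin> S \<Longrightarrow> f x = \<zero>" and \<phi>: "\<And>x. x \<in> X \<Longrightarrow> \<phi> x \<in> carrier V"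
  shows "lin_ext R V f \<phi> = finsum V (\<lambda>x. f x \<odot>\<^bsub>V\<^esub> \<phi> x) S"
proof -
  have "x \<in> S" "x \<in> X" if "f x \<noteq> \<zero>" for x using S that by auto
  then show ?thesis unfolding lin_ext_def
    by (intro mod_finsum_superset) (use V f S(1,2) \<phi> in auto)
qed

lemma lin_ext_linear:
  assumes V: "module R V" and \<phi>: "\<And>x. x \<in> X \<Longrightarrow> \<phi> x \<in> carrier V"
  shows "linear_map R (free_module R X) V (\<lambda>f. lin_ext R V f \<phi>)"
proof (rule linear_mapI)
  note [simp] = \<phi> V
  let ?P = "free_module R X"
  have supp: "finite {x. f x \<noteq> \<zero>}" "{x. f x \<noteq> \<zero>} \<subseteq> X" if "f \<in> carrier ?P" for f
    using that by (auto simp: free_carrier)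
  show cl: "lin_ext R V f \<phi> \<in> carrier V" if "f \<in> carrier ?P" for f
    unfolding lin_ext_def using that supp[OF that] by (intro mod_finsum_closed) auto
  show "lin_ext R V (f \<oplus>\<^bsub>?P\<^esub> g) \<phi> = lin_ext R V f \<phi> \<oplus>\<^bsub>V\<^esub> lin_ext R V g \<phi>"
    if f: "f \<in> carrier ?P" and g: "g \<in> carrier ?P" for f g
  proof -
    let ?S = "{x. f x \<noteq> \<zero>} \<union> {x. g x \<noteq> \<zero>}"
    have S: "finite ?S" "?S \<subseteq> X" using supp f g by auto
    have fg: "f \<oplus>\<^bsub>?P\<^esub> g \<in> carrier ?P" using f g by (simp del: free_simps)
    have "lin_ext R V (f \<oplus>\<^bsub>?P\<^esub> g) \<phi> = finsum V (\<lambda>x. (f \<oplus>\<^bsub>?P\<^esub> g) x \<odot>\<^bsub>V\<^esub> \<phi> x) ?S"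
      by (rule lin_ext_superset[OF V fg S]) auto
    also have "\<dots> = finsum V (\<lambda>x. f x \<odot>\<^bsub>V\<^esub> \<phi> x \<oplus>\<^bsub>V\<^esub> g x \<odot>\<^bsub>V\<^esub> \<phi> x) ?S"
      using S f g by (intro mod_finsum_cong) (auto simp: mod_add_smult)
    also have "\<dots> = finsum V (\<lambda>x. f x \<odot>\<^bsub>V\<^esub> \<phi> x) ?S \<oplus>\<^bsub>V\<^esub> finsum V (\<lambda>x. g x \<odot>\<^bsub>V\<^esub> \<phi> x) ?S"
      using S f g by (intro mod_finsum_add) auto
    also have "\<dots> = lin_ext R V f \<phi> \<oplus>\<^bsub>V\<^esub> lin_ext R V g \<phi>"
      using lin_ext_superset[OF V f S] lin_ext_superset[OF V g S] by auto
    finally show ?thesis .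
  qed
  show "lin_ext R V (c \<odot>\<^bsub>?P\<^esub> f) \<phi> = c \<odot>\<^bsub>V\<^esub> lin_ext R V f \<phi>"
    if c: "c \<in> carrier R" and f: "f \<in> carrier ?P" for c f
  proof -
    let ?S = "{x. f x \<noteq> \<zero>}"
    have S: "finite ?S" "?S \<subseteq> X" using supp f by auto
    have cf: "c \<odot>\<^bsub>?P\<^esub> f \<in> carrier ?P" using f c by (simp del: free_simps)
    have "lin_ext R V (c \<odot>\<^bsub>?P\<^esub> f) \<phi> = finsum V (\<lambda>x. (c \<odot>\<^bsub>?P\<^esub> f) x \<odot>\<^bsub>V\<^esub> \<phi> x) ?S"
      by (rule lin_ext_superset[OF V cf S]) (use c in auto)
    also have "\<dots> = finsum V (\<lambda>x. c \<odot>\<^bsub>V\<^esub> (f x \<odot>\<^bsub>V\<^esub> \<phi> x)) ?S"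
      using S f c by (intro mod_finsum_cong) (auto simp: mod_smult_smult)
    also have "\<dots> = c \<odot>\<^bsub>V\<^esub> finsum V (\<lambda>x. f x \<odot>\<^bsub>V\<^esub> \<phi> x) ?S"
      using S f c by (intro mod_finsum_smult) auto
    finally show ?thesis by (simp add: lin_ext_def)
  qed
qed

lemma lin_ext_basis_vec:
  assumes V: "module R V" and "\<phi> x \<in> carrier V"
  shows "lin_ext R V (basis_vec R x) \<phi> = \<phi> x"
proof -
  have "{y. basis_vec R x y \<noteq> \<zero>} = {x}" by (auto simp: basis_vec_def)
  then show ?thesis unfolding lin_ext_def using assms
    by (simp add: basis_vec_def)
qed

lemma linear_eq_on_free:
  assumes V: "module R V" and f: "linear_map R (free_module R X) V f"
    and g: "linear_map R (free_module R X) V g"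
    and eq: "\<And>x. x \<in> X \<Longrightarrow> f (basis_vec R x) = g (basis_vec R x)"
    and p: "p \<in> carrier (free_module R X)"
  shows "f p = g p"
proof -
  let ?P = "free_module R X" and ?S = "{x. p x \<noteq> \<zero>}"
  have S: "finite ?S" "?S \<subseteq> X" using p by (auto simp: free_carrier)
  have p_eq: "p = finsum ?P (\<lambda>x. p x \<odot>\<^bsub>?P\<^esub> basis_vec R x) ?S"
    by (rule free_expand[OF p S]) auto
  have *: "p x \<odot>\<^bsub>?P\<^esub> basis_vec R x \<in> carrier ?P" if "x \<in> ?S" for x
    using that S p by (intro mod_smult) auto
  have h: "h p = finsum V (\<lambda>x. p x \<odot>\<^bsub>V\<^esub> h (basis_vec R x)) ?S" if h: "linear_map R ?P V h" for h
  proof -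
    have "h p = finsum V (\<lambda>x. h (p x \<odot>\<^bsub>?P\<^esub> basis_vec R x)) ?S"
      by (subst p_eq, rule lin_finsum[OF _ V h *]) auto
    also have "\<dots> = finsum V (\<lambda>x. p x \<odot>\<^bsub>V\<^esub> h (basis_vec R x)) ?S"
      using lin_smult[OF h] lin_closed[OF h] p S V
      by (intro mod_finsum_cong) (auto simp del: free_simps)
    finally show ?thesis .
  qed
  show ?thesis unfolding h[OF f] h[OF g]
    using eq lin_closed[OF g] p S V by (intro mod_finsum_cong) auto
qed


section \<open>Tensor products\<close>

definition bilin ::
  "('a, 'v, 'm) module_scheme \<Rightarrow> ('a, 'w, 'n) module_scheme \<Rightarrow> ('a, 'u, 'p) module_scheme
    \<Rightarrow> ('v \<Rightarrow> 'w \<Rightarrow> 'u) \<Rightarrow> bool" where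
  "bilin A B V \<phi> \<longleftrightarrow> (\<forall>a\<in>carrier A. linear_map R B V (\<phi> a)) \<and>
     (\<forall>b\<in>carrier B. linear_map R A V (\<lambda>a. \<phi> a b))"

lemma bilinI:
  "(\<And>a. a \<in> carrier A \<Longrightarrow> linear_map R B V (\<phi> a)) \<Longrightarrow>
   (\<And>b. b \<in> carrier B \<Longrightarrow> linear_map R A V (\<lambda>a. \<phi> a b)) \<Longrightarrow> bilin A B V \<phi>"
  by (simp add: bilin_def)

lemma bilinD:
  "bilin A B V \<phi> \<Longrightarrow> a \<in> carrier A \<Longrightarrow> linear_map R B V (\<phi> a)"
  "bilin A B V \<phi> \<Longrightarrow> b \<in> carrier B \<Longrightarrow> linear_map R A V (\<lambda>a. \<phi> a b)"
  by (simp_all add: bilin_def)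

lemma bilin_closed: "bilin A B V \<phi> \<Longrightarrow> a \<in> carrier A \<Longrightarrow> b \<in> carrier B \<Longrightarrow> \<phi> a b \<in> carrier V"
  using bilinD(1)[of A B V \<phi> a] lin_closed[of B V "\<phi> a" b] by simp

lemma bilin_comp: "bilin A B V \<phi> \<Longrightarrow> linear_map R V W f \<Longrightarrow> bilin A B W (\<lambda>a b. f (\<phi> a b))"
  by (rule bilinI) (auto intro: lin_comp bilinD)

lemma bilin_precomp:
  assumes \<phi>: "bilin A B V \<phi>" and f: "linear_map R A' A f" and g: "linear_map R B' B g"
  shows "bilin A' B' V (\<lambda>a b. \<phi> (f a) (g b))"
proof (rule bilinI)
  show "linear_map R B' V (\<lambda>b. \<phi> (f a) (g b))" if "a \<in> carrier A'" for a
    by (rule lin_comp[OF g bilinD(1)[OF \<phi> lin_closed[OF f that]]])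
  show "linear_map R A' V (\<lambda>a. \<phi> (f a) (g b))" if "b \<in> carrier B'" for b
    by (rule lin_comp[OF f bilinD(2)[OF \<phi> lin_closed[OF g that]]])
qed

abbreviation "tfree A B \<equiv> free_module R (carrier A \<times> carrier B)"

lemma tensor_relations_submodule:
  assumes A: "module R A" and B: "module R B"
  shows "submodule (tensor_relations R A B) R (tfree A B)"
  unfolding tensor_relations_def Let_def
  by (rule gen_submodule_submodule[OF free_module_module])
    (use A B in \<open>auto simp del: free_simps intro!: mod_diff mod_add mod_smult\<close>)

text \<open>Bilinearity kills each of the four families of generators, and the kernel of the linear
  extension is a subspace, so it contains their span. This lets a bilinear map descend to the
  quotient.\<close>

lemma lin_ext_tensor_relations:
  assumes A: "module R A" and B: "module R B" and V: "module R V" and \<phi>: "bilin A B V \<phi>"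
    and n: "n \<in> tensor_relations R A B"
  shows "lin_ext R V n (\<lambda>(a, b). \<phi> a b) = \<zero>\<^bsub>V\<^esub>"
proof -
  let ?P = "tfree A B" and ?l = "\<lambda>p. lin_ext R V p (\<lambda>(a, b). \<phi> a b)"
  let ?e = "\<lambda>a b. basis_vec R (a, b)"
  have l: "linear_map R ?P V ?l"
    by (rule lin_ext_linear[OF V]) (auto intro: bilin_closed[OF \<phi>])
  have lb: "?l (?e a b) = \<phi> a b" if "a \<in> carrier A" "b \<in> carrier B" for a b
    using lin_ext_basis_vec[OF V, of "\<lambda>(a, b). \<phi> a b" "(a, b)"] bilin_closed[OF \<phi> that] by simp
  have e: "?e a b \<in> carrier ?P" if "a \<in> carrier A" "b \<in> carrier B" for a b using that by simp
  note cl = bilin_closed[OF \<phi>]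
  have K: "submodule {p \<in> carrier ?P. ?l p \<in> {\<zero>\<^bsub>V\<^esub>}} R ?P"
    by (rule submodule_vimage[OF free_module_module V l submodule_zero[OF V]])
  have 1: "?l (?e (a \<oplus>\<^bsub>A\<^esub> a') b \<ominus>\<^bsub>?P\<^esub> (?e a b \<oplus>\<^bsub>?P\<^esub> ?e a' b)) = \<zero>\<^bsub>V\<^esub>"
    if "a \<in> carrier A" "a' \<in> carrier A" "b \<in> carrier B" for a a' b
  proof -
    have "?l (?e (a \<oplus>\<^bsub>A\<^esub> a') b \<ominus>\<^bsub>?P\<^esub> (?e a b \<oplus>\<^bsub>?P\<^esub> ?e a' b)) =
        ?l (?e (a \<oplus>\<^bsub>A\<^esub> a') b) \<ominus>\<^bsub>V\<^esub> (?l (?e a b) \<oplus>\<^bsub>V\<^esub> ?l (?e a' b))"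
      using that A e by (simp add: lin_diff[OF free_module_module V l] lin_add[OF l] del: free_simps)
    also have "\<dots> = \<zero>\<^bsub>V\<^esub>"
      using that A V cl lin_add[OF bilinD(2)[OF \<phi>]] by (simp add: lb)
    finally show ?thesis .
  qed
  have 2: "?l (?e a (b \<oplus>\<^bsub>B\<^esub> b') \<ominus>\<^bsub>?P\<^esub> (?e a b \<oplus>\<^bsub>?P\<^esub> ?e a b')) = \<zero>\<^bsub>V\<^esub>"
    if "a \<in> carrier A" "b \<in> carrier B" "b' \<in> carrier B" for a b b'
  proof -
    have "?l (?e a (b \<oplus>\<^bsub>B\<^esub> b') \<ominus>\<^bsub>?P\<^esub> (?e a b \<oplus>\<^bsub>?P\<^esub> ?e a b')) =
        ?l (?e a (b \<oplus>\<^bsub>B\<^esub> b')) \<ominus>\<^bsub>V\<^esub> (?l (?e a b) \<oplus>\<^bsub>V\<^esub> ?l (?e a b'))"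
      using that B e by (simp add: lin_diff[OF free_module_module V l] lin_add[OF l] del: free_simps)
    also have "\<dots> = \<zero>\<^bsub>V\<^esub>"
      using that B V cl lin_add[OF bilinD(1)[OF \<phi>]] by (simp add: lb)
    finally show ?thesis .
  qed
  have 3: "?l (?e (c \<odot>\<^bsub>A\<^esub> a) b \<ominus>\<^bsub>?P\<^esub> c \<odot>\<^bsub>?P\<^esub> ?e a b) = \<zero>\<^bsub>V\<^esub>"
    if "c \<in> carrier R" "a \<in> carrier A" "b \<in> carrier B" for c a b
  proof -
    have "?l (?e (c \<odot>\<^bsub>A\<^esub> a) b \<ominus>\<^bsub>?P\<^esub> c \<odot>\<^bsub>?P\<^esub> ?e a b) = ?l (?e (c \<odot>\<^bsub>A\<^esub> a) b) \<ominus>\<^bsub>V\<^esub> c \<odot>\<^bsub>V\<^esub> ?l (?e a b)"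
      using that A e mod_smult[OF free_module_module]
      by (simp add: lin_diff[OF free_module_module V l] lin_smult[OF l] del: free_simps)
    also have "\<dots> = \<zero>\<^bsub>V\<^esub>"
      using that A V cl lin_smult[OF bilinD(2)[OF \<phi>]] by (simp add: lb)
    finally show ?thesis .
  qed
  have 4: "?l (?e a (c \<odot>\<^bsub>B\<^esub> b) \<ominus>\<^bsub>?P\<^esub> c \<odot>\<^bsub>?P\<^esub> ?e a b) = \<zero>\<^bsub>V\<^esub>"
    if "c \<in> carrier R" "a \<in> carrier A" "b \<in> carrier B" for c a b
  proof -
    have "?l (?e a (c \<odot>\<^bsub>B\<^esub> b) \<ominus>\<^bsub>?P\<^esub> c \<odot>\<^bsub>?P\<^esub> ?e a b) = ?l (?e a (c \<odot>\<^bsub>B\<^esub> b)) \<ominus>\<^bsub>V\<^esub> c \<odot>\<^bsub>V\<^esub> ?l (?e a b)"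
      using that B e mod_smult[OF free_module_module]
      by (simp add: lin_diff[OF free_module_module V l] lin_smult[OF l] del: free_simps)
    also have "\<dots> = \<zero>\<^bsub>V\<^esub>"
      using that B V cl lin_smult[OF bilinD(1)[OF \<phi>]] by (simp add: lb)
    finally show ?thesis .
  qed
  have "tensor_relations R A B \<subseteq> {p \<in> carrier ?P. ?l p \<in> {\<zero>\<^bsub>V\<^esub>}}"
    unfolding tensor_relations_def Let_def
    by (rule gen_submodule_least[OF K])
      (use A B 1 2 3 4 in \<open>auto simp del: free_simps intro!: mod_diff mod_add mod_smult\<close>)
  then show ?thesis using n by auto
qed

text \<open>The quotient map from the free module, of which \<open>ptensor\<close> is the value on
  basis vectors; it gives arbitrary tensors, and not only pure ones, a handle by
  representatives.\<close>

definition tquot where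
  "tquot A B p = tensor_relations R A B +>\<^bsub>tfree A B\<^esub> p"

context
  fixes A :: "('a, 'v, 'm) module_scheme" and B :: "('a, 'w, 'n) module_scheme"
  assumes A: "module R A" and B: "module R B"
begin

private abbreviation "P \<equiv> tfree A B"
private abbreviation "N \<equiv> tensor_relations R A B"

lemma tensor_relations_abelian: "abelian_subgroup N P"
  using submodule.axioms(1)[OF tensor_relations_submodule[OF A B]]
    module_abelian_group[OF free_module_module]
  by (intro abelian_subgroupI3 additive_subgroupI)

interpretation N: abelian_subgroup N P by (rule tensor_relations_abelian)

lemma tquot_mem: "p \<in> tquot A B p" if "p \<in> carrier P" for p
  unfolding tquot_def by (rule N.a_rcos_self[OF that])

lemma tquot_eqI: "p \<in> carrier P \<Longrightarrow> q \<in> tquot A B p \<Longrightarrow> tquot A B p = tquot A B q"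
  unfolding tquot_def by (rule N.a_repr_independence'[rotated])

lemma tquot_memD: "q \<in> tquot A B p \<Longrightarrow> \<exists>n\<in>N. q = n \<oplus>\<^bsub>P\<^esub> p"
  unfolding tquot_def a_r_coset_def' by auto

lemma tquot_memI: "n \<in> N \<Longrightarrow> n \<oplus>\<^bsub>P\<^esub> p \<in> tquot A B p"
  unfolding tquot_def a_r_coset_def' by auto

lemma tensor_carrier_eq: "carrier (tensor R A B) = tquot A B ` carrier P"
  by (auto simp: tensor_def tensor_space_def Let_def tquot_def A_RCOSETS_def')

lemma tquot_closed: "p \<in> carrier P \<Longrightarrow> tquot A B p \<in> carrier (tensor R A B)"
  by (simp add: tensor_carrier_eq)

lemma tensor_zero_eq: "\<zero>\<^bsub>tensor R A B\<^esub> = tquot A B \<zero>\<^bsub>P\<^esub>"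
proof -
  have "N +>\<^bsub>P\<^esub> \<zero>\<^bsub>P\<^esub> = N"
    by (rule N.a_coset_add_zero) (use N.a_subset in blast)
  then show ?thesis by (simp add: tensor_def tensor_space_def Let_def tquot_def)
qed

lemma tensor_add_eq:
  "p \<in> carrier P \<Longrightarrow> q \<in> carrier P \<Longrightarrow>
    tquot A B p \<oplus>\<^bsub>tensor R A B\<^esub> tquot A B q = tquot A B (p \<oplus>\<^bsub>P\<^esub> q)"
  unfolding tquot_def tensor_def tensor_space_def Let_def
  using N.a_rcos_sum[of p q] by simp

text \<open>Scalar multiplication of a coset is a union over all its representatives. The relations
  are closed under scaling, so every representative contributes the same coset, and the union over a
  nonempty set collapses to it.\<close>

lemma tensor_smult_eq:
  assumes c: "c \<in> carrier R" and p: "p \<in> carrier P"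
  shows "c \<odot>\<^bsub>tensor R A B\<^esub> tquot A B p = tquot A B (c \<odot>\<^bsub>P\<^esub> p)"
proof -
  have cP: "c \<odot>\<^bsub>P\<^esub> p \<in> carrier P" using c p by (intro mod_smult) auto
  have "tquot A B (c \<odot>\<^bsub>P\<^esub> f) = tquot A B (c \<odot>\<^bsub>P\<^esub> p)" if f: "f \<in> tquot A B p" for f
  proof -
    obtain n where n: "n \<in> N" "f = n \<oplus>\<^bsub>P\<^esub> p" using tquot_memD[OF f] by blast
    have "n \<in> carrier P" using n N.a_subset by auto
    then have "c \<odot>\<^bsub>P\<^esub> f = c \<odot>\<^bsub>P\<^esub> n \<oplus>\<^bsub>P\<^esub> c \<odot>\<^bsub>P\<^esub> p"
      unfolding n(2) by (intro mod_smult_add c p free_module_module)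
    moreover have "c \<odot>\<^bsub>P\<^esub> n \<in> N"
      by (rule submoduleD(4)[OF tensor_relations_submodule[OF A B] c n(1)])
    ultimately have "c \<odot>\<^bsub>P\<^esub> f \<in> tquot A B (c \<odot>\<^bsub>P\<^esub> p)" using tquot_memI by metis
    from tquot_eqI[OF cP this] show ?thesis by (rule sym)
  qed
  moreover have "tquot A B p \<noteq> {}" using tquot_mem[OF p] by (metis empty_iff)
  ultimately have "(\<Union>f\<in>tquot A B p. tquot A B (c \<odot>\<^bsub>P\<^esub> f)) = tquot A B (c \<odot>\<^bsub>P\<^esub> p)"
    by (intro SUP_eq_const)
  moreover have "c \<odot>\<^bsub>tensor R A B\<^esub> s = (\<Union>f\<in>s. tquot A B (c \<odot>\<^bsub>P\<^esub> f))" for s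
    unfolding tensor_def tensor_space_def Let_def tquot_def by (simp del: free_simps)
  ultimately show ?thesis by (rule trans[rotated])
qed

lemma tensor_cases:
  assumes "s \<in> carrier (tensor R A B)"
  obtains p where "p \<in> carrier P" "s = tquot A B p"
  using assms unfolding tensor_carrier_eq by (rule imageE)

lemma tensor_module: "module R (tensor R A B)"
proof -
  let ?T = "tensor R A B"
  have P: "module R P" by simp
  note eqs = tensor_add_eq tensor_smult_eq tensor_zero_eq tquot_closed
  have ag: "abelian_group ?T"
  proof (rule abelian_groupI)
    fix x y z assume x: "x \<in> carrier ?T" and y: "y \<in> carrier ?T" and z: "z \<in> carrier ?T"
    obtain p where p: "p \<in> carrier P" "x = tquot A B p" using x by (rule tensor_cases)
    obtain q where q: "q \<in> carrier P" "y = tquot A B q" using y by (rule tensor_cases)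
    obtain r where r: "r \<in> carrier P" "z = tquot A B r" using z by (rule tensor_cases)
    note * = p q r
    show "x \<oplus>\<^bsub>?T\<^esub> y \<oplus>\<^bsub>?T\<^esub> z = x \<oplus>\<^bsub>?T\<^esub> (y \<oplus>\<^bsub>?T\<^esub> z)"
      using * by (simp add: eqs mod_assoc[OF P] mod_add[OF P] del: free_simps)
  next
    fix x y assume "x \<in> carrier ?T" "y \<in> carrier ?T"
    then obtain p q where *: "p \<in> carrier P" "x = tquot A B p" "q \<in> carrier P" "y = tquot A B q"
      by (metis tensor_cases)
    show "x \<oplus>\<^bsub>?T\<^esub> y \<in> carrier ?T" using * by (simp add: eqs mod_add[OF P] del: free_simps)
    show "x \<oplus>\<^bsub>?T\<^esub> y = y \<oplus>\<^bsub>?T\<^esub> x" using * by (simp add: eqs mod_comm[OF P, of p q] del: free_simps)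
  next
    fix x assume "x \<in> carrier ?T"
    then obtain p where *: "p \<in> carrier P" "x = tquot A B p" by (metis tensor_cases)
    show "\<zero>\<^bsub>?T\<^esub> \<oplus>\<^bsub>?T\<^esub> x = x"
      using * by (simp add: eqs mod_zero[OF P] mod_zero_add[OF P] del: free_simps)
    have n: "\<ominus>\<^bsub>P\<^esub> p \<in> carrier P" "\<ominus>\<^bsub>P\<^esub> p \<oplus>\<^bsub>P\<^esub> p = \<zero>\<^bsub>P\<^esub>"
      using *(1) mod_neg[OF P] abelian_group.l_neg[OF module_abelian_group[OF P]] by auto
    show "\<exists>y\<in>carrier ?T. y \<oplus>\<^bsub>?T\<^esub> x = \<zero>\<^bsub>?T\<^esub>"
      using * n by (intro bexI[of _ "tquot A B (\<ominus>\<^bsub>P\<^esub> p)"]) (simp_all add: eqs del: free_simps)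
  next
    show "\<zero>\<^bsub>?T\<^esub> \<in> carrier ?T" using mod_zero[OF P] by (simp add: eqs del: free_simps)
  qed
  show ?thesis
  proof (rule moduleI[OF is_cring ag])
    fix c d x assume cd: "c \<in> carrier R" "d \<in> carrier R" and "x \<in> carrier ?T"
    then obtain p where *: "p \<in> carrier P" "x = tquot A B p" by (metis tensor_cases)
    show "(c \<oplus> d) \<odot>\<^bsub>?T\<^esub> x = c \<odot>\<^bsub>?T\<^esub> x \<oplus>\<^bsub>?T\<^esub> d \<odot>\<^bsub>?T\<^esub> x"
      using * cd by (simp add: eqs mod_add_smult[OF P] mod_smult[OF P] del: free_simps)
    show "(c \<otimes> d) \<odot>\<^bsub>?T\<^esub> x = c \<odot>\<^bsub>?T\<^esub> (d \<odot>\<^bsub>?T\<^esub> x)"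
      using * cd by (simp add: eqs mod_smult_smult[OF P] mod_smult[OF P] del: free_simps)
  next
    fix c x y assume c: "c \<in> carrier R" and "x \<in> carrier ?T" "y \<in> carrier ?T"
    then obtain p q where *: "p \<in> carrier P" "x = tquot A B p" "q \<in> carrier P" "y = tquot A B q"
      by (metis tensor_cases)
    show "c \<odot>\<^bsub>?T\<^esub> (x \<oplus>\<^bsub>?T\<^esub> y) = c \<odot>\<^bsub>?T\<^esub> x \<oplus>\<^bsub>?T\<^esub> c \<odot>\<^bsub>?T\<^esub> y"
      using * c by (simp add: eqs mod_smult_add[OF P] mod_smult[OF P] mod_add[OF P] del: free_simps)
  next
    fix c x assume c: "c \<in> carrier R" and "x \<in> carrier ?T"
    then obtain p where *: "p \<in> carrier P" "x = tquot A B p" by (metis tensor_cases)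
    show "c \<odot>\<^bsub>?T\<^esub> x \<in> carrier ?T" using * c by (simp add: eqs mod_smult[OF P] del: free_simps)
  next
    fix x assume "x \<in> carrier ?T"
    then obtain p where *: "p \<in> carrier P" "x = tquot A B p" by (metis tensor_cases)
    show "\<one> \<odot>\<^bsub>?T\<^esub> x = x" using * by (simp add: eqs mod_one_smult[OF P] del: free_simps)
  qed
qed

lemma tquot_linear: "linear_map R P (tensor R A B) (tquot A B)"
  by (rule linear_mapI) (simp_all add: tquot_closed tensor_add_eq tensor_smult_eq del: free_simps)

lemma tquot_rel: "n \<in> N \<Longrightarrow> tquot A B n = \<zero>\<^bsub>tensor R A B\<^esub>"
  using tquot_memI[of n "\<zero>\<^bsub>P\<^esub>"] tquot_eqI[OF mod_zero[OF free_module_module], of n] N.a_subset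
    mod_add_zero[OF free_module_module, of n] tensor_zero_eq by auto

lemma ptensor_closed:
  "a \<in> carrier A \<Longrightarrow> b \<in> carrier B \<Longrightarrow> ptensor R A B a b \<in> carrier (tensor R A B)"
  by (simp add: ptensor_def tquot_def[symmetric] tquot_closed)

lemma tquot_basis: "tquot A B (basis_vec R (a, b)) = ptensor R A B a b"
  by (simp add: ptensor_def tquot_def)

text \<open>For each linearity law the difference of the two sides, taken in the free module, is
  itself one of the generating relations, which the quotient map sends to zero.\<close>

lemma ptensor_bilin: "bilin A B (tensor R A B) (ptensor R A B)"
proof -
  let ?T = "tensor R A B" and ?e = "\<lambda>a b. basis_vec R (a, b)"
  have e: "?e a b \<in> carrier P" if "a \<in> carrier A" "b \<in> carrier B" for a b using that by simp
  have q: "tquot A B p = tquot A B q"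
    if h: "p \<in> carrier P" "q \<in> carrier P" "p \<ominus>\<^bsub>P\<^esub> q \<in> N" for p q
    by (rule mod_eq_of_diff_zero[OF tensor_module tquot_closed[OF h(1)] tquot_closed[OF h(2)]])
      (rule trans[OF lin_diff[OF free_module_module tensor_module tquot_linear h(1,2), symmetric]
        tquot_rel[OF h(3)]])
  have gen: "x \<in> N" if "x \<in> {?e (a \<oplus>\<^bsub>A\<^esub> a') b \<ominus>\<^bsub>P\<^esub> (?e a b \<oplus>\<^bsub>P\<^esub> ?e a' b) | a a' b.
           a \<in> carrier A \<and> a' \<in> carrier A \<and> b \<in> carrier B} \<union>
        {?e a (b \<oplus>\<^bsub>B\<^esub> b') \<ominus>\<^bsub>P\<^esub> (?e a b \<oplus>\<^bsub>P\<^esub> ?e a b') | a b b'.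
           a \<in> carrier A \<and> b \<in> carrier B \<and> b' \<in> carrier B} \<union>
        {?e (c \<odot>\<^bsub>A\<^esub> a) b \<ominus>\<^bsub>P\<^esub> c \<odot>\<^bsub>P\<^esub> ?e a b | c a b.
           c \<in> carrier R \<and> a \<in> carrier A \<and> b \<in> carrier B} \<union>
        {?e a (c \<odot>\<^bsub>B\<^esub> b) \<ominus>\<^bsub>P\<^esub> c \<odot>\<^bsub>P\<^esub> ?e a b | c a b.
           c \<in> carrier R \<and> a \<in> carrier A \<and> b \<in> carrier B}" for x
    unfolding tensor_relations_def Let_def using that by (rule gen_submodule_incl)
  have 1: "tquot A B (?e (a \<oplus>\<^bsub>A\<^esub> a') b) = tquot A B (?e a b) \<oplus>\<^bsub>?T\<^esub> tquot A B (?e a' b)"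
    if h: "a \<in> carrier A" "a' \<in> carrier A" "b \<in> carrier B" for a a' b
  proof -
    have "?e (a \<oplus>\<^bsub>A\<^esub> a') b \<ominus>\<^bsub>P\<^esub> (?e a b \<oplus>\<^bsub>P\<^esub> ?e a' b) \<in> N" by (rule gen) (use h in blast)
    then have "tquot A B (?e (a \<oplus>\<^bsub>A\<^esub> a') b) = tquot A B (?e a b \<oplus>\<^bsub>P\<^esub> ?e a' b)"
      by (rule q[rotated 2]) (use h A B in \<open>auto intro!: mod_add simp del: free_simps\<close>)
    also have "\<dots> = tquot A B (?e a b) \<oplus>\<^bsub>?T\<^esub> tquot A B (?e a' b)" by (rule tensor_add_eq[OF e[OF h(1,3)] e[OF h(2,3)], symmetric])
    finally show ?thesis .
  qed
  have 2: "tquot A B (?e a (b \<oplus>\<^bsub>B\<^esub> b')) = tquot A B (?e a b) \<oplus>\<^bsub>?T\<^esub> tquot A B (?e a b')"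
    if h: "a \<in> carrier A" "b \<in> carrier B" "b' \<in> carrier B" for a b b'
  proof -
    have "?e a (b \<oplus>\<^bsub>B\<^esub> b') \<ominus>\<^bsub>P\<^esub> (?e a b \<oplus>\<^bsub>P\<^esub> ?e a b') \<in> N" by (rule gen) (use h in blast)
    then have "tquot A B (?e a (b \<oplus>\<^bsub>B\<^esub> b')) = tquot A B (?e a b \<oplus>\<^bsub>P\<^esub> ?e a b')"
      by (rule q[rotated 2]) (use h A B in \<open>auto intro!: mod_add simp del: free_simps\<close>)
    also have "\<dots> = tquot A B (?e a b) \<oplus>\<^bsub>?T\<^esub> tquot A B (?e a b')" by (rule tensor_add_eq[OF e[OF h(1,2)] e[OF h(1,3)], symmetric])
    finally show ?thesis .
  qed
  have 3: "tquot A B (?e (c \<odot>\<^bsub>A\<^esub> a) b) = c \<odot>\<^bsub>?T\<^esub> tquot A B (?e a b)"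
    if h: "c \<in> carrier R" "a \<in> carrier A" "b \<in> carrier B" for c a b
  proof -
    have "?e (c \<odot>\<^bsub>A\<^esub> a) b \<ominus>\<^bsub>P\<^esub> (c \<odot>\<^bsub>P\<^esub> ?e a b) \<in> N" by (rule gen) (use h in blast)
    then have "tquot A B (?e (c \<odot>\<^bsub>A\<^esub> a) b) = tquot A B (c \<odot>\<^bsub>P\<^esub> ?e a b)"
      by (rule q[rotated 2]) (use h A B in \<open>auto intro!: mod_smult simp del: free_simps\<close>)
    also have "\<dots> = c \<odot>\<^bsub>?T\<^esub> tquot A B (?e a b)" by (rule tensor_smult_eq[OF h(1) e[OF h(2,3)], symmetric])
    finally show ?thesis .
  qed
  have 4: "tquot A B (?e a (c \<odot>\<^bsub>B\<^esub> b)) = c \<odot>\<^bsub>?T\<^esub> tquot A B (?e a b)"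
    if h: "c \<in> carrier R" "a \<in> carrier A" "b \<in> carrier B" for c a b
  proof -
    have "?e a (c \<odot>\<^bsub>B\<^esub> b) \<ominus>\<^bsub>P\<^esub> (c \<odot>\<^bsub>P\<^esub> ?e a b) \<in> N" by (rule gen) (use h in blast)
    then have "tquot A B (?e a (c \<odot>\<^bsub>B\<^esub> b)) = tquot A B (c \<odot>\<^bsub>P\<^esub> ?e a b)"
      by (rule q[rotated 2]) (use h A B in \<open>auto intro!: mod_smult simp del: free_simps\<close>)
    also have "\<dots> = c \<odot>\<^bsub>?T\<^esub> tquot A B (?e a b)" by (rule tensor_smult_eq[OF h(1) e[OF h(2,3)], symmetric])
    finally show ?thesis .
  qed
  show ?thesis
    unfolding tquot_basis[symmetric]
    by (intro bilinI linear_mapI) (use 1 2 3 4 tquot_closed[OF e] in simp_all)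
qed

text \<open>The representative picked by \<open>SOME\<close> differs from \<open>p\<close> by a
  relation, and relations vanish under the linear extension; hence the choice does not
  matter.\<close>

lemma sweedler_tquot:
  assumes V: "module R V" and \<phi>: "bilin A B V \<phi>" and p: "p \<in> carrier P"
  shows "sweedler R V (tquot A B p) \<phi> = lin_ext R V p (\<lambda>(a, b). \<phi> a b)"
proof -
  let ?l = "\<lambda>p. lin_ext R V p (\<lambda>(a, b). \<phi> a b)"
  have l: "linear_map R P V ?l"
    by (rule lin_ext_linear[OF V]) (auto intro: bilin_closed[OF \<phi>])
  have "(SOME f. f \<in> tquot A B p) \<in> tquot A B p" using someI[of "\<lambda>f. f \<in> tquot A B p", OF tquot_mem[OF p]] .
  then obtain n where n: "n \<in> N" "(SOME f. f \<in> tquot A B p) = n \<oplus>\<^bsub>P\<^esub> p"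
    using tquot_memD[of "SOME f. f \<in> tquot A B p" p] by auto
  have "n \<in> carrier P" using n N.a_subset by auto
  then have "?l (n \<oplus>\<^bsub>P\<^esub> p) = ?l n \<oplus>\<^bsub>V\<^esub> ?l p" using p by (rule lin_add[OF l])
  also have "\<dots> = ?l p"
    using lin_ext_tensor_relations[OF A B V \<phi> n(1)] lin_closed[OF l p] V by simp
  finally show ?thesis unfolding sweedler_def n(2) .
qed

lemma sweedler_linear:
  assumes V: "module R V" and \<phi>: "bilin A B V \<phi>"
  shows "linear_map R (tensor R A B) V (\<lambda>t. sweedler R V t \<phi>)"
proof -
  have l: "linear_map R P V (\<lambda>p. lin_ext R V p (\<lambda>(a, b). \<phi> a b))"
    by (rule lin_ext_linear[OF V]) (auto intro: bilin_closed[OF \<phi>])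
  note s = sweedler_tquot[OF V \<phi>]
  show ?thesis
  proof (rule linear_mapI)
    fix x y assume "x \<in> carrier (tensor R A B)" "y \<in> carrier (tensor R A B)"
    then obtain p q where *: "p \<in> carrier P" "x = tquot A B p" "q \<in> carrier P" "y = tquot A B q"
      by (metis tensor_cases)
    show "sweedler R V (x \<oplus>\<^bsub>tensor R A B\<^esub> y) \<phi> = sweedler R V x \<phi> \<oplus>\<^bsub>V\<^esub> sweedler R V y \<phi>"
      using * mod_add[OF free_module_module *(1,3)]
      by (simp add: tensor_add_eq s lin_add[OF l] del: free_simps)
  next
    fix c x assume c: "c \<in> carrier R" and "x \<in> carrier (tensor R A B)"
    then obtain p where *: "p \<in> carrier P" "x = tquot A B p" by (metis tensor_cases)
    show "sweedler R V (c \<odot>\<^bsub>tensor R A B\<^esub> x) \<phi> = c \<odot>\<^bsub>V\<^esub> sweedler R V x \<phi>"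
      using * c mod_smult[OF free_module_module c *(1)]
      by (simp add: tensor_smult_eq s lin_smult[OF l] del: free_simps)
  next
    fix x assume "x \<in> carrier (tensor R A B)"
    then obtain p where *: "p \<in> carrier P" "x = tquot A B p" by (metis tensor_cases)
    then show "sweedler R V x \<phi> \<in> carrier V" by (simp add: s lin_closed[OF l])
  qed
qed

lemma sweedler_ptensor:
  assumes V: "module R V" and \<phi>: "bilin A B V \<phi>" and "a \<in> carrier A" "b \<in> carrier B"
  shows "sweedler R V (ptensor R A B a b) \<phi> = \<phi> a b"
  using sweedler_tquot[OF V \<phi>, of "basis_vec R (a, b)"] assms(3,4)
    lin_ext_basis_vec[OF V, of "\<lambda>(a, b). \<phi> a b" "(a, b)"] bilin_closed[OF \<phi>]
  by (simp add: tquot_basis)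

text \<open>Pure tensors are the images of the basis of the free module, so this is the uniqueness
  half of the universal property. Most tensor identities below are reduced to pure tensors by
  it.\<close>

lemma linear_eq_on_tensor:
  assumes V: "module R V" and f: "linear_map R (tensor R A B) V f" and g: "linear_map R (tensor R A B) V g"
    and eq: "\<And>a b. a \<in> carrier A \<Longrightarrow> b \<in> carrier B \<Longrightarrow> f (ptensor R A B a b) = g (ptensor R A B a b)"
    and t: "t \<in> carrier (tensor R A B)"
  shows "f t = g t"
proof -
  obtain p where p: "p \<in> carrier P" "t = tquot A B p" using t by (rule tensor_cases)
  show ?thesis unfolding p(2)
    by (rule linear_eq_on_free[OF V lin_comp[OF tquot_linear f] lin_comp[OF tquot_linear g] _ p(1)])
      (auto simp: tquot_basis eq)
qed

lemma tensor_in_submodule: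
  assumes M: "submodule M R (tensor R A B)"
    and gen: "\<And>a b. a \<in> carrier A \<Longrightarrow> b \<in> carrier B \<Longrightarrow> ptensor R A B a b \<in> M"
    and t: "t \<in> carrier (tensor R A B)"
  shows "t \<in> M"
proof -
  obtain p where p: "p \<in> carrier P" "t = tquot A B p" using t by (rule tensor_cases)
  let ?S = "{x. p x \<noteq> \<zero>}"
  have S: "finite ?S" "?S \<subseteq> carrier A \<times> carrier B"
    using p(1) unfolding free_carrier by blast+
  have "tquot A B (finsum P (\<lambda>x. p x \<odot>\<^bsub>P\<^esub> basis_vec R x) ?S) =
      finsum (tensor R A B) (\<lambda>x. tquot A B (p x \<odot>\<^bsub>P\<^esub> basis_vec R x)) ?S"
    by (intro lin_finsum[OF free_module_module tensor_module tquot_linear] mod_smult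
        free_module_module basis_vec_carrier free_closed[OF p(1)]) (use S in blast)
  also have "\<dots> \<in> M"
  proof (rule submodule_finsum[OF tensor_module M])
    fix x assume x: "x \<in> ?S"
    then obtain a b where ab: "x = (a, b)" "a \<in> carrier A" "b \<in> carrier B" using S by auto
    have "tquot A B (p x \<odot>\<^bsub>P\<^esub> basis_vec R x) = p x \<odot>\<^bsub>tensor R A B\<^esub> ptensor R A B a b"
      using ab free_closed[OF p(1)] by (simp add: tensor_smult_eq tquot_basis[symmetric] del: free_simps)
    also have "\<dots> \<in> M" using gen[OF ab(2,3)] submoduleD(4)[OF M] free_closed[OF p(1)] by simp
    finally show "tquot A B (p x \<odot>\<^bsub>P\<^esub> basis_vec R x) \<in> M" .
  qed
  finally have "tquot A B (finsum P (\<lambda>x. p x \<odot>\<^bsub>P\<^esub> basis_vec R x) ?S) \<in> M" .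
  moreover have "finsum P (\<lambda>x. p x \<odot>\<^bsub>P\<^esub> basis_vec R x) ?S = p"
    using free_expand[OF p(1) S] by simp
  ultimately show ?thesis by (simp add: p(2))
qed

end


lemma submodule_add_cancel:
  assumes V: "module R V" and N: "submodule N R V" and x: "x \<in> N" and y: "y \<in> carrier V"
    and xy: "x \<oplus>\<^bsub>V\<^esub> y \<in> N"
  shows "y \<in> N"
proof -
  have xc: "x \<in> carrier V" using submoduleD(1)[OF N x] .
  have n: "(\<ominus> \<one>) \<odot>\<^bsub>V\<^esub> x \<in> carrier V" using V xc by simp
  have "x \<oplus>\<^bsub>V\<^esub> y \<oplus>\<^bsub>V\<^esub> (\<ominus> \<one>) \<odot>\<^bsub>V\<^esub> x \<in> N"
    by (rule submoduleD(3)[OF N xy]) (rule submoduleD(4)[OF N _ x], simp)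
  moreover have "x \<oplus>\<^bsub>V\<^esub> y \<oplus>\<^bsub>V\<^esub> (\<ominus> \<one>) \<odot>\<^bsub>V\<^esub> x = y \<oplus>\<^bsub>V\<^esub> (x \<oplus>\<^bsub>V\<^esub> (\<ominus> \<one>) \<odot>\<^bsub>V\<^esub> x)"
    by (simp only: mod_comm[OF V xc y] mod_assoc[OF V y xc n])
  ultimately show ?thesis using V xc y by simp
qed

text \<open>For fixed parameters both sides of each linearity law are linear in \<open>t\<close>, so
  pure tensors suffice. Nested \<open>sweedler\<close> expressions need this: it makes the inner
  value bilinear in the variables bound by the outer one.\<close>

lemma sweedler_param_linear:
  assumes A: "module R A" and B: "module R B" and V: "module R V" and X: "module R X"
    and t: "t \<in> carrier (tensor R A B)"
    and F: "\<And>x. x \<in> carrier X \<Longrightarrow> bilin A B V (F x)"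
    and lin: "\<And>a b. a \<in> carrier A \<Longrightarrow> b \<in> carrier B \<Longrightarrow> linear_map R X V (\<lambda>x. F x a b)"
  shows "linear_map R X V (\<lambda>x. sweedler R V t (F x))"
proof (rule linear_mapI)
  note sl = sweedler_linear[OF A B V F] and sp = sweedler_ptensor[OF A B V F]
  show "sweedler R V t (F x) \<in> carrier V" if "x \<in> carrier X" for x
    by (rule lin_closed[OF sl[OF that] t])
  show "sweedler R V t (F (x \<oplus>\<^bsub>X\<^esub> y)) = sweedler R V t (F x) \<oplus>\<^bsub>V\<^esub> sweedler R V t (F y)"
    if x: "x \<in> carrier X" and y: "y \<in> carrier X" for x y
  proof -
    have xy: "x \<oplus>\<^bsub>X\<^esub> y \<in> carrier X" by (rule mod_add[OF X x y])
    show ?thesis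
      by (rule linear_eq_on_tensor[OF A B V sl[OF xy] lin_add_map[OF V sl[OF x] sl[OF y]] _ t])
        (simp add: sp[OF x] sp[OF y] sp[OF xy] lin_add[OF lin x y])
  qed
  show "sweedler R V t (F (c \<odot>\<^bsub>X\<^esub> x)) = c \<odot>\<^bsub>V\<^esub> sweedler R V t (F x)"
    if c: "c \<in> carrier R" and x: "x \<in> carrier X" for c x
  proof -
    have cx: "c \<odot>\<^bsub>X\<^esub> x \<in> carrier X" by (rule mod_smult[OF X c x])
    show ?thesis
      by (rule linear_eq_on_tensor[OF A B V sl[OF cx] lin_smult_const[OF V sl[OF x] c] _ t])
        (simp add: sp[OF x] sp[OF cx] lin_smult[OF lin c x])
  qed
qed

section \<open>Contractions of tensors with functionals\<close>

text \<open>\<open>lcon B f\<close> is \<open>f \<otimes> id\<close> and \<open>rcon A \<chi>\<close> is \<open>id \<otimes> \<chi>\<close>, with the ground field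
  absorbed. Over a field the maps \<open>f \<otimes> id\<close> separate tensors and detect subspaces \<open>A \<otimes> W\<close>, so
  comodule identities can be tested on them.\<close>

definition lcon where "lcon B f t = sweedler R B t (\<lambda>a b. f a \<odot>\<^bsub>B\<^esub> b)"

definition rcon where "rcon A \<chi> t = sweedler R A t (\<lambda>a b. \<chi> b \<odot>\<^bsub>A\<^esub> a)"

definition tmap where
  "tmap A B f g t = sweedler R (tensor R A B) t (\<lambda>a b. ptensor R A B (f a) (g b))"

lemma functional_smult_linear:
  assumes B: "module R B" and f: "functional A f" and b: "b \<in> carrier B"
  shows "linear_map R A B (\<lambda>a. f a \<odot>\<^bsub>B\<^esub> b)"
  by (rule linear_mapI)
    (simp_all add: f b B functional_add[OF f] functional_smult[OF f] functional_closed[OF f]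
      mod_add_smult[OF B] mod_smult_smult[OF B])

lemma smult_linear: "module R B \<Longrightarrow> c \<in> carrier R \<Longrightarrow> linear_map R B B (\<lambda>b. c \<odot>\<^bsub>B\<^esub> b)"
  by (rule lin_smult_const[OF _ lin_id])

context
  fixes A :: "('a, 'v, 'm) module_scheme" and B :: "('a, 'w, 'n) module_scheme"
  assumes A: "module R A" and B: "module R B"
begin

private abbreviation "T \<equiv> tensor R A B"

lemma lcon_bilin: "functional A f \<Longrightarrow> bilin A B B (\<lambda>a b. f a \<odot>\<^bsub>B\<^esub> b)"
  by (rule bilinI) (simp_all add: smult_linear[OF B] functional_smult_linear[OF B])

lemma rcon_bilin: "functional B f \<Longrightarrow> bilin A B A (\<lambda>a b. f b \<odot>\<^bsub>A\<^esub> a)"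
  by (rule bilinI) (simp_all add: smult_linear[OF A] functional_smult_linear[OF A])

lemma lcon_linear: "functional A f \<Longrightarrow> linear_map R T B (lcon B f)"
  unfolding lcon_def by (rule sweedler_linear[OF A B B lcon_bilin])

lemma rcon_linear: "functional B f \<Longrightarrow> linear_map R T A (rcon A f)"
  unfolding rcon_def by (rule sweedler_linear[OF A B A rcon_bilin])

lemma lcon_ptensor:
  "functional A f \<Longrightarrow> a \<in> carrier A \<Longrightarrow> b \<in> carrier B \<Longrightarrow> lcon B f (ptensor R A B a b) = f a \<odot>\<^bsub>B\<^esub> b"
  unfolding lcon_def by (rule sweedler_ptensor[OF A B B lcon_bilin])

lemma rcon_ptensor:
  "functional B f \<Longrightarrow> a \<in> carrier A \<Longrightarrow> b \<in> carrier B \<Longrightarrow> rcon A f (ptensor R A B a b) = f b \<odot>\<^bsub>A\<^esub> a"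
  unfolding rcon_def by (rule sweedler_ptensor[OF A B A rcon_bilin])

lemma lcon_closed: "functional A f \<Longrightarrow> t \<in> carrier T \<Longrightarrow> lcon B f t \<in> carrier B"
  by (rule lin_closed[OF lcon_linear])

lemma rcon_closed: "functional B f \<Longrightarrow> t \<in> carrier T \<Longrightarrow> rcon A f t \<in> carrier A"
  by (rule lin_closed[OF rcon_linear])

text \<open>Both sides are the value of \<open>f\<close> \<otimes> \<open>g\<close> at
  \<open>t\<close>. The identity trades a functional on one factor for a functional on the other,
  which is how coordinates meet the action of functionals.\<close>

lemma lcon_rcon:
  assumes f: "functional A f" and g: "functional B g" and t: "t \<in> carrier T"
  shows "g (lcon B f t) = f (rcon A g t)"
  by (rule linear_eq_on_tensor[OF A B ground_module lin_comp[OF lcon_linear[OF f] g]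
        lin_comp[OF rcon_linear[OF g] f] _ t])
    (simp add: lcon_ptensor[OF f] rcon_ptensor[OF g] functional_smult[OF f] functional_smult[OF g]
      functional_closed[OF f] functional_closed[OF g] m_comm)

lemma ptensor_left_linear: "b \<in> carrier B \<Longrightarrow> linear_map R A T (\<lambda>a. ptensor R A B a b)"
  by (rule bilinD(2)[OF ptensor_bilin[OF A B]])

lemma ptensor_right_linear: "a \<in> carrier A \<Longrightarrow> linear_map R B T (\<lambda>b. ptensor R A B a b)"
  by (rule bilinD(1)[OF ptensor_bilin[OF A B]])

lemma tensor_sub_submodule:
  assumes "U \<subseteq> carrier A" "W \<subseteq> carrier B"
  shows "submodule (tensor_sub R A B U W) R T"
  unfolding tensor_sub_def
  by (rule gen_submodule_submodule[OF tensor_module[OF A B]])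
    (use assms ptensor_closed[OF A B] in blast)

lemma tensor_subI: "u \<in> U \<Longrightarrow> w \<in> W \<Longrightarrow> ptensor R A B u w \<in> tensor_sub R A B U W"
  unfolding tensor_sub_def by (rule gen_submodule_incl) blast

text \<open>\<open>tensor_list\<close> presents tensors as sums over an explicit finite list of left
  factors with unspecified right partners, so that induction on the number of terms is possible. The
  list need not be independent; \<open>span_list\<close> is the span against which the next left
  factor is tested.\<close>

primrec span_list :: "'v list \<Rightarrow> 'v set" where
  "span_list [] = {\<zero>\<^bsub>A\<^esub>}"
| "span_list (a # as) = {c \<odot>\<^bsub>A\<^esub> a \<oplus>\<^bsub>A\<^esub> u | c u. c \<in> carrier R \<and> u \<in> span_list as}"

primrec tensor_list :: "'v list \<Rightarrow> ('v \<times> 'w \<Rightarrow> 'a) set set" where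
  "tensor_list [] = {\<zero>\<^bsub>T\<^esub>}"
| "tensor_list (a # as) = {ptensor R A B a b \<oplus>\<^bsub>T\<^esub> s | b s. b \<in> carrier B \<and> s \<in> tensor_list as}"

lemma span_list_submodule: "set as \<subseteq> carrier A \<Longrightarrow> submodule (span_list as) R A"
proof (induction as)
  case Nil
  show ?case using submodule_zero[OF A] by simp
next
  case (Cons a as)
  then have S: "submodule (span_list as) R A" and a: "a \<in> carrier A" by auto
  note SD = submoduleD[OF S]
  show ?case
  proof (rule submodule_intro[OF A])
    fix x assume "x \<in> span_list (a # as)"
    then obtain c u where cu: "c \<in> carrier R" "u \<in> span_list as" "x = c \<odot>\<^bsub>A\<^esub> a \<oplus>\<^bsub>A\<^esub> u" by auto
    note uc = SD(1)[OF cu(2)]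
    show "x \<in> carrier A" using cu(1,3) a uc A by simp
    show "d \<odot>\<^bsub>A\<^esub> x \<in> span_list (a # as)" if d: "d \<in> carrier R" for d
    proof -
      have "d \<odot>\<^bsub>A\<^esub> x = (d \<otimes> c) \<odot>\<^bsub>A\<^esub> a \<oplus>\<^bsub>A\<^esub> d \<odot>\<^bsub>A\<^esub> u"
        unfolding cu(3) using cu(1) a uc d A by (simp add: mod_smult_add[OF A] mod_smult_smult[OF A])
      moreover have "d \<otimes> c \<in> carrier R" "d \<odot>\<^bsub>A\<^esub> u \<in> span_list as" using d cu(1) SD(4)[OF d cu(2)] by auto
      ultimately show ?thesis by auto
    qed
    show "x \<oplus>\<^bsub>A\<^esub> y \<in> span_list (a # as)" if "y \<in> span_list (a # as)" for y
    proof -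
      obtain d v where dv: "d \<in> carrier R" "v \<in> span_list as" "y = d \<odot>\<^bsub>A\<^esub> a \<oplus>\<^bsub>A\<^esub> v" using \<open>y \<in> _\<close> by auto
      note vc = SD(1)[OF dv(2)]
      have "x \<oplus>\<^bsub>A\<^esub> y = (c \<oplus> d) \<odot>\<^bsub>A\<^esub> a \<oplus>\<^bsub>A\<^esub> (u \<oplus>\<^bsub>A\<^esub> v)"
        unfolding cu(3) dv(3) using cu(1) dv(1) a uc vc A
        by (simp add: mod_add_smult[OF A] mod_ac)
      moreover have "c \<oplus> d \<in> carrier R" "u \<oplus>\<^bsub>A\<^esub> v \<in> span_list as" using cu(1) dv(1) SD(3)[OF cu(2) dv(2)] by auto
      ultimately show ?thesis by auto
    qed
  next
    have "\<zero>\<^bsub>A\<^esub> = \<zero> \<odot>\<^bsub>A\<^esub> a \<oplus>\<^bsub>A\<^esub> \<zero>\<^bsub>A\<^esub>" using A a by simp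
    then show "\<zero>\<^bsub>A\<^esub> \<in> span_list (a # as)" using SD(2) zero_closed by auto
  qed
qed

lemma tensor_list_subset: "set as \<subseteq> carrier A \<Longrightarrow> t \<in> tensor_list as \<Longrightarrow> t \<in> carrier T"
proof (induction as arbitrary: t)
  case Nil
  then show ?case using mod_zero[OF tensor_module[OF A B]] by simp
next
  case (Cons a as)
  then obtain b s where bs: "b \<in> carrier B" "s \<in> tensor_list as" "t = ptensor R A B a b \<oplus>\<^bsub>T\<^esub> s"
    by auto
  have "s \<in> carrier T" using Cons.IH[OF _ bs(2)] Cons.prems(1) by simp
  then show ?case using bs Cons.prems(1) mod_add[OF tensor_module[OF A B] ptensor_closed[OF A B]] by simp
qed

lemma tensor_list_add:
  "set as \<subseteq> carrier A \<Longrightarrow> s \<in> tensor_list as \<Longrightarrow> t \<in> tensor_list as \<Longrightarrow> s \<oplus>\<^bsub>T\<^esub> t \<in> tensor_list as"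
proof (induction as arbitrary: s t)
  case Nil
  then show ?case using mod_zero[OF tensor_module[OF A B]] mod_zero_add[OF tensor_module[OF A B]] by simp
next
  case (Cons a as)
  note T = tensor_module[OF A B]
  obtain b s' where 1: "b \<in> carrier B" "s' \<in> tensor_list as" "s = ptensor R A B a b \<oplus>\<^bsub>T\<^esub> s'"
    using Cons.prems by auto
  obtain c t' where 2: "c \<in> carrier B" "t' \<in> tensor_list as" "t = ptensor R A B a c \<oplus>\<^bsub>T\<^esub> t'"
    using Cons.prems by auto
  have a: "a \<in> carrier A" "set as \<subseteq> carrier A" using Cons.prems by auto
  note cl = tensor_list_subset[OF a(2) 1(2)] tensor_list_subset[OF a(2) 2(2)]
    ptensor_closed[OF A B a(1) 1(1)] ptensor_closed[OF A B a(1) 2(1)]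
  have "s \<oplus>\<^bsub>T\<^esub> t = ptensor R A B a (b \<oplus>\<^bsub>B\<^esub> c) \<oplus>\<^bsub>T\<^esub> (s' \<oplus>\<^bsub>T\<^esub> t')"
    unfolding 1(3) 2(3) lin_add[OF ptensor_right_linear[OF a(1)] 1(1) 2(1)]
    using cl by (simp add: mod_ac[OF T] mod_add[OF T])
  moreover have "s' \<oplus>\<^bsub>T\<^esub> t' \<in> tensor_list as" by (rule Cons.IH[OF a(2) 1(2) 2(2)])
  ultimately show ?case using mod_add[OF B 1(1) 2(1)] by auto
qed

lemma tensor_list_span:
  "set as \<subseteq> carrier A \<Longrightarrow> u \<in> span_list as \<Longrightarrow> b \<in> carrier B \<Longrightarrow> ptensor R A B u b \<in> tensor_list as"
proof (induction as arbitrary: u)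
  case Nil
  then show ?case using lin_zero[OF A tensor_module[OF A B] ptensor_left_linear[of b]] by simp
next
  case (Cons a as)
  obtain c v where cv: "c \<in> carrier R" "v \<in> span_list as" "u = c \<odot>\<^bsub>A\<^esub> a \<oplus>\<^bsub>A\<^esub> v" using Cons.prems by auto
  have a: "a \<in> carrier A" "set as \<subseteq> carrier A" and b: "b \<in> carrier B" using Cons.prems by auto
  have v: "v \<in> carrier A" using submoduleD(1)[OF span_list_submodule[OF a(2)] cv(2)] .
  have "ptensor R A B u b = ptensor R A B a (c \<odot>\<^bsub>B\<^esub> b) \<oplus>\<^bsub>T\<^esub> ptensor R A B v b"
    unfolding cv(3) lin_smult[OF ptensor_right_linear[OF a(1)] cv(1) b]
      lin_smult[OF ptensor_left_linear[OF b] cv(1) a(1), symmetric]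
    by (rule lin_add[OF ptensor_left_linear[OF b] mod_smult[OF A cv(1) a(1)] v])
  then show ?case using Cons.IH[OF a(2) cv(2) b] mod_smult[OF B cv(1) b] by auto
qed

lemma lcon_tensor_list_zero:
  assumes f: "functional A f"
  shows "set as \<subseteq> carrier A \<Longrightarrow> (\<And>u. u \<in> span_list as \<Longrightarrow> f u = \<zero>) \<Longrightarrow> t \<in> tensor_list as \<Longrightarrow>
    lcon B f t = \<zero>\<^bsub>B\<^esub>"
proof (induction as arbitrary: t)
  case Nil
  then show ?case using lin_zero[OF tensor_module[OF A B] B lcon_linear[OF f]] by simp
next
  case (Cons a as)
  obtain b s where bs: "b \<in> carrier B" "s \<in> tensor_list as" "t = ptensor R A B a b \<oplus>\<^bsub>T\<^esub> s"
    using Cons.prems by auto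
  have a: "a \<in> carrier A" "set as \<subseteq> carrier A" using Cons.prems by auto
  note SD = submoduleD[OF span_list_submodule[OF a(2)]]
  have "f a = \<zero>"
  proof (rule Cons.prems(2))
    have "a = \<one> \<odot>\<^bsub>A\<^esub> a \<oplus>\<^bsub>A\<^esub> \<zero>\<^bsub>A\<^esub>" using A a by simp
    then show "a \<in> span_list (a # as)" using SD(2) one_closed by auto
  qed
  moreover have "lcon B f s = \<zero>\<^bsub>B\<^esub>"
  proof (rule Cons.IH[OF a(2) _ bs(2)])
    fix u assume u: "u \<in> span_list as"
    then have "u = \<zero> \<odot>\<^bsub>A\<^esub> a \<oplus>\<^bsub>A\<^esub> u" using A a SD(1)[OF u] by simp
    then have "u \<in> span_list (a # as)" using u zero_closed by auto
    then show "f u = \<zero>" by (rule Cons.prems(2))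
  qed
  ultimately show ?case
    using lin_add[OF lcon_linear[OF f] ptensor_closed[OF A B a(1) bs(1)] tensor_list_subset[OF a(2) bs(2)]]
      lcon_ptensor[OF f a(1) bs(1)] bs(1) B by (simp add: bs(3))
qed

lemma tensor_list_exhaust:
  assumes "t \<in> carrier T" shows "\<exists>as. set as \<subseteq> carrier A \<and> t \<in> tensor_list as"
proof -
  note T = tensor_module[OF A B]
  let ?M = "{t. \<exists>as. set as \<subseteq> carrier A \<and> t \<in> tensor_list as}"
  \<comment> \<open>Concatenating the lists adds the tensors, so the tensors that admit such a
    presentation form a subspace.\<close>
  have app: "s \<oplus>\<^bsub>T\<^esub> t \<in> tensor_list (as @ bs)"
    if "set as \<subseteq> carrier A" "s \<in> tensor_list as" "set bs \<subseteq> carrier A" "t \<in> tensor_list bs" for as bs s t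
    using that
  proof (induction as arbitrary: s)
    case Nil
    then show ?case using tensor_list_subset[OF Nil(3,4)] mod_zero_add[OF T] by simp
  next
    case (Cons a as)
    obtain b s' where 1: "b \<in> carrier B" "s' \<in> tensor_list as" "s = ptensor R A B a b \<oplus>\<^bsub>T\<^esub> s'"
      using Cons.prems by auto
    have a: "a \<in> carrier A" "set as \<subseteq> carrier A" using Cons.prems by auto
    have "s \<oplus>\<^bsub>T\<^esub> t = ptensor R A B a b \<oplus>\<^bsub>T\<^esub> (s' \<oplus>\<^bsub>T\<^esub> t)"
      unfolding 1(3)
      by (rule mod_assoc[OF T ptensor_closed[OF A B a(1) 1(1)] tensor_list_subset[OF a(2) 1(2)]
            tensor_list_subset[OF Cons.prems(3,4)]])
    moreover have "s' \<oplus>\<^bsub>T\<^esub> t \<in> tensor_list (as @ bs)" by (rule Cons.IH[OF a(2) 1(2) Cons.prems(3,4)])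
    ultimately show ?case using 1(1) by auto
  qed
  have sm: "c \<odot>\<^bsub>T\<^esub> s \<in> tensor_list as" if c: "c \<in> carrier R" and "set as \<subseteq> carrier A" "s \<in> tensor_list as" for c as s
    using that(2,3)
  proof (induction as arbitrary: s)
    case Nil
    then show ?case using c mod_smult_zero[OF T] by simp
  next
    case (Cons a as)
    obtain b s' where 1: "b \<in> carrier B" "s' \<in> tensor_list as" "s = ptensor R A B a b \<oplus>\<^bsub>T\<^esub> s'"
      using Cons.prems by auto
    have a: "a \<in> carrier A" "set as \<subseteq> carrier A" using Cons.prems by auto
    have "c \<odot>\<^bsub>T\<^esub> s = ptensor R A B a (c \<odot>\<^bsub>B\<^esub> b) \<oplus>\<^bsub>T\<^esub> c \<odot>\<^bsub>T\<^esub> s'"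
      unfolding 1(3) lin_smult[OF ptensor_right_linear[OF a(1)] c 1(1)]
      by (rule mod_smult_add[OF T c ptensor_closed[OF A B a(1) 1(1)] tensor_list_subset[OF a(2) 1(2)]])
    then show ?case using Cons.IH[OF a(2) 1(2)] mod_smult[OF B c 1(1)] by auto
  qed
  have M: "submodule ?M R T"
  proof (rule submodule_intro[OF T])
    show "x \<in> carrier T" if "x \<in> ?M" for x using that tensor_list_subset by auto
    show "\<zero>\<^bsub>T\<^esub> \<in> ?M" by (auto intro!: exI[of _ "[]"])
    show "x \<oplus>\<^bsub>T\<^esub> y \<in> ?M" if "x \<in> ?M" "y \<in> ?M" for x y
    proof -
      obtain as bs where "set as \<subseteq> carrier A" "x \<in> tensor_list as" "set bs \<subseteq> carrier A" "y \<in> tensor_list bs"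
        using \<open>x \<in> ?M\<close> \<open>y \<in> ?M\<close> by auto
      then show ?thesis using app by (auto intro!: exI[of _ "as @ bs"])
    qed
    show "c \<odot>\<^bsub>T\<^esub> x \<in> ?M" if "c \<in> carrier R" "x \<in> ?M" for c x
      using that sm by blast
  qed
  have "ptensor R A B a b \<in> ?M" if "a \<in> carrier A" "b \<in> carrier B" for a b
  proof -
    have "ptensor R A B a b = ptensor R A B a b \<oplus>\<^bsub>T\<^esub> \<zero>\<^bsub>T\<^esub>"
      using mod_add_zero[OF T ptensor_closed[OF A B \<open>a \<in> _\<close> \<open>b \<in> _\<close>]] by simp
    then have "ptensor R A B a b \<in> tensor_list [a]" using \<open>b \<in> _\<close> by auto
    then show ?thesis using \<open>a \<in> _\<close> by (auto intro!: exI[of _ "[a]"] simp del: tensor_list.simps)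
  qed
  then have "t \<in> ?M" by (rule tensor_in_submodule[OF A B M _ assms])
  then show ?thesis by simp
qed

text \<open>Peel off the left tensor factors one at a time: a factor \<open>a\<close> outside the span of the
  remaining ones is detected by a functional vanishing on that span, so its partner lies in \<open>W\<close>.\<close>

lemma tensor_sub_if_lcon:
  assumes W: "submodule W R B" and t: "t \<in> carrier T"
    and lcon: "\<And>f. functional A f \<Longrightarrow> lcon B f t \<in> W"
  shows "t \<in> tensor_sub R A B (carrier A) W"
proof -
  note T = tensor_module[OF A B]
  have Ws: "W \<subseteq> carrier B" using submoduleD(1)[OF W] by blast
  note S = tensor_sub_submodule[OF subset_refl Ws]
  have "t \<in> tensor_sub R A B (carrier A) W"
    if "set as \<subseteq> carrier A" "t \<in> tensor_list as" "\<And>f. functional A f \<Longrightarrow> lcon B f t \<in> W" for as t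
    using that
  proof (induction as arbitrary: t)
    case Nil
    then show ?case using submoduleD(2)[OF S] by simp
  next
    case (Cons a as)
    obtain b s where bs: "b \<in> carrier B" "s \<in> tensor_list as" "t = ptensor R A B a b \<oplus>\<^bsub>T\<^esub> s"
      using Cons.prems(2) by auto
    have a: "a \<in> carrier A" "set as \<subseteq> carrier A" using Cons.prems(1) by auto
    note sc = tensor_list_subset[OF a(2) bs(2)] and pc = ptensor_closed[OF A B a(1) bs(1)]
    show ?case
    proof (cases "a \<in> span_list as")
      case True
      have "t \<in> tensor_list as"
        unfolding bs(3) by (rule tensor_list_add[OF a(2) tensor_list_span[OF a(2) True bs(1)] bs(2)])
      then show ?thesis by (rule Cons.IH[OF a(2) _ Cons.prems(3)])
    next
      case False
      from functional_separation[OF A span_list_submodule[OF a(2)] a(1) False]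
      obtain f where f: "functional A f" "\<And>u. u \<in> span_list as \<Longrightarrow> f u = \<zero>" "f a = \<one>" by auto
      have lt: "lcon B g t = g a \<odot>\<^bsub>B\<^esub> b \<oplus>\<^bsub>B\<^esub> lcon B g s" if g: "functional A g" for g
        unfolding bs(3) lin_add[OF lcon_linear[OF g] pc sc] lcon_ptensor[OF g a(1) bs(1)] by (rule refl)
      have "lcon B f t = b"
        using lt[OF f(1)] lcon_tensor_list_zero[OF f(1) a(2) f(2) bs(2)] f(3) bs(1) B by simp
      then have bW: "b \<in> W" using Cons.prems(3)[OF f(1)] by simp
      have "s \<in> tensor_sub R A B (carrier A) W"
      proof (rule Cons.IH[OF a(2) bs(2)])
        fix g assume g: "functional A g"
        have "g a \<odot>\<^bsub>B\<^esub> b \<in> W" by (rule submoduleD(4)[OF W functional_closed[OF g a(1)] bW])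
        moreover have "g a \<odot>\<^bsub>B\<^esub> b \<oplus>\<^bsub>B\<^esub> lcon B g s \<in> W" using Cons.prems(3)[OF g] lt[OF g] by simp
        ultimately show "lcon B g s \<in> W"
          using submodule_add_cancel[OF B W _ lcon_closed[OF g sc]] by simp
      qed
      then show ?thesis
        unfolding bs(3) by (rule submoduleD(3)[OF S tensor_subI[OF a(1) bW]])
    qed
  qed
  then show ?thesis using tensor_list_exhaust[OF t] lcon by blast
qed

lemma lcon_tensor_sub:
  assumes W: "submodule W R B" and f: "functional A f" and t: "t \<in> tensor_sub R A B (carrier A) W"
  shows "lcon B f t \<in> W"
proof -
  note T = tensor_module[OF A B]
  have "tensor_sub R A B (carrier A) W \<subseteq> {t \<in> carrier T. lcon B f t \<in> W}"
    unfolding tensor_sub_def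
  proof (rule gen_submodule_least[OF submodule_vimage[OF T B lcon_linear[OF f] W]], rule subsetI)
    fix x assume "x \<in> {ptensor R A B u w |u w. u \<in> carrier A \<and> w \<in> W}"
    then obtain u w where x: "x = ptensor R A B u w" "u \<in> carrier A" "w \<in> W" by auto
    note w = submoduleD(1)[OF W x(3)]
    show "x \<in> {t \<in> carrier T. lcon B f t \<in> W}"
      using ptensor_closed[OF A B x(2) w] lcon_ptensor[OF f x(2) w]
        submoduleD(4)[OF W functional_closed[OF f x(2)] x(3)] x(1) by simp
  qed
  then show ?thesis using t by auto
qed

text \<open>The case \<open>W\<close> = 0 of the detection of \<open>A\<close> \<otimes>
  \<open>W\<close>, since every element of \<open>A\<close> \<otimes> 0 is zero.\<close>

lemma tensor_zeroI:
  assumes t: "t \<in> carrier T" and lcon: "\<And>f. functional A f \<Longrightarrow> lcon B f t = \<zero>\<^bsub>B\<^esub>"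
  shows "t = \<zero>\<^bsub>T\<^esub>"
proof -
  note T = tensor_module[OF A B]
  have "t \<in> tensor_sub R A B (carrier A) {\<zero>\<^bsub>B\<^esub>}"
    by (rule tensor_sub_if_lcon[OF submodule_zero[OF B] t]) (simp add: lcon)
  moreover have "tensor_sub R A B (carrier A) {\<zero>\<^bsub>B\<^esub>} \<subseteq> {\<zero>\<^bsub>T\<^esub>}"
    unfolding tensor_sub_def
    by (rule gen_submodule_least[OF submodule_zero[OF T]])
      (auto simp: lin_zero[OF B T ptensor_right_linear])
  ultimately show ?thesis by blast
qed

lemma tensor_eqI:
  assumes s: "s \<in> carrier T" and t: "t \<in> carrier T"
    and lcon: "\<And>f. functional A f \<Longrightarrow> lcon B f s = lcon B f t"
  shows "s = t"
proof (rule mod_eq_of_diff_zero[OF tensor_module[OF A B] s t], rule tensor_zeroI)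
  show "s \<ominus>\<^bsub>T\<^esub> t \<in> carrier T" by (rule mod_diff[OF tensor_module[OF A B] s t])
  show "lcon B f (s \<ominus>\<^bsub>T\<^esub> t) = \<zero>\<^bsub>B\<^esub>" if f: "functional A f" for f
    unfolding lin_diff[OF tensor_module[OF A B] B lcon_linear[OF f] s t] lcon[OF f]
    by (rule mod_diff_self[OF B lcon_closed[OF f t]])
qed

end

lemma tmap_bilin:
  assumes A: "module R A" and B: "module R B" and f: "linear_map R A' A f" and g: "linear_map R B' B g"
  shows "bilin A' B' (tensor R A B) (\<lambda>a b. ptensor R A B (f a) (g b))"
  by (rule bilin_precomp[OF ptensor_bilin[OF A B] f g])

context
  fixes A :: "('a, 'v, 'm) module_scheme" and B :: "('a, 'w, 'n) module_scheme"
    and A' :: "('a, 'v1, 'm1) module_scheme" and B' :: "('a, 'w1, 'n1) module_scheme"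
    and f :: "'v1 \<Rightarrow> 'v" and g :: "'w1 \<Rightarrow> 'w"
  assumes A: "module R A" and B: "module R B" and A': "module R A'" and B': "module R B'"
    and f: "linear_map R A' A f" and g: "linear_map R B' B g"
begin

lemma tmap_linear: "linear_map R (tensor R A' B') (tensor R A B) (tmap A B f g)"
  unfolding tmap_def by (rule sweedler_linear[OF A' B' tensor_module[OF A B] tmap_bilin[OF A B f g]])

lemma tmap_ptensor:
  "a \<in> carrier A' \<Longrightarrow> b \<in> carrier B' \<Longrightarrow> tmap A B f g (ptensor R A' B' a b) = ptensor R A B (f a) (g b)"
  unfolding tmap_def by (rule sweedler_ptensor[OF A' B' tensor_module[OF A B] tmap_bilin[OF A B f g]])

lemma tmap_closed: "t \<in> carrier (tensor R A' B') \<Longrightarrow> tmap A B f g t \<in> carrier (tensor R A B)"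
  by (rule lin_closed[OF tmap_linear])

lemma lcon_tmap:
  assumes h: "functional A h" and t: "t \<in> carrier (tensor R A' B')"
  shows "lcon B h (tmap A B f g t) = g (lcon B' (\<lambda>a. h (f a)) t)"
proof -
  note hf = lin_comp[OF f h]
  show ?thesis
    by (rule linear_eq_on_tensor[OF A' B' B lin_comp[OF tmap_linear lcon_linear[OF A B h]]
          lin_comp[OF lcon_linear[OF A' B' hf] g] _ t])
      (simp add: tmap_ptensor lcon_ptensor[OF A B h lin_closed[OF f] lin_closed[OF g]]
        lcon_ptensor[OF A' B' hf] lin_smult[OF g functional_closed[OF hf]])
qed

lemma rcon_tmap:
  assumes h: "functional B h" and t: "t \<in> carrier (tensor R A' B')"
  shows "rcon A h (tmap A B f g t) = f (rcon A' (\<lambda>b. h (g b)) t)"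
proof -
  note hg = lin_comp[OF g h]
  show ?thesis
    by (rule linear_eq_on_tensor[OF A' B' A lin_comp[OF tmap_linear rcon_linear[OF A B h]]
          lin_comp[OF rcon_linear[OF A' B' hg] f] _ t])
      (simp add: tmap_ptensor rcon_ptensor[OF A B h lin_closed[OF f] lin_closed[OF g]]
        rcon_ptensor[OF A' B' hg] lin_smult[OF f functional_closed[OF hg]])
qed

end

subsection \<open>Corestriction\<close>

context
  fixes A :: "('a, 'v, 'm) module_scheme" and B :: "('a, 'w, 'n) module_scheme" and W :: "'w set"
  assumes A: "module R A" and B: "module R B" and W: "submodule W R B"
begin

private abbreviation "BW \<equiv> B\<lparr>carrier := W\<rparr>"
private abbreviation "incl s \<equiv> sweedler R (tensor R A B) s (ptensor R A B)"

lemma sub_module: "module R BW" by (rule submodule_module[OF B W])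

lemma tensor_incl_bilin: "bilin A BW (tensor R A B) (ptensor R A B)"
  by (rule bilin_precomp[OF ptensor_bilin[OF A B] lin_id lin_incl[OF W]])

lemma tensor_incl_linear: "linear_map R (tensor R A BW) (tensor R A B) (\<lambda>s. incl s)"
  by (rule sweedler_linear[OF A sub_module tensor_module[OF A B] tensor_incl_bilin])

lemma tensor_incl_ptensor:
  "a \<in> carrier A \<Longrightarrow> w \<in> W \<Longrightarrow> incl (ptensor R A BW a w) = ptensor R A B a w"
  using sweedler_ptensor[OF A sub_module tensor_module[OF A B] tensor_incl_bilin, of a w] by simp

lemma lcon_incl:
  assumes f: "functional A f" and s: "s \<in> carrier (tensor R A BW)"
  shows "lcon B f (incl s) = lcon BW f s"
  using linear_eq_on_tensor[OF A sub_module B lin_comp[OF tensor_incl_linear lcon_linear[OF A B f]]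
        lin_comp[OF lcon_linear[OF A sub_module f] lin_incl[OF W]] _ s]
    tensor_incl_ptensor lcon_ptensor[OF A B f] lcon_ptensor[OF A sub_module f] submoduleD(1)[OF W]
  by simp

text \<open>The contractions of \<open>s\<close> agree with those of its image, and contractions
  separate tensors. This is exactness of the tensor product over a field, and it makes the
  \<open>THE\<close> in \<open>corestrict\<close> meaningful.\<close>

lemma tensor_incl_inj:
  assumes s: "s \<in> carrier (tensor R A BW)" and s': "s' \<in> carrier (tensor R A BW)" and eq: "incl s = incl s'"
  shows "s = s'"
  by (rule tensor_eqI[OF A sub_module s s'])
    (simp add: lcon_incl[OF _ s, symmetric] lcon_incl[OF _ s', symmetric] eq)

lemma tensor_incl_surj:
  assumes t: "t \<in> tensor_sub R A B (carrier A) W"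
  shows "\<exists>s\<in>carrier (tensor R A BW). incl s = t"
proof -
  have "tensor_sub R A B (carrier A) W \<subseteq> (\<lambda>s. incl s) ` carrier (tensor R A BW)"
    unfolding tensor_sub_def
  proof (rule gen_submodule_least[OF submodule_image[OF tensor_module[OF A sub_module]
          tensor_module[OF A B] tensor_incl_linear submodule_carrier[OF tensor_module[OF A sub_module]]]], rule subsetI)
    fix x assume "x \<in> {ptensor R A B u w |u w. u \<in> carrier A \<and> w \<in> W}"
    then obtain u w where x: "x = ptensor R A B u w" "u \<in> carrier A" "w \<in> W" by auto
    have "ptensor R A BW u w \<in> carrier (tensor R A BW)" using ptensor_closed[OF A sub_module x(2)] x(3) by simp
    then show "x \<in> (\<lambda>s. incl s) ` carrier (tensor R A BW)"
      using tensor_incl_ptensor[OF x(2,3)] x(1) by (intro image_eqI) auto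
  qed
  then show ?thesis using t by auto
qed

lemma corestrict_eqI:
  assumes s: "s \<in> carrier (tensor R A BW)" and eq: "incl s = t"
  shows "corestrict R A B W t = s"
  unfolding corestrict_def
proof (rule the_equality)
  show "s \<in> carrier (tensor R A BW) \<and> incl s = t" using s eq by simp
  fix s' assume "s' \<in> carrier (tensor R A BW) \<and> incl s' = t"
  then have s': "s' \<in> carrier (tensor R A BW)" "incl s' = t" by auto
  show "s' = s" by (rule tensor_incl_inj[OF s'(1) s]) (simp only: s'(2) eq)
qed

lemma corestrict_props:
  assumes t: "t \<in> tensor_sub R A B (carrier A) W"
  shows "corestrict R A B W t \<in> carrier (tensor R A BW)" "incl (corestrict R A B W t) = t"
proof -
  obtain s where s: "s \<in> carrier (tensor R A BW)" "incl s = t" using tensor_incl_surj[OF t] by blast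
  show "corestrict R A B W t \<in> carrier (tensor R A BW)" "incl (corestrict R A B W t) = t"
    unfolding corestrict_eqI[OF s] by (rule s)+
qed

lemma lcon_corestrict:
  assumes f: "functional A f" and t: "t \<in> tensor_sub R A B (carrier A) W"
  shows "lcon BW f (corestrict R A B W t) = lcon B f t"
  using lcon_incl[OF f corestrict_props(1)[OF t]] corestrict_props(2)[OF t] by simp

lemma corestrict_linear:
  assumes F: "linear_map R X (tensor R A B) F"
    and FW: "\<And>x. x \<in> carrier X \<Longrightarrow> F x \<in> tensor_sub R A B (carrier A) W"
  shows "linear_map R X (tensor R A BW) (\<lambda>x. corestrict R A B W (F x))"
proof (rule linear_mapI)
  note p = corestrict_props[OF FW]
  note T = tensor_module[OF A sub_module]
  show "corestrict R A B W (F x) \<in> carrier (tensor R A BW)" if "x \<in> carrier X" for x by (rule p(1)[OF that])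
  show "corestrict R A B W (F (x \<oplus>\<^bsub>X\<^esub> y)) =
      corestrict R A B W (F x) \<oplus>\<^bsub>tensor R A BW\<^esub> corestrict R A B W (F y)"
    if x: "x \<in> carrier X" and y: "y \<in> carrier X" for x y
    by (rule corestrict_eqI[OF mod_add[OF T p(1)[OF x] p(1)[OF y]]])
      (simp only: lin_add[OF tensor_incl_linear p(1)[OF x] p(1)[OF y]] p(2)[OF x] p(2)[OF y] lin_add[OF F x y])
  show "corestrict R A B W (F (c \<odot>\<^bsub>X\<^esub> x)) = c \<odot>\<^bsub>tensor R A BW\<^esub> corestrict R A B W (F x)"
    if c: "c \<in> carrier R" and x: "x \<in> carrier X" for c x
    by (rule corestrict_eqI[OF mod_smult[OF T c p(1)[OF x]]])
      (simp only: lin_smult[OF tensor_incl_linear c p(1)[OF x]] p(2)[OF x] lin_smult[OF F c x])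
qed

end


section \<open>Algebras and their tensor products\<close>

context
  fixes A :: "('a, 'v, 'm) module_scheme"
  assumes A: "assoc_algebra R A"
begin

lemma alg_module: "module R A" and alg_ring: "ring A"
  using A by (simp_all add: assoc_algebra_def)

lemma alg_closed: "x \<in> carrier A \<Longrightarrow> y \<in> carrier A \<Longrightarrow> x \<otimes>\<^bsub>A\<^esub> y \<in> carrier A"
  and alg_one: "\<one>\<^bsub>A\<^esub> \<in> carrier A"
  and alg_assoc: "x \<in> carrier A \<Longrightarrow> y \<in> carrier A \<Longrightarrow> z \<in> carrier A \<Longrightarrow>
    x \<otimes>\<^bsub>A\<^esub> y \<otimes>\<^bsub>A\<^esub> z = x \<otimes>\<^bsub>A\<^esub> (y \<otimes>\<^bsub>A\<^esub> z)"
  and alg_l_one: "x \<in> carrier A \<Longrightarrow> \<one>\<^bsub>A\<^esub> \<otimes>\<^bsub>A\<^esub> x = x"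
  and alg_r_one: "x \<in> carrier A \<Longrightarrow> x \<otimes>\<^bsub>A\<^esub> \<one>\<^bsub>A\<^esub> = x"
  using ringE(2)[OF alg_ring]
  by (simp_all add: monoid.m_closed monoid.one_closed monoid.m_assoc monoid.l_one monoid.r_one)

lemma alg_smult_left: "c \<in> carrier R \<Longrightarrow> x \<in> carrier A \<Longrightarrow> y \<in> carrier A \<Longrightarrow>
    (c \<odot>\<^bsub>A\<^esub> x) \<otimes>\<^bsub>A\<^esub> y = c \<odot>\<^bsub>A\<^esub> (x \<otimes>\<^bsub>A\<^esub> y)"
  and alg_smult_right: "c \<in> carrier R \<Longrightarrow> x \<in> carrier A \<Longrightarrow> y \<in> carrier A \<Longrightarrow>
    x \<otimes>\<^bsub>A\<^esub> (c \<odot>\<^bsub>A\<^esub> y) = c \<odot>\<^bsub>A\<^esub> (x \<otimes>\<^bsub>A\<^esub> y)"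
  using A by (simp_all add: assoc_algebra_def)

lemma left_mult_linear: "x \<in> carrier A \<Longrightarrow> linear_map R A A (\<lambda>y. x \<otimes>\<^bsub>A\<^esub> y)"
  by (rule linear_mapI) (simp_all add: alg_closed alg_smult_right ringE(4)[OF alg_ring])

lemma right_mult_linear: "y \<in> carrier A \<Longrightarrow> linear_map R A A (\<lambda>x. x \<otimes>\<^bsub>A\<^esub> y)"
  by (rule linear_mapI) (simp_all add: alg_closed alg_smult_left ringE(3)[OF alg_ring])

lemma alg_zero_left: "x \<in> carrier A \<Longrightarrow> \<zero>\<^bsub>A\<^esub> \<otimes>\<^bsub>A\<^esub> x = \<zero>\<^bsub>A\<^esub>"
  by (rule lin_zero[OF alg_module alg_module right_mult_linear])

lemma alg_zero_right: "x \<in> carrier A \<Longrightarrow> x \<otimes>\<^bsub>A\<^esub> \<zero>\<^bsub>A\<^esub> = \<zero>\<^bsub>A\<^esub>"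
  by (rule lin_zero[OF alg_module alg_module left_mult_linear])

end

lemma tensor_one: "\<one>\<^bsub>tensor R A B\<^esub> = ptensor R A B \<one>\<^bsub>A\<^esub> \<one>\<^bsub>B\<^esub>"
  by (simp add: tensor_def)

text \<open>The product of \<open>tensor\<close> is defined with sums taken in
  \<open>tensor_space\<close>. \<open>sweedler\<close> reads only the additive structure and the
  scalars, which the record update leaves alone, so the sums may be taken in \<open>tensor\<close>
  itself.\<close>

lemma tensor_mult:
  fixes A :: "('a, 'b1, 'm) module_scheme" and B :: "('a, 'c1, 'n) module_scheme"
  shows "s \<otimes>\<^bsub>tensor R A B\<^esub> t =
    sweedler R (tensor R A B) s (\<lambda>a b. sweedler R (tensor R A B) t (\<lambda>c d.
      ptensor R A B (a \<otimes>\<^bsub>A\<^esub> c) (b \<otimes>\<^bsub>B\<^esub> d)))"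
proof -
  have "sweedler R (tensor_space R A B) u \<phi> = sweedler R (tensor R A B) u \<phi>"
    for u and \<phi> :: "'b1 \<Rightarrow> 'c1 \<Rightarrow> ('b1 \<times> 'c1 \<Rightarrow> 'a) set"
    by (simp add: sweedler_def lin_ext_def finsum_def tensor_def)
  moreover have "s \<otimes>\<^bsub>tensor R A B\<^esub> t = sweedler R (tensor_space R A B) s (\<lambda>a b.
      sweedler R (tensor_space R A B) t (\<lambda>c d. ptensor R A B (a \<otimes>\<^bsub>A\<^esub> c) (b \<otimes>\<^bsub>B\<^esub> d)))"
    by (simp add: tensor_def)
  ultimately show ?thesis by (simp only:)
qed

context
  fixes A :: "('a, 'v, 'm) module_scheme" and B :: "('a, 'w, 'n) module_scheme"
  assumes A: "assoc_algebra R A" and B: "assoc_algebra R B"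
begin

private abbreviation "AB \<equiv> tensor R A B"
private lemma mA: "module R A" and mB: "module R B" and mT: "module R AB"
  by (rule alg_module[OF A] alg_module[OF B] tensor_module[OF alg_module[OF A] alg_module[OF B]])+

private lemma inner_bilin:
  "a \<in> carrier A \<Longrightarrow> b \<in> carrier B \<Longrightarrow>
    bilin A B AB (\<lambda>c d. ptensor R A B (a \<otimes>\<^bsub>A\<^esub> c) (b \<otimes>\<^bsub>B\<^esub> d))"
  by (rule bilin_precomp[OF ptensor_bilin[OF mA mB] left_mult_linear[OF A] left_mult_linear[OF B]])

private lemma outer_bilin:
  assumes t: "t \<in> carrier AB"
  shows "bilin A B AB (\<lambda>a b. sweedler R AB t (\<lambda>c d. ptensor R A B (a \<otimes>\<^bsub>A\<^esub> c) (b \<otimes>\<^bsub>B\<^esub> d)))"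
proof (rule bilinI)
  show "linear_map R B AB (\<lambda>b. sweedler R AB t (\<lambda>c d. ptensor R A B (a \<otimes>\<^bsub>A\<^esub> c) (b \<otimes>\<^bsub>B\<^esub> d)))"
    if a: "a \<in> carrier A" for a
    by (rule sweedler_param_linear[OF mA mB mT mB t inner_bilin[OF a]])
      (assumption, rule lin_comp[OF right_mult_linear[OF B] ptensor_right_linear[OF mA mB alg_closed[OF A a]]])
  show "linear_map R A AB (\<lambda>a. sweedler R AB t (\<lambda>c d. ptensor R A B (a \<otimes>\<^bsub>A\<^esub> c) (b \<otimes>\<^bsub>B\<^esub> d)))"
    if b: "b \<in> carrier B" for b
    by (rule sweedler_param_linear[OF mA mB mT mA t inner_bilin[OF _ b]])
      (assumption, rule lin_comp[OF right_mult_linear[OF A] ptensor_left_linear[OF mA mB alg_closed[OF B b]]])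
qed

lemma tensor_mult_bilin: "bilin AB AB AB (mult AB)"
proof (rule bilinI)
  show "linear_map R AB AB (\<lambda>s. s \<otimes>\<^bsub>AB\<^esub> t)" if t: "t \<in> carrier AB" for t
    unfolding tensor_mult by (rule sweedler_linear[OF mA mB mT outer_bilin[OF t]])
  show "linear_map R AB AB (mult AB s)" if s: "s \<in> carrier AB" for s
  proof -
    have "linear_map R AB AB (\<lambda>t. s \<otimes>\<^bsub>AB\<^esub> t)"
      unfolding tensor_mult
      by (rule sweedler_param_linear[OF mA mB mT mT s outer_bilin])
        (assumption, rule sweedler_linear[OF mA mB mT inner_bilin])
    then show ?thesis .
  qed
qed

lemma tensor_mult_ptensor:
  assumes a: "a \<in> carrier A" and b: "b \<in> carrier B" and c: "c \<in> carrier A" and d: "d \<in> carrier B"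
  shows "ptensor R A B a b \<otimes>\<^bsub>AB\<^esub> ptensor R A B c d = ptensor R A B (a \<otimes>\<^bsub>A\<^esub> c) (b \<otimes>\<^bsub>B\<^esub> d)"
  unfolding tensor_mult sweedler_ptensor[OF mA mB mT outer_bilin[OF ptensor_closed[OF mA mB c d]] a b]
  by (rule sweedler_ptensor[OF mA mB mT inner_bilin[OF a b] c d])

text \<open>Multiplication by a pure tensor acts on the two factors separately. This and its three
  mirror images serve for products in which one factor has a coaction of the form
  \<open>gl g\<close> \<otimes> x.\<close>

lemma lcon_mult_left:
  assumes f: "functional A f" and x: "x \<in> carrier A" and y: "y \<in> carrier B" and t: "t \<in> carrier AB"
  shows "lcon B f (ptensor R A B x y \<otimes>\<^bsub>AB\<^esub> t) = y \<otimes>\<^bsub>B\<^esub> lcon B (\<lambda>a. f (x \<otimes>\<^bsub>A\<^esub> a)) t"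
proof -
  note g = lin_comp[OF left_mult_linear[OF A x] f]
  show ?thesis
    by (rule linear_eq_on_tensor[OF mA mB mB
          lin_comp[OF bilinD(1)[OF tensor_mult_bilin ptensor_closed[OF mA mB x y]] lcon_linear[OF mA mB f]]
          lin_comp[OF lcon_linear[OF mA mB g] left_mult_linear[OF B y]] _ t])
      (simp add: tensor_mult_ptensor x y lcon_ptensor[OF mA mB f] lcon_ptensor[OF mA mB g]
        alg_closed[OF A] alg_closed[OF B] alg_smult_right[OF B] functional_closed[OF f])
qed

lemma rcon_mult_left:
  assumes f: "functional B f" and x: "x \<in> carrier A" and y: "y \<in> carrier B" and t: "t \<in> carrier AB"
  shows "rcon A f (ptensor R A B x y \<otimes>\<^bsub>AB\<^esub> t) = x \<otimes>\<^bsub>A\<^esub> rcon A (\<lambda>b. f (y \<otimes>\<^bsub>B\<^esub> b)) t"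
proof -
  note g = lin_comp[OF left_mult_linear[OF B y] f]
  show ?thesis
    by (rule linear_eq_on_tensor[OF mA mB mA
          lin_comp[OF bilinD(1)[OF tensor_mult_bilin ptensor_closed[OF mA mB x y]] rcon_linear[OF mA mB f]]
          lin_comp[OF rcon_linear[OF mA mB g] left_mult_linear[OF A x]] _ t])
      (simp add: tensor_mult_ptensor x y rcon_ptensor[OF mA mB f] rcon_ptensor[OF mA mB g]
        alg_closed[OF A] alg_closed[OF B] alg_smult_right[OF A] functional_closed[OF f])
qed

lemma lcon_mult_right:
  assumes f: "functional A f" and x: "x \<in> carrier A" and y: "y \<in> carrier B" and t: "t \<in> carrier AB"
  shows "lcon B f (t \<otimes>\<^bsub>AB\<^esub> ptensor R A B x y) = lcon B (\<lambda>a. f (a \<otimes>\<^bsub>A\<^esub> x)) t \<otimes>\<^bsub>B\<^esub> y"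
proof -
  note g = lin_comp[OF right_mult_linear[OF A x] f]
  show ?thesis
    by (rule linear_eq_on_tensor[OF mA mB mB
          lin_comp[OF bilinD(2)[OF tensor_mult_bilin ptensor_closed[OF mA mB x y]] lcon_linear[OF mA mB f]]
          lin_comp[OF lcon_linear[OF mA mB g] right_mult_linear[OF B y]] _ t])
      (simp add: tensor_mult_ptensor x y lcon_ptensor[OF mA mB f] lcon_ptensor[OF mA mB g]
        alg_closed[OF A] alg_closed[OF B] alg_smult_left[OF B] functional_closed[OF f])
qed

lemma rcon_mult_right:
  assumes f: "functional B f" and x: "x \<in> carrier A" and y: "y \<in> carrier B" and t: "t \<in> carrier AB"
  shows "rcon A f (t \<otimes>\<^bsub>AB\<^esub> ptensor R A B x y) = rcon A (\<lambda>b. f (b \<otimes>\<^bsub>B\<^esub> y)) t \<otimes>\<^bsub>A\<^esub> x"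
proof -
  note g = lin_comp[OF right_mult_linear[OF B y] f]
  show ?thesis
    by (rule linear_eq_on_tensor[OF mA mB mA
          lin_comp[OF bilinD(2)[OF tensor_mult_bilin ptensor_closed[OF mA mB x y]] rcon_linear[OF mA mB f]]
          lin_comp[OF rcon_linear[OF mA mB g] right_mult_linear[OF A x]] _ t])
      (simp add: tensor_mult_ptensor x y rcon_ptensor[OF mA mB f] rcon_ptensor[OF mA mB g]
        alg_closed[OF A] alg_closed[OF B] alg_smult_left[OF A] functional_closed[OF f])
qed

end

section \<open>Coassociativity in terms of contractions\<close>

context
  fixes H :: "('a, 'h, 'm) module_scheme" and L :: "('a, 'l, 'n) module_scheme" and \<Delta> \<rho>
  assumes H: "module R H" and L: "module R L"
    and \<Delta>: "linear_map R H (tensor R H H) \<Delta>" and \<rho>: "linear_map R L (tensor R H L) \<rho>"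
begin

private abbreviation "HL \<equiv> tensor R H L"
private abbreviation "T3 \<equiv> tensor R H (tensor R H L)"
private lemma mHL: "module R HL" and mT3: "module R T3"
  by (rule tensor_module[OF H L] tensor_module[OF H tensor_module[OF H L]])+

private lemma inner1:
  "m \<in> carrier L \<Longrightarrow> bilin H H T3 (\<lambda>x1 x2. ptensor R H HL x1 (ptensor R H L x2 m))"
  by (rule bilin_precomp[OF ptensor_bilin[OF H mHL] lin_id ptensor_left_linear[OF H L]])

private lemma inner2: "x \<in> carrier H \<Longrightarrow> bilin H L T3 (\<lambda>y m. ptensor R H HL x (ptensor R H L y m))"
  by (rule bilin_comp[OF ptensor_bilin[OF H L] ptensor_right_linear[OF H mHL]])

private lemma outer1: "bilin H L T3 (\<lambda>x m. sweedler R T3 (\<Delta> x) (\<lambda>x1 x2.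
    ptensor R H HL x1 (ptensor R H L x2 m)))"
proof (rule bilinI)
  show "linear_map R L T3 (\<lambda>m. sweedler R T3 (\<Delta> x) (\<lambda>x1 x2. ptensor R H HL x1 (ptensor R H L x2 m)))"
    if x: "x \<in> carrier H" for x
    by (rule sweedler_param_linear[OF H H mT3 L lin_closed[OF \<Delta> x] inner1])
      (assumption, rule lin_comp[OF ptensor_right_linear[OF H L] ptensor_right_linear[OF H mHL]])
  show "linear_map R H T3 (\<lambda>x. sweedler R T3 (\<Delta> x) (\<lambda>x1 x2. ptensor R H HL x1 (ptensor R H L x2 m)))"
    if m: "m \<in> carrier L" for m
    by (rule lin_comp[OF \<Delta> sweedler_linear[OF H H mT3 inner1[OF m]]])
qed

private lemma outer2: "bilin H L T3 (\<lambda>x m. sweedler R T3 (\<rho> m) (\<lambda>y m'.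
    ptensor R H HL x (ptensor R H L y m')))"
proof (rule bilinI)
  show "linear_map R L T3 (\<lambda>m. sweedler R T3 (\<rho> m) (\<lambda>y m'. ptensor R H HL x (ptensor R H L y m')))"
    if x: "x \<in> carrier H" for x
    by (rule lin_comp[OF \<rho> sweedler_linear[OF H L mT3 inner2[OF x]]])
  show "linear_map R H T3 (\<lambda>x. sweedler R T3 (\<rho> m) (\<lambda>y m'. ptensor R H HL x (ptensor R H L y m')))"
    if m: "m \<in> carrier L" for m
    by (rule sweedler_param_linear[OF H L mT3 H lin_closed[OF \<rho> m] inner2])
      (assumption, rule ptensor_left_linear[OF H mHL ptensor_closed[OF H L]])
qed

text \<open>Apply \<open>f\<close> to the first of the three legs of the coassociativity law: one
  side becomes the coaction of a contraction, the other a contraction inside the left factor. From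
  here on coassociativity is used without triple tensor products. The case \<open>L\<close> =
  \<open>H\<close> with \<open>\<rho>\<close> = \<open>\<Delta>\<close> is the law for the Hopf
  algebra itself.\<close>

lemma coassoc_contraction:
  assumes l: "l \<in> carrier L" and f: "functional H f"
    and coassoc: "sweedler R T3 (\<rho> l) (\<lambda>x m. sweedler R T3 (\<Delta> x) (\<lambda>x1 x2.
             ptensor R H HL x1 (ptensor R H L x2 m))) =
         sweedler R T3 (\<rho> l) (\<lambda>x m. sweedler R T3 (\<rho> m) (\<lambda>y m'.
             ptensor R H HL x (ptensor R H L y m')))"
  shows "\<rho> (lcon L f (\<rho> l)) = tmap H L (\<lambda>x. lcon H f (\<Delta> x)) (\<lambda>m. m) (\<rho> l)"
proof -
  note lf = lcon_linear[OF H mHL f]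
  note fD = lin_comp[OF \<Delta> lcon_linear[OF H H f]]
  note rl = lin_closed[OF \<rho> l]
  \<comment> \<open>\<open>i1\<close> and \<open>i2\<close> evaluate the inner sums for a fixed
    outer pure tensor. The functional hits the first leg, which comes from the coproduct of
    \<open>x\<close> in one case and is \<open>x\<close> itself in the other.\<close>
  have i1: "lcon HL f (sweedler R T3 t (\<lambda>x1 x2. ptensor R H HL x1 (ptensor R H L x2 m))) =
      ptensor R H L (lcon H f t) m" if m: "m \<in> carrier L" and t: "t \<in> carrier (tensor R H H)" for m t
    by (rule linear_eq_on_tensor[OF H H mHL lin_comp[OF sweedler_linear[OF H H mT3 inner1[OF m]] lf]
          lin_comp[OF lcon_linear[OF H H f] ptensor_left_linear[OF H L m]] _ t])
      (simp add: sweedler_ptensor[OF H H mT3 inner1[OF m]] lcon_ptensor[OF H mHL f] ptensor_closed[OF H L] m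
        lcon_ptensor[OF H H f] lin_smult[OF ptensor_left_linear[OF H L m]] functional_closed[OF f])
  have i2: "lcon HL f (sweedler R T3 t (\<lambda>y m'. ptensor R H HL x (ptensor R H L y m'))) = f x \<odot>\<^bsub>HL\<^esub> t"
    if x: "x \<in> carrier H" and t: "t \<in> carrier HL" for x t
    by (rule linear_eq_on_tensor[OF H L mHL lin_comp[OF sweedler_linear[OF H L mT3 inner2[OF x]] lf]
          smult_linear[OF mHL functional_closed[OF f x]] _ t])
      (simp add: sweedler_ptensor[OF H L mT3 inner2[OF x]] lcon_ptensor[OF H mHL f] ptensor_closed[OF H L] x)
  have "\<rho> (lcon L f (\<rho> l)) = lcon HL f (sweedler R T3 (\<rho> l) (\<lambda>x m. sweedler R T3 (\<rho> m) (\<lambda>y m'.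
             ptensor R H HL x (ptensor R H L y m'))))"
    by (rule linear_eq_on_tensor[OF H L mHL lin_comp[OF lcon_linear[OF H L f] \<rho>]
          lin_comp[OF sweedler_linear[OF H L mT3 outer2] lf] _ rl])
      (simp add: sweedler_ptensor[OF H L mT3 outer2] i2 lin_closed[OF \<rho>] lcon_ptensor[OF H L f]
        lin_smult[OF \<rho>] functional_closed[OF f])
  also have "\<dots> = tmap H L (\<lambda>x. lcon H f (\<Delta> x)) (\<lambda>m. m) (\<rho> l)"
    unfolding coassoc[symmetric]
    by (rule linear_eq_on_tensor[OF H L mHL lin_comp[OF sweedler_linear[OF H L mT3 outer1] lf]
          tmap_linear[OF H L H L fD lin_id] _ rl])
      (simp add: sweedler_ptensor[OF H L mT3 outer1] i1 lin_closed[OF \<Delta>] tmap_ptensor[OF H L H L fD lin_id])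
  finally show ?thesis .
qed

end

section \<open>Homogeneous components\<close>

context
  fixes V :: "('a, 'v, 'm) module_scheme" and gr
  assumes V: "module R V" and gr: "grading R V gr"
begin

private abbreviation "cmp n v \<equiv> component V gr n v"

lemma gr_submodule: "submodule (gr n) R V"
  using gr by (simp add: grading_def)

lemmas gr_closed = submoduleD(1)[OF gr_submodule]

lemma component_unique:
  assumes v: "v \<in> carrier V" and "homogeneous_decomposition V gr v f"
  shows "cmp n v = f n"
proof -
  have "\<exists>!f. homogeneous_decomposition V gr v f" using gr v by (simp add: grading_def)
  from the1_equality[of "homogeneous_decomposition V gr v", OF this assms(2)]
  have "(THE f. homogeneous_decomposition V gr v f) = f" .
  then show ?thesis by (simp add: component_def)
qed

lemma component_decomposition:
  assumes v: "v \<in> carrier V"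
  shows "homogeneous_decomposition V gr v (\<lambda>n. cmp n v)"
proof -
  have "\<exists>!f. homogeneous_decomposition V gr v f" using gr v by (simp add: grading_def)
  then have "homogeneous_decomposition V gr v (THE f. homogeneous_decomposition V gr v f)" by (rule theI')
  then show ?thesis by (simp add: component_def)
qed

lemma component_mem: "v \<in> carrier V \<Longrightarrow> cmp n v \<in> gr n"
  using component_decomposition[of v] by (simp add: homogeneous_decomposition_def)

lemma component_closed: "v \<in> carrier V \<Longrightarrow> cmp n v \<in> carrier V"
  by (rule gr_closed[OF component_mem])

lemma component_finite: "v \<in> carrier V \<Longrightarrow> finite {n. cmp n v \<noteq> \<zero>\<^bsub>V\<^esub>}"
  using component_decomposition[of v] by (simp add: homogeneous_decomposition_def)

lemma component_sum: "v \<in> carrier V \<Longrightarrow> finsum V (\<lambda>n. cmp n v) {n. cmp n v \<noteq> \<zero>\<^bsub>V\<^esub>} = v"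
  using component_decomposition[of v] by (simp add: homogeneous_decomposition_def)

lemma component_sum_superset:
  assumes v: "v \<in> carrier V" and S: "finite S" "\<And>n. n \<notin> S \<Longrightarrow> cmp n v = \<zero>\<^bsub>V\<^esub>"
  shows "v = finsum V (\<lambda>n. cmp n v) S"
proof -
  have sub: "{n. cmp n v \<noteq> \<zero>\<^bsub>V\<^esub>} \<subseteq> S" using S(2) by auto
  have "finsum V (\<lambda>n. cmp n v) {n. cmp n v \<noteq> \<zero>\<^bsub>V\<^esub>} = finsum V (\<lambda>n. cmp n v) S"
    by (rule mod_finsum_superset[OF V S(1) sub]) (simp_all add: component_closed[OF v])
  then show ?thesis using component_sum[OF v] by simp
qed

lemma component_eqI:
  assumes v: "v \<in> carrier V" and f: "\<And>n. f n \<in> gr n" and S: "finite S" "\<And>n. n \<notin> S \<Longrightarrow> f n = \<zero>\<^bsub>V\<^esub>"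
    and sum: "v = finsum V f S"
  shows "cmp n v = f n"
proof (rule component_unique[OF v])
  have sub: "{n. f n \<noteq> \<zero>\<^bsub>V\<^esub>} \<subseteq> S" using S(2) by auto
  have "finsum V f {n. f n \<noteq> \<zero>\<^bsub>V\<^esub>} = finsum V f S"
    by (rule mod_finsum_superset[OF V S(1) sub]) (simp_all add: gr_closed[OF f])
  then show "homogeneous_decomposition V gr v f"
    unfolding homogeneous_decomposition_def using f sum finite_subset[OF sub S(1)] by simp
qed

lemma component_linear: "linear_map R V V (\<lambda>v. cmp n v)"
proof (rule linear_mapI)
  show "cmp n v \<in> carrier V" if "v \<in> carrier V" for v by (rule component_closed[OF that])
  show "cmp n (v \<oplus>\<^bsub>V\<^esub> w) = cmp n v \<oplus>\<^bsub>V\<^esub> cmp n w" if v: "v \<in> carrier V" and w: "w \<in> carrier V" for v w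
  proof -
    let ?S = "{n. cmp n v \<noteq> \<zero>\<^bsub>V\<^esub>} \<union> {n. cmp n w \<noteq> \<zero>\<^bsub>V\<^esub>}"
    have S: "finite ?S" using component_finite[OF v] component_finite[OF w] by simp
    have "v \<oplus>\<^bsub>V\<^esub> w = finsum V (\<lambda>n. cmp n v) ?S \<oplus>\<^bsub>V\<^esub> finsum V (\<lambda>n. cmp n w) ?S"
      using component_sum_superset[OF v S] component_sum_superset[OF w S] by simp
    also have "\<dots> = finsum V (\<lambda>n. cmp n v \<oplus>\<^bsub>V\<^esub> cmp n w) ?S"
      by (rule mod_finsum_add[OF V, symmetric]) (simp_all add: Pi_def component_closed v w)
    finally have sum: "v \<oplus>\<^bsub>V\<^esub> w = finsum V (\<lambda>n. cmp n v \<oplus>\<^bsub>V\<^esub> cmp n w) ?S" .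
    show ?thesis
      by (rule component_eqI[OF mod_add[OF V v w] _ S _ sum])
        (simp_all add: submoduleD(3)[OF gr_submodule component_mem[OF v] component_mem[OF w]] V)
  qed
  show "cmp n (c \<odot>\<^bsub>V\<^esub> v) = c \<odot>\<^bsub>V\<^esub> cmp n v" if c: "c \<in> carrier R" and v: "v \<in> carrier V" for c v
  proof -
    let ?S = "{n. cmp n v \<noteq> \<zero>\<^bsub>V\<^esub>}"
    have "c \<odot>\<^bsub>V\<^esub> v = c \<odot>\<^bsub>V\<^esub> finsum V (\<lambda>n. cmp n v) ?S" using component_sum[OF v] by simp
    also have "\<dots> = finsum V (\<lambda>n. c \<odot>\<^bsub>V\<^esub> cmp n v) ?S"
      by (rule mod_finsum_smult[OF V component_finite[OF v] c, symmetric]) (simp add: Pi_def component_closed v)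
    finally have sum: "c \<odot>\<^bsub>V\<^esub> v = finsum V (\<lambda>n. c \<odot>\<^bsub>V\<^esub> cmp n v) ?S" .
    show ?thesis
      by (rule component_eqI[OF mod_smult[OF V c v] _ component_finite[OF v] _ sum])
        (simp_all add: submoduleD(4)[OF gr_submodule c component_mem[OF v]] V c)
  qed
qed

lemma component_homogeneous:
  assumes v: "v \<in> gr m"
  shows "cmp n v = (if n = m then v else \<zero>\<^bsub>V\<^esub>)"
  by (rule component_eqI[of v "\<lambda>n. if n = m then v else \<zero>\<^bsub>V\<^esub>" "{m}"])
    (simp_all add: gr_closed[OF v] v submoduleD(2)[OF gr_submodule] V Pi_def)

lemma component_zeroD:
  assumes v: "v \<in> carrier V" and "\<And>n. cmp n v = \<zero>\<^bsub>V\<^esub>"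
  shows "v = \<zero>\<^bsub>V\<^esub>"
  using component_sum_superset[OF v, of "{}"] assms(2) V by simp

lemma mem_gr_iff: "v \<in> carrier V \<Longrightarrow> (\<And>m. m \<noteq> n \<Longrightarrow> cmp m v = \<zero>\<^bsub>V\<^esub>) \<Longrightarrow> v \<in> gr n"
  using component_sum_superset[of v "{n}"] component_mem[of v n] component_closed[of v n] V by (simp add: Pi_def)

lemma lin_component:
  assumes W: "module R W" and f: "linear_map R V W f" and v: "v \<in> carrier V"
    and zero: "\<And>n u. n \<noteq> m \<Longrightarrow> u \<in> gr n \<Longrightarrow> f u = \<zero>\<^bsub>W\<^esub>"
  shows "f v = f (cmp m v)"
proof -
  let ?S = "insert m {n. cmp n v \<noteq> \<zero>\<^bsub>V\<^esub>}"
  have S: "finite ?S" using component_finite[OF v] by simp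
  have "f v = f (finsum V (\<lambda>n. cmp n v) ?S)"
    using component_sum_superset[OF v S] by simp
  also have "\<dots> = finsum W (\<lambda>n. f (cmp n v)) ?S"
    by (rule lin_finsum[OF V W f component_closed[OF v]])
  also have "\<dots> = f (cmp m v)"
    by (rule mod_finsum_single[OF W S]) (use lin_closed[OF f component_closed[OF v]] zero component_mem[OF v] in auto)
  finally show ?thesis .
qed

end


section \<open>Twisted group algebras, and testing linear maps on graded pieces\<close>

lemma lin_ext_basis_vec_eq:
  "module R V \<Longrightarrow> \<phi> x = v \<Longrightarrow> v \<in> carrier V \<Longrightarrow> lin_ext R V (basis_vec R x) \<phi> = v"
  using lin_ext_basis_vec[of V \<phi> x] by simp

text \<open>The records of the group algebras and of the smash product differ from a free module or
  a tensor product in their multiplicative and coalgebra fields only, and the vector space axioms do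
  not see those.\<close>

lemma module_cong_fields:
  fixes V :: "('a, 'v, 'm) module_scheme" and W :: "('a, 'v, 'n) module_scheme"
  assumes V: "module R V" and "carrier W = carrier V" "add W = add V" "zero W = zero V"
    "smult W = smult V"
  shows "module R W"
proof -
  note ag = abelian_groupE[OF module_abelian_group[OF V]]
  have W: "abelian_group W"
    by (rule abelian_groupI; unfold assms(2-5); rule ag; assumption)
  show ?thesis
    by (rule moduleI[OF is_cring W]; unfold assms(2-5);
        rule mod_smult[OF V] mod_add_smult[OF V] mod_smult_add[OF V] mod_smult_smult[OF V]
          mod_one_smult[OF V]; assumption)
qed

lemma twisted_simps:
  "carrier (twisted_alg R G F \<psi>) = carrier (free_module R F)"
  "add (twisted_alg R G F \<psi>) = add (free_module R F)"
  "zero (twisted_alg R G F \<psi>) = zero (free_module R F)"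
  "smult (twisted_alg R G F \<psi>) = smult (free_module R F)"
  "one (twisted_alg R G F \<psi>) = basis_vec R \<one>\<^bsub>G\<^esub>"
  "mult (twisted_alg R G F \<psi>) = (\<lambda>x y. lin_ext R (free_module R F) x (\<lambda>g. lin_ext R (free_module R F) y (\<lambda>h.
                   \<psi> g h \<odot>\<^bsub>free_module R F\<^esub> basis_vec R (g \<otimes>\<^bsub>G\<^esub> h))))"
  unfolding twisted_alg_def by simp_all

lemma twisted_module: "module R (twisted_alg R G F \<psi>)"
  by (rule module_cong_fields[OF free_module_module]) (simp_all add: twisted_simps)

lemma twisted_mult_basis:
  assumes "g \<in> F" "h \<in> F" "g \<otimes>\<^bsub>G\<^esub> h \<in> F" "\<psi> g h \<in> carrier R"
  shows "basis_vec R g \<otimes>\<^bsub>twisted_alg R G F \<psi>\<^esub> basis_vec R h =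
    \<psi> g h \<odot>\<^bsub>free_module R F\<^esub> basis_vec R (g \<otimes>\<^bsub>G\<^esub> h)"
proof -
  note V = free_module_module
  have c: "\<psi> g h \<odot>\<^bsub>free_module R F\<^esub> basis_vec R (g \<otimes>\<^bsub>G\<^esub> h) \<in> carrier (free_module R F)"
    by (rule mod_smult[OF V assms(4) basis_vec_carrier[OF assms(3)]])
  have i: "lin_ext R (free_module R F) (basis_vec R h) (\<lambda>h. \<psi> g h \<odot>\<^bsub>free_module R F\<^esub> basis_vec R (g \<otimes>\<^bsub>G\<^esub> h))
    = \<psi> g h \<odot>\<^bsub>free_module R F\<^esub> basis_vec R (g \<otimes>\<^bsub>G\<^esub> h)"
    by (rule lin_ext_basis_vec_eq[OF V], rule refl, rule c)
  show ?thesis unfolding twisted_simps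
    by (rule lin_ext_basis_vec_eq[OF V], rule i, rule c)
qed

lemma twisted_mult_bilin:
  fixes F :: "'g set"
  assumes F: "\<And>g h. g \<in> F \<Longrightarrow> h \<in> F \<Longrightarrow> g \<otimes>\<^bsub>G\<^esub> h \<in> F" and \<psi>: "\<And>g h. g \<in> F \<Longrightarrow> h \<in> F \<Longrightarrow> \<psi> g h \<in> carrier R"
  shows "bilin (free_module R F) (free_module R F) (free_module R F) (mult (twisted_alg R G F \<psi>))"
proof -
  let ?V = "free_module R F"
  let ?i = "\<lambda>g y. lin_ext R ?V y (\<lambda>h. \<psi> g h \<odot>\<^bsub>?V\<^esub> basis_vec R (g \<otimes>\<^bsub>G\<^esub> h))"
  note V = free_module_module
  have il: "linear_map R ?V ?V (?i g)" if "g \<in> F" for g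
    by (rule lin_ext_linear[OF V]) (rule mod_smult[OF V \<psi>[OF that] basis_vec_carrier[OF F[OF that]]])
  show ?thesis unfolding twisted_simps
  proof (rule bilinI)
    show "linear_map R ?V ?V (\<lambda>x. lin_ext R ?V x (\<lambda>g. ?i g y))" if "y \<in> carrier ?V" for y
      by (rule lin_ext_linear[OF V]) (rule lin_closed[OF il that])
    show "linear_map R ?V ?V (\<lambda>y. lin_ext R ?V x (\<lambda>g. ?i g y))" if x: "x \<in> carrier ?V" for x
    proof -
      have S: "finite {g. x g \<noteq> \<zero>}" "\<And>g. g \<in> {g. x g \<noteq> \<zero>} \<Longrightarrow> g \<in> F"
        using x unfolding free_carrier by blast+
      show ?thesis unfolding lin_ext_def[of R ?V x]
        by (rule lin_finsum_map[OF V S(1)]) (rule lin_smult_const[OF V il[OF S(2)] free_closed[OF x]])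
    qed
  qed
qed

lemma group_algebra_simps:
  "carrier (group_algebra R G) = carrier (free_module R (carrier G))"
  "add (group_algebra R G) = add (free_module R (carrier G))"
  "zero (group_algebra R G) = zero (free_module R (carrier G))"
  "smult (group_algebra R G) = smult (free_module R (carrier G))"
  "one (group_algebra R G) = basis_vec R \<one>\<^bsub>G\<^esub>"
  "mult (group_algebra R G) = mult (twisted_alg R G (carrier G) (\<lambda>_ _. \<one>))"
  "comult (group_algebra R G) = (let A = twisted_alg R G (carrier G) (\<lambda>_ _. \<one>) in
    (\<lambda>x. lin_ext R (tensor R A A) x (\<lambda>g. ptensor R A A (basis_vec R g) (basis_vec R g))))"
  "counit (group_algebra R G) = (\<lambda>x. lin_ext R (ground_algebra R) x (\<lambda>_. \<one>))"
  "antipode (group_algebra R G) = (let A = twisted_alg R G (carrier G) (\<lambda>_ _. \<one>) in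
    (\<lambda>x. lin_ext R A x (\<lambda>g. basis_vec R (inv\<^bsub>G\<^esub> g))))"
  by (simp_all add: group_algebra_def Let_def module.defs hopf.defs twisted_simps)

lemma group_algebra_module: "module R (group_algebra R G)"
  by (rule module_cong_fields[OF free_module_module]) (simp_all add: group_algebra_simps)

lemma linear_map_group_algebra:
  "linear_map R (group_algebra R G) W f \<longleftrightarrow> linear_map R (free_module R (carrier G)) W f"
  by (simp add: linear_map_def group_algebra_simps)

lemma coefficient_functional: "functional (free_module R X) (\<lambda>x. x k)"
  by (rule linear_mapI) simp_all

text \<open>Functionals are bare functions, so two that are equal in the mathematical sense may
  still differ outside the carrier; contraction does not notice.\<close>

lemma lcon_cong:
  assumes A: "module R A" and B: "module R B" and f: "functional A f" and f': "functional A f'"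
    and eq: "\<And>a. a \<in> carrier A \<Longrightarrow> f a = f' a" and t: "t \<in> carrier (tensor R A B)"
  shows "lcon B f t = lcon B f' t"
  by (rule linear_eq_on_tensor[OF A B B lcon_linear[OF A B f] lcon_linear[OF A B f'] _ t])
    (simp add: lcon_ptensor[OF A B f] lcon_ptensor[OF A B f'] eq)

lemma rcon_cong:
  assumes A: "module R A" and B: "module R B" and f: "functional B f" and f': "functional B f'"
    and eq: "\<And>a. a \<in> carrier B \<Longrightarrow> f a = f' a" and t: "t \<in> carrier (tensor R A B)"
  shows "rcon A f t = rcon A f' t"
  by (rule linear_eq_on_tensor[OF A B A rcon_linear[OF A B f] rcon_linear[OF A B f'] _ t])
    (simp add: rcon_ptensor[OF A B f] rcon_ptensor[OF A B f'] eq)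

lemma tensor_grading_in_submodule:
  assumes A: "module R A" and B: "module R B" and gA: "grading R A grA" and gB: "grading R B grB"
    and W: "module R W" and f: "linear_map R (tensor R A B) W f" and N: "submodule N R W"
    and gen: "\<And>i j a b. i + j = n \<Longrightarrow> a \<in> grA i \<Longrightarrow> b \<in> grB j \<Longrightarrow> f (ptensor R A B a b) \<in> N"
    and t: "t \<in> tensor_grading R A grA B grB n"
  shows "t \<in> carrier (tensor R A B)" "f t \<in> N"
proof -
  have "tensor_grading R A grA B grB n \<subseteq> {t \<in> carrier (tensor R A B). f t \<in> N}"
    unfolding tensor_grading_def
  proof (rule gen_submodule_least[OF submodule_vimage[OF tensor_module[OF A B] W f N]], rule subsetI)
    fix x assume "x \<in> {ptensor R A B a b |a b i j. i + j = n \<and> a \<in> grA i \<and> b \<in> grB j}"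
    then obtain a b i j where x: "x = ptensor R A B a b" and *: "i + j = n" "a \<in> grA i" "b \<in> grB j" by auto
    show "x \<in> {t \<in> carrier (tensor R A B). f t \<in> N}"
      using gen[OF *] ptensor_closed[OF A B gr_closed[OF A gA *(2)] gr_closed[OF B gB *(3)]] x by simp
  qed
  then show "t \<in> carrier (tensor R A B)" "f t \<in> N" using t by auto
qed

lemma tensor_grading_linear_eq:
  assumes A: "module R A" and B: "module R B" and gA: "grading R A grA" and gB: "grading R B grB"
    and W: "module R W" and f: "linear_map R (tensor R A B) W f" and g: "linear_map R (tensor R A B) W g"
    and gen: "\<And>i j a b. i + j = n \<Longrightarrow> a \<in> grA i \<Longrightarrow> b \<in> grB j \<Longrightarrow>
      f (ptensor R A B a b) = g (ptensor R A B a b)"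
    and t: "t \<in> tensor_grading R A grA B grB n"
  shows "f t = g t"
proof -
  note gm = lin_smult_const[OF W g, of "\<ominus> \<one>"]
  have fg: "linear_map R (tensor R A B) W (\<lambda>t. f t \<oplus>\<^bsub>W\<^esub> (\<ominus> \<one>) \<odot>\<^bsub>W\<^esub> g t)"
    by (rule lin_add_map[OF W f gm]) simp
  have *: "f (ptensor R A B a b) \<oplus>\<^bsub>W\<^esub> (\<ominus> \<one>) \<odot>\<^bsub>W\<^esub> g (ptensor R A B a b) \<in> {\<zero>\<^bsub>W\<^esub>}"
    if "i + j = n" "a \<in> grA i" "b \<in> grB j" for i j a b
    using gen[OF that] lin_closed[OF g ptensor_closed[OF A B gr_closed[OF A gA that(2)] gr_closed[OF B gB that(3)]]] W
    by simp
  note tc = tensor_grading_in_submodule[OF A B gA gB W fg submodule_zero[OF W] * t]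
  have "f t \<ominus>\<^bsub>W\<^esub> g t = \<zero>\<^bsub>W\<^esub>"
    using tc(2) mod_diff_eq[OF W lin_closed[OF f tc(1)] lin_closed[OF g tc(1)]] by simp
  from mod_eq_of_diff_zero[OF W lin_closed[OF f tc(1)] lin_closed[OF g tc(1)] this] show ?thesis .
qed

lemma linear_eq_on_graded:
  assumes V: "module R V" and gr: "grading R V gr" and W: "module R W"
    and f: "linear_map R V W f" and g: "linear_map R V W g"
    and eq: "\<And>n u. u \<in> gr n \<Longrightarrow> f u = g u" and v: "v \<in> carrier V"
  shows "f v = g v"
proof -
  let ?S = "{n. component V gr n v \<noteq> \<zero>\<^bsub>V\<^esub>}"
  note c = component_closed[OF V gr v]
  have *: "h v = finsum W (\<lambda>n. h (component V gr n v)) ?S" if h: "linear_map R V W h" for h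
    using lin_finsum[OF V W h, of ?S "\<lambda>n. component V gr n v", OF c] component_sum[OF V gr v] by simp
  show ?thesis unfolding *[OF f] *[OF g]
    by (rule mod_finsum_cong[OF W eq[OF component_mem[OF V gr v]] lin_closed[OF g c]])
qed

end

section \<open>Graded Hopf algebras with degree zero part a group algebra\<close>

locale graded_hopf = field R for R :: "('a, 'b) ring_scheme" (structure) +
  fixes H :: "('a, 'h) hopf" and grH :: "nat \<Rightarrow> 'h set"
    and G :: "('g, 's) monoid_scheme" and \<iota> :: "('g \<Rightarrow> 'a) \<Rightarrow> 'h"
  assumes graded: "graded_hopf_algebra R H grH" and group_G: "group G" and finite_G: "finite (carrier G)"
    and degree_zero: "is_degree_zero_part R H grH (group_algebra R G) \<iota>"
begin

abbreviation "K \<equiv> group_algebra R G"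
abbreviation "KF \<equiv> free_module R (carrier G)"
abbreviation "HH \<equiv> tensor R H H"
abbreviation "\<Delta> \<equiv> comult H"
abbreviation "\<epsilon> \<equiv> counit H"
abbreviation "\<pi> \<equiv> degree_zero_proj H grH K \<iota>"

lemma hopf: "hopf_algebra R H" using graded by (simp add: graded_hopf_algebra_def)
lemma H_alg: "assoc_algebra R H" using hopf by (simp add: hopf_algebra_def)
lemmas mH = alg_module[OF H_alg]
lemmas mHH = tensor_module[OF mH mH]
lemmas mK = group_algebra_module[of G]
lemma grad_H: "grading R H grH" using graded by (simp add: graded_hopf_algebra_def)
lemma gr_mult: "x \<in> grH i \<Longrightarrow> y \<in> grH j \<Longrightarrow> x \<otimes>\<^bsub>H\<^esub> y \<in> grH (i + j)"
  using graded by (simp add: graded_hopf_algebra_def)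
lemmas H_closed = alg_closed[OF H_alg]
lemmas H_one = alg_one[OF H_alg]
lemmas H_assoc = alg_assoc[OF H_alg]

lemma Delta_hom: "alg_hom R H HH \<Delta>" using hopf by (simp add: hopf_algebra_def)
lemma Delta_linear: "linear_map R H HH \<Delta>" using Delta_hom by (simp add: alg_hom_def)
lemmas Delta_closed = lin_closed[OF Delta_linear]
lemma Delta_mult: "x \<in> carrier H \<Longrightarrow> y \<in> carrier H \<Longrightarrow> \<Delta> (x \<otimes>\<^bsub>H\<^esub> y) = \<Delta> x \<otimes>\<^bsub>HH\<^esub> \<Delta> y"
  using Delta_hom by (simp add: alg_hom_def ring_hom_def)
lemma eps_functional: "functional H \<epsilon>" using hopf by (simp add: hopf_algebra_def alg_hom_def)
lemma eps_positive: "n \<noteq> 0 \<Longrightarrow> x \<in> grH n \<Longrightarrow> \<epsilon> x = \<zero>"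
  using graded by (simp add: graded_hopf_algebra_def)
lemma counit_right: "h \<in> carrier H \<Longrightarrow> rcon H \<epsilon> (\<Delta> h) = h"
  using hopf by (simp add: hopf_algebra_def rcon_def)
lemma Delta_graded: "x \<in> grH n \<Longrightarrow> \<Delta> x \<in> tensor_grading R H grH H grH n"
  using graded by (simp add: graded_hopf_algebra_def)

lemma Delta_coassoc:
  assumes h: "h \<in> carrier H" and f: "functional H f"
  shows "\<Delta> (lcon H f (\<Delta> h)) = tmap H H (\<lambda>x. lcon H f (\<Delta> x)) (\<lambda>m. m) (\<Delta> h)"
  by (rule coassoc_contraction[OF mH mH Delta_linear Delta_linear h f])
    (use hopf h in \<open>simp add: hopf_algebra_def Let_def\<close>)

lemma iota_hom: "hopf_hom R K H \<iota>" and iota_bij: "bij_betw \<iota> (carrier K) (grH 0)"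
  using degree_zero by (simp_all add: is_degree_zero_part_def)
lemma iota_linear: "linear_map R K H \<iota>" using iota_hom by (simp add: hopf_hom_def alg_hom_def)
lemma iota_linear': "linear_map R KF H \<iota>" using iota_linear by (simp add: linear_map_group_algebra)
lemma iota_inj: "inj_on \<iota> (carrier K)" using iota_bij by (simp add: bij_betw_def)
lemma iota_image: "\<iota> ` carrier K = grH 0" using iota_bij by (simp add: bij_betw_def)

definition "gl g = \<iota> (basis_vec R g)"

lemma basis_K: "g \<in> carrier G \<Longrightarrow> basis_vec R g \<in> carrier K"
  by (simp add: group_algebra_simps)

lemma gl_closed: "g \<in> carrier G \<Longrightarrow> gl g \<in> carrier H"
  unfolding gl_def by (rule lin_closed[OF iota_linear basis_K])

lemma gl_degree: "g \<in> carrier G \<Longrightarrow> gl g \<in> grH 0"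
  unfolding gl_def using iota_image basis_K by blast

lemma K_mult_basis: "g \<in> carrier G \<Longrightarrow> h \<in> carrier G \<Longrightarrow>
    basis_vec R g \<otimes>\<^bsub>K\<^esub> basis_vec R h = basis_vec R (g \<otimes>\<^bsub>G\<^esub> h)"
  unfolding group_algebra_simps
  by (subst twisted_mult_basis)
    (simp_all add: group_G group.is_monoid monoid.m_closed mod_one_smult[OF free_module_module basis_vec_carrier]
      del: free_simps)

lemma gl_mult: "g \<in> carrier G \<Longrightarrow> h \<in> carrier G \<Longrightarrow> gl g \<otimes>\<^bsub>H\<^esub> gl h = gl (g \<otimes>\<^bsub>G\<^esub> h)"
  unfolding gl_def K_mult_basis[symmetric]
  using iota_hom basis_K[of g] basis_K[of h] by (simp add: hopf_hom_def alg_hom_def ring_hom_def)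

lemma gl_one: "gl \<one>\<^bsub>G\<^esub> = \<one>\<^bsub>H\<^esub>"
proof -
  have "\<iota> \<one>\<^bsub>K\<^esub> = \<one>\<^bsub>H\<^esub>" using iota_hom by (simp add: hopf_hom_def alg_hom_def ring_hom_def)
  then show ?thesis by (simp add: gl_def group_algebra_simps)
qed

lemma G_simps:
  "\<one>\<^bsub>G\<^esub> \<in> carrier G"
  "g \<in> carrier G \<Longrightarrow> inv\<^bsub>G\<^esub> g \<in> carrier G"
  "g \<in> carrier G \<Longrightarrow> h \<in> carrier G \<Longrightarrow> g \<otimes>\<^bsub>G\<^esub> h \<in> carrier G"
  "g \<in> carrier G \<Longrightarrow> \<one>\<^bsub>G\<^esub> \<otimes>\<^bsub>G\<^esub> g = g"
  "g \<in> carrier G \<Longrightarrow> g \<otimes>\<^bsub>G\<^esub> \<one>\<^bsub>G\<^esub> = g"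
  "g \<in> carrier G \<Longrightarrow> inv\<^bsub>G\<^esub> g \<otimes>\<^bsub>G\<^esub> g = \<one>\<^bsub>G\<^esub>"
  "g \<in> carrier G \<Longrightarrow> g \<otimes>\<^bsub>G\<^esub> inv\<^bsub>G\<^esub> g = \<one>\<^bsub>G\<^esub>"
  "g \<in> carrier G \<Longrightarrow> h \<in> carrier G \<Longrightarrow> k \<in> carrier G \<Longrightarrow> g \<otimes>\<^bsub>G\<^esub> h \<otimes>\<^bsub>G\<^esub> k = g \<otimes>\<^bsub>G\<^esub> (h \<otimes>\<^bsub>G\<^esub> k)"
  "inv\<^bsub>G\<^esub> \<one>\<^bsub>G\<^esub> = \<one>\<^bsub>G\<^esub>"
  "g \<in> carrier G \<Longrightarrow> inv\<^bsub>G\<^esub> (inv\<^bsub>G\<^esub> g) = g"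
proof -
  interpret G: group G by (rule group_G)
  show
    "\<one>\<^bsub>G\<^esub> \<in> carrier G"
    "g \<in> carrier G \<Longrightarrow> inv\<^bsub>G\<^esub> g \<in> carrier G"
    "g \<in> carrier G \<Longrightarrow> h \<in> carrier G \<Longrightarrow> g \<otimes>\<^bsub>G\<^esub> h \<in> carrier G"
    "g \<in> carrier G \<Longrightarrow> \<one>\<^bsub>G\<^esub> \<otimes>\<^bsub>G\<^esub> g = g"
    "g \<in> carrier G \<Longrightarrow> g \<otimes>\<^bsub>G\<^esub> \<one>\<^bsub>G\<^esub> = g"
    "g \<in> carrier G \<Longrightarrow> inv\<^bsub>G\<^esub> g \<otimes>\<^bsub>G\<^esub> g = \<one>\<^bsub>G\<^esub>"
    "g \<in> carrier G \<Longrightarrow> g \<otimes>\<^bsub>G\<^esub> inv\<^bsub>G\<^esub> g = \<one>\<^bsub>G\<^esub>"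
    "g \<in> carrier G \<Longrightarrow> h \<in> carrier G \<Longrightarrow> k \<in> carrier G \<Longrightarrow> g \<otimes>\<^bsub>G\<^esub> h \<otimes>\<^bsub>G\<^esub> k = g \<otimes>\<^bsub>G\<^esub> (h \<otimes>\<^bsub>G\<^esub> k)"
    "inv\<^bsub>G\<^esub> \<one>\<^bsub>G\<^esub> = \<one>\<^bsub>G\<^esub>"
    "g \<in> carrier G \<Longrightarrow> inv\<^bsub>G\<^esub> (inv\<^bsub>G\<^esub> g) = g"
    by (simp_all add: G.m_assoc)
qed

lemma G_shift:
  assumes "g \<in> carrier G" "h \<in> carrier G" "k \<in> carrier G"
  shows "k = g \<otimes>\<^bsub>G\<^esub> h \<longleftrightarrow> inv\<^bsub>G\<^esub> g \<otimes>\<^bsub>G\<^esub> k = h" "k = h \<otimes>\<^bsub>G\<^esub> g \<longleftrightarrow> k \<otimes>\<^bsub>G\<^esub> inv\<^bsub>G\<^esub> g = h"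
  using assms by (auto simp: G_simps G_simps(8)[symmetric])

lemma gl_inv_cancel:
  assumes g: "g \<in> carrier G" and h: "h \<in> carrier H"
  shows "h \<otimes>\<^bsub>H\<^esub> gl g \<otimes>\<^bsub>H\<^esub> gl (inv\<^bsub>G\<^esub> g) = h" "h \<otimes>\<^bsub>H\<^esub> gl (inv\<^bsub>G\<^esub> g) \<otimes>\<^bsub>H\<^esub> gl g = h"
  using g h G_simps(2)[OF g]
  by (simp_all add: H_assoc gl_closed gl_mult G_simps gl_one alg_r_one[OF H_alg])

lemma Delta_gl:
  assumes g: "g \<in> carrier G"
  shows "\<Delta> (gl g) = ptensor R H H (gl g) (gl g)"
proof -
  \<comment> \<open>The comultiplication of \<open>group_algebra\<close> is written over the
    underlying algebra record, so its values are tensors over \<open>?A\<close> and not over the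
    Hopf record \<open>K\<close>.\<close>
  let ?A = "twisted_alg R G (carrier G) (\<lambda>_ _. \<one>)"
  have mA: "module R ?A" by (rule twisted_module)
  have lA: "linear_map R ?A H \<iota>"
    using iota_linear by (simp add: linear_map_def twisted_simps group_algebra_simps)
  have bA: "basis_vec R g \<in> carrier ?A" using g by (simp add: twisted_simps)
  have "comult K (basis_vec R g) = ptensor R ?A ?A (basis_vec R g) (basis_vec R g)"
    unfolding group_algebra_simps Let_def
    by (rule lin_ext_basis_vec_eq[OF tensor_module[OF mA mA]], rule refl, rule ptensor_closed[OF mA mA bA bA])
  moreover have "\<Delta> (gl g) = sweedler R HH (comult K (basis_vec R g)) (\<lambda>y z. ptensor R H H (\<iota> y) (\<iota> z))"
    using iota_hom basis_K[OF g] by (simp add: hopf_hom_def gl_def)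
  ultimately have "\<Delta> (gl g) =
      sweedler R HH (ptensor R ?A ?A (basis_vec R g) (basis_vec R g)) (\<lambda>y z. ptensor R H H (\<iota> y) (\<iota> z))"
    by simp
  also have "\<dots> = ptensor R H H (gl g) (gl g)"
    unfolding gl_def
    by (rule sweedler_ptensor[OF mA mA mHH bilin_precomp[OF ptensor_bilin[OF mH mH] lA lA] bA bA])
  finally show ?thesis .
qed

lemma eps_gl: "g \<in> carrier G \<Longrightarrow> \<epsilon> (gl g) = \<one>"
proof -
  assume g: "g \<in> carrier G"
  have "\<epsilon> (gl g) = counit K (basis_vec R g)"
    using iota_hom basis_K[OF g] by (simp add: hopf_hom_def gl_def)
  also have "\<dots> = \<one>"
    unfolding group_algebra_simps by (rule lin_ext_basis_vec[OF ground_module]) simp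
  finally show ?thesis .
qed

lemma antipode_basis: "g \<in> carrier G \<Longrightarrow> antipode K (basis_vec R g) = basis_vec R (inv\<^bsub>G\<^esub> g)"
  unfolding group_algebra_simps Let_def
  by (rule lin_ext_basis_vec[OF twisted_module]) (simp add: twisted_simps G_simps)

lemma iota_pi: "h \<in> carrier H \<Longrightarrow> \<iota> (\<pi> h) = component H grH 0 h"
  and pi_closed: "h \<in> carrier H \<Longrightarrow> \<pi> h \<in> carrier K"
  unfolding degree_zero_proj_def
  using component_mem[OF mH grad_H, of h 0] f_inv_into_f[of _ \<iota> "carrier K"] inv_into_into[of _ \<iota> "carrier K"]
  unfolding iota_image by auto

lemma pi_iota: "x \<in> carrier K \<Longrightarrow> \<pi> (\<iota> x) = x"
proof -
  assume x: "x \<in> carrier K"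
  have ix: "\<iota> x \<in> grH 0" using x iota_image by blast
  have "component H grH 0 (\<iota> x) = \<iota> x" using component_homogeneous[OF mH grad_H ix, of 0] by simp
  then show ?thesis unfolding degree_zero_proj_def using inv_into_f_f[OF iota_inj x] by simp
qed

lemma pi_linear: "linear_map R H K \<pi>"
proof (rule linear_mapI)
  note cl = component_linear[OF mH grad_H, of 0]
  show "\<pi> x \<in> carrier K" if "x \<in> carrier H" for x by (rule pi_closed[OF that])
  show "\<pi> (x \<oplus>\<^bsub>H\<^esub> y) = \<pi> x \<oplus>\<^bsub>K\<^esub> \<pi> y" if x: "x \<in> carrier H" and y: "y \<in> carrier H" for x y
    by (rule inj_onD[OF iota_inj _ pi_closed[OF mod_add[OF mH x y]] mod_add[OF mK pi_closed[OF x] pi_closed[OF y]]])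
      (simp only: iota_pi[OF mod_add[OF mH x y]] lin_add[OF iota_linear pi_closed[OF x] pi_closed[OF y]]
        iota_pi[OF x] iota_pi[OF y] lin_add[OF cl x y])
  show "\<pi> (c \<odot>\<^bsub>H\<^esub> x) = c \<odot>\<^bsub>K\<^esub> \<pi> x" if c: "c \<in> carrier R" and x: "x \<in> carrier H" for c x
    by (rule inj_onD[OF iota_inj _ pi_closed[OF mod_smult[OF mH c x]] mod_smult[OF mK c pi_closed[OF x]]])
      (simp only: iota_pi[OF mod_smult[OF mH c x]] lin_smult[OF iota_linear c pi_closed[OF x]]
        iota_pi[OF x] lin_smult[OF cl c x])
qed

text \<open>A map that vanishes in positive degrees factors through the projection onto
  \<open>H(0)\<close>, and \<open>H(0)\<close> is spanned by the group elements.\<close>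

lemma linear_eq_on_H:
  assumes W: "module R W" and f: "linear_map R H W f" and f': "linear_map R H W f'"
    and pos: "\<And>n u. n \<noteq> 0 \<Longrightarrow> u \<in> grH n \<Longrightarrow> f u = \<zero>\<^bsub>W\<^esub>"
    and pos': "\<And>n u. n \<noteq> 0 \<Longrightarrow> u \<in> grH n \<Longrightarrow> f' u = \<zero>\<^bsub>W\<^esub>"
    and eq: "\<And>g. g \<in> carrier G \<Longrightarrow> f (gl g) = f' (gl g)" and h: "h \<in> carrier H"
  shows "f h = f' h"
proof -
  have "f h = f (\<iota> (\<pi> h))" "f' h = f' (\<iota> (\<pi> h))"
    unfolding iota_pi[OF h] by (rule lin_component[OF mH grad_H W f h pos] lin_component[OF mH grad_H W f' h pos'], assumption+)+
  moreover have "f (\<iota> (\<pi> h)) = f' (\<iota> (\<pi> h))"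
    by (rule linear_eq_on_free[OF W lin_comp[OF iota_linear' f] lin_comp[OF iota_linear' f']])
      (use eq pi_closed[OF h] in \<open>simp_all add: gl_def group_algebra_simps\<close>)
  ultimately show ?thesis by simp
qed

text \<open>The dual basis of the group elements, extended by zero to positive degrees. In the dual
  algebra of \<open>H\<close> these functionals are orthogonal idempotents with sum the counit,
  which is what splits comodules into parts indexed by \<open>G\<close>.\<close>

definition "ec k h = \<pi> h k"

lemma ec_functional: "functional H (ec k)"
proof -
  have "functional K (\<lambda>x. x k)" using coefficient_functional[of "carrier G" k] by (simp add: linear_map_group_algebra)
  from lin_comp[OF pi_linear this] show ?thesis by (simp add: ec_def[abs_def])
qed

lemmas ec_closed = functional_closed[OF ec_functional]

lemma ec_positive: "n \<noteq> 0 \<Longrightarrow> u \<in> grH n \<Longrightarrow> ec k u = \<zero>"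
proof -
  assume n: "n \<noteq> 0" and u: "u \<in> grH n"
  have uc: "u \<in> carrier H" by (rule gr_closed[OF mH grad_H u])
  have "\<iota> (\<pi> u) = \<iota> \<zero>\<^bsub>K\<^esub>"
    using iota_pi[OF uc] component_homogeneous[OF mH grad_H u, of 0] n lin_zero[OF mK mH iota_linear] by simp
  then have "\<pi> u = \<zero>\<^bsub>K\<^esub>" by (rule inj_onD[OF iota_inj _ pi_closed[OF uc] mod_zero[OF mK]])
  then show ?thesis by (simp add: ec_def group_algebra_simps)
qed

lemma ec_gl: "g \<in> carrier G \<Longrightarrow> ec k (gl g) = (if k = g then \<one> else \<zero>)"
  unfolding ec_def gl_def by (subst pi_iota[OF basis_K], assumption, unfold basis_vec_def, rule refl)

lemma ec_mult_left:
  assumes g: "g \<in> carrier G" and k: "k \<in> carrier G" and h: "h \<in> carrier H"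
  shows "ec k (gl g \<otimes>\<^bsub>H\<^esub> h) = ec (inv\<^bsub>G\<^esub> g \<otimes>\<^bsub>G\<^esub> k) h"
proof (rule linear_eq_on_H[OF ground_module lin_comp[OF left_mult_linear[OF H_alg gl_closed[OF g]] ec_functional]
      ec_functional _ _ _ h])
  show "ec k (gl g \<otimes>\<^bsub>H\<^esub> u) = \<zero>\<^bsub>ground_algebra R\<^esub>" if "n \<noteq> 0" "u \<in> grH n" for n u
    using ec_positive[OF that(1), of "gl g \<otimes>\<^bsub>H\<^esub> u" k] gr_mult[OF gl_degree[OF g] that(2)] by simp
  show "ec (inv\<^bsub>G\<^esub> g \<otimes>\<^bsub>G\<^esub> k) u = \<zero>\<^bsub>ground_algebra R\<^esub>" if "n \<noteq> 0" "u \<in> grH n" for n u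
    using ec_positive[OF that] by simp
  show "ec k (gl g \<otimes>\<^bsub>H\<^esub> gl h) = ec (inv\<^bsub>G\<^esub> g \<otimes>\<^bsub>G\<^esub> k) (gl h)" if "h \<in> carrier G" for h
    using g k that G_shift(1)[OF g that k] by (simp add: gl_mult ec_gl G_simps(3))
qed

lemma ec_mult_right:
  assumes g: "g \<in> carrier G" and k: "k \<in> carrier G" and h: "h \<in> carrier H"
  shows "ec k (h \<otimes>\<^bsub>H\<^esub> gl g) = ec (k \<otimes>\<^bsub>G\<^esub> inv\<^bsub>G\<^esub> g) h"
proof (rule linear_eq_on_H[OF ground_module lin_comp[OF right_mult_linear[OF H_alg gl_closed[OF g]] ec_functional]
      ec_functional _ _ _ h])
  show "ec k (u \<otimes>\<^bsub>H\<^esub> gl g) = \<zero>\<^bsub>ground_algebra R\<^esub>" if "n \<noteq> 0" "u \<in> grH n" for n u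
    using ec_positive[OF that(1), of "u \<otimes>\<^bsub>H\<^esub> gl g" k] gr_mult[OF that(2) gl_degree[OF g]] by simp
  show "ec (k \<otimes>\<^bsub>G\<^esub> inv\<^bsub>G\<^esub> g) u = \<zero>\<^bsub>ground_algebra R\<^esub>" if "n \<noteq> 0" "u \<in> grH n" for n u
    using ec_positive[OF that] by simp
  show "ec k (gl h \<otimes>\<^bsub>H\<^esub> gl g) = ec (k \<otimes>\<^bsub>G\<^esub> inv\<^bsub>G\<^esub> g) (gl h)" if "h \<in> carrier G" for h
    using g k that G_shift(2)[OF g that k] by (simp add: gl_mult ec_gl G_simps(3))
qed

text \<open>A homogeneous tensor of positive total degree has a factor of positive degree, which one
  of the two functionals kills; in degree zero the coproduct of a group element g is g \<otimes> g.
  So the \<open>ec k\<close> multiply as orthogonal idempotents under convolution.\<close>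

lemma ec_convolution:
  assumes g: "g \<in> carrier G" and k: "k \<in> carrier G" and h: "h \<in> carrier H"
  shows "ec k (lcon H (ec g) (\<Delta> h)) = (if g = k then ec k h else \<zero>)"
proof -
  note l = lin_comp[OF lcon_linear[OF mH mH ec_functional] ec_functional]
  have r: "functional H (\<lambda>h. if g = k then ec k h else \<zero>)"
    using ec_functional[of k] lin_zero_map[OF ground_module, of H] by (cases "g = k") simp_all
  show ?thesis
  proof (rule linear_eq_on_H[OF ground_module lin_comp[OF Delta_linear l] r _ _ _ h])
    fix n u assume n: "n \<noteq> 0" and u: "u \<in> grH n"
    have "ec k (lcon H (ec g) (\<Delta> u)) \<in> {\<zero>\<^bsub>ground_algebra R\<^esub>}"
    proof (rule tensor_grading_in_submodule(2)[OF mH mH grad_H grad_H ground_module l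
          submodule_zero[OF ground_module] _ Delta_graded[OF u]])
      fix i j a b assume ij: "i + j = n" and a: "a \<in> grH i" and b: "b \<in> grH j"
      note ac = gr_closed[OF mH grad_H a] and bc = gr_closed[OF mH grad_H b]
      have "ec k (lcon H (ec g) (ptensor R H H a b)) = ec g a \<otimes> ec k b"
        by (simp add: lcon_ptensor[OF mH mH ec_functional ac bc] functional_smult[OF ec_functional ec_closed[OF ac] bc])
      also have "\<dots> = \<zero>"
        using ij n ec_positive[OF _ a, of g] ec_positive[OF _ b, of k] ec_closed[OF ac] ec_closed[OF bc]
        by (cases "i = 0") simp_all
      finally show "ec k (lcon H (ec g) (ptensor R H H a b)) \<in> {\<zero>\<^bsub>ground_algebra R\<^esub>}" by simp
    qed
    then show "ec k (lcon H (ec g) (\<Delta> u)) = \<zero>\<^bsub>ground_algebra R\<^esub>" by simp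
    show "(if g = k then ec k u else \<zero>) = \<zero>\<^bsub>ground_algebra R\<^esub>" using ec_positive[OF n u] by simp
  next
    fix h assume h: "h \<in> carrier G"
    note hc = gl_closed[OF h]
    show "ec k (lcon H (ec g) (\<Delta> (gl h))) = (if g = k then ec k (gl h) else \<zero>)"
      by (auto simp: Delta_gl[OF h] lcon_ptensor[OF mH mH ec_functional hc hc] ec_gl[OF h]
          functional_smult[OF ec_functional _ hc])
  qed
qed

text \<open>Because \<open>G\<close> is finite, the sum of all \<open>ec k\<close> is a functional;
  it agrees with the counit on group elements and in positive degrees. The vector \<open>v\<close>
  carries the identity into an arbitrary space.\<close>

lemma ec_sum:
  assumes V: "module R V" and v: "v \<in> carrier V" and h: "h \<in> carrier H"
  shows "finsum V (\<lambda>k. ec k h \<odot>\<^bsub>V\<^esub> v) (carrier G) = \<epsilon> h \<odot>\<^bsub>V\<^esub> v"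
proof (rule linear_eq_on_H[OF V lin_finsum_map[OF V finite_G functional_smult_linear[OF V ec_functional v]]
      functional_smult_linear[OF V eps_functional v] _ _ _ h])
  show "finsum V (\<lambda>k. ec k u \<odot>\<^bsub>V\<^esub> v) (carrier G) = \<zero>\<^bsub>V\<^esub>" if "n \<noteq> 0" "u \<in> grH n" for n u
    by (rule mod_finsum_zero[OF V]) (simp add: ec_positive[OF that] V v)
  show "\<epsilon> u \<odot>\<^bsub>V\<^esub> v = \<zero>\<^bsub>V\<^esub>" if "n \<noteq> 0" "u \<in> grH n" for n u
    by (simp add: eps_positive[OF that] V v)
  show "finsum V (\<lambda>k. ec k (gl g) \<odot>\<^bsub>V\<^esub> v) (carrier G) = \<epsilon> (gl g) \<odot>\<^bsub>V\<^esub> v" if g: "g \<in> carrier G" for g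
    by (rule mod_finsum_single[OF V finite_G g]) (simp_all add: ec_gl[OF g] eps_gl[OF g] V v)
qed

text \<open>A group element g has coproduct g \<otimes> g, so contraction by \<open>ec k\<close>
  retains exactly the term of \<open>k\<close>. This is what produces homogeneous elements in
  \<open>L(0)\<close>.\<close>

lemma lcon_ec_degree_zero:
  assumes k: "k \<in> carrier G" and a: "a \<in> grH 0"
  shows "lcon H (ec k) (\<Delta> a) = ec k a \<odot>\<^bsub>H\<^esub> gl k"
proof -
  obtain x where x: "x \<in> carrier KF" "a = \<iota> x" using a iota_image by (auto simp: group_algebra_simps)
  show ?thesis unfolding x(2)
  proof (rule linear_eq_on_free[OF mH _ _ _ x(1)])
    show "linear_map R KF H (\<lambda>x. lcon H (ec k) (\<Delta> (\<iota> x)))"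
      by (rule lin_comp[OF iota_linear' lin_comp[OF Delta_linear lcon_linear[OF mH mH ec_functional]]])
    show "linear_map R KF H (\<lambda>x. ec k (\<iota> x) \<odot>\<^bsub>H\<^esub> gl k)"
      by (rule lin_comp[OF iota_linear' functional_smult_linear[OF mH ec_functional gl_closed[OF k]]])
    show "lcon H (ec k) (\<Delta> (\<iota> (basis_vec R g))) = ec k (\<iota> (basis_vec R g)) \<odot>\<^bsub>H\<^esub> gl k"
      if g: "g \<in> carrier G" for g
      unfolding gl_def[symmetric] Delta_gl[OF g] lcon_ptensor[OF mH mH ec_functional gl_closed[OF g] gl_closed[OF g]]
      using gl_closed[OF g] gl_closed[OF k] mH by (auto simp: ec_gl[OF g])
  qed
qed

subsection \<open>Coinvariants of the projection\<close>

text \<open>The component of \<open>h\<close> in degree \<open>k\<close> for the right coaction of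
  \<open>H(0)\<close> through the projection. The coinvariants are the part whose degree is the
  neutral element.\<close>

definition "dc k h = rcon H (ec k) (\<Delta> h)"

lemma dc_linear: "linear_map R H H (dc k)"
  unfolding dc_def[abs_def] by (rule lin_comp[OF Delta_linear rcon_linear[OF mH mH ec_functional]])

lemmas dc_closed = lin_closed[OF dc_linear]

abbreviation "C \<equiv> H_coinv R H K \<pi>"
abbreviation "HC \<equiv> H\<lparr>carrier := C\<rparr>"

lemma tensor_KF_eqI:
  assumes A: "module R A" and s: "s \<in> carrier (tensor R A K)" and t: "t \<in> carrier (tensor R A K)"
    and eq: "\<And>k. k \<in> carrier G \<Longrightarrow> rcon A (\<lambda>x. x k) s = rcon A (\<lambda>x. x k) t"
  shows "s = t"
proof (rule tensor_eqI[OF A mK s t])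
  fix f assume f: "functional A f"
  have ev: "functional K (\<lambda>x. x k)" for k
    using coefficient_functional[of "carrier G" k] by (simp add: linear_map_group_algebra)
  show "lcon K f s = lcon K f t"
  proof
    fix k show "lcon K f s k = lcon K f t k"
    proof (cases "k \<in> carrier G")
      case True
      then show ?thesis using lcon_rcon[OF A mK f ev s, of k] lcon_rcon[OF A mK f ev t, of k] eq[OF True] by simp
    next
      case False
      then show ?thesis
        using lcon_closed[OF A mK f s] lcon_closed[OF A mK f t] by (simp add: group_algebra_simps free_carrier)
    qed
  qed
qed

text \<open>Compare the coefficients of every group element k in the second factor of the defining
  identity in \<open>H\<close> \<otimes> \<open>H(0)\<close>. All facts about coinvariants are
  derived from the resulting equations in \<open>H\<close>.\<close>

lemma C_iff: "r \<in> C \<longleftrightarrow> r \<in> carrier H \<and> (\<forall>k\<in>carrier G. dc k r = (if k = \<one>\<^bsub>G\<^esub> then r else \<zero>\<^bsub>H\<^esub>))"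
proof (cases "r \<in> carrier H")
  case True
  have ev: "functional K (\<lambda>x. x k)" for k
    using coefficient_functional[of "carrier G" k] by (simp add: linear_map_group_algebra)
  have oneK: "\<one>\<^bsub>K\<^esub> \<in> carrier K" by (simp add: group_algebra_simps G_simps)
  note D = Delta_closed[OF True]
  have eq: "sweedler R (tensor R H K) (\<Delta> r) (\<lambda>x y. ptensor R H K x (\<pi> y)) = tmap H K (\<lambda>x. x) \<pi> (\<Delta> r)"
    by (simp add: tmap_def)
  have 1: "rcon H (\<lambda>x. x k) (tmap H K (\<lambda>x. x) \<pi> (\<Delta> r)) = dc k r" for k
    using rcon_tmap[OF mH mK mH mH lin_id pi_linear ev D, of k] by (simp add: dc_def ec_def[abs_def])
  have 2: "rcon H (\<lambda>x. x k) (ptensor R H K r \<one>\<^bsub>K\<^esub>) = (if k = \<one>\<^bsub>G\<^esub> then r else \<zero>\<^bsub>H\<^esub>)" for k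
    using rcon_ptensor[OF mH mK ev True oneK, of k] mH True by (simp add: group_algebra_simps basis_vec_def)
  have "tmap H K (\<lambda>x. x) \<pi> (\<Delta> r) = ptensor R H K r \<one>\<^bsub>K\<^esub> \<longleftrightarrow>
      (\<forall>k\<in>carrier G. rcon H (\<lambda>x. x k) (tmap H K (\<lambda>x. x) \<pi> (\<Delta> r)) = rcon H (\<lambda>x. x k) (ptensor R H K r \<one>\<^bsub>K\<^esub>))"
    using tensor_KF_eqI[OF mH tmap_closed[OF mH mK mH mH lin_id pi_linear D] ptensor_closed[OF mH mK True oneK]]
    by metis
  then show ?thesis using True unfolding 1 2 by (simp add: H_coinv_def eq)
qed (simp add: H_coinv_def)

lemma C_submodule: "submodule C R H"
proof (rule submodule_intro[OF mH])
  show "x \<in> carrier H" if "x \<in> C" for x using that by (simp add: C_iff)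
  show "\<zero>\<^bsub>H\<^esub> \<in> C" using mH lin_zero[OF mH mH dc_linear] by (simp add: C_iff)
  show "x \<oplus>\<^bsub>H\<^esub> y \<in> C" if "x \<in> C" "y \<in> C" for x y
    using that mH lin_add[OF dc_linear] by (simp add: C_iff)
  show "c \<odot>\<^bsub>H\<^esub> x \<in> C" if "c \<in> carrier R" "x \<in> C" for c x
    using that mH lin_smult[OF dc_linear] by (simp add: C_iff)
qed

lemmas C_closed = submoduleD(1)[OF C_submodule]
lemmas mHC = submodule_module[OF mH C_submodule]

lemma dc_mult_left:
  assumes g: "g \<in> carrier G" and k: "k \<in> carrier G" and h: "h \<in> carrier H"
  shows "dc k (gl g \<otimes>\<^bsub>H\<^esub> h) = gl g \<otimes>\<^bsub>H\<^esub> dc (inv\<^bsub>G\<^esub> g \<otimes>\<^bsub>G\<^esub> k) h"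
proof -
  note gc = gl_closed[OF g]
  have "dc k (gl g \<otimes>\<^bsub>H\<^esub> h) = gl g \<otimes>\<^bsub>H\<^esub> rcon H (\<lambda>b. ec k (gl g \<otimes>\<^bsub>H\<^esub> b)) (\<Delta> h)"
    unfolding dc_def Delta_mult[OF gc h] Delta_gl[OF g]
    by (rule rcon_mult_left[OF H_alg H_alg ec_functional gc gc Delta_closed[OF h]])
  also have "rcon H (\<lambda>b. ec k (gl g \<otimes>\<^bsub>H\<^esub> b)) (\<Delta> h) = dc (inv\<^bsub>G\<^esub> g \<otimes>\<^bsub>G\<^esub> k) h"
    unfolding dc_def
    by (rule rcon_cong[OF mH mH lin_comp[OF left_mult_linear[OF H_alg gc] ec_functional] ec_functional
          ec_mult_left[OF g k] Delta_closed[OF h]])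
  finally show ?thesis .
qed

lemma dc_mult_right:
  assumes g: "g \<in> carrier G" and k: "k \<in> carrier G" and h: "h \<in> carrier H"
  shows "dc k (h \<otimes>\<^bsub>H\<^esub> gl g) = dc (k \<otimes>\<^bsub>G\<^esub> inv\<^bsub>G\<^esub> g) h \<otimes>\<^bsub>H\<^esub> gl g"
proof -
  note gc = gl_closed[OF g]
  have "dc k (h \<otimes>\<^bsub>H\<^esub> gl g) = rcon H (\<lambda>b. ec k (b \<otimes>\<^bsub>H\<^esub> gl g)) (\<Delta> h) \<otimes>\<^bsub>H\<^esub> gl g"
    unfolding dc_def Delta_mult[OF h gc] Delta_gl[OF g]
    by (rule rcon_mult_right[OF H_alg H_alg ec_functional gc gc Delta_closed[OF h]])
  also have "rcon H (\<lambda>b. ec k (b \<otimes>\<^bsub>H\<^esub> gl g)) (\<Delta> h) = dc (k \<otimes>\<^bsub>G\<^esub> inv\<^bsub>G\<^esub> g) h"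
    unfolding dc_def
    by (rule rcon_cong[OF mH mH lin_comp[OF right_mult_linear[OF H_alg gc] ec_functional] ec_functional
          ec_mult_right[OF g k] Delta_closed[OF h]])
  finally show ?thesis .
qed

lemma dc_gl: "g \<in> carrier G \<Longrightarrow> dc k (gl g) = (if k = g then gl g else \<zero>\<^bsub>H\<^esub>)"
  unfolding dc_def Delta_gl
  by (simp add: rcon_ptensor[OF mH mH ec_functional gl_closed gl_closed] ec_gl gl_closed mH)

lemma one_C: "\<one>\<^bsub>H\<^esub> \<in> C"
  unfolding C_iff gl_one[symmetric] using gl_closed dc_gl G_simps(1) by simp

text \<open>Multiplying by g on the left and by its inverse on the right moves the component in
  degree k to the one in degree g^-1 k g, and this element is neutral exactly when k is. It is the
  action of \<open>H(0)\<close> that enters the smash multiplication.\<close>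

lemma conj_C:
  assumes g: "g \<in> carrier G" and r: "r \<in> C"
  shows "gl g \<otimes>\<^bsub>H\<^esub> r \<otimes>\<^bsub>H\<^esub> gl (inv\<^bsub>G\<^esub> g) \<in> C"
  unfolding C_iff
proof (intro conjI ballI)
  note rc = C_closed[OF r] and gc = gl_closed[OF g] and gi = G_simps(2)[OF g]
  note grc = H_closed[OF gc rc]
  show "gl g \<otimes>\<^bsub>H\<^esub> r \<otimes>\<^bsub>H\<^esub> gl (inv\<^bsub>G\<^esub> g) \<in> carrier H" by (rule H_closed[OF grc gl_closed[OF gi]])
  fix k assume k: "k \<in> carrier G"
  have kg: "k \<otimes>\<^bsub>G\<^esub> g \<in> carrier G" "inv\<^bsub>G\<^esub> g \<otimes>\<^bsub>G\<^esub> (k \<otimes>\<^bsub>G\<^esub> g) \<in> carrier G" using g k by (simp_all add: G_simps)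
  have "inv\<^bsub>G\<^esub> g \<otimes>\<^bsub>G\<^esub> (k \<otimes>\<^bsub>G\<^esub> g) = \<one>\<^bsub>G\<^esub> \<longleftrightarrow> k \<otimes>\<^bsub>G\<^esub> g = g \<otimes>\<^bsub>G\<^esub> \<one>\<^bsub>G\<^esub>"
    using G_shift(1)[OF g G_simps(1) kg(1)] by simp
  also have "\<dots> \<longleftrightarrow> k \<otimes>\<^bsub>G\<^esub> g = \<one>\<^bsub>G\<^esub> \<otimes>\<^bsub>G\<^esub> g" using g by (simp add: G_simps)
  also have "\<dots> \<longleftrightarrow> k = \<one>\<^bsub>G\<^esub>" using G_shift(2)[OF g G_simps(1) kg(1)] g k by (simp add: G_simps)
  finally have iff: "inv\<^bsub>G\<^esub> g \<otimes>\<^bsub>G\<^esub> (k \<otimes>\<^bsub>G\<^esub> g) = \<one>\<^bsub>G\<^esub> \<longleftrightarrow> k = \<one>\<^bsub>G\<^esub>" .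
  have "dc k (gl g \<otimes>\<^bsub>H\<^esub> r \<otimes>\<^bsub>H\<^esub> gl (inv\<^bsub>G\<^esub> g)) =
      gl g \<otimes>\<^bsub>H\<^esub> dc (inv\<^bsub>G\<^esub> g \<otimes>\<^bsub>G\<^esub> (k \<otimes>\<^bsub>G\<^esub> g)) r \<otimes>\<^bsub>H\<^esub> gl (inv\<^bsub>G\<^esub> g)"
    unfolding dc_mult_right[OF gi k grc] G_simps(10)[OF g] dc_mult_left[OF g kg(1) rc] by (rule refl)
  also have "dc (inv\<^bsub>G\<^esub> g \<otimes>\<^bsub>G\<^esub> (k \<otimes>\<^bsub>G\<^esub> g)) r = (if k = \<one>\<^bsub>G\<^esub> then r else \<zero>\<^bsub>H\<^esub>)"
    using r kg(2) iff by (simp add: C_iff)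
  finally show "dc k (gl g \<otimes>\<^bsub>H\<^esub> r \<otimes>\<^bsub>H\<^esub> gl (inv\<^bsub>G\<^esub> g)) =
      (if k = \<one>\<^bsub>G\<^esub> then gl g \<otimes>\<^bsub>H\<^esub> r \<otimes>\<^bsub>H\<^esub> gl (inv\<^bsub>G\<^esub> g) else \<zero>\<^bsub>H\<^esub>)"
    using alg_zero_left[OF H_alg gl_closed[OF gi]] alg_zero_right[OF H_alg gc] by simp
qed

text \<open>The element \<open>gl g\<close> is nonzero, its counit being 1, and it sits entirely in
  right degree g, while coinvariants sit in the neutral degree.\<close>

lemma smult_gl_C:
  assumes c: "c \<in> carrier R" "c \<noteq> \<zero>" and g: "g \<in> carrier G" and cg: "c \<odot>\<^bsub>H\<^esub> gl g \<in> C"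
  shows "g = \<one>\<^bsub>G\<^esub>"
proof (rule ccontr)
  assume "g \<noteq> \<one>\<^bsub>G\<^esub>"
  then have "dc g (c \<odot>\<^bsub>H\<^esub> gl g) = \<zero>\<^bsub>H\<^esub>" using cg g by (simp add: C_iff)
  then have "c \<odot>\<^bsub>H\<^esub> gl g = \<zero>\<^bsub>H\<^esub>" using lin_smult[OF dc_linear c(1) gl_closed[OF g]] dc_gl[OF g] by simp
  then have "gl g = \<zero>\<^bsub>H\<^esub>" by (rule mod_smult_eq_zeroD[OF mH c gl_closed[OF g]])
  then show False using eps_gl[OF g] functional_zero[OF mH eps_functional] by simp
qed

text \<open>The operators \<open>dc k\<close> act through the second factor of the coproduct, so by
  coassociativity they commute with contraction of the first factor; the contractions of a
  coinvariant are therefore coinvariant.\<close>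

lemma Delta_C: assumes r: "r \<in> C" shows "\<Delta> r \<in> tensor_sub R H H (carrier H) C"
proof (rule tensor_sub_if_lcon[OF mH mH C_submodule Delta_closed[OF C_closed[OF r]]])
  fix f assume f: "functional H f"
  note rc = C_closed[OF r]
  note D = Delta_closed[OF rc]
  note fD = lin_comp[OF Delta_linear lcon_linear[OF mH mH f]]
  have dl: "dc k (lcon H f (\<Delta> r)) = lcon H f (\<Delta> (dc k r))" for k
    unfolding dc_def Delta_coassoc[OF rc f]
    by (rule rcon_tmap[OF mH mH mH mH fD lin_id ec_functional D])
  show "lcon H f (\<Delta> r) \<in> C"
    unfolding C_iff dl using r lcon_closed[OF mH mH f D] lin_zero[OF mH mH fD] by (simp add: C_iff)
qed

end

section \<open>Subcomodules through functionals, and contractions of products\<close>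

context field begin

text \<open>Contractions detect the subspace \<open>H\<close> \<otimes> \<open>M\<close>.
  Subcomodules thereby become the subspaces stable under the functionals on \<open>H\<close>, a
  condition free of tensors.\<close>

lemma subcomodule_iff:
  assumes H: "module R H" and L: "module R L"
    and \<rho>: "\<And>l. l \<in> carrier L \<Longrightarrow> coact L l \<in> carrier (tensor R H L)"
  shows "subcomodule R H L M \<longleftrightarrow> submodule M R L \<and> (\<forall>x\<in>M. \<forall>f. functional H f \<longrightarrow> lcon L f (coact L x) \<in> M)"
proof (cases "submodule M R L")
  case True
  have "coact L x \<in> tensor_sub R H L (carrier H) M \<longleftrightarrow> (\<forall>f. functional H f \<longrightarrow> lcon L f (coact L x) \<in> M)"
    if "x \<in> M" for x
    using lcon_tensor_sub[OF H L True] tensor_sub_if_lcon[OF H L True \<rho>[OF submoduleD(1)[OF True that]]] by metis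
  then show ?thesis using True by (simp add: subcomodule_def)
qed (simp add: subcomodule_def)

text \<open>A product formula for a functional on \<open>B\<close> lifts to its contraction on
  \<open>A\<close> \<otimes> \<open>B\<close>; both sides are bilinear, so pure tensors decide. It
  is applied to \<open>ec k\<close> for products of coinvariants and to the coordinate functionals
  of \<open>L(0)\<close> for the multiplicativity of the embedding.\<close>

lemma rcon_mult_sum:
  assumes A: "assoc_algebra R A" and B: "assoc_algebra R B" and S: "finite S"
    and \<phi>: "functional B \<phi>" and \<phi>1: "\<And>g. g \<in> S \<Longrightarrow> functional B (\<phi>1 g)"
    and \<phi>2: "\<And>g. g \<in> S \<Longrightarrow> functional B (\<phi>2 g)"
    and mult: "\<And>b d. b \<in> carrier B \<Longrightarrow> d \<in> carrier B \<Longrightarrow>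
      \<phi> (b \<otimes>\<^bsub>B\<^esub> d) = finsum (ground_algebra R) (\<lambda>g. \<phi>1 g b \<otimes> \<phi>2 g d) S"
    and s: "s \<in> carrier (tensor R A B)" and t: "t \<in> carrier (tensor R A B)"
  shows "rcon A \<phi> (s \<otimes>\<^bsub>tensor R A B\<^esub> t) = finsum A (\<lambda>g. rcon A (\<phi>1 g) s \<otimes>\<^bsub>A\<^esub> rcon A (\<phi>2 g) t) S"
proof -
  let ?T = "tensor R A B"
  note mA = alg_module[OF A] and mB = alg_module[OF B]
  note rl = rcon_linear[OF mA mB] and rp = rcon_ptensor[OF mA mB]
  note tb = tensor_mult_bilin[OF A B]
  have smult_sum: "c \<odot>\<^bsub>A\<^esub> a = finsum A (\<lambda>g. u g \<odot>\<^bsub>A\<^esub> a) S"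
    if "c = finsum (ground_algebra R) u S" "\<And>g. g \<in> S \<Longrightarrow> u g \<in> carrier R" "a \<in> carrier A" for c u a
  proof -
    have "linear_map R (ground_algebra R) A (\<lambda>c. c \<odot>\<^bsub>A\<^esub> a)"
      by (rule functional_smult_linear[OF mA lin_id that(3)])
    from lin_finsum[OF ground_module mA this, of S u] show ?thesis
      unfolding that(1) using that(2) unfolding ground_simps by blast
  qed
  have pure: "rcon A \<phi> (ptensor R A B a b \<otimes>\<^bsub>?T\<^esub> t) =
      finsum A (\<lambda>g. rcon A (\<phi>1 g) (ptensor R A B a b) \<otimes>\<^bsub>A\<^esub> rcon A (\<phi>2 g) t) S"
    if a: "a \<in> carrier A" and b: "b \<in> carrier B" for a b
  proof (rule linear_eq_on_tensor[OF mA mB mA _ _ _ t])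
    note pc = ptensor_closed[OF mA mB a b]
    show "linear_map R ?T A (\<lambda>t. rcon A \<phi> (ptensor R A B a b \<otimes>\<^bsub>?T\<^esub> t))"
      by (rule lin_comp[OF bilinD(1)[OF tb pc] rl[OF \<phi>]])
    show "linear_map R ?T A (\<lambda>t. finsum A (\<lambda>g. rcon A (\<phi>1 g) (ptensor R A B a b) \<otimes>\<^bsub>A\<^esub> rcon A (\<phi>2 g) t) S)"
      by (rule lin_finsum_map[OF mA S], rule lin_comp[OF rl[OF \<phi>2] left_mult_linear[OF A rcon_closed[OF mA mB \<phi>1 pc]]])
    fix c d assume c: "c \<in> carrier A" and d: "d \<in> carrier B"
    have cl: "\<phi>1 g b \<in> carrier R" "\<phi>2 g d \<in> carrier R" if "g \<in> S" for g
      using functional_closed[OF \<phi>1[OF that] b] functional_closed[OF \<phi>2[OF that] d] by auto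
    have "rcon A \<phi> (ptensor R A B a b \<otimes>\<^bsub>?T\<^esub> ptensor R A B c d) = \<phi> (b \<otimes>\<^bsub>B\<^esub> d) \<odot>\<^bsub>A\<^esub> (a \<otimes>\<^bsub>A\<^esub> c)"
      unfolding tensor_mult_ptensor[OF A B a b c d]
      by (rule rp[OF \<phi> alg_closed[OF A a c] alg_closed[OF B b d]])
    also have "\<dots> = finsum A (\<lambda>g. (\<phi>1 g b \<otimes> \<phi>2 g d) \<odot>\<^bsub>A\<^esub> (a \<otimes>\<^bsub>A\<^esub> c)) S"
      by (rule smult_sum[OF mult[OF b d] _ alg_closed[OF A a c]]) (simp add: cl)
    also have "\<dots> = finsum A (\<lambda>g. rcon A (\<phi>1 g) (ptensor R A B a b) \<otimes>\<^bsub>A\<^esub> rcon A (\<phi>2 g) (ptensor R A B c d)) S"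
    proof (rule mod_finsum_cong[OF mA])
      fix g assume g: "g \<in> S"
      show "rcon A (\<phi>1 g) (ptensor R A B a b) \<otimes>\<^bsub>A\<^esub> rcon A (\<phi>2 g) (ptensor R A B c d) \<in> carrier A"
        by (rule alg_closed[OF A rcon_closed[OF mA mB \<phi>1[OF g] pc] rcon_closed[OF mA mB \<phi>2[OF g] ptensor_closed[OF mA mB c d]]])
      show "(\<phi>1 g b \<otimes> \<phi>2 g d) \<odot>\<^bsub>A\<^esub> (a \<otimes>\<^bsub>A\<^esub> c) = rcon A (\<phi>1 g) (ptensor R A B a b) \<otimes>\<^bsub>A\<^esub> rcon A (\<phi>2 g) (ptensor R A B c d)"
        unfolding rp[OF \<phi>1[OF g] a b] rp[OF \<phi>2[OF g] c d]
        using cl[OF g] a c mod_smult[OF mA]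
          mod_smult_lcomm[OF mA cl(1)[OF g] cl(2)[OF g] alg_closed[OF A a c]]
        by (simp add: alg_smult_left[OF A] alg_smult_right[OF A] mod_smult_smult[OF mA] alg_closed[OF A])
    qed
    finally show "rcon A \<phi> (ptensor R A B a b \<otimes>\<^bsub>?T\<^esub> ptensor R A B c d) =
        finsum A (\<lambda>g. rcon A (\<phi>1 g) (ptensor R A B a b) \<otimes>\<^bsub>A\<^esub> rcon A (\<phi>2 g) (ptensor R A B c d)) S" .
  qed
  show ?thesis
  proof (rule linear_eq_on_tensor[OF mA mB mA _ _ _ s])
    show "linear_map R ?T A (\<lambda>s. rcon A \<phi> (s \<otimes>\<^bsub>?T\<^esub> t))"
      by (rule lin_comp[OF bilinD(2)[OF tb t] rl[OF \<phi>]])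
    show "rcon A \<phi> (ptensor R A B a b \<otimes>\<^bsub>?T\<^esub> t) =
        finsum A (\<lambda>g. rcon A (\<phi>1 g) (ptensor R A B a b) \<otimes>\<^bsub>A\<^esub> rcon A (\<phi>2 g) t) S"
      if "a \<in> carrier A" "b \<in> carrier B" for a b by (rule pure[OF that])
    show "linear_map R ?T A (\<lambda>s. finsum A (\<lambda>g. rcon A (\<phi>1 g) s \<otimes>\<^bsub>A\<^esub> rcon A (\<phi>2 g) t) S)"
      by (rule lin_finsum_map[OF mA S], rule lin_comp[OF rl[OF \<phi>1] right_mult_linear[OF A rcon_closed[OF mA mB \<phi>2 t]]])
  qed
qed

text \<open>Evaluations at the points of \<open>X\<close> separate \<open>E\<close>; outside
  \<open>X\<close> every element of \<open>E\<close> vanishes, so nothing has to be compared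
  there.\<close>

lemma tensor_free_eqI:
  assumes A: "module R A" and E: "module R E" and EX: "carrier E = carrier (free_module R X)"
    and ev: "\<And>k. functional E (\<lambda>x. x k)"
    and s: "s \<in> carrier (tensor R A E)" and t: "t \<in> carrier (tensor R A E)"
    and eq: "\<And>k. k \<in> X \<Longrightarrow> rcon A (\<lambda>x. x k) s = rcon A (\<lambda>x. x k) t"
  shows "s = t"
proof (rule tensor_eqI[OF A E s t])
  fix f assume f: "functional A f"
  show "lcon E f s = lcon E f t"
  proof
    fix k show "lcon E f s k = lcon E f t k"
    proof (cases "k \<in> X")
      case True
      then show ?thesis using lcon_rcon[OF A E f ev s, of k] lcon_rcon[OF A E f ev t, of k] eq[OF True] by simp
    next
      case False
      then show ?thesis
        using lcon_closed[OF A E f s] lcon_closed[OF A E f t] unfolding EX free_carrier by simp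
    qed
  qed
qed

end

context graded_hopf begin

text \<open>The positive degrees form an ideal, so only degree zero parts contribute, and there the
  formula is the coefficient of \<open>k\<close> in a product of two elements of the group
  algebra.\<close>

lemma ec_mult:
  assumes k: "k \<in> carrier G" and x: "x \<in> carrier H" and y: "y \<in> carrier H"
  shows "ec k (x \<otimes>\<^bsub>H\<^esub> y) =
    finsum (ground_algebra R) (\<lambda>g. ec g x \<otimes> ec (inv\<^bsub>G\<^esub> g \<otimes>\<^bsub>G\<^esub> k) y) (carrier G)"
proof (rule linear_eq_on_H[OF ground_module lin_comp[OF right_mult_linear[OF H_alg y] ec_functional] _ _ _ _ x])
  show "functional H (\<lambda>x. finsum (ground_algebra R) (\<lambda>g. ec g x \<otimes> ec (inv\<^bsub>G\<^esub> g \<otimes>\<^bsub>G\<^esub> k) y) (carrier G))"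
    using functional_smult_linear[OF ground_module ec_functional, of "ec (inv\<^bsub>G\<^esub> _ \<otimes>\<^bsub>G\<^esub> k) y"] ec_closed[OF y]
    by (intro lin_finsum_map[OF ground_module finite_G]) simp
  fix n u assume n: "n \<noteq> 0" and u: "u \<in> grH n"
  note uc = gr_closed[OF mH grad_H u]
  have "ec k (u \<otimes>\<^bsub>H\<^esub> y) = \<zero>\<^bsub>ground_algebra R\<^esub>"
  proof (rule linear_eq_on_graded[OF mH grad_H ground_module lin_comp[OF left_mult_linear[OF H_alg uc] ec_functional]
        lin_zero_map[OF ground_module] _ y])
    fix m v assume "v \<in> grH m"
    from gr_mult[OF u this] show "ec k (u \<otimes>\<^bsub>H\<^esub> v) = \<zero>\<^bsub>ground_algebra R\<^esub>"
      using ec_positive[of "n + m" "u \<otimes>\<^bsub>H\<^esub> v" k] n by simp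
  qed
  then show "ec k (u \<otimes>\<^bsub>H\<^esub> y) = \<zero>\<^bsub>ground_algebra R\<^esub>" .
  show "finsum (ground_algebra R) (\<lambda>g. ec g u \<otimes> ec (inv\<^bsub>G\<^esub> g \<otimes>\<^bsub>G\<^esub> k) y) (carrier G) = \<zero>\<^bsub>ground_algebra R\<^esub>"
    by (rule mod_finsum_zero[OF ground_module]) (simp add: ec_positive[OF n u] ec_closed[OF y])
next
  fix h assume h: "h \<in> carrier G"
  show "ec k (gl h \<otimes>\<^bsub>H\<^esub> y) =
      finsum (ground_algebra R) (\<lambda>g. ec g (gl h) \<otimes> ec (inv\<^bsub>G\<^esub> g \<otimes>\<^bsub>G\<^esub> k) y) (carrier G)"
    unfolding ec_mult_left[OF h k y]
    by (rule mod_finsum_single[OF ground_module finite_G h, symmetric]) (simp_all add: ec_gl[OF h] ec_closed[OF y])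
qed

lemma C_mult:
  assumes a: "a \<in> C" and b: "b \<in> C"
  shows "a \<otimes>\<^bsub>H\<^esub> b \<in> C"
  unfolding C_iff
proof (intro conjI ballI)
  note ac = C_closed[OF a] and bc = C_closed[OF b]
  show "a \<otimes>\<^bsub>H\<^esub> b \<in> carrier H" by (rule H_closed[OF ac bc])
  fix k assume k: "k \<in> carrier G"
  have cl: "inv\<^bsub>G\<^esub> g \<otimes>\<^bsub>G\<^esub> k \<in> carrier G" if "g \<in> carrier G" for g using that k by (simp add: G_simps)
  have "dc k (a \<otimes>\<^bsub>H\<^esub> b) = finsum H (\<lambda>g. dc g a \<otimes>\<^bsub>H\<^esub> dc (inv\<^bsub>G\<^esub> g \<otimes>\<^bsub>G\<^esub> k) b) (carrier G)"
    unfolding dc_def Delta_mult[OF ac bc]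
    by (rule rcon_mult_sum[OF H_alg H_alg finite_G ec_functional ec_functional ec_functional ec_mult[OF k]
          Delta_closed[OF ac] Delta_closed[OF bc]])
  also have "\<dots> = (if k = \<one>\<^bsub>G\<^esub> then a \<otimes>\<^bsub>H\<^esub> b else \<zero>\<^bsub>H\<^esub>)"
  \<comment> \<open>Coinvariance of \<open>a\<close> kills every summand except the one at the
    neutral element.\<close>
  proof (rule mod_finsum_single[OF mH finite_G G_simps(1)])
    show "(if k = \<one>\<^bsub>G\<^esub> then a \<otimes>\<^bsub>H\<^esub> b else \<zero>\<^bsub>H\<^esub>) \<in> carrier H" using H_closed[OF ac bc] mH by simp
    show "dc \<one>\<^bsub>G\<^esub> a \<otimes>\<^bsub>H\<^esub> dc (inv\<^bsub>G\<^esub> \<one>\<^bsub>G\<^esub> \<otimes>\<^bsub>G\<^esub> k) b = (if k = \<one>\<^bsub>G\<^esub> then a \<otimes>\<^bsub>H\<^esub> b else \<zero>\<^bsub>H\<^esub>)"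
      using a b k alg_zero_right[OF H_alg ac] by (simp add: C_iff G_simps)
    show "dc g a \<otimes>\<^bsub>H\<^esub> dc (inv\<^bsub>G\<^esub> g \<otimes>\<^bsub>G\<^esub> k) b = \<zero>\<^bsub>H\<^esub>" if "g \<in> carrier G" "g \<noteq> \<one>\<^bsub>G\<^esub>" for g
      using a that alg_zero_left[OF H_alg dc_closed[OF bc]] by (simp add: C_iff)
  qed
  finally show "dc k (a \<otimes>\<^bsub>H\<^esub> b) = (if k = \<one>\<^bsub>G\<^esub> then a \<otimes>\<^bsub>H\<^esub> b else \<zero>\<^bsub>H\<^esub>)" .
qed

end

section \<open>Graded comodule algebras\<close>

locale graded_comod = graded_hopf R H grH G \<iota>
  for R :: "('a, 'b) ring_scheme" (structure) and H :: "('a, 'h) hopf" and grH :: "nat \<Rightarrow> 'h set"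
    and G :: "('g, 's) monoid_scheme" and \<iota> :: "('g \<Rightarrow> 'a) \<Rightarrow> 'h" +
  fixes L :: "('a, 'h, 'l) comod_alg" and grL :: "nat \<Rightarrow> 'l set"
  assumes comod: "graded_comodule_algebra R H grH L grL"
begin

abbreviation "\<rho> \<equiv> coact L"
abbreviation "H_L \<equiv> tensor R H L"

lemma L_comod: "comodule_algebra R H L" using comod by (simp add: graded_comodule_algebra_def)
lemma L_alg: "assoc_algebra R L" using L_comod by (simp add: comodule_algebra_def)
lemmas mL = alg_module[OF L_alg]
lemmas L_closed = alg_closed[OF L_alg]
lemmas L_one = alg_one[OF L_alg]
lemma grad_L: "grading R L grL" using comod by (simp add: graded_comodule_algebra_def)
lemma grL_one: "\<one>\<^bsub>L\<^esub> \<in> grL 0" using comod by (simp add: graded_comodule_algebra_def)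
lemma grL_mult: "x \<in> grL i \<Longrightarrow> y \<in> grL j \<Longrightarrow> x \<otimes>\<^bsub>L\<^esub> y \<in> grL (i + j)"
  using comod by (simp add: graded_comodule_algebra_def)
lemma rho_graded: "x \<in> grL n \<Longrightarrow> \<rho> x \<in> tensor_grading R H grH L grL n"
  using comod by (simp add: graded_comodule_algebra_def)
lemma rho_hom: "alg_hom R L H_L \<rho>" using L_comod by (simp add: comodule_algebra_def)
lemma rho_linear: "linear_map R L H_L \<rho>" using rho_hom by (simp add: alg_hom_def)
lemmas rho_closed = lin_closed[OF rho_linear]
lemma rho_mult: "x \<in> carrier L \<Longrightarrow> y \<in> carrier L \<Longrightarrow> \<rho> (x \<otimes>\<^bsub>L\<^esub> y) = \<rho> x \<otimes>\<^bsub>H_L\<^esub> \<rho> y"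
  using rho_hom by (simp add: alg_hom_def ring_hom_def)
lemma rho_one: "\<rho> \<one>\<^bsub>L\<^esub> = ptensor R H L \<one>\<^bsub>H\<^esub> \<one>\<^bsub>L\<^esub>"
  using rho_hom by (simp add: alg_hom_def ring_hom_def tensor_one)

lemma rho_coassoc:
  assumes l: "l \<in> carrier L" and f: "functional H f"
  shows "\<rho> (lcon L f (\<rho> l)) = tmap H L (\<lambda>x. lcon H f (\<Delta> x)) (\<lambda>m. m) (\<rho> l)"
  by (rule coassoc_contraction[OF mH mL Delta_linear rho_linear l f])
    (use L_comod l in \<open>simp add: comodule_algebra_def Let_def\<close>)

text \<open>The comodule \<open>L\<close> seen as a module over the functionals on \<open>H\<close>;
  applying \<open>f\<close> and then \<open>g\<close> is the action of the convolution of
  \<open>f\<close> with \<open>g\<close>, in this order.\<close>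

definition "act f l = lcon L f (\<rho> l)"

lemma act_linear: "functional H f \<Longrightarrow> linear_map R L L (act f)"
  unfolding act_def[abs_def] by (rule lin_comp[OF rho_linear lcon_linear[OF mH mL]])

lemmas act_closed = lin_closed[OF act_linear]

lemma act_eps: "l \<in> carrier L \<Longrightarrow> act \<epsilon> l = l"
  using L_comod by (simp add: comodule_algebra_def act_def lcon_def)

lemma conv_functional:
  "functional H f \<Longrightarrow> functional H g \<Longrightarrow> functional H (\<lambda>x. g (lcon H f (\<Delta> x)))"
  by (rule lin_comp[OF Delta_linear lin_comp[OF lcon_linear[OF mH mH]]])

lemma act_act:
  assumes l: "l \<in> carrier L" and f: "functional H f" and g: "functional H g"
  shows "act g (act f l) = act (\<lambda>x. g (lcon H f (\<Delta> x))) l"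
  unfolding act_def rho_coassoc[OF l f]
  by (rule lcon_tmap[OF mH mL mH mL lin_comp[OF Delta_linear lcon_linear[OF mH mH f]] lin_id g rho_closed[OF l]])

lemma act_cong:
  "functional H f \<Longrightarrow> functional H g \<Longrightarrow> (\<And>x. x \<in> carrier H \<Longrightarrow> f x = g x) \<Longrightarrow> l \<in> carrier L \<Longrightarrow> act f l = act g l"
  unfolding act_def by (rule lcon_cong[OF mH mL _ _ _ rho_closed])

lemma subcomodule_L:
  "subcomodule R H L M \<longleftrightarrow> submodule M R L \<and> (\<forall>x\<in>M. \<forall>f. functional H f \<longrightarrow> act f x \<in> M)"
  unfolding act_def by (rule subcomodule_iff[OF mH mL rho_closed])

text \<open>Inherited from the convolution of the \<open>ec k\<close>. Together with
  \<open>act_ec_sum\<close> it is the decomposition of \<open>L\<close> under the group algebra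
  coaction obtained by projecting the left factor to \<open>H(0)\<close>.\<close>

lemma act_ec_ec:
  assumes g: "g \<in> carrier G" and k: "k \<in> carrier G" and l: "l \<in> carrier L"
  shows "act (ec k) (act (ec g) l) = (if g = k then act (ec k) l else \<zero>\<^bsub>L\<^esub>)"
proof -
  have z: "functional H (\<lambda>x. \<zero>)" using lin_zero_map[OF ground_module, of H] by simp
  have "act (\<lambda>x. \<zero>) l = \<zero>\<^bsub>L\<^esub>"
    unfolding act_def
    by (rule linear_eq_on_tensor[OF mH mL mL lcon_linear[OF mH mL z] lin_zero_map[OF mL] _ rho_closed[OF l]])
      (simp add: lcon_ptensor[OF mH mL z] mL)
  then show ?thesis
    unfolding act_act[OF l ec_functional ec_functional]
    using act_cong[OF conv_functional[OF ec_functional ec_functional] ec_functional _ l, of k g k]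
      act_cong[OF conv_functional[OF ec_functional ec_functional] z _ l, of k g] ec_convolution[OF g k]
    by (cases "g = k") simp_all
qed

lemma act_ec_sum:
  assumes l: "l \<in> carrier L"
  shows "finsum L (\<lambda>k. act (ec k) l) (carrier G) = l"
proof -
  have "finsum L (\<lambda>k. lcon L (ec k) t) (carrier G) = lcon L \<epsilon> t" if "t \<in> carrier H_L" for t
  proof (rule linear_eq_on_tensor[OF mH mL mL lin_finsum_map[OF mL finite_G lcon_linear[OF mH mL ec_functional]]
        lcon_linear[OF mH mL eps_functional] _ that])
    show "finsum L (\<lambda>k. lcon L (ec k) (ptensor R H L a b)) (carrier G) = lcon L \<epsilon> (ptensor R H L a b)"
      if a: "a \<in> carrier H" and b: "b \<in> carrier L" for a b
      unfolding lcon_ptensor[OF mH mL ec_functional a b] lcon_ptensor[OF mH mL eps_functional a b]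
      by (rule ec_sum[OF mL b a])
  qed
  from this[OF rho_closed[OF l]] show ?thesis using act_eps[OF l] by (simp add: act_def)
qed

text \<open>Of the tensors of total degree \<open>m + n\<close> only those with left degree
  \<open>m\<close> survive \<open>f\<close>, and their right factor has degree
  \<open>n\<close>.\<close>

lemma act_graded:
  assumes f: "functional H f" and fz: "\<And>n u. n \<noteq> m \<Longrightarrow> u \<in> grH n \<Longrightarrow> f u = \<zero>" and l: "l \<in> grL (m + n)"
  shows "act f l \<in> grL n"
  unfolding act_def
proof (rule tensor_grading_in_submodule(2)[OF mH mL grad_H grad_L mL lcon_linear[OF mH mL f]
      gr_submodule[OF mL grad_L] _ rho_graded[OF l]])
  fix i j a b assume ij: "i + j = m + n" and a: "a \<in> grH i" and b: "b \<in> grL j"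
  note ac = gr_closed[OF mH grad_H a] and bc = gr_closed[OF mL grad_L b]
  show "lcon L f (ptensor R H L a b) \<in> grL n"
    unfolding lcon_ptensor[OF mH mL f ac bc]
    using ij fz[OF _ a] b submoduleD(2)[OF gr_submodule[OF mL grad_L]] mL bc
      submoduleD(4)[OF gr_submodule[OF mL grad_L] functional_closed[OF f ac] b]
    by (cases "i = m") simp_all
qed

text \<open>A left factor of degree \<open>m\<close> cannot occur in total degree below
  \<open>m\<close>. This discards all components under the top degree when \<open>m\<close> is the
  top degree of an element.\<close>

lemma act_low_degree:
  assumes f: "functional H f" and fz: "\<And>n u. n \<noteq> m \<Longrightarrow> u \<in> grH n \<Longrightarrow> f u = \<zero>" and l: "l \<in> grL n" and n: "n < m"
  shows "act f l = \<zero>\<^bsub>L\<^esub>"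
proof -
  have "act f l \<in> {\<zero>\<^bsub>L\<^esub>}"
    unfolding act_def
  proof (rule tensor_grading_in_submodule(2)[OF mH mL grad_H grad_L mL lcon_linear[OF mH mL f]
        submodule_zero[OF mL] _ rho_graded[OF l]])
    fix i j a b assume ij: "i + j = n" and a: "a \<in> grH i" and b: "b \<in> grL j"
    note ac = gr_closed[OF mH grad_H a] and bc = gr_closed[OF mL grad_L b]
    show "lcon L f (ptensor R H L a b) \<in> {\<zero>\<^bsub>L\<^esub>}"
      unfolding lcon_ptensor[OF mH mL f ac bc] using ij n fz[OF _ a] mL bc by simp
  qed
  then show ?thesis by simp
qed

lemma act_ec_graded: "l \<in> grL n \<Longrightarrow> act (ec k) l \<in> grL n"
  using act_graded[OF ec_functional, of 0 k l n] ec_positive by simp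

lemma act_ec_component:
  assumes l: "l \<in> carrier L"
  shows "act (ec k) (component L grL n l) = component L grL n (act (ec k) l)"
proof (rule linear_eq_on_graded[OF mL grad_L mL lin_comp[OF component_linear[OF mL grad_L] act_linear[OF ec_functional]]
      lin_comp[OF act_linear[OF ec_functional] component_linear[OF mL grad_L]] _ l])
  fix m u assume u: "u \<in> grL m"
  show "act (ec k) (component L grL n u) = component L grL n (act (ec k) u)"
    using component_homogeneous[OF mL grad_L u, of n] component_homogeneous[OF mL grad_L act_ec_graded[OF u], of n]
      lin_zero[OF mL mL act_linear[OF ec_functional]] by simp
qed

text \<open>This refers to the full coaction of \<open>H\<close>, not to its projection to
  \<open>H(0)\<close>. It is stronger than being fixed by the weight projection of \<open>k\<close>,
  and on \<open>L(0)\<close> the two agree.\<close>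

definition "gdeg k x \<longleftrightarrow> x \<in> carrier L \<and> \<rho> x = ptensor R H L (gl k) x"

lemma gdeg_closed: "gdeg k x \<Longrightarrow> x \<in> carrier L"
  by (simp add: gdeg_def)

lemma gdeg_act: "gdeg k x \<Longrightarrow> k \<in> carrier G \<Longrightarrow> functional H f \<Longrightarrow> act f x = f (gl k) \<odot>\<^bsub>L\<^esub> x"
  by (simp add: gdeg_def act_def lcon_ptensor[OF mH mL] gl_closed)

text \<open>In total degree zero the left factors lie in \<open>H(0)\<close>, where contraction by
  \<open>ec k\<close> returns a multiple of \<open>gl k\<close>. So \<open>ec k\<close> followed by
  any \<open>f\<close> is \<open>ec k\<close> times the number \<open>f (gl k)\<close>.\<close>

lemma gdeg_act_ec:
  assumes k: "k \<in> carrier G" and l: "l \<in> grL 0"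
  shows "gdeg k (act (ec k) l)"
proof -
  have lc: "l \<in> carrier L" by (rule gr_closed[OF mL grad_L l])
  have ac: "act (ec k) l \<in> carrier L" by (rule act_closed[OF ec_functional lc])
  have "\<rho> (act (ec k) l) = ptensor R H L (gl k) (act (ec k) l)"
  proof (rule tensor_eqI[OF mH mL rho_closed[OF ac] ptensor_closed[OF mH mL gl_closed[OF k] ac]])
    fix f assume f: "functional H f"
    note cf = conv_functional[OF ec_functional[of k] f]
    note fg = functional_closed[OF f gl_closed[OF k]]
    have "lcon L f (\<rho> (act (ec k) l)) = lcon L (\<lambda>x. f (lcon H (ec k) (\<Delta> x))) (\<rho> l)"
      using act_act[OF lc ec_functional f, of k] by (simp add: act_def)
    also have "\<dots> = f (gl k) \<odot>\<^bsub>L\<^esub> lcon L (ec k) (\<rho> l)"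
    proof (rule tensor_grading_linear_eq[OF mH mL grad_H grad_L mL lcon_linear[OF mH mL cf]
          lin_smult_const[OF mL lcon_linear[OF mH mL ec_functional] fg] _ rho_graded[OF l]])
      fix i j a b assume "i + j = (0::nat)" and a: "a \<in> grH i" and b: "b \<in> grL j"
      then have a0: "a \<in> grH 0" by simp
      note ac = gr_closed[OF mH grad_H a] and bc = gr_closed[OF mL grad_L b]
      show "lcon L (\<lambda>x. f (lcon H (ec k) (\<Delta> x))) (ptensor R H L a b) = f (gl k) \<odot>\<^bsub>L\<^esub> lcon L (ec k) (ptensor R H L a b)"
        unfolding lcon_ptensor[OF mH mL cf ac bc] lcon_ptensor[OF mH mL ec_functional ac bc]
          lcon_ec_degree_zero[OF k a0] functional_smult[OF f ec_closed[OF ac] gl_closed[OF k]]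
        using mod_smult_smult[OF mL fg ec_closed[OF ac] bc] m_comm[OF fg ec_closed[OF ac]] by simp
    qed
    also have "\<dots> = lcon L f (ptensor R H L (gl k) (act (ec k) l))"
      unfolding lcon_ptensor[OF mH mL f gl_closed[OF k] ac] by (simp add: act_def)
    finally show "lcon L f (\<rho> (act (ec k) l)) = lcon L f (ptensor R H L (gl k) (act (ec k) l))" .
  qed
  then show ?thesis using ac by (simp add: gdeg_def)
qed

lemma gdeg_mult:
  assumes g: "g \<in> carrier G" and h: "h \<in> carrier G" and x: "gdeg g x" and y: "gdeg h y"
  shows "gdeg (g \<otimes>\<^bsub>G\<^esub> h) (x \<otimes>\<^bsub>L\<^esub> y)"
proof -
  have xc: "x \<in> carrier L" "\<rho> x = ptensor R H L (gl g) x" and yc: "y \<in> carrier L" "\<rho> y = ptensor R H L (gl h) y"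
    using x y by (simp_all add: gdeg_def)
  show ?thesis unfolding gdeg_def
    using rho_mult[OF xc(1) yc(1)] tensor_mult_ptensor[OF H_alg L_alg gl_closed[OF g] xc(1) gl_closed[OF h] yc(1)]
      L_closed[OF xc(1) yc(1)] by (simp add: xc(2) yc(2) gl_mult[OF g h])
qed

lemma gdeg_smult: "gdeg k x \<Longrightarrow> k \<in> carrier G \<Longrightarrow> c \<in> carrier R \<Longrightarrow> gdeg k (c \<odot>\<^bsub>L\<^esub> x)"
  unfolding gdeg_def
  using lin_smult[OF rho_linear] lin_smult[OF ptensor_right_linear[OF mH mL gl_closed]] mod_smult[OF mL] by simp

lemma gdeg_one_iff: "gdeg \<one>\<^bsub>G\<^esub> x \<longleftrightarrow> x \<in> coinvariants R H L"
  by (simp add: gdeg_def coinvariants_def gl_one)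

lemma gdeg_one_one: "gdeg \<one>\<^bsub>G\<^esub> \<one>\<^bsub>L\<^esub>"
  unfolding gdeg_def using rho_one L_one by (simp add: gl_one)

text \<open>The coaction of \<open>x\<close> is the pure tensor \<open>gl g\<close> \<otimes>
  \<open>x\<close>, so \<open>f\<close> is merely shifted by \<open>gl g\<close> before it acts on
  \<open>y\<close>. This is why the right ideal generated by \<open>x\<close> is stable under
  functionals.\<close>

lemma act_gdeg_mult:
  assumes g: "g \<in> carrier G" and x: "gdeg g x" and y: "y \<in> carrier L" and f: "functional H f"
  shows "act f (x \<otimes>\<^bsub>L\<^esub> y) = x \<otimes>\<^bsub>L\<^esub> act (\<lambda>a. f (gl g \<otimes>\<^bsub>H\<^esub> a)) y"
proof -
  have xc: "x \<in> carrier L" "\<rho> x = ptensor R H L (gl g) x" using x by (simp_all add: gdeg_def)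
  show ?thesis unfolding act_def rho_mult[OF xc(1) y] xc(2)
    by (rule lcon_mult_left[OF H_alg L_alg f gl_closed[OF g] xc(1) rho_closed[OF y]])
qed

lemma act_ec_gdeg_mult:
  assumes g: "g \<in> carrier G" and k: "k \<in> carrier G" and x: "gdeg g x" and y: "y \<in> carrier L"
  shows "act (ec k) (x \<otimes>\<^bsub>L\<^esub> y) = x \<otimes>\<^bsub>L\<^esub> act (ec (inv\<^bsub>G\<^esub> g \<otimes>\<^bsub>G\<^esub> k)) y"
  unfolding act_gdeg_mult[OF g x y ec_functional]
  using act_cong[OF lin_comp[OF left_mult_linear[OF H_alg gl_closed[OF g]] ec_functional] ec_functional
      ec_mult_left[OF g k] y] by simp

end

context field begin

lemma free_in_submodule:
  assumes N: "submodule N R (free_module R X)" and gen: "\<And>x. x \<in> X \<Longrightarrow> basis_vec R x \<in> N"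
    and p: "p \<in> carrier (free_module R X)"
  shows "p \<in> N"
proof -
  let ?S = "{x. p x \<noteq> \<zero>}"
  have S: "finite ?S" "?S \<subseteq> X" using p unfolding free_carrier by blast+
  have "finsum (free_module R X) (\<lambda>x. p x \<odot>\<^bsub>free_module R X\<^esub> basis_vec R x) ?S \<in> N"
  proof (rule submodule_finsum[OF free_module_module N])
    fix x assume "x \<in> ?S"
    then have "x \<in> X" using S(2) by blast
    then show "p x \<odot>\<^bsub>free_module R X\<^esub> basis_vec R x \<in> N"
      by (intro submoduleD(4)[OF N free_closed[OF p]] gen)
  qed
  then show ?thesis using free_expand[OF p S] by simp
qed

lemma twisted_group_algebra_simps:
  "carrier (twisted_group_algebra R G F \<psi>) = carrier (free_module R F)"
  "add (twisted_group_algebra R G F \<psi>) = add (free_module R F)"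
  "zero (twisted_group_algebra R G F \<psi>) = zero (free_module R F)"
  "smult (twisted_group_algebra R G F \<psi>) = smult (free_module R F)"
  "one (twisted_group_algebra R G F \<psi>) = basis_vec R \<one>\<^bsub>G\<^esub>"
  "mult (twisted_group_algebra R G F \<psi>) = mult (twisted_alg R G F \<psi>)"
  "coact (twisted_group_algebra R G F \<psi>) = (\<lambda>x. lin_ext R (tensor R (group_algebra R G) (twisted_alg R G F \<psi>)) x
    (\<lambda>g. ptensor R (group_algebra R G) (twisted_alg R G F \<psi>) (basis_vec R g) (basis_vec R g)))"
  by (simp_all add: twisted_group_algebra_def Let_def module.defs comod_alg.defs twisted_simps)

lemma twisted_group_algebra_module: "module R (twisted_group_algebra R G F \<psi>)"
  by (rule module_cong_fields[OF free_module_module]) (simp_all add: twisted_group_algebra_simps)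

lemma linear_map_from_twisted_group_algebra:
  "linear_map R (twisted_group_algebra R G F \<psi>) W f \<longleftrightarrow> linear_map R (free_module R F) W f"
  by (simp add: linear_map_def twisted_group_algebra_simps)

lemma linear_map_from_twisted_alg:
  "linear_map R (twisted_alg R G F \<psi>) W f \<longleftrightarrow> linear_map R (free_module R F) W f"
  by (simp add: linear_map_def twisted_simps)

lemma linear_map_to_twisted_group_algebra:
  "linear_map R W (twisted_group_algebra R G F \<psi>) f \<longleftrightarrow> linear_map R W (free_module R F) f"
  by (simp add: linear_map_def twisted_group_algebra_simps)

lemma linear_map_to_twisted_alg:
  "linear_map R W (twisted_alg R G F \<psi>) f \<longleftrightarrow> linear_map R W (free_module R F) f"
  by (simp add: linear_map_def twisted_simps)

lemmas linear_map_twisted = linear_map_from_twisted_group_algebra linear_map_from_twisted_alg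
  linear_map_to_twisted_group_algebra linear_map_to_twisted_alg

end

section \<open>The smash product\<close>

locale graded_hopf_cocycle = graded_hopf R H grH G \<iota>
  for R :: "('a, 'b) ring_scheme" (structure) and H :: "('a, 'h) hopf" and grH :: "nat \<Rightarrow> 'h set"
    and G :: "('g, 's) monoid_scheme" and \<iota> :: "('g \<Rightarrow> 'a) \<Rightarrow> 'h" +
  fixes F :: "'g set" and \<psi> :: "'g \<Rightarrow> 'g \<Rightarrow> 'a"
  assumes F_subgroup: "subgroup F G" and cocycle: "two_cocycle R G F \<psi>"
begin

lemma F_G: "g \<in> F \<Longrightarrow> g \<in> carrier G"
  using subgroup.subset[OF F_subgroup] by blast
lemmas F_one = subgroup.one_closed[OF F_subgroup]
lemmas F_mult = subgroup.m_closed[OF F_subgroup]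
lemmas F_inv = subgroup.m_inv_closed[OF F_subgroup]
lemma finite_F: "finite F" using finite_subset[OF subgroup.subset[OF F_subgroup] finite_G] .
lemma psi_unit: "g \<in> F \<Longrightarrow> h \<in> F \<Longrightarrow> \<psi> g h \<in> carrier R \<and> \<psi> g h \<noteq> \<zero>"
  using cocycle field_Units by (auto simp: two_cocycle_def)
lemma psi_closed: "g \<in> F \<Longrightarrow> h \<in> F \<Longrightarrow> \<psi> g h \<in> carrier R"
  using psi_unit by simp

text \<open>\<open>E0\<close> and \<open>K1\<close> are the algebra records beneath \<open>E\<close>
  and \<open>K\<close>. The coaction of \<open>E\<close> takes its values in \<open>K\<close>
  \<otimes> \<open>E0\<close> and the comultiplication of \<open>K\<close> in \<open>K1\<close>
  \<otimes> \<open>K1\<close>, so all four records occur although only two vector spaces are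
  involved.\<close>

abbreviation "E \<equiv> twisted_group_algebra R G F \<psi>"
abbreviation "E0 \<equiv> twisted_alg R G F \<psi>"
abbreviation "K1 \<equiv> twisted_alg R G (carrier G) (\<lambda>_ _. \<one>)"
abbreviation "VF \<equiv> free_module R F"
abbreviation "KE \<equiv> tensor R K E0"
abbreviation "CE \<equiv> tensor R HC E"
abbreviation "H_CE \<equiv> tensor R H CE"
abbreviation "Sm \<equiv> smash R H K \<iota> \<pi> E"

lemmas mE = twisted_group_algebra_module[of G F \<psi>]
lemmas mE0 = twisted_module[of G F \<psi>]
lemmas mK1 = twisted_module[of G "carrier G" "\<lambda>_ _. \<one>"]
lemmas mKE = tensor_module[OF mK mE0]
lemmas mCE = tensor_module[OF mHC mE]
lemmas mH_CE = tensor_module[OF mH mCE]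

lemma carrier_E: "carrier E = carrier VF" by (simp add: twisted_group_algebra_simps)
lemma carrier_E0: "carrier E0 = carrier VF" by (simp add: twisted_simps)
lemma carrier_K: "carrier K = carrier KF" by (simp add: group_algebra_simps)
lemma carrier_K1: "carrier K1 = carrier KF" by (simp add: twisted_simps)
lemma basis_E: "g \<in> F \<Longrightarrow> basis_vec R g \<in> carrier E" by (simp add: carrier_E)
lemma basis_E0: "g \<in> F \<Longrightarrow> basis_vec R g \<in> carrier E0" by (simp add: carrier_E0)

lemma smash_simps:
  "carrier Sm = carrier CE" "add Sm = add CE" "zero Sm = zero CE" "smult Sm = smult CE"
  "one Sm = ptensor R HC E \<one>\<^bsub>H\<^esub> (basis_vec R \<one>\<^bsub>G\<^esub>)"
  "s \<otimes>\<^bsub>Sm\<^esub> t = sweedler R CE s (\<lambda>a l. sweedler R CE t (\<lambda>b m.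
    sweedler R CE (coact E l) (\<lambda>x l0. ptensor R HC E
      (sweedler R H (comult K x) (\<lambda>x1 x2. a \<otimes>\<^bsub>H\<^esub> \<iota> x1 \<otimes>\<^bsub>H\<^esub> b \<otimes>\<^bsub>H\<^esub> \<iota> (antipode K x2))) (l0 \<otimes>\<^bsub>E\<^esub> m))))"
  "coact Sm s = sweedler R H_CE s (\<lambda>a l. sweedler R H_CE (coact E l) (\<lambda>x l0.
    sweedler R H_CE (corestrict R H H C (\<Delta> a)) (\<lambda>a1 a2.
      ptensor R H CE (a1 \<otimes>\<^bsub>H\<^esub> \<iota> x) (ptensor R HC E a2 l0))))"
  by (simp_all add: smash_def Let_def module.defs comod_alg.defs tensor_one twisted_group_algebra_simps)

lemma mSm: "module R Sm"
  by (rule module_cong_fields[OF mCE]) (simp_all add: smash_simps)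

subsection \<open>Coordinates\<close>

text \<open>As \<open>F\<close> is a basis of \<open>E\<close>, an element of the smash product is
  the sum over k in \<open>F\<close> of its coordinate at k, a coinvariant, tensored with k.
  Identities in the smash product are proved coordinatewise.\<close>

definition "coord k t = rcon HC (\<lambda>l. l k) t"
definition "pt a g = ptensor R HC E a (basis_vec R g)"

lemma ev_functional: "functional E (\<lambda>l. l k)"
  using coefficient_functional[of F k] by (simp add: linear_map_twisted)

lemma coord_linear_C: "linear_map R CE HC (coord k)"
  unfolding coord_def[abs_def] by (rule rcon_linear[OF mHC mE ev_functional])

lemma coord_C: "t \<in> carrier CE \<Longrightarrow> coord k t \<in> C"
  using lin_closed[OF coord_linear_C, of t k] by simp

lemma coord_linear: "linear_map R CE H (coord k)"
  by (rule lin_comp[OF coord_linear_C lin_incl[OF C_submodule]])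

lemmas coord_closed = lin_closed[OF coord_linear]

lemma pt_closed: "a \<in> C \<Longrightarrow> g \<in> F \<Longrightarrow> pt a g \<in> carrier CE"
  unfolding pt_def by (rule ptensor_closed[OF mHC mE]) (simp_all add: basis_E)

lemma pt_linear: "g \<in> F \<Longrightarrow> linear_map R HC CE (\<lambda>a. pt a g)"
  unfolding pt_def by (rule ptensor_left_linear[OF mHC mE basis_E])

lemma coord_pt: "a \<in> C \<Longrightarrow> g \<in> F \<Longrightarrow> coord k (pt a g) = (if k = g then a else \<zero>\<^bsub>H\<^esub>)"
proof -
  assume a: "a \<in> C" and g: "g \<in> F"
  have aH: "a \<in> carrier HC" using a by simp
  show ?thesis
    unfolding coord_def pt_def rcon_ptensor[OF mHC mE ev_functional aH basis_E[OF g]]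
    using C_closed[OF a] mH by (simp add: basis_vec_def)
qed

lemma CE_eqI:
  assumes "s \<in> carrier CE" "t \<in> carrier CE" "\<And>k. k \<in> F \<Longrightarrow> coord k s = coord k t"
  shows "s = t"
  by (rule tensor_free_eqI[OF mHC mE carrier_E ev_functional assms(1,2)]) (use assms(3) in \<open>simp add: coord_def\<close>)

lemma linear_eq_on_CE:
  assumes W: "module R W" and f: "linear_map R CE W f" and f': "linear_map R CE W f'"
    and eq: "\<And>a g. a \<in> C \<Longrightarrow> g \<in> F \<Longrightarrow> f (pt a g) = f' (pt a g)" and t: "t \<in> carrier CE"
  shows "f t = f' t"
proof (rule linear_eq_on_tensor[OF mHC mE W f f' _ t])
  fix a l assume a: "a \<in> carrier HC" and l: "l \<in> carrier E"
  note pl = ptensor_right_linear[OF mHC mE a]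
  show "f (ptensor R HC E a l) = f' (ptensor R HC E a l)"
    by (rule linear_eq_on_free[OF W _ _ _ l[unfolded carrier_E]])
      (use lin_comp[OF pl f] lin_comp[OF pl f'] eq[of a] a in \<open>simp_all add: linear_map_twisted pt_def\<close>)
qed

lemma smash_one: "one Sm = pt \<one>\<^bsub>H\<^esub> \<one>\<^bsub>G\<^esub>"
  by (simp add: smash_simps pt_def)

subsection \<open>Multiplication\<close>

lemma comult_K_linear: "linear_map R KF (tensor R K1 K1) (comult K)"
  unfolding group_algebra_simps Let_def
  by (rule lin_ext_linear[OF tensor_module[OF mK1 mK1]])
    (rule ptensor_closed[OF mK1 mK1]; simp add: carrier_K1)

lemma comult_K_basis: "g \<in> carrier G \<Longrightarrow> comult K (basis_vec R g) = ptensor R K1 K1 (basis_vec R g) (basis_vec R g)"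
  unfolding group_algebra_simps Let_def
  by (rule lin_ext_basis_vec_eq[OF tensor_module[OF mK1 mK1]], rule refl, rule ptensor_closed[OF mK1 mK1])
    (simp_all add: carrier_K1)

lemma antipode_K_linear: "linear_map R K1 K1 (antipode K)"
  unfolding group_algebra_simps Let_def linear_map_twisted(2)
  by (rule lin_ext_linear[OF mK1]) (simp add: carrier_K1 G_simps)

lemma iota_K1: "linear_map R K1 H \<iota>"
  unfolding linear_map_twisted by (rule iota_linear')

text \<open>The left factor of the smash multiplication as a function of the group algebra element
  \<open>x\<close>, isolated because only the complete sum over the coproduct of \<open>x\<close>
  lies in \<open>C\<close>.\<close>

definition "Q a b x = sweedler R H (comult K x) (\<lambda>x1 x2. a \<otimes>\<^bsub>H\<^esub> \<iota> x1 \<otimes>\<^bsub>H\<^esub> b \<otimes>\<^bsub>H\<^esub> \<iota> (antipode K x2))"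

lemma Q_bilin:
  assumes a: "a \<in> carrier H" and b: "b \<in> carrier H"
  shows "bilin K1 K1 H (\<lambda>x1 x2. a \<otimes>\<^bsub>H\<^esub> \<iota> x1 \<otimes>\<^bsub>H\<^esub> b \<otimes>\<^bsub>H\<^esub> \<iota> (antipode K x2))"
proof (rule bilinI)
  fix x assume x: "x \<in> carrier K1"
  note ix = lin_closed[OF iota_K1 x] and sx = lin_closed[OF iota_K1 lin_closed[OF antipode_K_linear x]]
  show "linear_map R K1 H (\<lambda>x2. a \<otimes>\<^bsub>H\<^esub> \<iota> x \<otimes>\<^bsub>H\<^esub> b \<otimes>\<^bsub>H\<^esub> \<iota> (antipode K x2))"
    by (rule lin_comp[OF antipode_K_linear lin_comp[OF iota_K1 left_mult_linear[OF H_alg H_closed[OF H_closed[OF a ix] b]]]])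
  show "linear_map R K1 H (\<lambda>x1. a \<otimes>\<^bsub>H\<^esub> \<iota> x1 \<otimes>\<^bsub>H\<^esub> b \<otimes>\<^bsub>H\<^esub> \<iota> (antipode K x))"
    by (rule lin_comp[OF iota_K1 lin_comp[OF left_mult_linear[OF H_alg a] lin_comp[OF right_mult_linear[OF H_alg b]
            right_mult_linear[OF H_alg sx]]]])
qed

lemma Q_linear: "a \<in> carrier H \<Longrightarrow> b \<in> carrier H \<Longrightarrow> linear_map R KF H (Q a b)"
  unfolding Q_def[abs_def] by (rule lin_comp[OF comult_K_linear sweedler_linear[OF mK1 mK1 mH Q_bilin]])

lemma Q_linear_right:
  assumes a: "a \<in> carrier H" and x: "x \<in> carrier KF"
  shows "linear_map R H H (\<lambda>b. Q a b x)"
  unfolding Q_def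
proof (rule sweedler_param_linear[OF mK1 mK1 mH mH lin_closed[OF comult_K_linear x] Q_bilin[OF a]])
  fix x1 x2 assume x1: "x1 \<in> carrier K1" and x2: "x2 \<in> carrier K1"
  show "linear_map R H H (\<lambda>b. a \<otimes>\<^bsub>H\<^esub> \<iota> x1 \<otimes>\<^bsub>H\<^esub> b \<otimes>\<^bsub>H\<^esub> \<iota> (antipode K x2))"
    by (rule lin_comp[OF left_mult_linear[OF H_alg H_closed[OF a lin_closed[OF iota_K1 x1]]]
          right_mult_linear[OF H_alg lin_closed[OF iota_K1 lin_closed[OF antipode_K_linear x2]]]])
qed assumption

lemma Q_linear_left:
  assumes b: "b \<in> carrier H" and x: "x \<in> carrier KF"
  shows "linear_map R H H (\<lambda>a. Q a b x)"
  unfolding Q_def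
proof (rule sweedler_param_linear[OF mK1 mK1 mH mH lin_closed[OF comult_K_linear x] Q_bilin[OF _ b]])
  fix x1 x2 assume x1: "x1 \<in> carrier K1" and x2: "x2 \<in> carrier K1"
  show "linear_map R H H (\<lambda>a. a \<otimes>\<^bsub>H\<^esub> \<iota> x1 \<otimes>\<^bsub>H\<^esub> b \<otimes>\<^bsub>H\<^esub> \<iota> (antipode K x2))"
    by (rule lin_comp[OF right_mult_linear[OF H_alg lin_closed[OF iota_K1 x1]] lin_comp[OF right_mult_linear[OF H_alg b]
          right_mult_linear[OF H_alg lin_closed[OF iota_K1 lin_closed[OF antipode_K_linear x2]]]]])
qed assumption

lemma Q_basis:
  assumes a: "a \<in> carrier H" and b: "b \<in> carrier H" and g: "g \<in> carrier G"
  shows "Q a b (basis_vec R g) = a \<otimes>\<^bsub>H\<^esub> gl g \<otimes>\<^bsub>H\<^esub> b \<otimes>\<^bsub>H\<^esub> gl (inv\<^bsub>G\<^esub> g)"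
proof -
  have bK: "basis_vec R g \<in> carrier K1" using g by (simp add: carrier_K1)
  show ?thesis
    unfolding Q_def comult_K_basis[OF g] sweedler_ptensor[OF mK1 mK1 mH Q_bilin[OF a b] bK bK]
      antipode_basis[OF g] gl_def by (rule refl)
qed

text \<open>On a group element g it is \<open>a\<close> times the conjugate of \<open>b\<close> by
  g, a product of two coinvariants; the group elements span, and \<open>C\<close> is a
  subspace.\<close>

lemma Q_C:
  assumes a: "a \<in> C" and b: "b \<in> C" and x: "x \<in> carrier KF"
  shows "Q a b x \<in> C"
proof -
  note ac = C_closed[OF a] and bc = C_closed[OF b]
  have "x \<in> {x \<in> carrier KF. Q a b x \<in> C}"
  proof (rule free_in_submodule[OF submodule_vimage[OF free_module_module mH Q_linear[OF ac bc] C_submodule] _ x])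
    fix g assume g: "g \<in> carrier G"
    have "Q a b (basis_vec R g) = a \<otimes>\<^bsub>H\<^esub> (gl g \<otimes>\<^bsub>H\<^esub> b \<otimes>\<^bsub>H\<^esub> gl (inv\<^bsub>G\<^esub> g))"
      using ac bc gl_closed[OF g] gl_closed[OF G_simps(2)[OF g]]
      by (simp add: Q_basis[OF ac bc g] H_assoc H_closed)
    then show "basis_vec R g \<in> {x \<in> carrier KF. Q a b x \<in> C}"
      using C_mult[OF a conj_C[OF g b]] g by simp
  qed
  then show ?thesis by simp
qed

lemma Q_K_HC: "a \<in> C \<Longrightarrow> b \<in> C \<Longrightarrow> linear_map R K HC (Q a b)"
  unfolding linear_map_group_algebra by (rule lin_corestrict[OF Q_linear Q_C]) (simp_all add: C_closed)

lemma Q_HC_right: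
  assumes a: "a \<in> C" and x: "x \<in> carrier K" shows "linear_map R HC HC (\<lambda>b. Q a b x)"
  by (rule lin_corestrict[OF lin_restrict[OF C_submodule Q_linear_right[OF C_closed[OF a] x[unfolded carrier_K]]]])
    (simp add: Q_C[OF a _ x[unfolded carrier_K]])

lemma Q_HC_left:
  assumes b: "b \<in> C" and x: "x \<in> carrier K" shows "linear_map R HC HC (\<lambda>a. Q a b x)"
  by (rule lin_corestrict[OF lin_restrict[OF C_submodule Q_linear_left[OF C_closed[OF b] x[unfolded carrier_K]]]])
    (simp add: Q_C[OF _ b x[unfolded carrier_K]])

lemma E_mult_bilin: "bilin VF VF VF (mult E)"
  unfolding twisted_group_algebra_simps by (rule twisted_mult_bilin[OF F_mult psi_closed])

lemma E_mult_left: "m \<in> carrier E \<Longrightarrow> linear_map R E0 E (\<lambda>l. l \<otimes>\<^bsub>E\<^esub> m)"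
  unfolding linear_map_twisted carrier_E by (rule bilinD(2)[OF E_mult_bilin])

lemma E_mult_right: "l \<in> carrier E0 \<Longrightarrow> linear_map R E E (\<lambda>m. l \<otimes>\<^bsub>E\<^esub> m)"
  unfolding linear_map_twisted carrier_E0 by (rule bilinD(1)[OF E_mult_bilin])

lemma coactE_linear: "linear_map R E KE (coact E)"
  unfolding linear_map_twisted(1) unfolding twisted_group_algebra_simps
  by (rule lin_ext_linear[OF mKE], rule ptensor_closed[OF mK mE0]) (simp_all add: basis_K F_G carrier_E0)

lemma coactE_basis: "g \<in> F \<Longrightarrow> coact E (basis_vec R g) = ptensor R K E0 (basis_vec R g) (basis_vec R g)"
  unfolding twisted_group_algebra_simps
  by (rule lin_ext_basis_vec_eq[OF mKE], rule refl, rule ptensor_closed[OF mK mE0])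
    (simp_all add: basis_K F_G carrier_E0)

text \<open>The smash product of the pure tensors \<open>a\<close> \<otimes> \<open>l\<close> and
  \<open>b\<close> \<otimes> \<open>m\<close>. Linearity in each of the four arguments makes the
  nested sums of the multiplication independent of representatives.\<close>

definition "Th a l b m = sweedler R CE (coact E l) (\<lambda>x l0. ptensor R HC E (Q a b x) (l0 \<otimes>\<^bsub>E\<^esub> m))"

lemma theta_bilin:
  "a \<in> C \<Longrightarrow> b \<in> C \<Longrightarrow> m \<in> carrier E \<Longrightarrow> bilin K E0 CE (\<lambda>x l0. ptensor R HC E (Q a b x) (l0 \<otimes>\<^bsub>E\<^esub> m))"
  by (rule bilin_precomp[OF ptensor_bilin[OF mHC mE] Q_K_HC E_mult_left])

lemma Th_linear_l:
  "a \<in> C \<Longrightarrow> b \<in> C \<Longrightarrow> m \<in> carrier E \<Longrightarrow> linear_map R E CE (\<lambda>l. Th a l b m)"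
  unfolding Th_def by (rule lin_comp[OF coactE_linear sweedler_linear[OF mK mE0 mCE theta_bilin]])

lemma Q_HC: "a \<in> C \<Longrightarrow> b \<in> C \<Longrightarrow> x \<in> carrier K \<Longrightarrow> Q a b x \<in> carrier HC"
  using Q_C[of a b x] by (simp add: carrier_K)

lemma Th_linear_m:
  assumes a: "a \<in> C" and b: "b \<in> C" and l: "l \<in> carrier E"
  shows "linear_map R E CE (\<lambda>m. Th a l b m)"
  unfolding Th_def
  by (rule sweedler_param_linear[OF mK mE0 mCE mE lin_closed[OF coactE_linear l] theta_bilin[OF a b]])
    (assumption, rule lin_comp[OF E_mult_right ptensor_right_linear[OF mHC mE Q_HC[OF a b]]])

lemma E_mult_closed: "l \<in> carrier E0 \<Longrightarrow> m \<in> carrier E \<Longrightarrow> l \<otimes>\<^bsub>E\<^esub> m \<in> carrier E"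
  by (rule lin_closed[OF E_mult_right])

lemma Th_linear_b:
  assumes a: "a \<in> C" and l: "l \<in> carrier E" and m: "m \<in> carrier E"
  shows "linear_map R HC CE (\<lambda>b. Th a l b m)"
  unfolding Th_def
proof (rule sweedler_param_linear[OF mK mE0 mCE mHC lin_closed[OF coactE_linear l]])
  show "bilin K E0 CE (\<lambda>x l0. ptensor R HC E (Q a b x) (l0 \<otimes>\<^bsub>E\<^esub> m))" if "b \<in> carrier HC" for b
    using theta_bilin[OF a _ m] that by simp
  show "linear_map R HC CE (\<lambda>b. ptensor R HC E (Q a b x) (l0 \<otimes>\<^bsub>E\<^esub> m))"
    if "x \<in> carrier K" "l0 \<in> carrier E0" for x l0
    by (rule lin_comp[OF Q_HC_right[OF a that(1)] ptensor_left_linear[OF mHC mE E_mult_closed[OF that(2) m]]])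
qed

lemma Th_linear_a:
  assumes b: "b \<in> C" and l: "l \<in> carrier E" and m: "m \<in> carrier E"
  shows "linear_map R HC CE (\<lambda>a. Th a l b m)"
  unfolding Th_def
proof (rule sweedler_param_linear[OF mK mE0 mCE mHC lin_closed[OF coactE_linear l]])
  show "bilin K E0 CE (\<lambda>x l0. ptensor R HC E (Q a b x) (l0 \<otimes>\<^bsub>E\<^esub> m))" if "a \<in> carrier HC" for a
    using theta_bilin[OF _ b m] that by simp
  show "linear_map R HC CE (\<lambda>a. ptensor R HC E (Q a b x) (l0 \<otimes>\<^bsub>E\<^esub> m))"
    if "x \<in> carrier K" "l0 \<in> carrier E0" for x l0
    by (rule lin_comp[OF Q_HC_left[OF b that(1)] ptensor_left_linear[OF mHC mE E_mult_closed[OF that(2) m]]])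
qed

lemma Th_bilin: "a \<in> C \<Longrightarrow> l \<in> carrier E \<Longrightarrow> bilin HC E CE (\<lambda>b m. Th a l b m)"
  by (rule bilinI) (simp_all add: Th_linear_m Th_linear_b)

lemma Th_outer:
  assumes t: "t \<in> carrier CE"
  shows "bilin HC E CE (\<lambda>a l. sweedler R CE t (\<lambda>b m. Th a l b m))"
proof (rule bilinI)
  show "linear_map R E CE (\<lambda>l. sweedler R CE t (\<lambda>b m. Th a l b m))" if "a \<in> carrier HC" for a
    by (rule sweedler_param_linear[OF mHC mE mCE mE t]) (use that in \<open>simp_all add: Th_bilin Th_linear_l\<close>)
  show "linear_map R HC CE (\<lambda>a. sweedler R CE t (\<lambda>b m. Th a l b m))" if "l \<in> carrier E" for l
    by (rule sweedler_param_linear[OF mHC mE mCE mHC t]) (use that in \<open>simp_all add: Th_bilin Th_linear_a\<close>)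
qed

lemma Sm_mult: "s \<otimes>\<^bsub>Sm\<^esub> t = sweedler R CE s (\<lambda>a l. sweedler R CE t (\<lambda>b m. Th a l b m))"
  by (simp add: smash_simps Th_def Q_def)

lemma Sm_mult_left: "t \<in> carrier CE \<Longrightarrow> linear_map R CE CE (\<lambda>s. s \<otimes>\<^bsub>Sm\<^esub> t)"
  unfolding Sm_mult by (rule sweedler_linear[OF mHC mE mCE Th_outer])

lemma Sm_mult_right:
  assumes s: "s \<in> carrier CE" shows "linear_map R CE CE (\<lambda>t. s \<otimes>\<^bsub>Sm\<^esub> t)"
  unfolding Sm_mult
proof (rule sweedler_param_linear[OF mHC mE mCE mCE s Th_outer])
  show "linear_map R CE CE (\<lambda>t. sweedler R CE t (\<lambda>b m. Th a l b m))"
    if "a \<in> carrier HC" "l \<in> carrier E" for a l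
    using sweedler_linear[OF mHC mE mCE Th_bilin] that by simp
qed assumption

lemmas Sm_mult_closed = lin_closed[OF Sm_mult_right]

text \<open>For group elements both the coaction and the coproduct are single tensors, so each of
  the nested sums has one term.\<close>

lemma Sm_mult_pt:
  assumes a: "a \<in> C" and b: "b \<in> C" and g: "g \<in> F" and h: "h \<in> F"
  shows "pt a g \<otimes>\<^bsub>Sm\<^esub> pt b h =
    \<psi> g h \<odot>\<^bsub>CE\<^esub> pt (a \<otimes>\<^bsub>H\<^esub> gl g \<otimes>\<^bsub>H\<^esub> b \<otimes>\<^bsub>H\<^esub> gl (inv\<^bsub>G\<^esub> g)) (g \<otimes>\<^bsub>G\<^esub> h)"
proof -
  have aH: "a \<in> carrier HC" and bH: "b \<in> carrier HC" using a b by simp_all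
  note gE = basis_E[OF g] and hE = basis_E[OF h]
  have "pt a g \<otimes>\<^bsub>Sm\<^esub> pt b h = Th a (basis_vec R g) b (basis_vec R h)"
    unfolding Sm_mult pt_def
      sweedler_ptensor[OF mHC mE mCE Th_outer[OF ptensor_closed[OF mHC mE bH hE]] aH gE]
    by (rule sweedler_ptensor[OF mHC mE mCE Th_bilin[OF a gE] bH hE])
  also have "\<dots> = ptensor R HC E (Q a b (basis_vec R g)) (basis_vec R g \<otimes>\<^bsub>E\<^esub> basis_vec R h)"
    unfolding Th_def coactE_basis[OF g]
    by (rule sweedler_ptensor[OF mK mE0 mCE theta_bilin[OF a b hE] basis_K[OF F_G[OF g]] basis_E0[OF g]])
  also have "basis_vec R g \<otimes>\<^bsub>E\<^esub> basis_vec R h = \<psi> g h \<odot>\<^bsub>E\<^esub> basis_vec R (g \<otimes>\<^bsub>G\<^esub> h)"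
    unfolding twisted_group_algebra_simps
    by (rule twisted_mult_basis[where \<psi> = \<psi>, OF g h F_mult[OF g h] psi_closed[OF g h]])
  also have "ptensor R HC E (Q a b (basis_vec R g)) \<dots> =
      \<psi> g h \<odot>\<^bsub>CE\<^esub> ptensor R HC E (Q a b (basis_vec R g)) (basis_vec R (g \<otimes>\<^bsub>G\<^esub> h))"
    by (rule lin_smult[OF ptensor_right_linear[OF mHC mE Q_HC[OF a b basis_K[OF F_G[OF g]]]] psi_closed[OF g h]
          basis_E[OF F_mult[OF g h]]])
  finally show ?thesis unfolding pt_def Q_basis[OF C_closed[OF a] C_closed[OF b] F_G[OF g]] .
qed

text \<open>Both sides are bilinear. For \<open>a\<close> \<otimes> g and \<open>b\<close> \<otimes>
  h the sum reduces to the term indexed by g, and this term is nonzero only if its partner g^-1 k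
  equals h, that is, if k = gh.\<close>

lemma coord_mult:
  assumes k: "k \<in> F" and s: "s \<in> carrier CE" and t: "t \<in> carrier CE"
  shows "coord k (s \<otimes>\<^bsub>Sm\<^esub> t) = finsum H (\<lambda>g. \<psi> g (inv\<^bsub>G\<^esub> g \<otimes>\<^bsub>G\<^esub> k) \<odot>\<^bsub>H\<^esub>
    (coord g s \<otimes>\<^bsub>H\<^esub> gl g \<otimes>\<^bsub>H\<^esub> coord (inv\<^bsub>G\<^esub> g \<otimes>\<^bsub>G\<^esub> k) t \<otimes>\<^bsub>H\<^esub> gl (inv\<^bsub>G\<^esub> g))) F"
proof -
  let ?r = "\<lambda>s t g. \<psi> g (inv\<^bsub>G\<^esub> g \<otimes>\<^bsub>G\<^esub> k) \<odot>\<^bsub>H\<^esub>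
    (coord g s \<otimes>\<^bsub>H\<^esub> gl g \<otimes>\<^bsub>H\<^esub> coord (inv\<^bsub>G\<^esub> g \<otimes>\<^bsub>G\<^esub> k) t \<otimes>\<^bsub>H\<^esub> gl (inv\<^bsub>G\<^esub> g))"
  have p: "\<psi> g (inv\<^bsub>G\<^esub> g \<otimes>\<^bsub>G\<^esub> k) \<in> carrier R" "gl g \<in> carrier H" "gl (inv\<^bsub>G\<^esub> g) \<in> carrier H" if "g \<in> F" for g
    using psi_closed[OF that F_mult[OF F_inv[OF that] k]] gl_closed[OF F_G[OF that]]
      gl_closed[OF F_G[OF F_inv[OF that]]] by auto
  have ls: "linear_map R CE H (\<lambda>s. ?r s t g)" if t: "t \<in> carrier CE" and g: "g \<in> F" for t g
    by (rule lin_smult_const[OF mH _ p(1)[OF g]], rule lin_comp[OF coord_linear], rule lin_comp[OF right_mult_linear[OF H_alg p(2)[OF g]]],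
        rule lin_comp[OF right_mult_linear[OF H_alg coord_closed[OF t]] right_mult_linear[OF H_alg p(3)[OF g]]])
  have lt: "linear_map R CE H (\<lambda>t. ?r s t g)" if s: "s \<in> carrier CE" and g: "g \<in> F" for s g
    by (rule lin_smult_const[OF mH _ p(1)[OF g]], rule lin_comp[OF coord_linear],
        rule lin_comp[OF left_mult_linear[OF H_alg H_closed[OF coord_closed[OF s] p(2)[OF g]]] right_mult_linear[OF H_alg p(3)[OF g]]])
  have pure: "coord k (pt a g \<otimes>\<^bsub>Sm\<^esub> pt b h) = finsum H (?r (pt a g) (pt b h)) F"
    if a: "a \<in> C" and g: "g \<in> F" and b: "b \<in> C" and h: "h \<in> F" for a g b h
  proof -
    let ?c = "a \<otimes>\<^bsub>H\<^esub> gl g \<otimes>\<^bsub>H\<^esub> b \<otimes>\<^bsub>H\<^esub> gl (inv\<^bsub>G\<^esub> g)"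
    note ac = C_closed[OF a] and bc = C_closed[OF b]
    have c: "?c \<in> C" using Q_C[OF a b, of "basis_vec R g"] F_G[OF g] by (simp add: Q_basis[OF ac bc F_G[OF g]])
    have "coord k (pt a g \<otimes>\<^bsub>Sm\<^esub> pt b h) = \<psi> g h \<odot>\<^bsub>H\<^esub> (if k = g \<otimes>\<^bsub>G\<^esub> h then ?c else \<zero>\<^bsub>H\<^esub>)"
      unfolding Sm_mult_pt[OF a b g h] lin_smult[OF coord_linear psi_closed[OF g h] pt_closed[OF c F_mult[OF g h]]]
        coord_pt[OF c F_mult[OF g h]] by (rule refl)
    also have "\<dots> = ?r (pt a g) (pt b h) g"
      unfolding coord_pt[OF a g] coord_pt[OF b h] G_shift(1)[OF F_G[OF g] F_G[OF h] F_G[OF k]]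
      using p[OF g] ac psi_closed[OF g h] mH
      by (simp add: alg_zero_right[OF H_alg] alg_zero_left[OF H_alg] H_closed)
    also have "\<dots> = finsum H (?r (pt a g) (pt b h)) F"
    proof (rule mod_finsum_single[OF mH finite_F g, symmetric])
      show "?r (pt a g) (pt b h) g \<in> carrier H" by (rule lin_closed[OF ls[OF pt_closed[OF b h] g] pt_closed[OF a g]])
      fix g' assume g': "g' \<in> F" "g' \<noteq> g"
      show "?r (pt a g) (pt b h) g' = \<zero>\<^bsub>H\<^esub>"
        unfolding coord_pt[OF a g] coord_pt[OF b h]
        using p[OF g'(1)] g'(2) bc mH by (simp add: alg_zero_left[OF H_alg])
    qed (rule refl)
    finally show ?thesis .
  qed
  show ?thesis
  proof (rule linear_eq_on_CE[OF mH lin_comp[OF Sm_mult_left[OF t] coord_linear] lin_finsum_map[OF mH finite_F ls[OF t]] _ s])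
    fix a g assume a: "a \<in> C" and g: "g \<in> F"
    note ag = pt_closed[OF a g]
    show "coord k (pt a g \<otimes>\<^bsub>Sm\<^esub> t) = finsum H (?r (pt a g) t) F"
      by (rule linear_eq_on_CE[OF mH lin_comp[OF Sm_mult_right[OF ag] coord_linear]
            lin_finsum_map[OF mH finite_F lt[OF ag]] pure[OF a g] t])
  qed
qed

subsection \<open>Coaction\<close>

definition "cD a = corestrict R H H C (\<Delta> a)"

lemma cD_linear: "linear_map R HC (tensor R H HC) cD"
  unfolding cD_def[abs_def]
  by (rule corestrict_linear[OF mH mH C_submodule lin_restrict[OF C_submodule Delta_linear]]) (simp add: Delta_C)

lemma cD_closed: "a \<in> C \<Longrightarrow> cD a \<in> carrier (tensor R H HC)"
  using lin_closed[OF cD_linear, of a] by simp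

text \<open>The pair \<open>a1\<close>, \<open>a2\<close> stands for the coproduct of the
  coinvariant, the pair \<open>x\<close>, \<open>l\<close> for the coaction of the group algebra
  part. Bilinearity is needed in the first pair, and in the second one after the sum over the
  first.\<close>

definition "ka x l a1 a2 = ptensor R H CE (a1 \<otimes>\<^bsub>H\<^esub> \<iota> x) (ptensor R HC E a2 l)"

lemma ka_bilin: "x \<in> carrier K \<Longrightarrow> l \<in> carrier E \<Longrightarrow> bilin H HC H_CE (ka x l)"
  unfolding ka_def[abs_def]
  by (rule bilin_precomp[OF ptensor_bilin[OF mH mCE] right_mult_linear[OF H_alg lin_closed[OF iota_linear]]
        ptensor_left_linear[OF mHC mE]])

lemma ka_bilin': 
  assumes a: "a \<in> C"
  shows "bilin K E0 H_CE (\<lambda>x l. sweedler R H_CE (cD a) (ka x l))"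
proof (rule bilinI)
  fix x assume x: "x \<in> carrier K"
  show "linear_map R E0 H_CE (\<lambda>l. sweedler R H_CE (cD a) (ka x l))"
  proof (rule sweedler_param_linear[OF mH mHC mH_CE mE0 cD_closed[OF a]])
    show "bilin H HC H_CE (ka x l)" if "l \<in> carrier E0" for l
      using ka_bilin[OF x, of l] that by (simp add: carrier_E carrier_E0)
    show "linear_map R E0 H_CE (\<lambda>l. ka x l a1 a2)" if a1: "a1 \<in> carrier H" and a2: "a2 \<in> carrier HC" for a1 a2
      using lin_comp[OF ptensor_right_linear[OF mHC mE a2]
          ptensor_right_linear[OF mH mCE H_closed[OF a1 lin_closed[OF iota_linear x]]]]
      unfolding linear_map_twisted ka_def .
  qed
next
  fix l assume l: "l \<in> carrier E0"
  then have lE: "l \<in> carrier E" by (simp add: carrier_E carrier_E0)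
  show "linear_map R K H_CE (\<lambda>x. sweedler R H_CE (cD a) (ka x l))"
  proof (rule sweedler_param_linear[OF mH mHC mH_CE mK cD_closed[OF a] ka_bilin[OF _ lE]])
    show "linear_map R K H_CE (\<lambda>x. ka x l a1 a2)" if a1: "a1 \<in> carrier H" and a2: "a2 \<in> carrier HC" for a1 a2
      unfolding ka_def
      by (rule lin_comp[OF iota_linear lin_comp[OF left_mult_linear[OF H_alg a1]
              ptensor_left_linear[OF mH mCE ptensor_closed[OF mHC mE a2 lE]]]])
  qed assumption
qed

lemma coactA_bilin:
  "bilin HC E H_CE (\<lambda>a l. sweedler R H_CE (coact E l) (\<lambda>x l0. sweedler R H_CE (cD a) (ka x l0)))"
proof (rule bilinI)
  show "linear_map R E H_CE (\<lambda>l. sweedler R H_CE (coact E l) (\<lambda>x l0. sweedler R H_CE (cD a) (ka x l0)))"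
    if "a \<in> carrier HC" for a
    using lin_comp[OF coactE_linear sweedler_linear[OF mK mE0 mH_CE ka_bilin', of a]] that by simp
  show "linear_map R HC H_CE (\<lambda>a. sweedler R H_CE (coact E l) (\<lambda>x l0. sweedler R H_CE (cD a) (ka x l0)))"
    if l: "l \<in> carrier E" for l
  proof (rule sweedler_param_linear[OF mK mE0 mH_CE mHC lin_closed[OF coactE_linear l]])
    show "bilin K E0 H_CE (\<lambda>x l0. sweedler R H_CE (cD a) (ka x l0))" if "a \<in> carrier HC" for a
      using ka_bilin'[of a] that by simp
    show "linear_map R HC H_CE (\<lambda>a. sweedler R H_CE (cD a) (ka x l0))"
      if "x \<in> carrier K" "l0 \<in> carrier E0" for x l0
      using lin_comp[OF cD_linear sweedler_linear[OF mH mHC mH_CE ka_bilin[OF that(1), of l0]]] that(2)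
      by (simp add: carrier_E carrier_E0)
  qed
qed

lemma coactA: "coact Sm s =
    sweedler R H_CE s (\<lambda>a l. sweedler R H_CE (coact E l) (\<lambda>x l0. sweedler R H_CE (cD a) (ka x l0)))"
  unfolding smash_simps cD_def ka_def[abs_def] by (rule refl)

lemma coactA_linear: "linear_map R CE H_CE (coact Sm)"
proof -
  have "linear_map R CE H_CE (\<lambda>s. coact Sm s)"
    unfolding coactA by (rule sweedler_linear[OF mHC mE mH_CE coactA_bilin])
  then show ?thesis .
qed

lemmas coactA_closed = lin_closed[OF coactA_linear]

lemma coactA_pt:
  assumes a: "a \<in> C" and g: "g \<in> F"
  shows "coact Sm (pt a g) = sweedler R H_CE (cD a) (ka (basis_vec R g) (basis_vec R g))"
proof -
  have aH: "a \<in> carrier HC" using a by simp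
  show ?thesis
    unfolding coactA pt_def sweedler_ptensor[OF mHC mE mH_CE coactA_bilin aH basis_E[OF g]] coactE_basis[OF g]
    by (rule sweedler_ptensor[OF mK mE0 mH_CE ka_bilin'[OF a] basis_K[OF F_G[OF g]] basis_E0[OF g]])
qed

text \<open>The coaction sends \<open>a\<close> \<otimes> g to the sum of a_1 g \<otimes> (a_2
  \<otimes> g). The group element is kept in the last factor, so coordinates do not mix, and on the
  left it only shifts the functional.\<close>

lemma coord_coact:
  assumes f: "functional H f" and k: "k \<in> F" and t: "t \<in> carrier CE"
  shows "coord k (lcon CE f (coact Sm t)) = lcon H (\<lambda>x. f (x \<otimes>\<^bsub>H\<^esub> gl k)) (\<Delta> (coord k t))"
proof -
  note fk = lin_comp[OF right_mult_linear[OF H_alg gl_closed] f]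
  note lc = lin_comp[OF lcon_linear[OF mH mCE f] coord_linear]
  show ?thesis
  proof (rule linear_eq_on_CE[OF mH lin_comp[OF coactA_linear lc]
        lin_comp[OF coord_linear lin_comp[OF Delta_linear lcon_linear[OF mH mH fk[OF F_G[OF k]]]]] _ t])
    fix a g assume a: "a \<in> C" and g: "g \<in> F"
    note gG = F_G[OF g] and gc = gl_closed[OF F_G[OF g]]
    note kb = ka_bilin[OF basis_K[OF F_G[OF g]] basis_E[OF g]]
    have r: "linear_map R (tensor R H HC) H (\<lambda>u. if k = g then lcon HC (\<lambda>x. f (x \<otimes>\<^bsub>H\<^esub> gl k)) u else \<zero>\<^bsub>H\<^esub>)"
      using lin_comp[OF lcon_linear[OF mH mHC fk[OF F_G[OF k]]] lin_incl[OF C_submodule]] lin_zero_map[OF mH]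
      by (cases "k = g") simp_all
    have *: "coord k (lcon CE f (sweedler R H_CE u (ka (basis_vec R g) (basis_vec R g)))) =
        (if k = g then lcon HC (\<lambda>x. f (x \<otimes>\<^bsub>H\<^esub> gl k)) u else \<zero>\<^bsub>H\<^esub>)" if u: "u \<in> carrier (tensor R H HC)" for u
    proof (rule linear_eq_on_tensor[OF mH mHC mH lin_comp[OF sweedler_linear[OF mH mHC mH_CE kb] lc] r _ u])
      fix a1 a2 assume a1: "a1 \<in> carrier H" and a2: "a2 \<in> carrier HC"
      have a2C: "a2 \<in> C" using a2 by simp
      note fa = functional_closed[OF f H_closed[OF a1 gc]]
      have "lcon CE f (sweedler R H_CE (ptensor R H HC a1 a2) (ka (basis_vec R g) (basis_vec R g))) =
          f (a1 \<otimes>\<^bsub>H\<^esub> gl g) \<odot>\<^bsub>CE\<^esub> pt a2 g"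
        unfolding sweedler_ptensor[OF mH mHC mH_CE kb a1 a2] unfolding ka_def gl_def[symmetric] pt_def[symmetric]
        by (rule lcon_ptensor[OF mH mCE f H_closed[OF a1 gc] pt_closed[OF a2C g]])
      then have "coord k (lcon CE f (sweedler R H_CE (ptensor R H HC a1 a2) (ka (basis_vec R g) (basis_vec R g)))) =
          f (a1 \<otimes>\<^bsub>H\<^esub> gl g) \<odot>\<^bsub>H\<^esub> (if k = g then a2 else \<zero>\<^bsub>H\<^esub>)"
        by (simp only: lin_smult[OF coord_linear fa pt_closed[OF a2C g]] coord_pt[OF a2C g])
      also have "\<dots> = (if k = g then lcon HC (\<lambda>x. f (x \<otimes>\<^bsub>H\<^esub> gl k)) (ptensor R H HC a1 a2) else \<zero>\<^bsub>H\<^esub>)"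
        using lcon_ptensor[OF mH mHC fk[OF gG] a1 a2] fa mH by simp
      finally show "coord k (lcon CE f (sweedler R H_CE (ptensor R H HC a1 a2) (ka (basis_vec R g) (basis_vec R g)))) =
        (if k = g then lcon HC (\<lambda>x. f (x \<otimes>\<^bsub>H\<^esub> gl k)) (ptensor R H HC a1 a2) else \<zero>\<^bsub>H\<^esub>)" .
    qed
    show "coord k (lcon CE f (coact Sm (pt a g))) = lcon H (\<lambda>x. f (x \<otimes>\<^bsub>H\<^esub> gl k)) (\<Delta> (coord k (pt a g)))"
      unfolding coactA_pt[OF a g] *[OF cD_closed[OF a]] coord_pt[OF a g]
      using lcon_corestrict[OF mH mH C_submodule fk[OF F_G[OF k]] Delta_C[OF a], folded cD_def]
        lin_zero[OF mH mH lin_comp[OF Delta_linear lcon_linear[OF mH mH fk[OF F_G[OF k]]]]]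
      by auto
  qed
qed

text \<open>Apply the counit to the factor that \<open>coord_coact\<close> leaves over. The
  functional \<open>f\<close> is arbitrary, so the coaction determines the coordinate times
  \<open>gl k\<close>, and any nonzero value of a functional there certifies a nonzero
  contraction.\<close>

lemma eps_coord_coact:
  assumes f: "functional H f" and k: "k \<in> F" and t: "t \<in> carrier CE"
  shows "\<epsilon> (coord k (lcon CE f (coact Sm t))) = f (coord k t \<otimes>\<^bsub>H\<^esub> gl k)"
proof -
  note ct = coord_closed[OF t]
  show ?thesis
    unfolding coord_coact[OF f k t]
      lcon_rcon[OF mH mH lin_comp[OF right_mult_linear[OF H_alg gl_closed[OF F_G[OF k]]] f] eps_functional
        Delta_closed[OF ct]] counit_right[OF ct] by (rule refl)
qed

subsection \<open>Grading\<close>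

abbreviation "grS \<equiv> smash_grading R H grH K \<pi> E"

lemma grS_eq: "grS n = tensor_sub R HC E (grH n \<inter> C) (carrier E)"
  by (simp add: smash_grading_def Let_def)

lemma grS_submodule: "submodule (grS n) R CE"
  unfolding grS_eq by (rule tensor_sub_submodule[OF mHC mE]) auto

lemma pt_grS: "a \<in> grH n \<Longrightarrow> a \<in> C \<Longrightarrow> g \<in> F \<Longrightarrow> pt a g \<in> grS n"
  unfolding grS_eq pt_def by (rule tensor_subI[OF mHC mE]) (simp_all add: basis_E)

lemma coord_grS:
  assumes t: "t \<in> grS n" shows "coord k t \<in> grH n"
proof -
  have "grS n \<subseteq> {t \<in> carrier CE. coord k t \<in> grH n}"
    unfolding grS_eq tensor_sub_def
  proof (rule gen_submodule_least[OF submodule_vimage[OF mCE mH coord_linear gr_submodule[OF mH grad_H]]], rule subsetI)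
    fix x assume "x \<in> {ptensor R HC E u w |u w. u \<in> grH n \<inter> C \<and> w \<in> carrier E}"
    then obtain u w where x: "x = ptensor R HC E u w" "u \<in> grH n" "u \<in> C" "w \<in> carrier E" by auto
    have uH: "u \<in> carrier HC" using x(3) by simp
    have "coord k x = w k \<odot>\<^bsub>H\<^esub> u"
      using rcon_ptensor[OF mHC mE ev_functional uH x(4), of k] by (simp add: coord_def x(1))
    also have "\<dots> \<in> grH n"
      using submoduleD(4)[OF gr_submodule[OF mH grad_H] _ x(2), of "w k"] functional_closed[OF ev_functional x(4)] by simp
    finally show "x \<in> {t \<in> carrier CE. coord k t \<in> grH n}"
      using ptensor_closed[OF mHC mE uH x(4)] x(1) by simp
  qed
  then show ?thesis using t by auto
qed

end

context field begin

text \<open>Values of \<open>sweedler\<close> depend only on the vector space fields of the record.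
  With \<open>tensor_cong_fields\<close> this carries results on the bare tensor product over to the
  smash product and its subalgebras.\<close>

lemma sweedler_cong_fields:
  assumes "carrier W = carrier V" "add W = add V" "zero W = zero V" "smult W = smult V"
  shows "sweedler R W t \<phi> = sweedler R V t \<phi>"
  using assms by (simp add: sweedler_def lin_ext_def finsum_def finprod_def)

lemma tensor_cong_fields:
  assumes "carrier B' = carrier B" "add B' = add B" "smult B' = smult B"
  shows "ptensor R A B' = ptensor R A B" "carrier (tensor R A B') = carrier (tensor R A B)"
    "add (tensor R A B') = add (tensor R A B)" "zero (tensor R A B') = zero (tensor R A B)"
    "smult (tensor R A B') = smult (tensor R A B)"
  using assms by (simp_all add: tensor_def tensor_space_def ptensor_def[abs_def] tensor_relations_def)

end

context graded_hopf_cocycle begin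

lemma Sm_tensor_fields:
  "ptensor R H Sm = ptensor R H CE" "carrier (tensor R H Sm) = carrier H_CE"
  "add (tensor R H Sm) = add H_CE" "zero (tensor R H Sm) = zero H_CE"
  "smult (tensor R H Sm) = smult H_CE"
  by (rule tensor_cong_fields; simp add: smash_simps)+

lemma lcon_Sm: "lcon Sm f t = lcon CE f t"
  using sweedler_cong_fields[of Sm CE t "\<lambda>a b. f a \<odot>\<^bsub>CE\<^esub> b"] by (simp add: lcon_def smash_simps)

lemma coactSm_linear: "linear_map R Sm (tensor R H Sm) (coact Sm)"
  using coactA_linear by (simp add: linear_map_def smash_simps(1-4) Sm_tensor_fields)

lemma pt_one_mult:
  assumes g: "g \<in> F" and h: "h \<in> F"
  shows "pt \<one>\<^bsub>H\<^esub> g \<otimes>\<^bsub>Sm\<^esub> pt \<one>\<^bsub>H\<^esub> h = \<psi> g h \<odot>\<^bsub>CE\<^esub> pt \<one>\<^bsub>H\<^esub> (g \<otimes>\<^bsub>G\<^esub> h)"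
proof -
  note gG = F_G[OF g]
  note gc = gl_closed[OF gG]
  have "\<one>\<^bsub>H\<^esub> \<otimes>\<^bsub>H\<^esub> gl g \<otimes>\<^bsub>H\<^esub> \<one>\<^bsub>H\<^esub> \<otimes>\<^bsub>H\<^esub> gl (inv\<^bsub>G\<^esub> g) = \<one>\<^bsub>H\<^esub>"
    using gc by (simp add: alg_l_one[OF H_alg] alg_r_one[OF H_alg] gl_mult[OF gG G_simps(2)[OF gG]] G_simps(7)[OF gG] gl_one)
  then show ?thesis using Sm_mult_pt[OF one_C one_C g h] by simp
qed

definition "ug g = pt \<one>\<^bsub>H\<^esub> g"

lemma ug_closed: "g \<in> F \<Longrightarrow> ug g \<in> carrier CE"
  unfolding ug_def by (rule pt_closed[OF one_C])

lemma coord_ug: "g \<in> F \<Longrightarrow> coord k (ug g) = (if k = g then \<one>\<^bsub>H\<^esub> else \<zero>\<^bsub>H\<^esub>)"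
  unfolding ug_def by (rule coord_pt[OF one_C])

lemma eps_one: "\<epsilon> \<one>\<^bsub>H\<^esub> = \<one>"
  using eps_gl[OF G_simps(1)] by (simp add: gl_one)

lemma ug_one_nonzero: "ug \<one>\<^bsub>G\<^esub> \<noteq> \<zero>\<^bsub>CE\<^esub>"
proof
  assume "ug \<one>\<^bsub>G\<^esub> = \<zero>\<^bsub>CE\<^esub>"
  then have "\<one>\<^bsub>H\<^esub> = \<zero>\<^bsub>H\<^esub>" using coord_ug[OF F_one, of "\<one>\<^bsub>G\<^esub>"] lin_zero[OF mCE mH coord_linear, of "\<one>\<^bsub>G\<^esub>"] by simp
  then show False using eps_one functional_zero[OF mH eps_functional] by simp
qed

lemma smult_ug_mult:
  assumes c: "c \<in> carrier R" and d: "d \<in> carrier R" and g: "g \<in> F" and h: "h \<in> F"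
  shows "(c \<odot>\<^bsub>CE\<^esub> ug g) \<otimes>\<^bsub>Sm\<^esub> (d \<odot>\<^bsub>CE\<^esub> ug h) = (c \<otimes> d \<otimes> \<psi> g h) \<odot>\<^bsub>CE\<^esub> ug (g \<otimes>\<^bsub>G\<^esub> h)"
proof -
  note ugc = ug_closed[OF g] and uhc = ug_closed[OF h] and ughc = ug_closed[OF F_mult[OF g h]]
  note p = psi_closed[OF g h]
  have dh: "d \<odot>\<^bsub>CE\<^esub> ug h \<in> carrier CE" by (rule mod_smult[OF mCE d uhc])
  have "(c \<odot>\<^bsub>CE\<^esub> ug g) \<otimes>\<^bsub>Sm\<^esub> (d \<odot>\<^bsub>CE\<^esub> ug h) = c \<odot>\<^bsub>CE\<^esub> (d \<odot>\<^bsub>CE\<^esub> (ug g \<otimes>\<^bsub>Sm\<^esub> ug h))"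
    unfolding lin_smult[OF Sm_mult_left[OF dh] c ugc] lin_smult[OF Sm_mult_right[OF ugc] d uhc] by (rule refl)
  also have "\<dots> = (c \<otimes> d \<otimes> \<psi> g h) \<odot>\<^bsub>CE\<^esub> ug (g \<otimes>\<^bsub>G\<^esub> h)"
    unfolding ug_def pt_one_mult[OF g h]
    using mod_smult_smult[OF mCE c d mod_smult[OF mCE p ughc]] mod_smult_smult[OF mCE m_closed[OF c d] p ughc]
    by (simp add: ug_def)
  finally show ?thesis .
qed

end

locale graded_comod_cocycle = graded_comod R H grH G \<iota> L grL + graded_hopf_cocycle R H grH G \<iota> F \<psi>
  for R :: "('a, 'b) ring_scheme" (structure) and H :: "('a, 'h) hopf" and grH :: "nat \<Rightarrow> 'h set"
    and G :: "('g, 's) monoid_scheme" and \<iota> :: "('g \<Rightarrow> 'a) \<Rightarrow> 'h"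
    and L :: "('a, 'h, 'l) comod_alg" and grL :: "nat \<Rightarrow> 'l set"
    and F :: "'g set" and \<psi> :: "'g \<Rightarrow> 'g \<Rightarrow> 'a"
begin

abbreviation "SM M \<equiv> sub_comod_alg R H Sm M"

lemma SM_fields:
  "carrier (SM M) = M" "add (SM M) = add CE" "zero (SM M) = zero CE" "smult (SM M) = smult CE"
  "mult (SM M) = mult Sm" "one (SM M) = one Sm" "coact (SM M) x = corestrict R H Sm M (coact Sm x)"
  by (simp_all add: sub_comod_alg_def smash_simps(2-4))

lemma SM_module:
  assumes "submodule M R Sm" shows "module R (SM M)"
  by (rule module_cong_fields[OF submodule_module[OF mSm assms]]) (simp_all add: SM_fields smash_simps(2-4))

lemma SM_tensor_fields:
  "ptensor R H (SM M) = ptensor R H (Sm\<lparr>carrier := M\<rparr>)" "carrier (tensor R H (SM M)) = carrier (tensor R H (Sm\<lparr>carrier := M\<rparr>))"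
  "add (tensor R H (SM M)) = add (tensor R H (Sm\<lparr>carrier := M\<rparr>))"
  "zero (tensor R H (SM M)) = zero (tensor R H (Sm\<lparr>carrier := M\<rparr>))"
  "smult (tensor R H (SM M)) = smult (tensor R H (Sm\<lparr>carrier := M\<rparr>))"
  by (rule tensor_cong_fields; simp add: SM_fields smash_simps(2-4))+

lemma lcon_SM: "lcon (SM M) f t = lcon (Sm\<lparr>carrier := M\<rparr>) f t"
  unfolding lcon_def
  using sweedler_cong_fields[of "SM M" "Sm\<lparr>carrier := M\<rparr>" t "\<lambda>a b. f a \<odot>\<^bsub>CE\<^esub> b"]
  by (simp add: SM_fields smash_simps(2-4))

lemma submodule_SmI: "submodule M R Sm \<longleftrightarrow> submodule M R CE"
proof -
  have "submodule M R CE" if M: "submodule M R Sm"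
    by (rule submodule_intro[OF mCE]) (use submoduleD[OF M] in \<open>simp_all add: smash_simps(1-4)\<close>)
  moreover have "submodule M R Sm" if M: "submodule M R CE"
    by (rule submodule_intro[OF mSm]) (use submoduleD[OF M] in \<open>simp_all add: smash_simps(1-4)\<close>)
  ultimately show ?thesis by blast
qed

text \<open>Contracting by all functionals separates tensors and undoes the corestriction in the
  coaction of the subalgebra, so being a comodule map means commuting with
  \<open>act\<close>.\<close>

lemma comodule_map_iff:
  assumes M: "submodule M R Sm" and j: "linear_map R L (SM M) j" and l: "l \<in> carrier L"
    and sub: "coact Sm (j l) \<in> tensor_sub R H Sm (carrier H) M"
  shows "coact (SM M) (j l) = sweedler R (tensor R H (SM M)) (\<rho> l) (\<lambda>x m. ptensor R H (SM M) x (j m)) \<longleftrightarrow>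
    (\<forall>f. functional H f \<longrightarrow> lcon CE f (coact Sm (j l)) = j (act f l))"
proof -
  have eq: "sweedler R (tensor R H (SM M)) (\<rho> l) (\<lambda>x m. ptensor R H (SM M) x (j m)) = tmap H (SM M) (\<lambda>x. x) j (\<rho> l)"
    by (simp add: tmap_def)
  note mSM = SM_module[OF M]
  have c1: "coact (SM M) (j l) \<in> carrier (tensor R H (SM M))"
    unfolding SM_fields SM_tensor_fields by (rule corestrict_props(1)[OF mH mSm M sub])
  note c2 = tmap_closed[OF mH mSM mH mL lin_id j rho_closed[OF l]]
  have l1: "lcon (SM M) f (coact (SM M) (j l)) = lcon CE f (coact Sm (j l))" if f: "functional H f" for f
    unfolding lcon_SM SM_fields lcon_corestrict[OF mH mSm M f sub] by (rule lcon_Sm)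
  have l2: "lcon (SM M) f (tmap H (SM M) (\<lambda>x. x) j (\<rho> l)) = j (act f l)" if f: "functional H f" for f
    unfolding lcon_tmap[OF mH mSM mH mL lin_id j f rho_closed[OF l]] by (simp add: act_def)
  show ?thesis unfolding eq
  proof
    assume "coact (SM M) (j l) = tmap H (SM M) (\<lambda>x. x) j (\<rho> l)"
    then show "\<forall>f. functional H f \<longrightarrow> lcon CE f (coact Sm (j l)) = j (act f l)"
      using l1 l2 by metis
  next
    assume *: "\<forall>f. functional H f \<longrightarrow> lcon CE f (coact Sm (j l)) = j (act f l)"
    show "coact (SM M) (j l) = tmap H (SM M) (\<lambda>x. x) j (\<rho> l)"
      by (rule tensor_eqI[OF mH mSM c1 c2]) (use * l1 l2 in simp)
  qed
qed

section \<open>Comodule subalgebras of the smash product are simple\<close>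

context
  fixes M j
  assumes M: "graded_comodule_subalgebra R H Sm grS M"
    and iso: "graded_comod_alg_iso R H L grL (SM M) (\<lambda>n. M \<inter> grS n) j"
begin

lemma M_submodule: "submodule M R Sm"
  using M by (simp add: graded_comodule_subalgebra_def subcomodule_def)

lemma M_coact: "x \<in> M \<Longrightarrow> coact Sm x \<in> tensor_sub R H Sm (carrier H) M"
  using M by (simp add: graded_comodule_subalgebra_def subcomodule_def)

lemma j_linear_SM: "linear_map R L (SM M) j"
  using iso by (simp add: graded_comod_alg_iso_def alg_hom_def)

lemma j_M: "l \<in> carrier L \<Longrightarrow> j l \<in> M"
  using lin_closed[OF j_linear_SM, of l] by (simp add: SM_fields)

lemma j_linear: "linear_map R L CE j"
  using j_linear_SM j_M submoduleD(1)[OF M_submodule]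
  by (auto simp: linear_map_def SM_fields smash_simps(1))

lemmas j_closed = lin_closed[OF j_linear]

lemma j_mult: "x \<in> carrier L \<Longrightarrow> y \<in> carrier L \<Longrightarrow> j (x \<otimes>\<^bsub>L\<^esub> y) = j x \<otimes>\<^bsub>Sm\<^esub> j y"
  using iso by (simp add: graded_comod_alg_iso_def alg_hom_def ring_hom_def SM_fields)

lemma j_one: "j \<one>\<^bsub>L\<^esub> = ug \<one>\<^bsub>G\<^esub>"
  using iso by (simp add: graded_comod_alg_iso_def alg_hom_def ring_hom_def SM_fields smash_one ug_def)

lemma j_inj: "inj_on j (carrier L)"
  using iso by (simp add: graded_comod_alg_iso_def bij_betw_def)

lemma j_graded:
  assumes x: "x \<in> grL n" shows "j x \<in> grS n"
proof -
  have "j ` grL n = M \<inter> grS n" using iso by (simp add: graded_comod_alg_iso_def)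
  then show ?thesis using imageI[OF x, of j] by blast
qed

lemma j_coact:
  assumes l: "l \<in> carrier L" and f: "functional H f"
  shows "lcon CE f (coact Sm (j l)) = j (act f l)"
  using comodule_map_iff[OF M_submodule j_linear_SM l M_coact[OF j_M[OF l]]] iso l f
  by (simp add: graded_comod_alg_iso_def)

lemma j_zeroD: "x \<in> carrier L \<Longrightarrow> j x = \<zero>\<^bsub>CE\<^esub> \<Longrightarrow> x = \<zero>\<^bsub>L\<^esub>"
  using inj_onD[OF j_inj, of x "\<zero>\<^bsub>L\<^esub>"] lin_zero[OF mL mCE j_linear] mL by simp

text \<open>For every \<open>f\<close>, \<open>eps_coord_coact\<close> evaluates \<open>f\<close> at
  the coordinate times g as f(k) times the counit of the coordinate. Hence the coordinate is a
  scalar multiple of k g^-1. It is also coinvariant, which forces either the scalar to vanish or k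
  g^-1 to be neutral.\<close>

lemma coord_gdeg:
  assumes k: "k \<in> carrier G" and x: "gdeg k x" and g: "g \<in> F"
  shows "coord g (j x) = (if g = k then \<epsilon> (coord g (j x)) \<odot>\<^bsub>H\<^esub> \<one>\<^bsub>H\<^esub> else \<zero>\<^bsub>H\<^esub>)"
proof -
  note xc = gdeg_closed[OF x] and gG = F_G[OF g]
  note jx = j_closed[OF xc]
  note ac = coord_closed[OF jx, of g]
  note e = functional_closed[OF eps_functional ac]
  note kg = G_simps(3)[OF k G_simps(2)[OF gG]]
  have "coord g (j x) \<otimes>\<^bsub>H\<^esub> gl g = \<epsilon> (coord g (j x)) \<odot>\<^bsub>H\<^esub> gl k"
  proof (rule functional_eqI[OF mH H_closed[OF ac gl_closed[OF gG]] mod_smult[OF mH e gl_closed[OF k]]])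
    fix f assume f: "functional H f"
    note fk = functional_closed[OF f gl_closed[OF k]]
    have "f (coord g (j x) \<otimes>\<^bsub>H\<^esub> gl g) = \<epsilon> (coord g (j (f (gl k) \<odot>\<^bsub>L\<^esub> x)))"
      unfolding eps_coord_coact[OF f g jx, symmetric] j_coact[OF xc f] gdeg_act[OF x k f] by (rule refl)
    also have "\<dots> = f (gl k) \<otimes> \<epsilon> (coord g (j x))"
      unfolding lin_smult[OF j_linear fk xc] lin_smult[OF coord_linear fk jx] by (rule functional_smult[OF eps_functional fk ac])
    also have "\<dots> = f (\<epsilon> (coord g (j x)) \<odot>\<^bsub>H\<^esub> gl k)"
      unfolding functional_smult[OF f e gl_closed[OF k]] by (rule m_comm[OF fk e])
    finally show "f (coord g (j x) \<otimes>\<^bsub>H\<^esub> gl g) = f (\<epsilon> (coord g (j x)) \<odot>\<^bsub>H\<^esub> gl k)" .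
  qed
  then have "coord g (j x) \<otimes>\<^bsub>H\<^esub> gl g \<otimes>\<^bsub>H\<^esub> gl (inv\<^bsub>G\<^esub> g) = (\<epsilon> (coord g (j x)) \<odot>\<^bsub>H\<^esub> gl k) \<otimes>\<^bsub>H\<^esub> gl (inv\<^bsub>G\<^esub> g)"
    by simp
  then have a: "coord g (j x) = \<epsilon> (coord g (j x)) \<odot>\<^bsub>H\<^esub> gl (k \<otimes>\<^bsub>G\<^esub> inv\<^bsub>G\<^esub> g)"
    unfolding gl_inv_cancel(1)[OF gG ac]
      alg_smult_left[OF H_alg e gl_closed[OF k] gl_closed[OF G_simps(2)[OF gG]]] gl_mult[OF k G_simps(2)[OF gG]] .
  show ?thesis
  proof (cases "\<epsilon> (coord g (j x)) = \<zero>")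
    case True
    have "coord g (j x) = \<zero>\<^bsub>H\<^esub>"
      using a unfolding True using mod_zero_smult[OF mH gl_closed[OF kg]] by simp
    then show ?thesis unfolding True using mod_zero_smult[OF mH H_one] by simp
  next
    case False
    have "\<epsilon> (coord g (j x)) \<odot>\<^bsub>H\<^esub> gl (k \<otimes>\<^bsub>G\<^esub> inv\<^bsub>G\<^esub> g) \<in> C" using coord_C[OF jx, of g] a by simp
    then have "k \<otimes>\<^bsub>G\<^esub> inv\<^bsub>G\<^esub> g = \<one>\<^bsub>G\<^esub>" by (rule smult_gl_C[OF e False kg])
    then have "g = k" using G_shift(2)[OF gG G_simps(1) k] gG by (simp add: G_simps)
    then show ?thesis using a \<open>k \<otimes>\<^bsub>G\<^esub> inv\<^bsub>G\<^esub> g = \<one>\<^bsub>G\<^esub>\<close> by (simp add: gl_one)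
  qed
qed

lemma j_gdeg_zero:
  assumes k: "k \<in> carrier G" "k \<notin> F" and x: "gdeg k x" shows "x = \<zero>\<^bsub>L\<^esub>"
proof (rule j_zeroD[OF gdeg_closed[OF x]], rule CE_eqI[OF j_closed[OF gdeg_closed[OF x]] mod_zero[OF mCE]])
  fix g assume g: "g \<in> F"
  then have "g \<noteq> k" using k(2) by blast
  then show "coord g (j x) = coord g \<zero>\<^bsub>CE\<^esub>"
    using coord_gdeg[OF k(1) x g] lin_zero[OF mCE mH coord_linear] by simp
qed

text \<open>By \<open>coord_gdeg\<close> the coordinates away from \<open>k\<close> vanish and the
  one at \<open>k\<close> is a scalar. Thus the elements of group degree \<open>k\<close> form a
  space of dimension at most one.\<close>

lemma j_gdeg:
  assumes k: "k \<in> F" and x: "gdeg k x"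
  shows "j x = \<epsilon> (coord k (j x)) \<odot>\<^bsub>CE\<^esub> ug k" "\<epsilon> (coord k (j x)) \<in> carrier R"
proof -
  note jx = j_closed[OF gdeg_closed[OF x]]
  show e: "\<epsilon> (coord k (j x)) \<in> carrier R" by (rule functional_closed[OF eps_functional coord_closed[OF jx]])
  show "j x = \<epsilon> (coord k (j x)) \<odot>\<^bsub>CE\<^esub> ug k"
  proof (rule CE_eqI[OF jx mod_smult[OF mCE e ug_closed[OF k]]])
    fix g assume g: "g \<in> F"
    show "coord g (j x) = coord g (\<epsilon> (coord k (j x)) \<odot>\<^bsub>CE\<^esub> ug k)"
      unfolding lin_smult[OF coord_linear e ug_closed[OF k]] coord_ug[OF k]
      using coord_gdeg[OF F_G[OF k] x g] e mH by auto
  qed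
qed

lemma eq_smult_one:
  assumes x: "x \<in> carrier L" and c: "c \<in> carrier R" and jx: "j x = c \<odot>\<^bsub>CE\<^esub> ug \<one>\<^bsub>G\<^esub>"
  shows "x = c \<odot>\<^bsub>L\<^esub> \<one>\<^bsub>L\<^esub>"
  by (rule inj_onD[OF j_inj _ x mod_smult[OF mL c L_one]])
    (simp only: lin_smult[OF j_linear c L_one] j_one jx)

text \<open>Coinvariants are the elements whose group degree is neutral, and the image of such an
  element is a multiple of the unit of the smash product, which is the image of the unit of
  \<open>L\<close>.\<close>

lemma coinvariants_trivial: "coinvariants R H L = {c \<odot>\<^bsub>L\<^esub> \<one>\<^bsub>L\<^esub> | c. c \<in> carrier R}"
proof
  show "coinvariants R H L \<subseteq> {c \<odot>\<^bsub>L\<^esub> \<one>\<^bsub>L\<^esub> | c. c \<in> carrier R}"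
  proof
    fix x assume "x \<in> coinvariants R H L"
    then have x: "gdeg \<one>\<^bsub>G\<^esub> x" by (simp add: gdeg_one_iff)
    show "x \<in> {c \<odot>\<^bsub>L\<^esub> \<one>\<^bsub>L\<^esub> | c. c \<in> carrier R}"
      using eq_smult_one[OF gdeg_closed[OF x] j_gdeg(2,1)[OF F_one x]] j_gdeg(2)[OF F_one x] by blast
  qed
  show "{c \<odot>\<^bsub>L\<^esub> \<one>\<^bsub>L\<^esub> | c. c \<in> carrier R} \<subseteq> coinvariants R H L"
    using gdeg_smult[OF gdeg_one_one G_simps(1)] by (auto simp: gdeg_one_iff)
qed

text \<open>Contracting a nonzero element of \<open>I\<close> by a functional concentrated in its top degree gives
  a nonzero element of degree zero.\<close>

lemma ideal_degree_zero:
  assumes I: "subcomodule R H L I" and s: "s \<in> I" "s \<noteq> \<zero>\<^bsub>L\<^esub>"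
  shows "\<exists>l\<in>I. l \<in> grL 0 \<and> l \<noteq> \<zero>\<^bsub>L\<^esub>"
proof -
  have I': "submodule I R L" "\<And>x f. x \<in> I \<Longrightarrow> functional H f \<Longrightarrow> act f x \<in> I"
    using I by (simp_all add: subcomodule_L)
  have sc: "s \<in> carrier L" by (rule submoduleD(1)[OF I'(1) s(1)])
  let ?S = "{n. component L grL n s \<noteq> \<zero>\<^bsub>L\<^esub>}"
  have S: "finite ?S" "?S \<noteq> {}"
    using component_finite[OF mL grad_L sc] component_zeroD[OF mL grad_L sc] s(2) by auto
  define N where "N = Max ?S"
  have N: "N \<in> ?S" "\<And>n. n \<in> ?S \<Longrightarrow> n \<le> N" using Max_in[OF S] Max_ge[OF S(1)] by (simp_all add: N_def)
  define u where "u = component L grL N s"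
  have u: "u \<in> grL N" "u \<noteq> \<zero>\<^bsub>L\<^esub>" using component_mem[OF mL grad_L sc] N(1) by (auto simp: u_def)
  have uc: "u \<in> carrier L" by (rule gr_closed[OF mL grad_L u(1)])
  have "\<exists>g\<in>F. coord g (j u) \<noteq> \<zero>\<^bsub>H\<^esub>"
  proof (rule ccontr)
    assume "\<not> (\<exists>g\<in>F. coord g (j u) \<noteq> \<zero>\<^bsub>H\<^esub>)"
    then have "j u = \<zero>\<^bsub>CE\<^esub>"
      using lin_zero[OF mCE mH coord_linear] by (intro CE_eqI[OF j_closed[OF uc] mod_zero[OF mCE]]) simp
    then show False using j_zeroD[OF uc] u(2) by blast
  qed
  then obtain g where g: "g \<in> F" "coord g (j u) \<noteq> \<zero>\<^bsub>H\<^esub>" by blast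
  \<comment> \<open>By \<open>eps_coord_coact\<close> a functional sees the coordinate only after
    multiplication by \<open>gl g\<close>, so it is chosen on \<open>?b\<close>. This is nonzero
    because \<open>gl g\<close> is invertible.\<close>
  let ?b = "coord g (j u) \<otimes>\<^bsub>H\<^esub> gl g"
  note gG = F_G[OF g(1)]
  note ac = coord_closed[OF j_closed[OF uc], of g]
  note bc = H_closed[OF ac gl_closed[OF gG]]
  have bN: "?b \<in> grH N" using gr_mult[OF coord_grS[OF j_graded[OF u(1)]] gl_degree[OF gG]] by simp
  have "?b \<noteq> \<zero>\<^bsub>H\<^esub>"
  proof
    assume "?b = \<zero>\<^bsub>H\<^esub>"
    then have "coord g (j u) = \<zero>\<^bsub>H\<^esub>"
      using gl_inv_cancel(1)[OF gG ac] alg_zero_left[OF H_alg gl_closed[OF G_simps(2)[OF gG]]] by simp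
    then show False using g(2) by blast
  qed
  then have "?b \<notin> {\<zero>\<^bsub>H\<^esub>}" by simp
  from functional_separation[OF mH submodule_zero[OF mH] bc this]
  obtain f0 where f0: "functional H f0" "f0 ?b = \<one>" by auto
  \<comment> \<open>Composing with the projection to degree \<open>N\<close> keeps the value at
    \<open>?b\<close>, which has degree \<open>N\<close>, and makes \<open>f\<close> vanish in all
    other degrees.\<close>
  define f where "f x = f0 (component H grH N x)" for x
  have f: "functional H f" unfolding f_def[abs_def] by (rule lin_comp[OF component_linear[OF mH grad_H] f0(1)])
  have fz: "f v = \<zero>" if "n \<noteq> N" "v \<in> grH n" for n v
    using component_homogeneous[OF mH grad_H that(2), of N] that(1) functional_zero[OF mH f0(1)] by (simp add: f_def)
  have fb: "f ?b = \<one>" using component_homogeneous[OF mH grad_H bN, of N] f0(2) by (simp add: f_def)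
  have "act f s = act f (finsum L (\<lambda>n. component L grL n s) ?S)"
    using component_sum[OF mL grad_L sc] by simp
  also have "\<dots> = finsum L (\<lambda>n. act f (component L grL n s)) ?S"
    by (rule lin_finsum[OF mL mL act_linear[OF f] component_closed[OF mL grad_L sc]])
  also have "\<dots> = act f u"
  proof (rule mod_finsum_single[OF mL S(1) N(1) act_closed[OF f uc]])
    fix n assume n: "n \<in> ?S" "n \<noteq> N"
    then have "n < N" using N(2)[OF n(1)] by simp
    from act_low_degree[OF f fz component_mem[OF mL grad_L sc] this]
    show "act f (component L grL n s) = \<zero>\<^bsub>L\<^esub>" by simp
  qed (simp add: u_def)
  finally have su: "act f s = act f u" .
  have "act f u \<in> grL 0" using act_graded[OF f fz, where l = u and n = 0] u(1) by simp
  moreover have "act f u \<noteq> \<zero>\<^bsub>L\<^esub>"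
  proof
    assume z: "act f u = \<zero>\<^bsub>L\<^esub>"
    have "f ?b = \<epsilon> (coord g (j (act f u)))"
      unfolding eps_coord_coact[OF f g(1) j_closed[OF uc], symmetric] j_coact[OF uc f] by (rule refl)
    also have "\<dots> = \<zero>"
      unfolding z lin_zero[OF mL mCE j_linear] lin_zero[OF mCE mH coord_linear] by (rule functional_zero[OF mH eps_functional])
    finally show False using fb by simp
  qed
  moreover have "act f u \<in> I" using I'(2)[OF s(1) f] su by simp
  ultimately show ?thesis by blast
qed

text \<open>Each further factor \<open>x\<close> multiplies the scalar by \<open>c\<close> and by a
  cocycle value, both nonzero. The powers are formed in \<open>L\<close> itself, so the inverse that
  finiteness of \<open>G\<close> yields stays inside the subalgebra.\<close>

lemma power_preimage:
  assumes k: "k \<in> F" and x: "x \<in> carrier L" and jx: "j x = c \<odot>\<^bsub>CE\<^esub> ug k" and c: "c \<in> carrier R" "c \<noteq> \<zero>"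
  shows "\<exists>y\<in>carrier L. \<exists>d\<in>carrier R. d \<noteq> \<zero> \<and> k [^]\<^bsub>G\<^esub> n \<in> F \<and> j y = d \<odot>\<^bsub>CE\<^esub> ug (k [^]\<^bsub>G\<^esub> (n::nat))"
proof (induction n)
  case 0
  have "j \<one>\<^bsub>L\<^esub> = \<one> \<odot>\<^bsub>CE\<^esub> ug \<one>\<^bsub>G\<^esub>" using mod_one_smult[OF mCE ug_closed[OF F_one]] j_one by simp
  then show ?case using L_one F_one by (intro bexI[of _ "\<one>\<^bsub>L\<^esub>"] bexI[of _ \<one>]) simp_all
next
  case (Suc n)
  then obtain y d where y: "y \<in> carrier L" and d: "d \<in> carrier R" "d \<noteq> \<zero>" and kn: "k [^]\<^bsub>G\<^esub> n \<in> F"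
    and jy: "j y = d \<odot>\<^bsub>CE\<^esub> ug (k [^]\<^bsub>G\<^esub> n)" by blast
  note p = psi_unit[OF kn k]
  have "j (y \<otimes>\<^bsub>L\<^esub> x) = (d \<otimes> c \<otimes> \<psi> (k [^]\<^bsub>G\<^esub> n) k) \<odot>\<^bsub>CE\<^esub> ug (k [^]\<^bsub>G\<^esub> n \<otimes>\<^bsub>G\<^esub> k)"
    unfolding j_mult[OF y x] jy jx by (rule smult_ug_mult[OF d(1) c(1) kn k])
  moreover have "d \<otimes> c \<otimes> \<psi> (k [^]\<^bsub>G\<^esub> n) k \<in> carrier R" "d \<otimes> c \<otimes> \<psi> (k [^]\<^bsub>G\<^esub> n) k \<noteq> \<zero>"
    using d c p integral[of "d \<otimes> c" "\<psi> (k [^]\<^bsub>G\<^esub> n) k"] integral[of d c] by auto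
  ultimately show ?case using L_closed[OF y x] F_mult[OF kn k]
    by (intro bexI[of _ "y \<otimes>\<^bsub>L\<^esub> x"] bexI[of _ "d \<otimes> c \<otimes> \<psi> (k [^]\<^bsub>G\<^esub> n) k"]) (simp_all add: nat_pow_def)
qed

lemma H_simple: "right_H_simple R H L"
  unfolding right_H_simple_def
proof (intro conjI allI impI)
  have "\<one>\<^bsub>L\<^esub> \<noteq> \<zero>\<^bsub>L\<^esub>" using j_one ug_one_nonzero lin_zero[OF mL mCE j_linear] by auto
  then show "carrier L \<noteq> {\<zero>\<^bsub>L\<^esub>}" using L_one by auto
  fix I assume I: "subcomodule R H L I \<and> (\<forall>x\<in>I. \<forall>a\<in>carrier L. x \<otimes>\<^bsub>L\<^esub> a \<in> I)"
  have I': "submodule I R L" "\<And>x f. x \<in> I \<Longrightarrow> functional H f \<Longrightarrow> act f x \<in> I"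
    using I by (simp_all add: subcomodule_L)
  show "I = {\<zero>\<^bsub>L\<^esub>} \<or> I = carrier L"
  proof (cases "I \<subseteq> {\<zero>\<^bsub>L\<^esub>}")
    case True
    then show ?thesis using submoduleD(2)[OF I'(1)] by blast
  next
    case False
    then obtain s where "s \<in> I" "s \<noteq> \<zero>\<^bsub>L\<^esub>" by blast
    then obtain l where l: "l \<in> I" "l \<in> grL 0" "l \<noteq> \<zero>\<^bsub>L\<^esub>"
      using ideal_degree_zero[OF conjunct1[OF I]] by blast
    have lc: "l \<in> carrier L" by (rule submoduleD(1)[OF I'(1) l(1)])
    \<comment> \<open>The weight components of \<open>l\<close> add up to \<open>l\<close>, so one
      of them is nonzero; it lies in \<open>I\<close> because \<open>I\<close> is stable under
      functionals.\<close>
    have "\<exists>k\<in>carrier G. act (ec k) l \<noteq> \<zero>\<^bsub>L\<^esub>"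
    proof (rule ccontr)
      assume "\<not> (\<exists>k\<in>carrier G. act (ec k) l \<noteq> \<zero>\<^bsub>L\<^esub>)"
      then have "finsum L (\<lambda>k. act (ec k) l) (carrier G) = \<zero>\<^bsub>L\<^esub>" by (intro mod_finsum_zero[OF mL]) blast
      then show False using act_ec_sum[OF lc] l(3) by simp
    qed
    then obtain k where k: "k \<in> carrier G" "act (ec k) l \<noteq> \<zero>\<^bsub>L\<^esub>" by blast
    define x where "x = act (ec k) l"
    have x: "gdeg k x" "x \<in> I" "x \<noteq> \<zero>\<^bsub>L\<^esub>" "x \<in> carrier L"
      using gdeg_act_ec[OF k(1) l(2)] I'(2)[OF l(1) ec_functional] k(2) act_closed[OF ec_functional lc] by (simp_all add: x_def)
    have kF: "k \<in> F" using j_gdeg_zero[OF k(1) _ x(1)] x(3) by blast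
    define c where "c = \<epsilon> (coord k (j x))"
    have c: "j x = c \<odot>\<^bsub>CE\<^esub> ug k" "c \<in> carrier R" using j_gdeg[OF kF x(1)] by (simp_all add: c_def)
    have c0: "c \<noteq> \<zero>"
    proof
      assume "c = \<zero>"
      then have "j x = \<zero>\<^bsub>CE\<^esub>" using c(1) mod_zero_smult[OF mCE ug_closed[OF kF]] by simp
      then show False using j_zeroD[OF x(4)] x(3) by blast
    qed
    interpret G: group G by (rule group_G)
    have "\<not> inj (\<lambda>n::nat. k [^]\<^bsub>G\<^esub> n)"
    proof
      assume "inj (\<lambda>n::nat. k [^]\<^bsub>G\<^esub> n)"
      moreover have "range (\<lambda>n::nat. k [^]\<^bsub>G\<^esub> n) \<subseteq> carrier G" using k(1) by auto
      ultimately show False using finite_subset[OF _ finite_G] finite_imageD by blast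
    qed
    then obtain a b :: nat where ab: "a < b" "k [^]\<^bsub>G\<^esub> b = k [^]\<^bsub>G\<^esub> a"
      unfolding inj_def by (metis linorder_neqE_nat)
    \<comment> \<open>Two powers of \<open>k\<close> coincide since \<open>G\<close> is finite. The
      power with exponent \<open>b - a\<close> is then neutral, and the exponent one smaller gives
      the inverse of \<open>k\<close>; both subtractions are exact because
      \<open>a < b\<close>.\<close>
    define m where "m = b - a - 1"
    have "k [^]\<^bsub>G\<^esub> (b - a) = \<one>\<^bsub>G\<^esub>" using G.pow_eq_div2[OF k(1) ab(2)] .
    moreover have "b - a = Suc m" using ab(1) by (simp add: m_def)
    ultimately have km: "k \<otimes>\<^bsub>G\<^esub> k [^]\<^bsub>G\<^esub> m = \<one>\<^bsub>G\<^esub>"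
      using G.nat_pow_Suc2[OF k(1), of m] by simp
    obtain y d where y: "y \<in> carrier L" and d: "d \<in> carrier R" "d \<noteq> \<zero>" and kn: "k [^]\<^bsub>G\<^esub> m \<in> F"
      and jy: "j y = d \<odot>\<^bsub>CE\<^esub> ug (k [^]\<^bsub>G\<^esub> m)" using power_preimage[OF kF x(4) c c0, of m] by blast
    note p = psi_unit[OF kF kn]
    \<comment> \<open>The scalar collects the two coefficients and the cocycle value of the product;
      it is nonzero, so a unit multiple of the identity of \<open>L\<close> lies in the
      ideal.\<close>
    define e where "e = c \<otimes> d \<otimes> \<psi> k (k [^]\<^bsub>G\<^esub> m)"
    have e: "e \<in> carrier R" "e \<noteq> \<zero>"
      using d c(2) c0 p integral[of "c \<otimes> d" "\<psi> k (k [^]\<^bsub>G\<^esub> m)"] integral[of c d] by (auto simp: e_def)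
    have "j (x \<otimes>\<^bsub>L\<^esub> y) = e \<odot>\<^bsub>CE\<^esub> ug \<one>\<^bsub>G\<^esub>"
      unfolding j_mult[OF x(4) y] jy c(1) smult_ug_mult[OF c(2) d(1) kF kn] km e_def by (rule refl)
    then have xy: "x \<otimes>\<^bsub>L\<^esub> y = e \<odot>\<^bsub>L\<^esub> \<one>\<^bsub>L\<^esub>" by (rule eq_smult_one[OF L_closed[OF x(4) y] e(1)])
    have "x \<otimes>\<^bsub>L\<^esub> y \<in> I" using I x(2) y by simp
    then have eI: "e \<odot>\<^bsub>L\<^esub> \<one>\<^bsub>L\<^esub> \<in> I" using xy by simp
    have ie: "inv e \<in> carrier R" "inv e \<otimes> e = \<one>" using e field_Units by auto
    have "inv e \<odot>\<^bsub>L\<^esub> (e \<odot>\<^bsub>L\<^esub> \<one>\<^bsub>L\<^esub>) = \<one>\<^bsub>L\<^esub>"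
      unfolding mod_smult_smult[OF mL ie(1) e(1) L_one, symmetric] ie(2) by (rule mod_one_smult[OF mL L_one])
    then have oneI: "\<one>\<^bsub>L\<^esub> \<in> I" using submoduleD(4)[OF I'(1) ie(1) eI] by simp
    have "carrier L \<subseteq> I"
    proof
      fix a assume a: "a \<in> carrier L"
      have "\<one>\<^bsub>L\<^esub> \<otimes>\<^bsub>L\<^esub> a \<in> I" using I oneI a by blast
      then show "a \<in> I" using alg_l_one[OF L_alg a] by simp
    qed
    then show ?thesis using submoduleD(1)[OF I'(1)] by blast
  qed
qed

end

end

context field begin

lemma mod_smult_cancel:
  assumes V: "module R V" and c: "c \<in> carrier R" "d \<in> carrier R" and x: "x \<in> carrier V" "x \<noteq> \<zero>\<^bsub>V\<^esub>"
    and eq: "c \<odot>\<^bsub>V\<^esub> x = d \<odot>\<^bsub>V\<^esub> x"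
  shows "c = d"
proof -
  let ?e = "c \<ominus> d"
  have e: "?e \<in> carrier R" "?e \<oplus> d = c" using c by (simp_all add: a_minus_def a_assoc l_neg)
  have "?e \<odot>\<^bsub>V\<^esub> x \<oplus>\<^bsub>V\<^esub> d \<odot>\<^bsub>V\<^esub> x = \<zero>\<^bsub>V\<^esub> \<oplus>\<^bsub>V\<^esub> d \<odot>\<^bsub>V\<^esub> x"
    unfolding mod_add_smult[OF V e(1) c(2) x(1), symmetric] e(2) eq
    using mod_zero_add[OF V mod_smult[OF V c(2) x(1)]] by simp
  from mod_add_right_cancel[OF V mod_smult[OF V e(1) x(1)] mod_zero[OF V] mod_smult[OF V c(2) x(1)] this]
  have "?e = \<zero>" using mod_smult_eq_zeroD[OF V e(1) _ x(1)] x(2) by blast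
  then show ?thesis using e(2) c(2) by simp
qed

lemma graded_in_submodule:
  assumes V: "module R V" and gr: "grading R V gr" and N: "submodule N R V"
    and sub: "\<And>n u. u \<in> gr n \<Longrightarrow> u \<in> N" and v: "v \<in> carrier V"
  shows "v \<in> N"
proof -
  have "finsum V (\<lambda>n. component V gr n v) {n. component V gr n v \<noteq> \<zero>\<^bsub>V\<^esub>} \<in> N"
    by (rule submodule_finsum[OF V N sub[OF component_mem[OF V gr v]]])
  then show ?thesis using component_sum[OF V gr v] by simp
qed

end

section \<open>The degree zero part of a simple comodule algebra\<close>

context graded_comod
begin

text \<open>The positive degrees form an ideal: a product of homogeneous elements has degree zero
  only if both factors have. So the projection to \<open>L(0)\<close> is multiplicative.\<close>

lemma component_zero_mult:
  assumes x: "x \<in> carrier L" and y: "y \<in> carrier L"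
  shows "component L grL 0 (x \<otimes>\<^bsub>L\<^esub> y) = component L grL 0 x \<otimes>\<^bsub>L\<^esub> component L grL 0 y"
proof -
  note cl = component_linear[OF mL grad_L, of 0] and cc = component_closed[OF mL grad_L]
  note ch = component_homogeneous[OF mL grad_L]
  note z = alg_zero_left[OF L_alg] alg_zero_right[OF L_alg]
  show ?thesis
  proof (rule linear_eq_on_graded[OF mL grad_L mL lin_comp[OF right_mult_linear[OF L_alg y] cl]
        lin_comp[OF cl right_mult_linear[OF L_alg cc[OF y]]] _ x])
    fix n u assume u: "u \<in> grL n"
    note uc = gr_closed[OF mL grad_L u]
    show "component L grL 0 (u \<otimes>\<^bsub>L\<^esub> y) = component L grL 0 u \<otimes>\<^bsub>L\<^esub> component L grL 0 y"
    proof (rule linear_eq_on_graded[OF mL grad_L mL lin_comp[OF left_mult_linear[OF L_alg uc] cl]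
          lin_comp[OF cl left_mult_linear[OF L_alg cc[OF uc]]] _ y])
      fix m v assume v: "v \<in> grL m"
      note vc = gr_closed[OF mL grad_L v]
      show "component L grL 0 (u \<otimes>\<^bsub>L\<^esub> v) = component L grL 0 u \<otimes>\<^bsub>L\<^esub> component L grL 0 v"
        unfolding ch[OF grL_mult[OF u v]] ch[OF u] ch[OF v] using z uc vc mL by simp
    qed
  qed
qed

definition "homg k x \<longleftrightarrow> x \<in> grL 0 \<and> gdeg k x"

lemma homg_closed: "homg k x \<Longrightarrow> x \<in> carrier L"
  by (simp add: homg_def gdeg_def)

lemma homg_one: "homg \<one>\<^bsub>G\<^esub> \<one>\<^bsub>L\<^esub>"
  by (simp add: homg_def gdeg_one_one grL_one)

lemma homg_mult: "g \<in> carrier G \<Longrightarrow> h \<in> carrier G \<Longrightarrow> homg g x \<Longrightarrow> homg h y \<Longrightarrow> homg (g \<otimes>\<^bsub>G\<^esub> h) (x \<otimes>\<^bsub>L\<^esub> y)"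
  using gdeg_mult[of g h x y] grL_mult[of x 0 y 0] by (simp add: homg_def)

lemma homg_act_ec: "k \<in> carrier G \<Longrightarrow> l \<in> grL 0 \<Longrightarrow> homg k (act (ec k) l)"
  unfolding homg_def by (intro conjI act_ec_graded gdeg_act_ec)

lemma act_ec_one: "k \<in> carrier G \<Longrightarrow> act (ec k) \<one>\<^bsub>L\<^esub> = (if k = \<one>\<^bsub>G\<^esub> then \<one>\<^bsub>L\<^esub> else \<zero>\<^bsub>L\<^esub>)"
  using gdeg_act[OF gdeg_one_one G_simps(1) ec_functional, of k] ec_gl[OF G_simps(1), of k] mL L_one by simp

context
  assumes simple: "right_H_simple R H L"
    and coinv: "coinvariants R H L = {c \<odot>\<^bsub>L\<^esub> \<one>\<^bsub>L\<^esub> | c. c \<in> carrier R}"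
begin

lemma one_nonzero: "\<one>\<^bsub>L\<^esub> \<noteq> \<zero>\<^bsub>L\<^esub>"
proof
  assume z: "\<one>\<^bsub>L\<^esub> = \<zero>\<^bsub>L\<^esub>"
  have "x = \<zero>\<^bsub>L\<^esub>" if x: "x \<in> carrier L" for x
    using alg_l_one[OF L_alg x] alg_zero_left[OF L_alg x] unfolding z by simp
  then have "carrier L = {\<zero>\<^bsub>L\<^esub>}" using mod_zero[OF mL] by blast
  then show False using simple by (simp add: right_H_simple_def)
qed

text \<open>A nonzero homogeneous \<open>x\<close> generates a nonzero right ideal \<open>xL\<close> that is a subcomodule.\<close>

lemma homg_right_inverse:
  assumes g: "g \<in> carrier G" and x: "homg g x" and x0: "x \<noteq> \<zero>\<^bsub>L\<^esub>"
  shows "\<exists>y. homg (inv\<^bsub>G\<^esub> g) y \<and> x \<otimes>\<^bsub>L\<^esub> y = \<one>\<^bsub>L\<^esub>"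
proof -
  note xc = homg_closed[OF x]
  have xg: "x \<in> grL 0" "gdeg g x" using x by (simp_all add: homg_def)
  let ?I = "(\<lambda>a. x \<otimes>\<^bsub>L\<^esub> a) ` carrier L"
  have S: "submodule ?I R L"
    by (rule submodule_image[OF mL mL left_mult_linear[OF L_alg xc] submodule_carrier[OF mL]])
  have sub: "subcomodule R H L ?I"
    unfolding subcomodule_L
  proof (intro conjI S ballI allI impI)
    fix a f assume a: "a \<in> ?I" and f: "functional H f"
    then obtain b where b: "b \<in> carrier L" "a = x \<otimes>\<^bsub>L\<^esub> b" by blast
    show "act f a \<in> ?I"
      unfolding b(2) act_gdeg_mult[OF g xg(2) b(1) f]
      by (rule imageI, rule act_closed[OF lin_comp[OF left_mult_linear[OF H_alg gl_closed[OF g]] f] b(1)])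
  qed
  have ideal: "\<forall>a\<in>?I. \<forall>b\<in>carrier L. a \<otimes>\<^bsub>L\<^esub> b \<in> ?I"
  proof (intro ballI)
    fix a b assume a: "a \<in> ?I" and b: "b \<in> carrier L"
    then obtain c where c: "c \<in> carrier L" "a = x \<otimes>\<^bsub>L\<^esub> c" by blast
    show "a \<otimes>\<^bsub>L\<^esub> b \<in> ?I"
      unfolding c(2) alg_assoc[OF L_alg xc c(1) b] by (rule imageI, rule L_closed[OF c(1) b])
  qed
  have "x \<in> ?I" using alg_r_one[OF L_alg xc] L_one by force
  then have "?I \<noteq> {\<zero>\<^bsub>L\<^esub>}" using x0 by blast
  then have "?I = carrier L" using simple sub ideal unfolding right_H_simple_def by blast
  then have "\<one>\<^bsub>L\<^esub> \<in> ?I" using L_one by simp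
  then obtain a where a: "a \<in> carrier L" "x \<otimes>\<^bsub>L\<^esub> a = \<one>\<^bsub>L\<^esub>" by (metis imageE)
  \<comment> \<open>The right inverse \<open>a\<close> need not be homogeneous. As \<open>x\<close>
    is homogeneous of degree zero and of group degree \<open>g\<close>, the equation survives the
    projection of \<open>a\<close> to degree zero and then to the weight of the inverse of
    \<open>g\<close>.\<close>
  define b where "b = component L grL 0 a"
  have b: "b \<in> grL 0" "b \<in> carrier L" using component_mem[OF mL grad_L a(1)] component_closed[OF mL grad_L a(1)] by (simp_all add: b_def)
  have xb: "x \<otimes>\<^bsub>L\<^esub> b = \<one>\<^bsub>L\<^esub>"
    using component_zero_mult[OF xc a(1)] component_homogeneous[OF mL grad_L xg(1), of 0]
      component_homogeneous[OF mL grad_L grL_one, of 0] by (simp add: b_def a(2))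
  have "x \<otimes>\<^bsub>L\<^esub> act (ec (inv\<^bsub>G\<^esub> g)) b = \<one>\<^bsub>L\<^esub>"
    using act_ec_gdeg_mult[OF g G_simps(1) xg(2) b(2)] act_ec_one[OF G_simps(1)] G_simps(5)[OF G_simps(2)[OF g]]
    by (simp add: xb)
  then show ?thesis using homg_act_ec[OF G_simps(2)[OF g] b(1)] by blast
qed

text \<open>The right inverse y is again homogeneous and nonzero, so it has a right inverse z of its
  own; then x = x(yz) = (xy)z = z, and the inverse is two-sided.\<close>

lemma homg_inverse:
  assumes g: "g \<in> carrier G" and x: "homg g x" and x0: "x \<noteq> \<zero>\<^bsub>L\<^esub>"
  shows "\<exists>y. homg (inv\<^bsub>G\<^esub> g) y \<and> x \<otimes>\<^bsub>L\<^esub> y = \<one>\<^bsub>L\<^esub> \<and> y \<otimes>\<^bsub>L\<^esub> x = \<one>\<^bsub>L\<^esub> \<and> y \<noteq> \<zero>\<^bsub>L\<^esub>"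
proof -
  obtain y where y: "homg (inv\<^bsub>G\<^esub> g) y" "x \<otimes>\<^bsub>L\<^esub> y = \<one>\<^bsub>L\<^esub>" using homg_right_inverse[OF assms] by blast
  note xc = homg_closed[OF x] and yc = homg_closed[OF y(1)]
  have y0: "y \<noteq> \<zero>\<^bsub>L\<^esub>" using y(2) alg_zero_right[OF L_alg xc] one_nonzero by auto
  obtain z where z: "homg (inv\<^bsub>G\<^esub> (inv\<^bsub>G\<^esub> g)) z" "y \<otimes>\<^bsub>L\<^esub> z = \<one>\<^bsub>L\<^esub>"
    using homg_right_inverse[OF G_simps(2)[OF g] y(1) y0] by blast
  note zc = homg_closed[OF z(1)]
  have "x = z"
    using alg_assoc[OF L_alg xc yc zc] alg_r_one[OF L_alg xc] alg_l_one[OF L_alg zc] y(2) z(2) by simp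
  then show ?thesis using y z(2) y0 by blast
qed

lemma homg_mult_nonzero:
  assumes g: "g \<in> carrier G" and x: "homg g x" "x \<noteq> \<zero>\<^bsub>L\<^esub>" and y: "y \<in> carrier L" "y \<noteq> \<zero>\<^bsub>L\<^esub>"
  shows "x \<otimes>\<^bsub>L\<^esub> y \<noteq> \<zero>\<^bsub>L\<^esub>"
proof
  assume z: "x \<otimes>\<^bsub>L\<^esub> y = \<zero>\<^bsub>L\<^esub>"
  obtain x' where x': "homg (inv\<^bsub>G\<^esub> g) x'" "x' \<otimes>\<^bsub>L\<^esub> x = \<one>\<^bsub>L\<^esub>" using homg_inverse[OF g x] by blast
  note xc = homg_closed[OF x(1)] and xc' = homg_closed[OF x'(1)]
  have "y = \<zero>\<^bsub>L\<^esub>"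
    using alg_assoc[OF L_alg xc' xc y(1)] alg_l_one[OF L_alg y(1)] alg_zero_right[OF L_alg xc'] x'(2) z by simp
  then show False using y(2) by blast
qed

lemma homg_unique:
  assumes g: "g \<in> carrier G" and x: "homg g x" "x \<noteq> \<zero>\<^bsub>L\<^esub>" and x': "homg g x'"
  shows "\<exists>c\<in>carrier R. x' = c \<odot>\<^bsub>L\<^esub> x"
proof -
  obtain y where y: "homg (inv\<^bsub>G\<^esub> g) y" "x \<otimes>\<^bsub>L\<^esub> y = \<one>\<^bsub>L\<^esub>" using homg_inverse[OF g x] by blast
  note xc = homg_closed[OF x(1)] and yc = homg_closed[OF y(1)] and xc' = homg_closed[OF x']
  have "gdeg \<one>\<^bsub>G\<^esub> (y \<otimes>\<^bsub>L\<^esub> x')"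
    using homg_mult[OF G_simps(2)[OF g] g y(1) x'] G_simps(6)[OF g] by (simp add: homg_def)
  then obtain c where c: "c \<in> carrier R" "y \<otimes>\<^bsub>L\<^esub> x' = c \<odot>\<^bsub>L\<^esub> \<one>\<^bsub>L\<^esub>"
    using coinv by (auto simp: gdeg_one_iff)
  have "x' = x \<otimes>\<^bsub>L\<^esub> (y \<otimes>\<^bsub>L\<^esub> x')"
    using alg_assoc[OF L_alg xc yc xc'] alg_l_one[OF L_alg xc'] y(2) by simp
  also have "\<dots> = c \<odot>\<^bsub>L\<^esub> x"
    unfolding c(2) alg_smult_right[OF L_alg c(1) xc L_one] alg_r_one[OF L_alg xc] by (rule refl)
  finally show ?thesis using c(1) by blast
qed

section \<open>The subgroup and the cocycle carried by L(0)\<close>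

definition "supp = {g \<in> carrier G. \<exists>x. homg g x \<and> x \<noteq> \<zero>\<^bsub>L\<^esub>}"
text \<open>A basis vector of each homogeneous line. Taking the unit of \<open>L\<close> at the
  neutral element is what normalises the cocycle.\<close>

definition "ub g = (if g = \<one>\<^bsub>G\<^esub> then \<one>\<^bsub>L\<^esub> else (SOME x. homg g x \<and> x \<noteq> \<zero>\<^bsub>L\<^esub>))"
definition "cocy g h = (SOME c. c \<in> carrier R \<and> ub g \<otimes>\<^bsub>L\<^esub> ub h = c \<odot>\<^bsub>L\<^esub> ub (g \<otimes>\<^bsub>G\<^esub> h))"

lemma supp_G: "g \<in> supp \<Longrightarrow> g \<in> carrier G"
  by (simp add: supp_def)

lemma ub: "g \<in> supp \<Longrightarrow> homg g (ub g) \<and> ub g \<noteq> \<zero>\<^bsub>L\<^esub>"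
proof (cases "g = \<one>\<^bsub>G\<^esub>")
  case True
  then show ?thesis using homg_one one_nonzero by (simp add: ub_def)
next
  case False
  assume "g \<in> supp"
  then have "\<exists>x. homg g x \<and> x \<noteq> \<zero>\<^bsub>L\<^esub>" by (simp add: supp_def)
  from someI_ex[OF this] show ?thesis using False by (simp add: ub_def)
qed

text \<open>Closure under inverses is the homogeneity of the inverse, and closure under products
  holds since an invertible element times a nonzero one is nonzero.\<close>

lemma supp_subgroup: "subgroup supp G"
proof (rule group.subgroupI[OF group_G])
  show "supp \<subseteq> carrier G" using supp_G by blast
  have "\<one>\<^bsub>G\<^esub> \<in> supp" using homg_one one_nonzero G_simps(1) unfolding supp_def by blast
  then show "supp \<noteq> {}" by blast
  show "inv\<^bsub>G\<^esub> g \<in> supp" if g: "g \<in> supp" for g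
    using homg_inverse[OF supp_G[OF g]] ub[OF g] G_simps(2)[OF supp_G[OF g]] unfolding supp_def by blast
  show "g \<otimes>\<^bsub>G\<^esub> h \<in> supp" if g: "g \<in> supp" and h: "h \<in> supp" for g h
    using homg_mult[OF supp_G[OF g] supp_G[OF h], of "ub g" "ub h"] homg_mult_nonzero[OF supp_G[OF g], of "ub g" "ub h"]
      ub[OF g] ub[OF h] homg_closed[of h "ub h"] G_simps(3)[OF supp_G[OF g] supp_G[OF h]] unfolding supp_def by blast
qed

lemma supp_mult: "g \<in> supp \<Longrightarrow> h \<in> supp \<Longrightarrow> g \<otimes>\<^bsub>G\<^esub> h \<in> supp"
  by (rule subgroup.m_closed[OF supp_subgroup])

lemma cocy:
  assumes g: "g \<in> supp" and h: "h \<in> supp"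
  shows "cocy g h \<in> carrier R" "ub g \<otimes>\<^bsub>L\<^esub> ub h = cocy g h \<odot>\<^bsub>L\<^esub> ub (g \<otimes>\<^bsub>G\<^esub> h)"
proof -
  note gh = ub[OF supp_mult[OF g h]]
  have "\<exists>c. c \<in> carrier R \<and> ub g \<otimes>\<^bsub>L\<^esub> ub h = c \<odot>\<^bsub>L\<^esub> ub (g \<otimes>\<^bsub>G\<^esub> h)"
    using homg_unique[OF supp_G[OF supp_mult[OF g h]], of "ub (g \<otimes>\<^bsub>G\<^esub> h)" "ub g \<otimes>\<^bsub>L\<^esub> ub h"] gh
      homg_mult[OF supp_G[OF g] supp_G[OF h], of "ub g" "ub h"] ub[OF g] ub[OF h] by blast
  from someI_ex[OF this]
  show "cocy g h \<in> carrier R" "ub g \<otimes>\<^bsub>L\<^esub> ub h = cocy g h \<odot>\<^bsub>L\<^esub> ub (g \<otimes>\<^bsub>G\<^esub> h)"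
    by (simp_all add: cocy_def)
qed

lemma ub_closed: "g \<in> supp \<Longrightarrow> ub g \<in> carrier L"
  using ub[of g] homg_closed[of g] by simp

text \<open>The cocycle identity is associativity of a product of three basis vectors, read off as
  an equality of coefficients of one nonzero vector. The values are units because products of basis
  vectors do not vanish, and the normalisation comes from the unit being a basis vector.\<close>

lemma cocy_two_cocycle: "two_cocycle R G supp cocy"
  unfolding two_cocycle_def
proof (intro conjI ballI)
  fix a b assume a: "a \<in> supp" and b: "b \<in> supp"
  have "cocy a b \<noteq> \<zero>"
  proof
    assume "cocy a b = \<zero>"
    then have "ub a \<otimes>\<^bsub>L\<^esub> ub b = \<zero>\<^bsub>L\<^esub>"
      using cocy(2)[OF a b] mod_zero_smult[OF mL ub_closed[OF supp_mult[OF a b]]] by simp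
    then show False
      using homg_mult_nonzero[OF supp_G[OF a], of "ub a" "ub b"] ub[OF a] ub[OF b] ub_closed[OF b] by blast
  qed
  then show "cocy a b \<in> Units R" using cocy(1)[OF a b] field_Units by blast
next
  fix a b c assume a: "a \<in> supp" and b: "b \<in> supp" and c: "c \<in> supp"
  note ab = supp_mult[OF a b] and bc = supp_mult[OF b c]
  note abc = supp_mult[OF ab c] and abc' = supp_mult[OF a bc]
  have G: "a \<otimes>\<^bsub>G\<^esub> b \<otimes>\<^bsub>G\<^esub> c = a \<otimes>\<^bsub>G\<^esub> (b \<otimes>\<^bsub>G\<^esub> c)" by (rule G_simps(8)[OF supp_G[OF a] supp_G[OF b] supp_G[OF c]])
  have "(cocy a b \<otimes> cocy (a \<otimes>\<^bsub>G\<^esub> b) c) \<odot>\<^bsub>L\<^esub> ub (a \<otimes>\<^bsub>G\<^esub> b \<otimes>\<^bsub>G\<^esub> c) = ub a \<otimes>\<^bsub>L\<^esub> ub b \<otimes>\<^bsub>L\<^esub> ub c"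
    unfolding cocy(2)[OF a b] alg_smult_left[OF L_alg cocy(1)[OF a b] ub_closed[OF ab] ub_closed[OF c]]
      cocy(2)[OF ab c] by (rule mod_smult_smult[OF mL cocy(1)[OF a b] cocy(1)[OF ab c] ub_closed[OF abc]])
  also have "\<dots> = ub a \<otimes>\<^bsub>L\<^esub> (ub b \<otimes>\<^bsub>L\<^esub> ub c)"
    by (rule alg_assoc[OF L_alg ub_closed[OF a] ub_closed[OF b] ub_closed[OF c]])
  also have "\<dots> = (cocy b c \<otimes> cocy a (b \<otimes>\<^bsub>G\<^esub> c)) \<odot>\<^bsub>L\<^esub> ub (a \<otimes>\<^bsub>G\<^esub> (b \<otimes>\<^bsub>G\<^esub> c))"
    unfolding cocy(2)[OF b c] alg_smult_right[OF L_alg cocy(1)[OF b c] ub_closed[OF a] ub_closed[OF bc]]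
      cocy(2)[OF a bc] by (rule mod_smult_smult[OF mL cocy(1)[OF b c] cocy(1)[OF a bc] ub_closed[OF abc'], symmetric])
  finally have eq: "(cocy a b \<otimes> cocy (a \<otimes>\<^bsub>G\<^esub> b) c) \<odot>\<^bsub>L\<^esub> ub (a \<otimes>\<^bsub>G\<^esub> (b \<otimes>\<^bsub>G\<^esub> c)) =
      (cocy b c \<otimes> cocy a (b \<otimes>\<^bsub>G\<^esub> c)) \<odot>\<^bsub>L\<^esub> ub (a \<otimes>\<^bsub>G\<^esub> (b \<otimes>\<^bsub>G\<^esub> c))" unfolding G .
  show "cocy a b \<otimes> cocy (a \<otimes>\<^bsub>G\<^esub> b) c = cocy b c \<otimes> cocy a (b \<otimes>\<^bsub>G\<^esub> c)"
    by (rule mod_smult_cancel[OF mL _ _ ub_closed[OF abc'] conjunct2[OF ub[OF abc']] eq])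
      (simp_all add: cocy(1)[OF a b] cocy(1)[OF ab c] cocy(1)[OF b c] cocy(1)[OF a bc])
next
  fix a assume a: "a \<in> supp"
  note one = subgroup.one_closed[OF supp_subgroup]
  have u1: "ub \<one>\<^bsub>G\<^esub> = \<one>\<^bsub>L\<^esub>" by (simp add: ub_def)
  have s: "\<one> \<odot>\<^bsub>L\<^esub> ub a = ub a" by (rule mod_one_smult[OF mL ub_closed[OF a]])
  have "cocy a \<one>\<^bsub>G\<^esub> \<odot>\<^bsub>L\<^esub> ub a = \<one> \<odot>\<^bsub>L\<^esub> ub a"
    using cocy(2)[OF a one] alg_r_one[OF L_alg ub_closed[OF a]] u1 s G_simps(5)[OF supp_G[OF a]] by simp
  then show "cocy a \<one>\<^bsub>G\<^esub> = \<one>"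
    by (rule mod_smult_cancel[OF mL cocy(1)[OF a one] one_closed ub_closed[OF a] conjunct2[OF ub[OF a]]])
  have "cocy \<one>\<^bsub>G\<^esub> a \<odot>\<^bsub>L\<^esub> ub a = \<one> \<odot>\<^bsub>L\<^esub> ub a"
    using cocy(2)[OF one a] alg_l_one[OF L_alg ub_closed[OF a]] u1 s G_simps(4)[OF supp_G[OF a]] by simp
  then show "cocy \<one>\<^bsub>G\<^esub> a = \<one>"
    by (rule mod_smult_cancel[OF mL cocy(1)[OF one a] one_closed ub_closed[OF a] conjunct2[OF ub[OF a]]])
qed

text \<open>The choices made above are packaged as an existence statement, in the form in which the
  embedding takes its subgroup, cocycle and homogeneous basis as parameters.\<close>

lemma degree_zero_structure:
  "\<exists>F \<psi> u. subgroup F G \<and> two_cocycle R G F \<psi> \<and> u \<one>\<^bsub>G\<^esub> = \<one>\<^bsub>L\<^esub> \<and>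
    (\<forall>g\<in>F. homg g (u g) \<and> u g \<noteq> \<zero>\<^bsub>L\<^esub>) \<and>
    (\<forall>g\<in>F. \<forall>x. homg g x \<longrightarrow> (\<exists>c\<in>carrier R. x = c \<odot>\<^bsub>L\<^esub> u g)) \<and>
    (\<forall>g\<in>carrier G - F. \<forall>x. homg g x \<longrightarrow> x = \<zero>\<^bsub>L\<^esub>) \<and>
    (\<forall>g\<in>F. \<forall>h\<in>F. u g \<otimes>\<^bsub>L\<^esub> u h = \<psi> g h \<odot>\<^bsub>L\<^esub> u (g \<otimes>\<^bsub>G\<^esub> h))"
proof (intro exI conjI)
  show "subgroup supp G" by (rule supp_subgroup)
  show "two_cocycle R G supp cocy" by (rule cocy_two_cocycle)
  show "ub \<one>\<^bsub>G\<^esub> = \<one>\<^bsub>L\<^esub>" by (simp add: ub_def)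
  show "\<forall>g\<in>supp. homg g (ub g) \<and> ub g \<noteq> \<zero>\<^bsub>L\<^esub>" using ub by simp
  show "\<forall>g\<in>supp. \<forall>x. homg g x \<longrightarrow> (\<exists>c\<in>carrier R. x = c \<odot>\<^bsub>L\<^esub> ub g)"
    using homg_unique[OF supp_G] ub by simp
  show "\<forall>g\<in>carrier G - supp. \<forall>x. homg g x \<longrightarrow> x = \<zero>\<^bsub>L\<^esub>" by (auto simp: supp_def)
  show "\<forall>g\<in>supp. \<forall>h\<in>supp. ub g \<otimes>\<^bsub>L\<^esub> ub h = cocy g h \<odot>\<^bsub>L\<^esub> ub (g \<otimes>\<^bsub>G\<^esub> h)" using cocy(2) by simp
qed

end

end

section \<open>The embedding into the smash product\<close>

text \<open>Triviality of the coinvariants is present here as \<open>u_span\<close>: each part of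
  \<open>L(0)\<close> with group degree in \<open>F\<close> is a line. Simplicity of
  \<open>L\<close> serves to show that the embedding is injective.\<close>

locale graded_comod_basis = graded_comod_cocycle R H grH G \<iota> L grL F \<psi>
  for R :: "('a, 'b) ring_scheme" (structure) and H :: "('a, 'h) hopf" and grH :: "nat \<Rightarrow> 'h set"
    and G :: "('g, 's) monoid_scheme" and \<iota> :: "('g \<Rightarrow> 'a) \<Rightarrow> 'h"
    and L :: "('a, 'h, 'l) comod_alg" and grL :: "nat \<Rightarrow> 'l set"
    and F :: "'g set" and \<psi> :: "'g \<Rightarrow> 'g \<Rightarrow> 'a" +
  fixes u :: "'g \<Rightarrow> 'l"
  assumes u_one: "u \<one>\<^bsub>G\<^esub> = \<one>\<^bsub>L\<^esub>"
    and u_hom: "g \<in> F \<Longrightarrow> homg g (u g)" and u_nonzero: "g \<in> F \<Longrightarrow> u g \<noteq> \<zero>\<^bsub>L\<^esub>"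
    and u_span: "g \<in> F \<Longrightarrow> homg g x \<Longrightarrow> \<exists>c\<in>carrier R. x = c \<odot>\<^bsub>L\<^esub> u g"
    and u_outside: "g \<in> carrier G \<Longrightarrow> g \<notin> F \<Longrightarrow> homg g x \<Longrightarrow> x = \<zero>\<^bsub>L\<^esub>"
    and u_mult: "g \<in> F \<Longrightarrow> h \<in> F \<Longrightarrow> u g \<otimes>\<^bsub>L\<^esub> u h = \<psi> g h \<odot>\<^bsub>L\<^esub> u (g \<otimes>\<^bsub>G\<^esub> h)"
    and simple: "right_H_simple R H L"
begin

section \<open>Coordinates on the degree zero part of L\<close>

lemma u_closed: "g \<in> F \<Longrightarrow> u g \<in> carrier L"
  using homg_closed[OF u_hom] .

abbreviation "p0 m \<equiv> component L grL 0 m"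

lemmas p0_linear = component_linear[OF mL grad_L, of 0]
lemmas p0_closed = component_closed[OF mL grad_L, of _ 0]
lemmas p0_mem = component_mem[OF mL grad_L, of _ 0]

text \<open>The dual basis of the vectors \<open>u k\<close> of \<open>L(0)\<close>, extended by
  zero to positive degrees: for \<open>L\<close> what \<open>ec k\<close> is for
  \<open>H\<close>.\<close>

definition "\<chi> k m = (SOME c. c \<in> carrier R \<and> act (ec k) (p0 m) = c \<odot>\<^bsub>L\<^esub> u k)"

lemma chi:
  assumes k: "k \<in> F" and m: "m \<in> carrier L"
  shows "\<chi> k m \<in> carrier R" "act (ec k) (p0 m) = \<chi> k m \<odot>\<^bsub>L\<^esub> u k"
proof -
  have "\<exists>c. c \<in> carrier R \<and> act (ec k) (p0 m) = c \<odot>\<^bsub>L\<^esub> u k"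
    using u_span[OF k homg_act_ec[OF F_G[OF k] p0_mem[OF m]]] by blast
  from someI_ex[OF this] show "\<chi> k m \<in> carrier R" "act (ec k) (p0 m) = \<chi> k m \<odot>\<^bsub>L\<^esub> u k"
    by (simp_all add: \<chi>_def)
qed

lemma chi_eqI:
  assumes k: "k \<in> F" and m: "m \<in> carrier L" and c: "c \<in> carrier R" and eq: "act (ec k) (p0 m) = c \<odot>\<^bsub>L\<^esub> u k"
  shows "\<chi> k m = c"
  by (rule mod_smult_cancel[OF mL chi(1)[OF k m] c u_closed[OF k] u_nonzero[OF k]]) (simp only: chi(2)[OF k m, symmetric] eq)

lemma chi_functional:
  assumes k: "k \<in> F" shows "functional L (\<chi> k)"
proof (rule linear_mapI)
  note l = lin_comp[OF p0_linear act_linear[OF ec_functional]]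
  show "\<chi> k x \<in> carrier (ground_algebra R)" if "x \<in> carrier L" for x using chi(1)[OF k that] by simp
  show "\<chi> k (x \<oplus>\<^bsub>L\<^esub> y) = \<chi> k x \<oplus>\<^bsub>ground_algebra R\<^esub> \<chi> k y" if x: "x \<in> carrier L" and y: "y \<in> carrier L" for x y
    by (rule chi_eqI[OF k mod_add[OF mL x y]])
      (simp_all add: chi(1)[OF k x] chi(1)[OF k y] lin_add[OF l x y] chi(2)[OF k x] chi(2)[OF k y] mod_add_smult[OF mL] u_closed[OF k])
  show "\<chi> k (c \<odot>\<^bsub>L\<^esub> x) = c \<odot>\<^bsub>ground_algebra R\<^esub> \<chi> k x" if c: "c \<in> carrier R" and x: "x \<in> carrier L" for c x
    by (rule chi_eqI[OF k mod_smult[OF mL c x]])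
      (simp_all add: chi(1)[OF k x] c lin_smult[OF l c x] chi(2)[OF k x] mod_smult_smult[OF mL] u_closed[OF k])
qed

text \<open>The weight projections commute with the projection to \<open>L(0)\<close> and are
  orthogonal to each other, so only the weight \<open>k\<close> is visible to this
  functional.\<close>

lemma chi_act_ec:
  assumes k: "k \<in> F" and g: "g \<in> carrier G" and m: "m \<in> carrier L"
  shows "\<chi> k (act (ec g) m) = (if g = k then \<chi> k m else \<zero>)"
proof (rule chi_eqI[OF k act_closed[OF ec_functional m]])
  show "(if g = k then \<chi> k m else \<zero>) \<in> carrier R" using chi(1)[OF k m] by simp
  show "act (ec k) (p0 (act (ec g) m)) = (if g = k then \<chi> k m else \<zero>) \<odot>\<^bsub>L\<^esub> u k"
    unfolding act_ec_component[OF m, symmetric] act_ec_ec[OF g F_G[OF k] p0_closed[OF m]]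
    using chi(2)[OF k m] u_closed[OF k] mL by simp
qed

lemma chi_positive: "k \<in> F \<Longrightarrow> n \<noteq> 0 \<Longrightarrow> m \<in> grL n \<Longrightarrow> \<chi> k m = \<zero>"
proof -
  assume k: "k \<in> F" and n: "n \<noteq> 0" and m: "m \<in> grL n"
  have "p0 m = \<zero>\<^bsub>L\<^esub>" using component_homogeneous[OF mL grad_L m, of 0] n by simp
  then show ?thesis
    using lin_zero[OF mL mL act_linear[OF ec_functional]] u_closed[OF k] mL
    by (intro chi_eqI[OF k gr_closed[OF mL grad_L m] zero_closed]) simp
qed

lemma chi_one: "k \<in> F \<Longrightarrow> \<chi> k \<one>\<^bsub>L\<^esub> = (if k = \<one>\<^bsub>G\<^esub> then \<one> else \<zero>)"
  using component_homogeneous[OF mL grad_L grL_one, of 0] act_ec_one[OF F_G, of k] u_closed[of k] L_one mL u_one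
  by (intro chi_eqI) auto

text \<open>The weight components of an element of \<open>L(0)\<close> add up to it, and those
  outside \<open>F\<close> vanish by \<open>u_outside\<close>.\<close>

lemma p0_expand:
  assumes m: "m \<in> carrier L"
  shows "p0 m = finsum L (\<lambda>k. \<chi> k m \<odot>\<^bsub>L\<^esub> u k) F"
proof -
  have "finsum L (\<lambda>k. \<chi> k m \<odot>\<^bsub>L\<^esub> u k) F = finsum L (\<lambda>k. act (ec k) (p0 m)) F"
    by (rule mod_finsum_cong[OF mL chi(2)[OF _ m, symmetric] act_closed[OF ec_functional p0_closed[OF m]]])
  also have "\<dots> = finsum L (\<lambda>k. act (ec k) (p0 m)) (carrier G)"
  proof (rule mod_finsum_superset[OF mL finite_G])
    show "F \<subseteq> carrier G" using F_G by blast
    show "act (ec k) (p0 m) = \<zero>\<^bsub>L\<^esub>" if "k \<in> carrier G - F" for k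
      using u_outside[OF _ _ homg_act_ec[OF _ p0_mem[OF m]]] that by blast
    show "act (ec k) (p0 m) \<in> carrier L" for k by (rule act_closed[OF ec_functional p0_closed[OF m]])
  qed
  also have "\<dots> = p0 m" by (rule act_ec_sum[OF p0_closed[OF m]])
  finally show ?thesis by (rule sym)
qed

lemma F_shift: "g \<in> F \<Longrightarrow> k \<in> F \<Longrightarrow> inv\<^bsub>G\<^esub> g \<otimes>\<^bsub>G\<^esub> k \<in> F"
  by (rule F_mult[OF F_inv])

lemma G_cancel: "g \<in> carrier G \<Longrightarrow> k \<in> carrier G \<Longrightarrow> g \<otimes>\<^bsub>G\<^esub> (inv\<^bsub>G\<^esub> g \<otimes>\<^bsub>G\<^esub> k) = k"
  using G_shift(1)[of g "inv\<^bsub>G\<^esub> g \<otimes>\<^bsub>G\<^esub> k" k] by (simp add: G_simps(2,3))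

text \<open>The projection to \<open>L(0)\<close> is multiplicative, so this is a product expanded
  in the basis: the vector at g meets the vector at g^-1 k, and \<open>u_mult\<close> contributes
  the cocycle value.\<close>

lemma chi_mult:
  assumes k: "k \<in> F" and m: "m \<in> carrier L" and m': "m' \<in> carrier L"
  shows "\<chi> k (m \<otimes>\<^bsub>L\<^esub> m') = finsum (ground_algebra R)
    (\<lambda>g. \<chi> g m \<otimes> (\<psi> g (inv\<^bsub>G\<^esub> g \<otimes>\<^bsub>G\<^esub> k) \<otimes> \<chi> (inv\<^bsub>G\<^esub> g \<otimes>\<^bsub>G\<^esub> k) m')) F"
proof -
  let ?c = "\<lambda>g. \<chi> g m \<otimes> (\<psi> g (inv\<^bsub>G\<^esub> g \<otimes>\<^bsub>G\<^esub> k) \<otimes> \<chi> (inv\<^bsub>G\<^esub> g \<otimes>\<^bsub>G\<^esub> k) m')"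
  have c: "\<psi> g (inv\<^bsub>G\<^esub> g \<otimes>\<^bsub>G\<^esub> k) \<in> carrier R" "\<chi> (inv\<^bsub>G\<^esub> g \<otimes>\<^bsub>G\<^esub> k) m' \<in> carrier R" "\<chi> g m \<in> carrier R" "?c g \<in> carrier R"
    if "g \<in> F" for g
    using psi_closed[OF that F_shift[OF that k]] chi(1)[OF F_shift[OF that k] m'] chi(1)[OF that m] by simp_all
  note uk = u_closed[OF k]
  note pm = p0_closed[OF m] and pm' = p0_closed[OF m']
  note l = lin_comp[OF right_mult_linear[OF L_alg pm'] act_linear[OF ec_functional]]
  have term_eq: "act (ec k) ((\<chi> g m \<odot>\<^bsub>L\<^esub> u g) \<otimes>\<^bsub>L\<^esub> p0 m') = ?c g \<odot>\<^bsub>L\<^esub> u k" if g: "g \<in> F" for g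
  proof -
    note gk = F_shift[OF g k]
    note cg = c[OF g]
    have "act (ec k) ((\<chi> g m \<odot>\<^bsub>L\<^esub> u g) \<otimes>\<^bsub>L\<^esub> p0 m') = \<chi> g m \<odot>\<^bsub>L\<^esub> act (ec k) (u g \<otimes>\<^bsub>L\<^esub> p0 m')"
      by (rule lin_smult[OF l chi(1)[OF g m] u_closed[OF g]])
    also have "act (ec k) (u g \<otimes>\<^bsub>L\<^esub> p0 m') = u g \<otimes>\<^bsub>L\<^esub> act (ec (inv\<^bsub>G\<^esub> g \<otimes>\<^bsub>G\<^esub> k)) (p0 m')"
      using act_ec_gdeg_mult[OF F_G[OF g] F_G[OF k] _ pm'] u_hom[OF g] by (simp add: homg_def)
    also have "\<dots> = \<chi> (inv\<^bsub>G\<^esub> g \<otimes>\<^bsub>G\<^esub> k) m' \<odot>\<^bsub>L\<^esub> (\<psi> g (inv\<^bsub>G\<^esub> g \<otimes>\<^bsub>G\<^esub> k) \<odot>\<^bsub>L\<^esub> u k)"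
      unfolding chi(2)[OF gk m'] alg_smult_right[OF L_alg cg(2) u_closed[OF g] u_closed[OF gk]]
        u_mult[OF g gk] G_cancel[OF F_G[OF g] F_G[OF k]] by (rule refl)
    also have "\<dots> = (\<psi> g (inv\<^bsub>G\<^esub> g \<otimes>\<^bsub>G\<^esub> k) \<otimes> \<chi> (inv\<^bsub>G\<^esub> g \<otimes>\<^bsub>G\<^esub> k) m') \<odot>\<^bsub>L\<^esub> u k"
      unfolding mod_smult_lcomm[OF mL cg(2,1) uk] by (rule mod_smult_smult[OF mL cg(1,2) uk, symmetric])
    also have "\<chi> g m \<odot>\<^bsub>L\<^esub> \<dots> = ?c g \<odot>\<^bsub>L\<^esub> u k"
      by (rule mod_smult_smult[OF mL cg(3) m_closed[OF cg(1,2)] uk, symmetric])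
    finally show ?thesis .
  qed
  have kl: "linear_map R (ground_algebra R) L (\<lambda>c. c \<odot>\<^bsub>L\<^esub> u k)" by (rule functional_smult_linear[OF mL lin_id uk])
  have cR: "?c g \<in> carrier (ground_algebra R)" if "g \<in> F" for g using c(4)[OF that] by simp
  show ?thesis
  proof (rule chi_eqI[OF k L_closed[OF m m']])
    show "finsum (ground_algebra R) ?c F \<in> carrier R"
      using mod_finsum_closed[OF ground_module, of ?c F] c(4) by (simp add: Pi_def)
    have "act (ec k) (p0 (m \<otimes>\<^bsub>L\<^esub> m')) = act (ec k) (finsum L (\<lambda>g. \<chi> g m \<odot>\<^bsub>L\<^esub> u g) F \<otimes>\<^bsub>L\<^esub> p0 m')"
      unfolding component_zero_mult[OF m m'] p0_expand[OF m, symmetric] by (rule refl)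
    also have "\<dots> = finsum L (\<lambda>g. act (ec k) ((\<chi> g m \<odot>\<^bsub>L\<^esub> u g) \<otimes>\<^bsub>L\<^esub> p0 m')) F"
      by (rule lin_finsum[OF mL mL l]) (rule mod_smult[OF mL chi(1)[OF _ m] u_closed])
    also have "\<dots> = finsum L (\<lambda>g. ?c g \<odot>\<^bsub>L\<^esub> u k) F"
      by (rule mod_finsum_cong[OF mL term_eq mod_smult[OF mL c(4) uk]])
    also have "\<dots> = finsum (ground_algebra R) ?c F \<odot>\<^bsub>L\<^esub> u k"
      by (rule lin_finsum[OF ground_module mL kl cR, symmetric])
    finally show "act (ec k) (p0 (m \<otimes>\<^bsub>L\<^esub> m')) = finsum (ground_algebra R) ?c F \<odot>\<^bsub>L\<^esub> u k" .
  qed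
qed

text \<open>The map \<open>a \<otimes> g \<mapsto> a\<iota>(g) \<otimes> g\<close> identifies the smash product with the cotensor product of \<open>H\<close>
  and the cocycle group algebra over \<open>H(0)\<close>. The \<open>hc k\<close> are the coordinates of the map
  \<open>l \<mapsto> l\<^sub>-\<^sub>1 \<otimes> p\<^sub>0(l\<^sub>0)\<close> into the cotensor product, and \<open>pc\<close> undoes the identification.\<close>

definition "hc k l = rcon H (\<chi> k) (\<rho> l)"

lemma hc_linear: "k \<in> F \<Longrightarrow> linear_map R L H (hc k)"
  unfolding hc_def[abs_def] by (rule lin_comp[OF rho_linear rcon_linear[OF mH mL chi_functional]])

lemmas hc_closed = lin_closed[OF hc_linear]

text \<open>Both sides evaluate \<open>f\<close> \<otimes> \<open>\<chi> k\<close> on the coaction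
  of \<open>l\<close>.\<close>

lemma chi_act: "k \<in> F \<Longrightarrow> functional H f \<Longrightarrow> l \<in> carrier L \<Longrightarrow> \<chi> k (act f l) = f (hc k l)"
  unfolding act_def hc_def by (rule lcon_rcon[OF mH mL _ chi_functional rho_closed])

text \<open>Coassociativity lets the contraction of the right factor commute with \<open>f\<close>
  on the left one; thus \<open>hc k\<close> is a comodule map from \<open>L\<close> to
  \<open>H\<close>.\<close>

lemma hc_act:
  assumes k: "k \<in> F" and f: "functional H f" and l: "l \<in> carrier L"
  shows "hc k (act f l) = lcon H f (\<Delta> (hc k l))"
  unfolding hc_def act_def rho_coassoc[OF l f]
  by (rule rcon_tmap[OF mH mL mH mL lin_comp[OF Delta_linear lcon_linear[OF mH mH f]] lin_id chi_functional[OF k] rho_closed[OF l]])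

text \<open>Under an arbitrary \<open>f\<close> the left side becomes the coordinate at
  \<open>g\<close> of a weight projection of \<open>act f l\<close>, and that coordinate sees only
  weight \<open>g\<close>. So \<open>hc g l\<close> has right degree \<open>g\<close>, which is the
  cotensor condition.\<close>

lemma dc_hc:
  assumes k: "k \<in> carrier G" and g: "g \<in> F" and l: "l \<in> carrier L"
  shows "dc k (hc g l) = (if k = g then hc g l else \<zero>\<^bsub>H\<^esub>)"
proof (rule functional_eqI[OF mH dc_closed[OF hc_closed[OF g l]]])
  show "(if k = g then hc g l else \<zero>\<^bsub>H\<^esub>) \<in> carrier H"
    by (cases "k = g") (simp_all only: if_True if_False simp_thms hc_closed[OF g l] mod_zero[OF mH])
  fix f assume f: "functional H f"
  have "f (dc k (hc g l)) = ec k (hc g (act f l))"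
    unfolding dc_def hc_act[OF g f l]
    by (rule lcon_rcon[OF mH mH f ec_functional Delta_closed[OF hc_closed[OF g l]], symmetric])
  also have "\<dots> = \<chi> g (act (ec k) (act f l))"
    by (rule chi_act[OF g ec_functional act_closed[OF f l], symmetric])
  also have "\<dots> = (if k = g then \<chi> g (act f l) else \<zero>)" by (rule chi_act_ec[OF g k act_closed[OF f l]])
  also have "\<dots> = f (if k = g then hc g l else \<zero>\<^bsub>H\<^esub>)"
    by (cases "k = g") (simp_all only: if_True if_False simp_thms chi_act[OF g f l] functional_zero[OF mH f])
  finally show "f (dc k (hc g l)) = f (if k = g then hc g l else \<zero>\<^bsub>H\<^esub>)" .
qed

definition "pc k l = hc k l \<otimes>\<^bsub>H\<^esub> gl (inv\<^bsub>G\<^esub> k)"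

lemma gl_inv_closed: "k \<in> F \<Longrightarrow> gl (inv\<^bsub>G\<^esub> k) \<in> carrier H"
  by (rule gl_closed[OF F_G[OF F_inv]])

lemma pc_linear: "k \<in> F \<Longrightarrow> linear_map R L H (pc k)"
  unfolding pc_def[abs_def] by (rule lin_comp[OF hc_linear right_mult_linear[OF H_alg gl_inv_closed]])

lemmas pc_closed = lin_closed[OF pc_linear]

text \<open>Right multiplication by the inverse of \<open>g\<close> moves the right degree
  \<open>g\<close> of \<open>hc g l\<close> to the neutral element, which makes it
  coinvariant.\<close>

lemma pc_C:
  assumes g: "g \<in> F" and l: "l \<in> carrier L"
  shows "pc g l \<in> C"
  unfolding C_iff
proof (intro conjI ballI)
  note gG = F_G[OF g]
  show "pc g l \<in> carrier H" by (rule pc_closed[OF g l])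
  fix k assume k: "k \<in> carrier G"
  have iff: "k \<otimes>\<^bsub>G\<^esub> g = g \<longleftrightarrow> k = \<one>\<^bsub>G\<^esub>"
    using G_shift(2)[OF gG k gG] G_simps(7)[OF gG] by auto
  have "dc k (pc g l) = dc (k \<otimes>\<^bsub>G\<^esub> g) (hc g l) \<otimes>\<^bsub>H\<^esub> gl (inv\<^bsub>G\<^esub> g)"
    unfolding pc_def dc_mult_right[OF G_simps(2)[OF gG] k hc_closed[OF g l]] G_simps(10)[OF gG] by (rule refl)
  then show "dc k (pc g l) = (if k = \<one>\<^bsub>G\<^esub> then pc g l else \<zero>\<^bsub>H\<^esub>)"
    unfolding dc_hc[OF G_simps(3)[OF k gG] g l] iff pc_def
    using alg_zero_left[OF H_alg gl_inv_closed[OF g]] by simp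
qed

lemma pc_linear_C: "k \<in> F \<Longrightarrow> linear_map R L HC (pc k)"
  by (rule lin_corestrict[OF pc_linear pc_C])

lemma pc_gl: "g \<in> F \<Longrightarrow> l \<in> carrier L \<Longrightarrow> pc g l \<otimes>\<^bsub>H\<^esub> gl g = hc g l"
  unfolding pc_def by (rule gl_inv_cancel(2)[OF F_G hc_closed])

text \<open>The functional vanishes on positive degrees of \<open>L\<close>, so in the surviving
  tensors the whole degree \<open>n\<close> sits in the left factor.\<close>

lemma hc_graded:
  assumes k: "k \<in> F" and l: "l \<in> grL n"
  shows "hc k l \<in> grH n"
  unfolding hc_def
proof (rule tensor_grading_in_submodule(2)[OF mH mL grad_H grad_L mH rcon_linear[OF mH mL chi_functional[OF k]]
      gr_submodule[OF mH grad_H] _ rho_graded[OF l]])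
  fix i j a b assume ij: "i + j = n" and a: "a \<in> grH i" and b: "b \<in> grL j"
  note ac = gr_closed[OF mH grad_H a] and bc = gr_closed[OF mL grad_L b]
  show "rcon H (\<chi> k) (ptensor R H L a b) \<in> grH n"
    unfolding rcon_ptensor[OF mH mL chi_functional[OF k] ac bc]
    using ij a chi_positive[OF k _ b] submoduleD(2)[OF gr_submodule[OF mH grad_H]] mH ac
      submoduleD(4)[OF gr_submodule[OF mH grad_H] chi(1)[OF k bc] a]
    by (cases "j = 0") simp_all
qed

lemma pc_graded: "k \<in> F \<Longrightarrow> l \<in> grL n \<Longrightarrow> pc k l \<in> grH n"
  unfolding pc_def using gr_mult[OF hc_graded gl_degree[OF F_G[OF F_inv]], of k l n k] by simp

lemma hc_mult:
  assumes k: "k \<in> F" and x: "x \<in> carrier L" and y: "y \<in> carrier L"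
  shows "hc k (x \<otimes>\<^bsub>L\<^esub> y) = finsum H (\<lambda>g. hc g x \<otimes>\<^bsub>H\<^esub> (\<psi> g (inv\<^bsub>G\<^esub> g \<otimes>\<^bsub>G\<^esub> k) \<odot>\<^bsub>H\<^esub> hc (inv\<^bsub>G\<^esub> g \<otimes>\<^bsub>G\<^esub> k) y)) F"
proof -
  \<comment> \<open>The cocycle value is absorbed into the second functional, which brings
    \<open>chi_mult\<close> into the shape required by \<open>rcon_mult_sum\<close>.\<close>
  let ?\<phi> = "\<lambda>g d. \<psi> g (inv\<^bsub>G\<^esub> g \<otimes>\<^bsub>G\<^esub> k) \<otimes> \<chi> (inv\<^bsub>G\<^esub> g \<otimes>\<^bsub>G\<^esub> k) d"
  have \<phi>: "functional L (?\<phi> g)" if g: "g \<in> F" for g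
    using lin_smult_const[OF ground_module chi_functional[OF F_shift[OF g k]] psi_closed[OF g F_shift[OF g k]]] by simp
  have r: "rcon H (?\<phi> g) (\<rho> y) = \<psi> g (inv\<^bsub>G\<^esub> g \<otimes>\<^bsub>G\<^esub> k) \<odot>\<^bsub>H\<^esub> hc (inv\<^bsub>G\<^esub> g \<otimes>\<^bsub>G\<^esub> k) y" if g: "g \<in> F" for g
  proof -
    note gk = F_shift[OF g k]
    note p = psi_closed[OF g gk] and cf = chi_functional[OF gk]
    show ?thesis unfolding hc_def
      by (rule linear_eq_on_tensor[OF mH mL mH rcon_linear[OF mH mL \<phi>[OF g]]
            lin_smult_const[OF mH rcon_linear[OF mH mL cf] p] _ rho_closed[OF y]])
        (simp add: rcon_ptensor[OF mH mL \<phi>[OF g]] rcon_ptensor[OF mH mL cf] mod_smult_smult[OF mH p functional_closed[OF cf]])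
  qed
  have "hc k (x \<otimes>\<^bsub>L\<^esub> y) = finsum H (\<lambda>g. rcon H (\<chi> g) (\<rho> x) \<otimes>\<^bsub>H\<^esub> rcon H (?\<phi> g) (\<rho> y)) F"
    unfolding hc_def rho_mult[OF x y]
    by (rule rcon_mult_sum[OF H_alg L_alg finite_F chi_functional[OF k] chi_functional \<phi> chi_mult[OF k]
          rho_closed[OF x] rho_closed[OF y]])
  also have "\<dots> = finsum H (\<lambda>g. hc g x \<otimes>\<^bsub>H\<^esub> (\<psi> g (inv\<^bsub>G\<^esub> g \<otimes>\<^bsub>G\<^esub> k) \<odot>\<^bsub>H\<^esub> hc (inv\<^bsub>G\<^esub> g \<otimes>\<^bsub>G\<^esub> k) y)) F"
  proof (rule mod_finsum_cong[OF mH])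
    fix g assume g: "g \<in> F"
    note gk = F_shift[OF g k]
    show "rcon H (\<chi> g) (\<rho> x) \<otimes>\<^bsub>H\<^esub> rcon H (?\<phi> g) (\<rho> y) =
        hc g x \<otimes>\<^bsub>H\<^esub> (\<psi> g (inv\<^bsub>G\<^esub> g \<otimes>\<^bsub>G\<^esub> k) \<odot>\<^bsub>H\<^esub> hc (inv\<^bsub>G\<^esub> g \<otimes>\<^bsub>G\<^esub> k) y)"
      unfolding r[OF g] hc_def[of g] by (rule refl)
    show "hc g x \<otimes>\<^bsub>H\<^esub> (\<psi> g (inv\<^bsub>G\<^esub> g \<otimes>\<^bsub>G\<^esub> k) \<odot>\<^bsub>H\<^esub> hc (inv\<^bsub>G\<^esub> g \<otimes>\<^bsub>G\<^esub> k) y) \<in> carrier H"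
      by (rule H_closed[OF hc_closed[OF g x] mod_smult[OF mH psi_closed[OF g gk] hc_closed[OF gk y]]])
  qed
  finally show ?thesis .
qed

text \<open>In Sweedler notation l is sent to the sum over g in \<open>F\<close> of \<chi>_g(l_0)
  l_-1 g^-1 \<otimes> g.\<close>

definition "\<Phi> l = finsum CE (\<lambda>g. pt (pc g l) g) F"

lemma Phi_linear: "linear_map R L CE \<Phi>"
  unfolding \<Phi>_def[abs_def] by (rule lin_finsum_map[OF mCE finite_F]) (rule lin_comp[OF pc_linear_C pt_linear])

lemmas Phi_closed = lin_closed[OF Phi_linear]

lemma coord_Phi:
  assumes k: "k \<in> F" and l: "l \<in> carrier L"
  shows "coord k (\<Phi> l) = pc k l"
proof -
  have "coord k (\<Phi> l) = finsum H (\<lambda>g. coord k (pt (pc g l) g)) F"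
    unfolding \<Phi>_def by (rule lin_finsum[OF mCE mH coord_linear pt_closed[OF pc_C[OF _ l]]])
  also have "\<dots> = pc k l"
    by (rule mod_finsum_single[OF mH finite_F k pc_closed[OF k l]]) (simp_all add: coord_pt[OF pc_C[OF _ l]] k)
  finally show ?thesis .
qed

text \<open>In each summand of \<open>coord_mult\<close> the factor g cancels the inverse contained
  in \<open>pc g x\<close>, and the two inverses on the right, of g^-1 k and of g, multiply to the
  inverse of k. What remains is \<open>hc_mult\<close> times that inverse.\<close>

lemma Phi_mult:
  assumes x: "x \<in> carrier L" and y: "y \<in> carrier L"
  shows "\<Phi> (x \<otimes>\<^bsub>L\<^esub> y) = \<Phi> x \<otimes>\<^bsub>Sm\<^esub> \<Phi> y"
proof (rule CE_eqI[OF Phi_closed[OF L_closed[OF x y]] Sm_mult_closed[OF Phi_closed[OF x] Phi_closed[OF y]]])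
  fix k assume k: "k \<in> F"
  let ?t = "\<lambda>g. hc g x \<otimes>\<^bsub>H\<^esub> (\<psi> g (inv\<^bsub>G\<^esub> g \<otimes>\<^bsub>G\<^esub> k) \<odot>\<^bsub>H\<^esub> hc (inv\<^bsub>G\<^esub> g \<otimes>\<^bsub>G\<^esub> k) y)"
  have t: "?t g \<in> carrier H" if g: "g \<in> F" for g
    by (rule H_closed[OF hc_closed[OF g x] mod_smult[OF mH psi_closed[OF g F_shift[OF g k]] hc_closed[OF F_shift[OF g k] y]]])
  have "coord k (\<Phi> (x \<otimes>\<^bsub>L\<^esub> y)) = finsum H ?t F \<otimes>\<^bsub>H\<^esub> gl (inv\<^bsub>G\<^esub> k)"
    unfolding coord_Phi[OF k L_closed[OF x y]] pc_def hc_mult[OF k x y] by (rule refl)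
  also have "\<dots> = finsum H (\<lambda>g. ?t g \<otimes>\<^bsub>H\<^esub> gl (inv\<^bsub>G\<^esub> k)) F"
    by (rule lin_finsum[OF mH mH right_mult_linear[OF H_alg gl_inv_closed[OF k]] t])
  also have "\<dots> = finsum H (\<lambda>g. \<psi> g (inv\<^bsub>G\<^esub> g \<otimes>\<^bsub>G\<^esub> k) \<odot>\<^bsub>H\<^esub>
    (coord g (\<Phi> x) \<otimes>\<^bsub>H\<^esub> gl g \<otimes>\<^bsub>H\<^esub> coord (inv\<^bsub>G\<^esub> g \<otimes>\<^bsub>G\<^esub> k) (\<Phi> y) \<otimes>\<^bsub>H\<^esub> gl (inv\<^bsub>G\<^esub> g))) F"
  proof (rule mod_finsum_cong[OF mH])
    fix g assume g: "g \<in> F"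
    note gk = F_shift[OF g k] and p = psi_closed[OF g F_shift[OF g k]]
    note a = hc_closed[OF g x] and b = hc_closed[OF gk y]
    note ik = gl_inv_closed[OF k] and ig = gl_inv_closed[OF g] and igk = gl_inv_closed[OF gk]
    have inv_eq: "inv\<^bsub>G\<^esub> (inv\<^bsub>G\<^esub> g \<otimes>\<^bsub>G\<^esub> k) \<otimes>\<^bsub>G\<^esub> inv\<^bsub>G\<^esub> g = inv\<^bsub>G\<^esub> k"
      using group.inv_mult_group[OF group_G F_G[OF g] F_G[OF gk]] G_cancel[OF F_G[OF g] F_G[OF k]] by simp
    have "coord g (\<Phi> x) \<otimes>\<^bsub>H\<^esub> gl g \<otimes>\<^bsub>H\<^esub> coord (inv\<^bsub>G\<^esub> g \<otimes>\<^bsub>G\<^esub> k) (\<Phi> y) \<otimes>\<^bsub>H\<^esub> gl (inv\<^bsub>G\<^esub> g) =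
        hc g x \<otimes>\<^bsub>H\<^esub> (hc (inv\<^bsub>G\<^esub> g \<otimes>\<^bsub>G\<^esub> k) y \<otimes>\<^bsub>H\<^esub> gl (inv\<^bsub>G\<^esub> (inv\<^bsub>G\<^esub> g \<otimes>\<^bsub>G\<^esub> k))) \<otimes>\<^bsub>H\<^esub> gl (inv\<^bsub>G\<^esub> g)"
      unfolding coord_Phi[OF g x] coord_Phi[OF gk y] pc_gl[OF g x] pc_def[of "inv\<^bsub>G\<^esub> g \<otimes>\<^bsub>G\<^esub> k"] by (rule refl)
    also have "\<dots> = hc g x \<otimes>\<^bsub>H\<^esub> (hc (inv\<^bsub>G\<^esub> g \<otimes>\<^bsub>G\<^esub> k) y \<otimes>\<^bsub>H\<^esub> gl (inv\<^bsub>G\<^esub> k))"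
      unfolding H_assoc[OF a H_closed[OF b igk] ig] H_assoc[OF b igk ig]
        gl_mult[OF F_G[OF F_inv[OF gk]] F_G[OF F_inv[OF g]]] inv_eq by (rule refl)
    finally have c: "coord g (\<Phi> x) \<otimes>\<^bsub>H\<^esub> gl g \<otimes>\<^bsub>H\<^esub> coord (inv\<^bsub>G\<^esub> g \<otimes>\<^bsub>G\<^esub> k) (\<Phi> y) \<otimes>\<^bsub>H\<^esub> gl (inv\<^bsub>G\<^esub> g) =
      hc g x \<otimes>\<^bsub>H\<^esub> (hc (inv\<^bsub>G\<^esub> g \<otimes>\<^bsub>G\<^esub> k) y \<otimes>\<^bsub>H\<^esub> gl (inv\<^bsub>G\<^esub> k))" .
    show "?t g \<otimes>\<^bsub>H\<^esub> gl (inv\<^bsub>G\<^esub> k) = \<psi> g (inv\<^bsub>G\<^esub> g \<otimes>\<^bsub>G\<^esub> k) \<odot>\<^bsub>H\<^esub>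
        (coord g (\<Phi> x) \<otimes>\<^bsub>H\<^esub> gl g \<otimes>\<^bsub>H\<^esub> coord (inv\<^bsub>G\<^esub> g \<otimes>\<^bsub>G\<^esub> k) (\<Phi> y) \<otimes>\<^bsub>H\<^esub> gl (inv\<^bsub>G\<^esub> g))"
      unfolding c alg_smult_right[OF H_alg p a b] alg_smult_left[OF H_alg p H_closed[OF a b] ik] H_assoc[OF a b ik] by (rule refl)
    show "\<psi> g (inv\<^bsub>G\<^esub> g \<otimes>\<^bsub>G\<^esub> k) \<odot>\<^bsub>H\<^esub>
        (coord g (\<Phi> x) \<otimes>\<^bsub>H\<^esub> gl g \<otimes>\<^bsub>H\<^esub> coord (inv\<^bsub>G\<^esub> g \<otimes>\<^bsub>G\<^esub> k) (\<Phi> y) \<otimes>\<^bsub>H\<^esub> gl (inv\<^bsub>G\<^esub> g)) \<in> carrier H"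
      unfolding c by (rule mod_smult[OF mH p H_closed[OF a H_closed[OF b ik]]])
  qed
  also have "\<dots> = coord k (\<Phi> x \<otimes>\<^bsub>Sm\<^esub> \<Phi> y)"
    by (rule coord_mult[OF k Phi_closed[OF x] Phi_closed[OF y], symmetric])
  finally show "coord k (\<Phi> (x \<otimes>\<^bsub>L\<^esub> y)) = coord k (\<Phi> x \<otimes>\<^bsub>Sm\<^esub> \<Phi> y)" .
qed

lemma Phi_one: "\<Phi> \<one>\<^bsub>L\<^esub> = ug \<one>\<^bsub>G\<^esub>"
proof (rule CE_eqI[OF Phi_closed[OF L_one] ug_closed[OF F_one]])
  fix k assume k: "k \<in> F"
  have "hc k \<one>\<^bsub>L\<^esub> = (if k = \<one>\<^bsub>G\<^esub> then \<one>\<^bsub>H\<^esub> else \<zero>\<^bsub>H\<^esub>)"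
    unfolding hc_def rho_one rcon_ptensor[OF mH mL chi_functional[OF k] H_one L_one] chi_one[OF k]
    using mH H_one by simp
  then show "coord k (\<Phi> \<one>\<^bsub>L\<^esub>) = coord k (ug \<one>\<^bsub>G\<^esub>)"
    unfolding coord_Phi[OF k L_one] coord_ug[OF F_one] pc_def
    using alg_zero_left[OF H_alg gl_inv_closed[OF k]] alg_l_one[OF H_alg H_one]
    by (simp add: G_simps gl_one)
qed

text \<open>The shift of the functional by k in \<open>coord_coact\<close> cancels against the
  inverse of k in \<open>pc\<close>, and what is left is \<open>hc_act\<close>.\<close>

lemma Phi_coact:
  assumes l: "l \<in> carrier L" and f: "functional H f"
  shows "lcon CE f (coact Sm (\<Phi> l)) = \<Phi> (act f l)"
proof (rule CE_eqI[OF lcon_closed[OF mH mCE f coactA_closed[OF Phi_closed[OF l]]] Phi_closed[OF act_closed[OF f l]]])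
  fix k assume k: "k \<in> F"
  note kc = gl_closed[OF F_G[OF k]] and ik = gl_inv_closed[OF k]
  note h = hc_closed[OF k l]
  note fk = lin_comp[OF right_mult_linear[OF H_alg kc] f]
  note fk' = lin_comp[OF right_mult_linear[OF H_alg ik] fk]
  have "coord k (lcon CE f (coact Sm (\<Phi> l))) = lcon H (\<lambda>x. f (x \<otimes>\<^bsub>H\<^esub> gl k)) (\<Delta> (hc k l \<otimes>\<^bsub>H\<^esub> gl (inv\<^bsub>G\<^esub> k)))"
    unfolding coord_coact[OF f k Phi_closed[OF l]] coord_Phi[OF k l] pc_def by (rule refl)
  also have "\<dots> = lcon H (\<lambda>x. f (x \<otimes>\<^bsub>H\<^esub> gl (inv\<^bsub>G\<^esub> k) \<otimes>\<^bsub>H\<^esub> gl k)) (\<Delta> (hc k l)) \<otimes>\<^bsub>H\<^esub> gl (inv\<^bsub>G\<^esub> k)"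
    unfolding Delta_mult[OF h ik] Delta_gl[OF F_G[OF F_inv[OF k]]]
    by (rule lcon_mult_right[OF H_alg H_alg fk ik ik Delta_closed[OF h]])
  also have "lcon H (\<lambda>x. f (x \<otimes>\<^bsub>H\<^esub> gl (inv\<^bsub>G\<^esub> k) \<otimes>\<^bsub>H\<^esub> gl k)) (\<Delta> (hc k l)) = lcon H f (\<Delta> (hc k l))"
    by (rule lcon_cong[OF mH mH fk' f _ Delta_closed[OF h]]) (simp add: gl_inv_cancel(2)[OF F_G[OF k]])
  also have "\<dots> \<otimes>\<^bsub>H\<^esub> gl (inv\<^bsub>G\<^esub> k) = coord k (\<Phi> (act f l))"
    unfolding coord_Phi[OF k act_closed[OF f l]] pc_def hc_act[OF k f l] by (rule refl)
  finally show "coord k (lcon CE f (coact Sm (\<Phi> l))) = coord k (\<Phi> (act f l))" .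
qed

text \<open>The kernel of \<open>\<Phi>\<close> is a right ideal and a subcomodule not containing \<open>1\<close>.\<close>

lemma Phi_zeroD:
  assumes "l \<in> carrier L" "\<Phi> l = \<zero>\<^bsub>CE\<^esub>" shows "l = \<zero>\<^bsub>L\<^esub>"
proof -
  let ?I = "{l \<in> carrier L. \<Phi> l \<in> {\<zero>\<^bsub>CE\<^esub>}}"
  have S: "submodule ?I R L" by (rule submodule_vimage[OF mL mCE Phi_linear submodule_zero[OF mCE]])
  have sub: "subcomodule R H L ?I"
    unfolding subcomodule_L
  proof (intro conjI S ballI allI impI)
    fix x f assume x: "x \<in> ?I" and f: "functional H f"
    then have xc: "x \<in> carrier L" "\<Phi> x = \<zero>\<^bsub>CE\<^esub>" by auto
    have "\<Phi> (act f x) = \<zero>\<^bsub>CE\<^esub>"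
      unfolding Phi_coact[OF xc(1) f, symmetric] xc(2)
      by (rule lin_zero[OF mCE mCE lin_comp[OF coactA_linear lcon_linear[OF mH mCE f]]])
    then show "act f x \<in> ?I" using act_closed[OF f xc(1)] by simp
  qed
  have ideal: "\<forall>x\<in>?I. \<forall>a\<in>carrier L. x \<otimes>\<^bsub>L\<^esub> a \<in> ?I"
  proof (intro ballI)
    fix x a assume x: "x \<in> ?I" and a: "a \<in> carrier L"
    then have xc: "x \<in> carrier L" "\<Phi> x = \<zero>\<^bsub>CE\<^esub>" by auto
    have "\<Phi> (x \<otimes>\<^bsub>L\<^esub> a) = \<zero>\<^bsub>CE\<^esub>"
      unfolding Phi_mult[OF xc(1) a] xc(2) by (rule lin_zero[OF mCE mCE Sm_mult_left[OF Phi_closed[OF a]]])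
    then show "x \<otimes>\<^bsub>L\<^esub> a \<in> ?I" using L_closed[OF xc(1) a] by simp
  qed
  have "\<one>\<^bsub>L\<^esub> \<notin> ?I" using Phi_one ug_one_nonzero by simp
  then have "?I \<noteq> carrier L" using L_one by blast
  then have "?I = {\<zero>\<^bsub>L\<^esub>}" using simple sub ideal unfolding right_H_simple_def by blast
  moreover have "l \<in> ?I" using assms by simp
  ultimately show ?thesis by blast
qed

lemma Phi_inj: "inj_on \<Phi> (carrier L)"
  by (rule inj_on_lin[OF mL mCE Phi_linear Phi_zeroD])

lemma Phi_graded:
  assumes l: "l \<in> grL n" shows "\<Phi> l \<in> grS n"
  unfolding \<Phi>_def
  by (rule submodule_finsum[OF mCE grS_submodule]) (rule pt_grS[OF pc_graded[OF _ l] pc_C[OF _ gr_closed[OF mL grad_L l]]])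

text \<open>The maps \<open>pc k\<close> preserve degrees, hence commute with taking components. A
  component of \<open>l\<close> outside degree \<open>n\<close> has vanishing coordinates, so it is
  zero by injectivity.\<close>

lemma Phi_graded_converse:
  assumes l: "l \<in> carrier L" and Pl: "\<Phi> l \<in> grS n"
  shows "l \<in> grL n"
proof (rule mem_gr_iff[OF mL grad_L l])
  fix m assume m: "m \<noteq> n"
  note cl = component_closed[OF mL grad_L l, of m]
  show "component L grL m l = \<zero>\<^bsub>L\<^esub>"
  proof (rule Phi_zeroD[OF cl], rule CE_eqI[OF Phi_closed[OF cl] mod_zero[OF mCE]])
    fix k assume k: "k \<in> F"
    have "pc k (component L grL m l) = component H grH m (pc k l)"
    proof (rule linear_eq_on_graded[OF mL grad_L mH lin_comp[OF component_linear[OF mL grad_L] pc_linear[OF k]]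
          lin_comp[OF pc_linear[OF k] component_linear[OF mH grad_H]] _ l])
      fix i v assume v: "v \<in> grL i"
      show "pc k (component L grL m v) = component H grH m (pc k v)"
        using component_homogeneous[OF mL grad_L v, of m] component_homogeneous[OF mH grad_H pc_graded[OF k v], of m]
          lin_zero[OF mL mH pc_linear[OF k]] by simp
    qed
    also have "\<dots> = \<zero>\<^bsub>H\<^esub>"
      using component_homogeneous[OF mH grad_H coord_grS[OF Pl], of m k] m coord_Phi[OF k l] by simp
    finally show "coord k (\<Phi> (component L grL m l)) = coord k \<zero>\<^bsub>CE\<^esub>"
      using coord_Phi[OF k cl] lin_zero[OF mCE mH coord_linear] by simp
  qed
qed

section \<open>The image of the embedding as a graded comodule subalgebra\<close>

definition "Im = \<Phi> ` carrier L"

lemma Im_submodule: "submodule Im R Sm"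
  unfolding Im_def submodule_SmI by (rule submodule_image[OF mL mCE Phi_linear submodule_carrier[OF mL]])

lemma Im_subcomodule: "subcomodule R H Sm Im"
proof -
  have "coact Sm x \<in> carrier (tensor R H Sm)" if "x \<in> carrier Sm" for x by (rule lin_closed[OF coactSm_linear that])
  from subcomodule_iff[OF mH mSm this] show ?thesis
    using Im_submodule Phi_coact act_closed by (auto simp: Im_def lcon_Sm)
qed

lemma Im_graded_subspace: "graded_subspace R Sm grS Im"
  unfolding graded_subspace_def
proof (intro conjI Im_submodule equalityI)
  let ?X = "\<Union>n. Im \<inter> grS n"
  have X: "?X \<subseteq> carrier Sm" using submoduleD(1)[OF Im_submodule] by blast
  note g = gen_submodule_submodule[OF mSm X]
  have gCE: "submodule (gen_submodule R Sm ?X) R CE" using g by (simp add: submodule_SmI)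
  show "gen_submodule R Sm ?X \<subseteq> Im" by (rule gen_submodule_least[OF Im_submodule]) blast
  show "Im \<subseteq> gen_submodule R Sm ?X"
  proof
    fix x assume "x \<in> Im"
    then obtain l where l: "l \<in> carrier L" "x = \<Phi> l" by (auto simp: Im_def)
    \<comment> \<open>The preimage of the generated subspace is a subspace of \<open>L\<close>, so
      only homogeneous elements need checking, and the image of one lies in a single intersection of
      \<open>Im\<close> with a homogeneous component.\<close>
    have "l \<in> {l \<in> carrier L. \<Phi> l \<in> gen_submodule R Sm ?X}"
    proof (rule graded_in_submodule[OF mL grad_L submodule_vimage[OF mL mCE Phi_linear gCE] _ l(1)])
      fix n v assume v: "v \<in> grL n"
      note vc = gr_closed[OF mL grad_L v]
      have "\<Phi> v \<in> ?X" using Phi_graded[OF v] vc by (auto simp: Im_def)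
      from gen_submodule_incl[OF this] show "v \<in> {l \<in> carrier L. \<Phi> l \<in> gen_submodule R Sm ?X}" using vc by simp
    qed
    then show "x \<in> gen_submodule R Sm ?X" using l(2) by simp
  qed
qed

lemma Im_graded_comodule_subalgebra: "graded_comodule_subalgebra R H Sm grS Im"
  unfolding graded_comodule_subalgebra_def subalgebra_of_def
proof (intro conjI Im_submodule Im_subcomodule Im_graded_subspace ballI)
  show "\<one>\<^bsub>Sm\<^esub> \<in> Im" using imageI[OF L_one, of \<Phi>] by (simp add: Im_def Phi_one ug_def smash_one)
  fix x y assume "x \<in> Im" "y \<in> Im"
  then obtain a b where "a \<in> carrier L" "x = \<Phi> a" "b \<in> carrier L" "y = \<Phi> b" by (auto simp: Im_def)
  then show "x \<otimes>\<^bsub>Sm\<^esub> y \<in> Im" using imageI[OF L_closed, of a b \<Phi>] Phi_mult[of a b] by (simp add: Im_def)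
qed

lemma Phi_linear_SM: "linear_map R L (SM Im) \<Phi>"
  using Phi_linear by (auto simp: linear_map_def SM_fields Im_def)

lemma Phi_iso: "graded_comod_alg_iso R H L grL (SM Im) (\<lambda>n. Im \<inter> grS n) \<Phi>"
  unfolding graded_comod_alg_iso_def
proof (intro conjI ballI allI)
  show "alg_hom R L (SM Im) \<Phi>"
    unfolding alg_hom_def
  proof (intro conjI Phi_linear_SM ring_hom_memI)
    show "\<Phi> x \<in> carrier (SM Im)" if "x \<in> carrier L" for x by (rule lin_closed[OF Phi_linear_SM that])
    show "\<Phi> (x \<otimes>\<^bsub>L\<^esub> y) = \<Phi> x \<otimes>\<^bsub>SM Im\<^esub> \<Phi> y" if "x \<in> carrier L" "y \<in> carrier L" for x y
      using Phi_mult[OF that] by (simp add: SM_fields)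
    show "\<Phi> (x \<oplus>\<^bsub>L\<^esub> y) = \<Phi> x \<oplus>\<^bsub>SM Im\<^esub> \<Phi> y" if "x \<in> carrier L" "y \<in> carrier L" for x y
      by (rule lin_add[OF Phi_linear_SM that])
    show "\<Phi> \<one>\<^bsub>L\<^esub> = \<one>\<^bsub>SM Im\<^esub>" by (simp add: SM_fields Phi_one ug_def smash_one)
  qed
  show "bij_betw \<Phi> (carrier L) (carrier (SM Im))"
    using Phi_inj by (simp add: bij_betw_def SM_fields Im_def)
  show "coact (SM Im) (\<Phi> l) = sweedler R (tensor R H (SM Im)) (\<rho> l) (\<lambda>x m. ptensor R H (SM Im) x (\<Phi> m))"
    if l: "l \<in> carrier L" for l
  proof -
    have "coact Sm (\<Phi> l) \<in> tensor_sub R H Sm (carrier H) Im"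
      using Im_subcomodule l by (simp add: subcomodule_def Im_def)
    from comodule_map_iff[OF Im_submodule Phi_linear_SM l this] show ?thesis using Phi_coact[OF l] by simp
  qed
  show "\<Phi> ` grL n = Im \<inter> grS n" for n
  proof (intro equalityI subsetI)
    fix x assume "x \<in> \<Phi> ` grL n"
    then show "x \<in> Im \<inter> grS n" using Phi_graded gr_closed[OF mL grad_L] by (auto simp: Im_def)
  next
    fix x assume "x \<in> Im \<inter> grS n"
    then obtain l where "l \<in> carrier L" "x = \<Phi> l" "\<Phi> l \<in> grS n" by (auto simp: Im_def)
    then show "x \<in> \<Phi> ` grL n" using Phi_graded_converse by blast
  qed
qed

end

theorem theorem6p17:
  fixes R :: "('k, 'r) ring_scheme"
    and H :: "('k, 'h) hopf" and grH :: "nat \<Rightarrow> 'h set"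
    and G :: "('g, 's) monoid_scheme" and \<iota> :: "('g \<Rightarrow> 'k) \<Rightarrow> 'h"
    and L :: "('k, 'h, 'l) comod_alg" and grL :: "nat \<Rightarrow> 'l set"
  assumes "field R"
    and "graded_hopf_algebra R H grH"
    and "group G" and "finite (carrier G)"
    and "is_degree_zero_part R H grH (group_algebra R G) \<iota>"
    and "graded_comodule_algebra R H grH L grL"
  shows "(right_H_simple R H L \<and> coinvariants R H L = {c \<odot>\<^bsub>L\<^esub> \<one>\<^bsub>L\<^esub> | c. c \<in> carrier R}) \<longleftrightarrow>
    (\<exists>F \<psi>. subgroup F G \<and> two_cocycle R G F \<psi> \<and>
       (let K = group_algebra R G;
            \<pi> = degree_zero_proj H grH K \<iota>;
            E = twisted_group_algebra R G F \<psi>;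
            A = smash R H K \<iota> \<pi> E;
            grA = smash_grading R H grH K \<pi> E in
        \<exists>M f. graded_comodule_subalgebra R H A grA M \<and>
          graded_comod_alg_iso R H L grL (sub_comod_alg R H A M) (\<lambda>n. M \<inter> grA n) f))"
    (is "?lhs \<longleftrightarrow> ?rhs")
proof
  interpret graded_comod R H grH G \<iota> L grL
    by (rule graded_comod.intro[OF graded_hopf.intro[OF assms(1) graded_hopf_axioms.intro[OF assms(2-5)]]
          graded_comod_axioms.intro[OF assms(6)]])
  {
    assume lhs: ?lhs
    from degree_zero_structure[OF conjunct1[OF lhs] conjunct2[OF lhs]] show ?rhs
    proof (elim exE conjE)
      fix F \<psi> u
      assume *: "subgroup F G" "two_cocycle R G F \<psi>" "u \<one>\<^bsub>G\<^esub> = \<one>\<^bsub>L\<^esub>"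
        "\<forall>g\<in>F. homg g (u g) \<and> u g \<noteq> \<zero>\<^bsub>L\<^esub>"
        "\<forall>g\<in>F. \<forall>x. homg g x \<longrightarrow> (\<exists>c\<in>carrier R. x = c \<odot>\<^bsub>L\<^esub> u g)"
        "\<forall>g\<in>carrier G - F. \<forall>x. homg g x \<longrightarrow> x = \<zero>\<^bsub>L\<^esub>"
        "\<forall>g\<in>F. \<forall>h\<in>F. u g \<otimes>\<^bsub>L\<^esub> u h = \<psi> g h \<odot>\<^bsub>L\<^esub> u (g \<otimes>\<^bsub>G\<^esub> h)"
      have "graded_comod_cocycle R H grH G \<iota> L grL F \<psi>"
        by (rule graded_comod_cocycle.intro[OF graded_comod_axioms graded_hopf_cocycle.intro[OF graded_hopf_axioms
              graded_hopf_cocycle_axioms.intro[OF *(1,2)]]])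
      moreover have "graded_comod_basis_axioms R H G \<iota> L grL F \<psi> u"
      proof (rule graded_comod_basis_axioms.intro)
        show "u \<one>\<^bsub>G\<^esub> = \<one>\<^bsub>L\<^esub>" by (rule *(3))
        show "homg g (u g)" if "g \<in> F" for g using bspec[OF *(4) that] by (rule conjunct1)
        show "u g \<noteq> \<zero>\<^bsub>L\<^esub>" if "g \<in> F" for g using bspec[OF *(4) that] by (rule conjunct2)
        show "\<exists>c\<in>carrier R. x = c \<odot>\<^bsub>L\<^esub> u g" if "g \<in> F" "homg g x" for g x
          using bspec[OF *(5) that(1)] that(2) by blast
        show "x = \<zero>\<^bsub>L\<^esub>" if "g \<in> carrier G" "g \<notin> F" "homg g x" for g x
          using bspec[OF *(6) DiffI[OF that(1,2)]] that(3) by blast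
        show "u g \<otimes>\<^bsub>L\<^esub> u h = \<psi> g h \<odot>\<^bsub>L\<^esub> u (g \<otimes>\<^bsub>G\<^esub> h)" if "g \<in> F" "h \<in> F" for g h
          by (rule bspec[OF bspec[OF *(7) that(1)] that(2)])
        show "right_H_simple R H L" by (rule conjunct1[OF lhs])
      qed
      ultimately interpret graded_comod_basis R H grH G \<iota> L grL F \<psi> u
        by (rule graded_comod_basis.intro)
      \<comment> \<open>The subalgebra is \<open>Im\<close> and the isomorphism is
        \<open>\<Phi>\<close>; both witnesses are found by unification.\<close>
      show ?rhs
        unfolding Let_def
        by (intro exI conjI, rule *(1), rule *(2), rule Im_graded_comodule_subalgebra, rule Phi_iso)
    qed
  }
  {
    assume ?rhs
    then show ?lhs
      unfolding Let_def
    proof (elim exE conjE)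
      fix F \<psi> M f
      assume *: "subgroup F G" "two_cocycle R G F \<psi>"
        and M: "graded_comodule_subalgebra R H (smash R H K \<iota> \<pi> (twisted_group_algebra R G F \<psi>))
          (smash_grading R H grH K \<pi> (twisted_group_algebra R G F \<psi>)) M"
        and iso: "graded_comod_alg_iso R H L grL
          (sub_comod_alg R H (smash R H K \<iota> \<pi> (twisted_group_algebra R G F \<psi>)) M)
          (\<lambda>n. M \<inter> smash_grading R H grH K \<pi> (twisted_group_algebra R G F \<psi>) n) f"
      interpret graded_comod_cocycle R H grH G \<iota> L grL F \<psi>
        by (rule graded_comod_cocycle.intro[OF graded_comod_axioms graded_hopf_cocycle.intro[OF graded_hopf_axioms
              graded_hopf_cocycle_axioms.intro[OF *(1,2)]]])
      show ?lhs
        by (rule conjI[OF H_simple[OF M iso] coinvariants_trivial[OF M iso]])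
    qed
  }
qed

end
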